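(* Suppose that: (1) the undirected graph $\mathcal G$ is connected; (2) $\mathbb X^*\neq\emptyset$ and $f^*>-\infty$; (3) for every $i\in[n]$ and almost all $\xi_i$, $F_i(\cdot,\xi_i)$ is smooth with constant $L_f>0$, i.e., differentiable with $L_f$-Lipschitz gradient; (4) there exist constants $\sigma_0,\sigma_1$ such that $\mathbf E_{\xi_i}[\|\nabla_xF_i(x,\xi_i)-\nabla f_i(x)\|^2]\le\sigma_0^2\|\nabla f_i(x)\|^2+\sigma_1^2$ for all $i\in[n]$, $x\in\mathbb R^p$; (5) there exist constants $\tilde\sigma_0,\sigma_2$ such that $\|\nabla f_i(x)-\nabla f(x)\|^2\le\tilde\sigma_0^2\|\nabla f(x)\|^2+\sigma_2^2$ for all $i\in[n]$, $x\in\mathbb R^p$; (6) $f$ satisfies the Polyak–Łojasiewicz condition with constant $\nu>0$: $\frac12\|\nabla f(x)\|^2\ge\nu(f(x)-f^* )$ for all $x\in\mathbb R^p$; and that $\nu$ is known in advance. Let $\{x_{i,k}\}$ be the sequence generated by Algorithm 1 with $$\alpha_k=\kappa_1\beta_k,\quad\beta_k=\kappa_0(k+t_1),\quad\eta_k=\frac{\kappa_2}{\beta_k},\quad \delta_{i,k}\le\frac{\kappa_\delta\sqrt{p\eta_k}}{\sqrt{n+p}},\quad\forall k\in\mathbb N_0,$$ where $\kappa_1>c_1$, $\kappa_2\in(0,c_2(\kappa_1))$, $\kappa_0\in[\frac{3\hat c_0\nu\kappa_2}{16},\frac{3\nu\kappa_2}{16})$, $t_1\ge\hat c_3(\kappa_0,\kappa_1,\kappa_2)$,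 $\kappa_\delta>0$ and $\hat c_0\in(0,1)$. Then, for any $T\in\mathbb N_+$, $$\mathbf E\Big[\frac1n\sum_{i=1}^n\|x_{i,T}-\bar x_T\|^2\Big]=\mathcal O\Big(\frac p{T^2}\Big),\qquad \mathbf E[f(\bar x_T)-f^*]=\mathcal O\Big(\frac p{nT}\Big)+\mathcal O\Big(\frac p{T^2}\Big),$$ where $\bar x_k=\frac1n\sum_{i=1}^nx_{i,k}$. Moreover, the omitted constants in the first term $\mathcal O(\frac p{nT})$ on the right-hand side of the second bound do not depend on any parameters related to the communication network.
   Context: Problem: $n$ agents, $[n]=\{1,\dots,n\}$. For each $i\in[n]$, $\xi_i$ is a random variable and $F_i(\cdot,\xi_i):\mathbb R^p\to\mathbb R$ a stochastic function (not necessarily convex); $f_i(x)=\mathbf E_{\xi_i}[F_i(x,\xi_i)]$, $f(x)=\frac1n\sum_{i=1}^nf_i(x)$, $f^*=\min_{x\in\mathbb R^p}f(x)$, $\mathbb X^*$ is the set of minimizers of $f$. Network: $\mathcal G=([n],\mathcal E)$ is an undirected graph with symmetric weights $a_{ij}>0$ if $(i,j)\in\mathcal E$, $a_{ij}=0$ otherwise, $a_{ii}=0$; $L=(L_{ij})$ is the weighted Laplacian, $L=\mathrm{diag}(\sum_ja_{1j},\dots,\sum_ja_{nj})-(a_{ij})$. $\rho(\cdot)$ is the spectral radius and $\rho_2(L)$ the minimum positive eigenvalue of $L$. $\|\cdot\|$ is the Euclidean norm. $\mathbb N_+$: positive integers; $\mathbb N_0$: nonnegative integers. Algorithm 1 (distributed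 zeroth-order primal–dual algorithm): given positive sequences $\{\alpha_k\},\{\beta_k\},\{\eta_k\},\{\delta_{i,k}\}$, initial points $x_{i,0}\in\mathbb R^p$ and $v_{i,0}=\mathbf 0_p$, at each iteration $k$ each agent $i$ draws $u_{i,k}$ uniformly from the unit sphere $\mathbb S^p$ of $\mathbb R^p$ and $\xi_{i,k}$ from the distribution of $\xi_i$ (all $u_{i,k},\xi_{j,l}$ mutually independent), sets $$g^e_{i,k}=\frac{p\,(F_i(x_{i,k}+\delta_{i,k}u_{i,k},\xi_{i,k})-F_i(x_{i,k},\xi_{i,k}))}{\delta_{i,k}}u_{i,k},$$ and updates $x_{i,k+1}=x_{i,k}-\eta_k(\alpha_k\sum_{j=1}^nL_{ij}x_{j,k}+\beta_kv_{i,k}+g^e_{i,k})$, $v_{i,k+1}=v_{i,k}+\eta_k\beta_k\sum_{j=1}^nL_{ij}x_{j,k}$. Constants: $c_1=\frac1{\rho_2(L)}+1$, $c_2(\kappa_1)=\min\{\frac{\varepsilon_2}{\varepsilon_3},\frac15\}$, $c_3(\kappa_1,\kappa_2)=\frac{24(1+\tilde\sigma_0^2)\kappa_3}{\kappa_2}$, $\kappa_3=\frac1{\rho_2(L)}+\kappa_1+1$, $\kappa_4=\frac1{\rho_2(L)}+\kappa_1$, $\varepsilon_1=\max\{1+3L_f^2,\ (8+8p(1+\sigma_0^2)(1+\tilde\sigma_0^2)(6+L_f))^{1/2}L_f,\ p\kappa_3\}$, $\varepsilon_2=(\kappa_1-1)\rho_2(L)-1$, $\varepsilon_3=\rho(L)+(2\kappa_1^2+1)\rho(L^2)+1$,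 $\varepsilon_4=\frac12(\varepsilon_2\kappa_2-\varepsilon_3\kappa_2^2)$, $\varepsilon_5=\frac12-\kappa_1\kappa_2\rho_2(L)+\kappa_2^2\rho(L)+\frac12(1+3\kappa_1\kappa_2+2\kappa_2)\kappa_1\kappa_2\rho(L^2)$, $\varepsilon_6=\frac14(\kappa_2-5\kappa_2^2)$, $$\varepsilon_7=8(7+6\kappa_2+2\kappa_4+10\kappa_2\kappa_4)\kappa_2L_f^4+\frac{(1+2L_f^2)\kappa_2}{2p(1+\sigma_0^2)(1+\tilde\sigma_0^2)}+\Big(\frac5{p(1+\sigma_0^2)(1+\tilde\sigma_0^2)}+24\Big)L_f^2\kappa_2^2,$$ $\varepsilon_8=\kappa_4+\kappa_1\kappa_2+3\kappa_2^2+\kappa_2\kappa_4$, $\varepsilon_{10}=10+L_f+\frac1{\kappa_2}(2\kappa_4+1)L_f^2+(10\kappa_4+6)L_f^2$, $$c_0(\kappa_1,\kappa_2)=\max\Big\{\varepsilon_1,\ \frac{2\varepsilon_5}{\varepsilon_4},\ \Big(\frac{2p(1+\sigma_0^2)(1+\tilde\sigma_0^2)\varepsilon_7}{\varepsilon_4}\Big)^{1/2},\ \frac{\varepsilon_8}{2\varepsilon_6},\ \frac{24(1+\tilde\sigma_0^2)\kappa_4}{\kappa_2},\ 128p(1+\sigma_0^2)(1+\tilde\sigma_0^2)\kappa_2\varepsilon_{10}\Big\},$$ $$\hat c_3(\kappa_0,\kappa_1,\kappa_2)=\max\Big\{\frac{c_0(\kappa_1,\kappa_2)}{\kappa_0},\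 c_3(\kappa_1,\kappa_2),\ \frac2{3\varepsilon_4},\ \frac2{3\varepsilon_6}\Big\}.$$ *)

theory Defs
  imports "HOL-Probability.Probability" "HOL-Analysis.Abstract_Euclidean_Space"
    "Jordan_Normal_Form.Spectral_Radius"
begin

text \<open>
  The dimension \<open>p\<close> and the number \<open>n\<close> of agents are natural numbers quantified inside
  the theorem (the constants in the bounds must be uniform in them), so they are not encoded in
  types. Vectors of \<open>p\<close>-dimensional space are functions \<open>nat \<Rightarrow> real\<close> that vanish at all
  indices \<open>\<ge> p\<close>, as in the library's \<^term>\<open>Euclidean_space p\<close>. Agents are numbered
  \<open>0, \<dots>, n - 1\<close>.
\<close>

type_synonym rvec = "nat \<Rightarrow> real"

abbreviation space_R :: "nat \<Rightarrow> rvec set" where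
  "space_R p \<equiv> topspace (Euclidean_space p)"

definition enorm :: "nat \<Rightarrow> rvec \<Rightarrow> real" where
  "enorm p x = L2_set x {..<p}"

definition einner :: "nat \<Rightarrow> rvec \<Rightarrow> rvec \<Rightarrow> real" where
  "einner p x y = (\<Sum>c<p. x c * y c)"

definition vdiff :: "rvec \<Rightarrow> rvec \<Rightarrow> rvec" where
  "vdiff x y = (\<lambda>c. x c - y c)"

definition has_gradient :: "nat \<Rightarrow> (rvec \<Rightarrow> real) \<Rightarrow> rvec \<Rightarrow> rvec \<Rightarrow> bool" where
  "has_gradient p f g x \<longleftrightarrow> g \<in> space_R p \<and>
     (\<forall>e>0. \<exists>d>0. \<forall>y\<in>space_R p. enorm p (vdiff y x) < d \<longrightarrow>
        \<bar>f y - f x - einner p g (vdiff y x)\<bar> \<le> e * enorm p (vdiff y x))"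

definition grad :: "nat \<Rightarrow> (rvec \<Rightarrow> real) \<Rightarrow> rvec \<Rightarrow> rvec" where
  "grad p f x = (THE g. has_gradient p f g x)"

definition smooth_on_R :: "nat \<Rightarrow> real \<Rightarrow> (rvec \<Rightarrow> real) \<Rightarrow> bool" where
  "smooth_on_R p Lf f \<longleftrightarrow>
     (\<forall>x\<in>space_R p. \<exists>g. has_gradient p f g x) \<and>
     (\<forall>x\<in>space_R p. \<forall>y\<in>space_R p.
        enorm p (vdiff (grad p f x) (grad p f y)) \<le> Lf * enorm p (vdiff x y))"

definition minimizers :: "nat \<Rightarrow> (rvec \<Rightarrow> real) \<Rightarrow> rvec set" where
  "minimizers p f = {x \<in> space_R p. \<forall>y\<in>space_R p. f x \<le> f y}"

definition opt_value :: "nat \<Rightarrow> (rvec \<Rightarrow> real) \<Rightarrow> real" where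
  "opt_value p f = (INF x\<in>space_R p. f x)"

definition polyak_lojasiewicz :: "nat \<Rightarrow> real \<Rightarrow> (rvec \<Rightarrow> real) \<Rightarrow> bool" where
  "polyak_lojasiewicz p \<nu> f \<longleftrightarrow>
     (\<forall>x\<in>space_R p. 1 / 2 * (enorm p (grad p f x))\<^sup>2 \<ge> \<nu> * (f x - opt_value p f))"

text \<open>
  The uniform distribution on the unit sphere (normalized surface measure) is the image of the
  uniform distribution on the unit ball under \<open>x \<mapsto> x / \<parallel>x\<parallel>\<close>. Elements of the product space
  are \<open>undefined\<close> outside \<open>{..<p}\<close>; the map below replaces these entries by \<open>0\<close>.
\<close>

definition uniform_sphere :: "nat \<Rightarrow> rvec measure" where
  "uniform_sphere p =
     distr (uniform_measure (\<Pi>\<^sub>M c\<in>{..<p}. lborel)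
              {x \<in> space (\<Pi>\<^sub>M c\<in>{..<p}. (lborel :: real measure)). enorm p x \<le> 1})
       borel (\<lambda>x c. if c < p then x c / enorm p x else 0)"


definition weighted_graph :: "nat \<Rightarrow> (nat \<times> nat) set \<Rightarrow> (nat \<Rightarrow> nat \<Rightarrow> real) \<Rightarrow> bool" where
  "weighted_graph n E a \<longleftrightarrow>
     E \<subseteq> {..<n} \<times> {..<n} \<and> sym E \<and> irrefl E \<and>
     (\<forall>i<n. \<forall>j<n. a i j = a j i \<and> (if (i, j) \<in> E then a i j > 0 else a i j = 0))"

definition connected_graph :: "nat \<Rightarrow> (nat \<times> nat) set \<Rightarrow> bool" where
  "connected_graph n E \<longleftrightarrow> (\<forall>i<n. \<forall>j<n. (i, j) \<in> E\<^sup>*)"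

definition laplacian :: "nat \<Rightarrow> (nat \<Rightarrow> nat \<Rightarrow> real) \<Rightarrow> real mat" where
  "laplacian n a = mat n n (\<lambda>(i, j). (if i = j then \<Sum>l<n. a i l else 0) - a i j)"

definition rho :: "real mat \<Rightarrow> real" where
  "rho A = spectral_radius (map_mat complex_of_real A)"

definition rho2 :: "real mat \<Rightarrow> real" where
  "rho2 A = Min {l. eigenvalue A l \<and> l > 0}"


text \<open>\<open>D i\<close> is the law of \<open>\<xi>\<^sub>i\<close>.\<close>

definition local_cost ::
  "(nat \<Rightarrow> 'c measure) \<Rightarrow> (nat \<Rightarrow> rvec \<Rightarrow> 'c \<Rightarrow> real) \<Rightarrow> nat \<Rightarrow> rvec \<Rightarrow> real" where
  "local_cost D F i x = (\<integral>z. F i x z \<partial>D i)"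

definition global_cost ::
  "nat \<Rightarrow> (nat \<Rightarrow> 'c measure) \<Rightarrow> (nat \<Rightarrow> rvec \<Rightarrow> 'c \<Rightarrow> real) \<Rightarrow> rvec \<Rightarrow> real" where
  "global_cost n D F x = 1 / real n * (\<Sum>i<n. local_cost D F i x)"

definition average :: "nat \<Rightarrow> (nat \<Rightarrow> rvec) \<Rightarrow> rvec" where
  "average n x = (\<lambda>c. 1 / real n * (\<Sum>i<n. x i c))"

definition consensus_error :: "nat \<Rightarrow> nat \<Rightarrow> (nat \<Rightarrow> rvec) \<Rightarrow> real" where
  "consensus_error n p x = 1 / real n * (\<Sum>i<n. (enorm p (vdiff (x i) (average n x)))\<^sup>2)"


definition zo_gradient ::
  "nat \<Rightarrow> (rvec \<Rightarrow> 'c \<Rightarrow> real) \<Rightarrow> real \<Rightarrow> rvec \<Rightarrow> rvec \<Rightarrow> 'c \<Rightarrow> rvec" where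
  "zo_gradient p Fi d x u z =
     (\<lambda>c. real p * (Fi (\<lambda>b. x b + d * u b) z - Fi x z) / d * u c)"

text \<open>
  One sample path of the primal and dual iterates \<open>(x\<^sub>i\<^sub>,\<^sub>k, v\<^sub>i\<^sub>,\<^sub>k)\<^sub>i\<close>, given realizations
  \<open>u i k\<close> and \<open>\<xi> i k\<close> of the random draws.
\<close>

primrec zo_iterates ::
  "nat \<Rightarrow> nat \<Rightarrow> real mat \<Rightarrow> (nat \<Rightarrow> rvec \<Rightarrow> 'c \<Rightarrow> real) \<Rightarrow>
   (nat \<Rightarrow> real) \<Rightarrow> (nat \<Rightarrow> real) \<Rightarrow> (nat \<Rightarrow> real) \<Rightarrow> (nat \<Rightarrow> nat \<Rightarrow> real) \<Rightarrow>
   (nat \<Rightarrow> rvec) \<Rightarrow> (nat \<Rightarrow> nat \<Rightarrow> rvec) \<Rightarrow> (nat \<Rightarrow> nat \<Rightarrow> 'c) \<Rightarrow>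
   nat \<Rightarrow> (nat \<Rightarrow> rvec) \<times> (nat \<Rightarrow> rvec)" where
  "zo_iterates n p L F \<alpha> \<beta> \<eta> \<delta> x0 u \<xi> 0 = (x0, \<lambda>i c. 0)"
| "zo_iterates n p L F \<alpha> \<beta> \<eta> \<delta> x0 u \<xi> (Suc k) =
     (let (x, v) = zo_iterates n p L F \<alpha> \<beta> \<eta> \<delta> x0 u \<xi> k in
       (\<lambda>i c. x i c - \<eta> k * (\<alpha> k * (\<Sum>j<n. L $$ (i, j) * x j c) + \<beta> k * v i c
                 + zo_gradient p (F i) (\<delta> i k) (x i) (u i k) (\<xi> i k) c),
        \<lambda>i c. v i c + \<eta> k * \<beta> k * (\<Sum>j<n. L $$ (i, j) * x j c)))"

text \<open>
  The draws \<open>u i k\<close> (indices \<open>Inl (i, k)\<close>) and \<open>\<xi> i k\<close> (indices \<open>Inr (i, k)\<close>) have values in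
  different types, so joint independence of the whole family is stated for the generated
  \<open>\<sigma>\<close>-algebras.
\<close>

definition zo_sampling ::
  "nat \<Rightarrow> nat \<Rightarrow> (nat \<Rightarrow> 'c measure) \<Rightarrow> 'w measure \<Rightarrow>
   (nat \<Rightarrow> nat \<Rightarrow> 'w \<Rightarrow> rvec) \<Rightarrow> (nat \<Rightarrow> nat \<Rightarrow> 'w \<Rightarrow> 'c) \<Rightarrow> bool" where
  "zo_sampling n p D M u \<xi> \<longleftrightarrow>
     prob_space M \<and> (\<forall>i<n. prob_space (D i)) \<and>
     (\<forall>i<n. \<forall>k. u i k \<in> measurable M borel \<and> distr M borel (u i k) = uniform_sphere p) \<and>
     (\<forall>i<n. \<forall>k. \<xi> i k \<in> measurable M (D i) \<and> distr M (D i) (\<xi> i k) = D i) \<and>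
     prob_space.indep_sets M
       (\<lambda>s. case s of
          Inl (i, k) \<Rightarrow> {u i k -` A \<inter> space M | A. A \<in> sets borel}
        | Inr (i, k) \<Rightarrow> {\<xi> i k -` B \<inter> space M | B. B \<in> sets (D i)})
       (({..<n} \<times> UNIV) <+> ({..<n} \<times> UNIV))"


text \<open>
  \<open>s0\<close> and \<open>st0\<close> are \<open>\<sigma>\<^sub>0\<close> and \<open>\<sigma>\<^sub>0\<close> with a tilde. Outside the locale each constant takes
  those of the fixed parameters on which it depends as leading arguments.
\<close>

locale zo_constants =
  fixes L :: "real mat" and p :: nat and Lf s0 st0 :: real
begin

definition c1 :: real where
  "c1 = 1 / rho2 L + 1"

definition kappa3 :: "real \<Rightarrow> real" where
  "kappa3 \<kappa>1 = 1 / rho2 L + \<kappa>1 + 1"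

definition kappa4 :: "real \<Rightarrow> real" where
  "kappa4 \<kappa>1 = 1 / rho2 L + \<kappa>1"

definition eps1 :: "real \<Rightarrow> real" where
  "eps1 \<kappa>1 = Max {1 + 3 * Lf\<^sup>2,
     sqrt (8 + 8 * real p * (1 + s0\<^sup>2) * (1 + st0\<^sup>2) * (6 + Lf)) * Lf,
     real p * kappa3 \<kappa>1}"

definition eps2 :: "real \<Rightarrow> real" where
  "eps2 \<kappa>1 = (\<kappa>1 - 1) * rho2 L - 1"

definition eps3 :: "real \<Rightarrow> real" where
  "eps3 \<kappa>1 = rho L + (2 * \<kappa>1\<^sup>2 + 1) * rho (L * L) + 1"

definition eps4 :: "real \<Rightarrow> real \<Rightarrow> real" where
  "eps4 \<kappa>1 \<kappa>2 = 1 / 2 * (eps2 \<kappa>1 * \<kappa>2 - eps3 \<kappa>1 * \<kappa>2\<^sup>2)"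

definition eps5 :: "real \<Rightarrow> real \<Rightarrow> real" where
  "eps5 \<kappa>1 \<kappa>2 = 1 / 2 - \<kappa>1 * \<kappa>2 * rho2 L + \<kappa>2\<^sup>2 * rho L
     + 1 / 2 * (1 + 3 * \<kappa>1 * \<kappa>2 + 2 * \<kappa>2) * \<kappa>1 * \<kappa>2 * rho (L * L)"

definition eps6 :: "real \<Rightarrow> real" where
  "eps6 \<kappa>2 = 1 / 4 * (\<kappa>2 - 5 * \<kappa>2\<^sup>2)"

definition eps7 :: "real \<Rightarrow> real \<Rightarrow> real" where
  "eps7 \<kappa>1 \<kappa>2 =
     8 * (7 + 6 * \<kappa>2 + 2 * kappa4 \<kappa>1 + 10 * \<kappa>2 * kappa4 \<kappa>1) * \<kappa>2 * Lf ^ 4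
     + (1 + 2 * Lf\<^sup>2) * \<kappa>2 / (2 * real p * (1 + s0\<^sup>2) * (1 + st0\<^sup>2))
     + (5 / (real p * (1 + s0\<^sup>2) * (1 + st0\<^sup>2)) + 24) * Lf\<^sup>2 * \<kappa>2\<^sup>2"

definition eps8 :: "real \<Rightarrow> real \<Rightarrow> real" where
  "eps8 \<kappa>1 \<kappa>2 = kappa4 \<kappa>1 + \<kappa>1 * \<kappa>2 + 3 * \<kappa>2\<^sup>2 + \<kappa>2 * kappa4 \<kappa>1"

definition eps10 :: "real \<Rightarrow> real \<Rightarrow> real" where
  "eps10 \<kappa>1 \<kappa>2 = 10 + Lf + 1 / \<kappa>2 * (2 * kappa4 \<kappa>1 + 1) * Lf\<^sup>2
     + (10 * kappa4 \<kappa>1 + 6) * Lf\<^sup>2"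

definition c0 :: "real \<Rightarrow> real \<Rightarrow> real" where
  "c0 \<kappa>1 \<kappa>2 = Max {eps1 \<kappa>1,
     2 * eps5 \<kappa>1 \<kappa>2 / eps4 \<kappa>1 \<kappa>2,
     sqrt (2 * real p * (1 + s0\<^sup>2) * (1 + st0\<^sup>2) * eps7 \<kappa>1 \<kappa>2 / eps4 \<kappa>1 \<kappa>2),
     eps8 \<kappa>1 \<kappa>2 / (2 * eps6 \<kappa>2),
     24 * (1 + st0\<^sup>2) * kappa4 \<kappa>1 / \<kappa>2,
     128 * real p * (1 + s0\<^sup>2) * (1 + st0\<^sup>2) * \<kappa>2 * eps10 \<kappa>1 \<kappa>2}"

definition c2 :: "real \<Rightarrow> real" where
  "c2 \<kappa>1 = min (eps2 \<kappa>1 / eps3 \<kappa>1) (1 / 5)"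

definition c3 :: "real \<Rightarrow> real \<Rightarrow> real" where
  "c3 \<kappa>1 \<kappa>2 = 24 * (1 + st0\<^sup>2) * kappa3 \<kappa>1 / \<kappa>2"

definition c3_hat :: "real \<Rightarrow> real \<Rightarrow> real \<Rightarrow> real" where
  "c3_hat \<kappa>0 \<kappa>1 \<kappa>2 = Max {c0 \<kappa>1 \<kappa>2 / \<kappa>0, c3 \<kappa>1 \<kappa>2,
     2 / (3 * eps4 \<kappa>1 \<kappa>2), 2 / (3 * eps6 \<kappa>2)}"

end

end

theory Submission
  imports Defs
begin

text \<open>
  With \<open>\<eta>\<^sub>k \<beta>\<^sub>k = \<kappa>2\<close> and \<open>\<eta>\<^sub>k \<alpha>\<^sub>k = \<kappa>1 \<kappa>2\<close> constant, the disagreement and the dual variables follow a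
  linear recursion with constant coefficients, driven by \<open>\<eta>\<^sub>k\<close> times the gradient estimators. A
  quadratic Lyapunov function shows that it is a contraction, so the consensus error is
  \<open>O(\<eta>\<^sub>k\<^sup>2)\<close> as soon as the second moments of the estimators are bounded.

  For the average iterate, the descent lemma, the Polyak-Lojasiewicz inequality and
  \<open>\<nu> \<eta>\<^sub>k / 2 \<ge> (8/3) / (k + t1)\<close> give \<open>D\<^sub>k\<^sub>+\<^sub>1 \<le> (1 - a / (k + t1)) D\<^sub>k + A (p / n) / (k + t1)\<^sup>2\<close>
  plus terms of third order in \<open>1 / (k + t1)\<close>, with \<open>a > 2\<close>. Only two contributions to \<open>A\<close> survive: the
  variance, divided by \<open>n\<close> since the agents draw independently, and the squared bias of the
  estimators, which is of order \<open>p \<eta>\<^sub>k / n\<close> because the bias is at most \<open>Lf \<delta>\<close> without any factor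
  of the dimension. Neither involves the network. An induction on both recursions yields
  \<open>D\<^sub>k = O(p / (n k)) + O(1 / k\<^sup>2)\<close>; the finitely many steps before the asymptotic regime only enter
  the second term.
\<close>

text \<open>The order of the quantifiers shapes the proof. The constants of the
  \<open>1 / T\<^sup>2\<close> terms are fixed before \<open>n\<close>, \<open>p\<close>, the graph
  and the costs, the leading constant even before the step-size parameters. The former works because
  \<open>t1 * \<kappa>0\<close> bounds every factor \<open>p\<close> outside the leading term and
  because the contraction rate sees the graph only through \<open>rho2\<close>; the latter because
  \<open>\<kappa>2 / \<kappa>0\<close> lies between \<open>16 / (3 * \<nu>)\<close> and
  \<open>16 / (3 * c0hat * \<nu>)\<close>. The bound on the radii is read in two ways:
  \<open>p / (n + p)\<close> is at most \<open>p / n\<close> in the squared bias and at most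
  \<open>1\<close> in the variance.

  Suboptimality and consensus error feed each other. The joint induction closes because the feedback
  into the consensus error carries an additional \<open>1 / (k + t1)\<close>, so a late start beats
  any constant.

  A technical obstacle is that the costs are smooth only for almost all samples and constrained only
  on \<open>space_R p\<close>. The analysis is carried out for modified costs that are smooth for
  every sample and ignore all coordinates beyond \<open>p\<close>; almost surely both give the same
  iterates.\<close>

section \<open>Inner product and norm of vectors given as functions\<close>

lemma einner_add_left: "einner n (\<lambda>i. x i + y i) z = einner n x z + einner n y z"
  by (simp add: einner_def algebra_simps sum.distrib)

lemma einner_add_right: "einner n z (\<lambda>i. x i + y i) = einner n z x + einner n z y"
  by (simp add: einner_def algebra_simps sum.distrib)

lemma einner_diff_left: "einner n (\<lambda>i. x i - y i) z = einner n x z - einner n y z"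
  by (simp add: einner_def algebra_simps sum_subtractf)

lemma einner_diff_right: "einner n z (\<lambda>i. x i - y i) = einner n z x - einner n z y"
  by (simp add: einner_def algebra_simps sum_subtractf)

lemma einner_mult_left: "einner n (\<lambda>i. c * x i) z = c * einner n x z"
  by (simp add: einner_def sum_distrib_left mult.assoc)

lemma einner_mult_right: "einner n z (\<lambda>i. c * x i) = c * einner n z x"
  by (simp add: einner_def sum_distrib_left algebra_simps)

lemmas einner_linear = einner_add_left einner_add_right einner_diff_left einner_diff_right
  einner_mult_left einner_mult_right

lemma einner_commute: "einner n x y = einner n y x"
  by (simp add: einner_def mult.commute)

lemma continuous_on_coordinate: "continuous_on A (\<lambda>x :: nat \<Rightarrow> real. x i)"
  by (rule continuous_on_subset[OF continuous_on_product_coordinates]) simp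

lemma einner_self: "einner n x x = (enorm n x)\<^sup>2"
  by (simp add: einner_def enorm_def L2_set_def sum_nonneg power2_eq_square)

lemma einner_self_nonneg [simp]: "0 \<le> einner n x x"
  by (simp add: einner_self)

lemma enorm_nonneg [simp]: "0 \<le> enorm n x"
  by (simp add: enorm_def)

lemma einner_self_eq_0_iff: "einner n x x = 0 \<longleftrightarrow> (\<forall>i<n. x i = 0)"
  unfolding einner_def by (subst sum_nonneg_eq_0_iff) auto

lemma einner_cong: "(\<And>i. i < n \<Longrightarrow> x i = x' i) \<Longrightarrow> (\<And>i. i < n \<Longrightarrow> y i = y' i) \<Longrightarrow>
    einner n x y = einner n x' y'"
  by (simp add: einner_def)

lemma einner_Cauchy_Schwarz: "\<bar>einner n x y\<bar> \<le> enorm n x * enorm n y"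
proof -
  have "\<bar>einner n x y\<bar> \<le> (\<Sum>i<n. \<bar>x i\<bar> * \<bar>y i\<bar>)"
    unfolding einner_def by (rule order_trans[OF sum_abs]) (simp add: abs_mult)
  also have "\<dots> \<le> enorm n x * enorm n y"
    unfolding enorm_def by (rule L2_set_mult_ineq)
  finally show ?thesis .
qed

subsection \<open>Extremal eigenvectors\<close>

text \<open>Rayleigh's principle: the form attains its minimum on the unit sphere of
  \<open>P\<close>, and a minimiser is an eigenvector. It is applied to the sum-zero vectors for
  \<open>rho2\<close>, and to the whole space with the negated Laplacian for the largest
  eigenvalue.\<close>

lemma symmetric_minimal_eigenvector:
  fixes T :: "(nat \<Rightarrow> real) \<Rightarrow> nat \<Rightarrow> real"
  assumes T_add: "\<And>x y. T (\<lambda>i. x i + y i) = (\<lambda>i. T x i + T y i)"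
    and T_scale: "\<And>c x. T (\<lambda>i. c * x i) = (\<lambda>i. c * T x i)"
    and T_sym: "\<And>x y. einner n x (T y) = einner n (T x) y"
    and T_cont: "\<And>i. continuous_on UNIV (\<lambda>x. T x i)"
    and P_sub: "\<And>x. x \<in> P \<Longrightarrow> \<forall>i\<ge>n. x i = 0"
    and P_closed: "closed P"
    and P_add: "\<And>x y. x \<in> P \<Longrightarrow> y \<in> P \<Longrightarrow> (\<lambda>i. x i + y i) \<in> P"
    and P_scale: "\<And>c x. x \<in> P \<Longrightarrow> (\<lambda>i. c * x i) \<in> P"
    and P_T: "\<And>x. x \<in> P \<Longrightarrow> T x \<in> P"
    and P_ne: "e \<in> P" "einner n e e \<noteq> 0"
  obtains v \<mu> where "v \<in> P" "einner n v v = 1" "T v = (\<lambda>i. \<mu> * v i)"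
    "\<And>x. x \<in> P \<Longrightarrow> \<mu> * einner n x x \<le> einner n x (T x)"
proof -
  define S where "S = P \<inter> {x. einner n x x = 1}"
  have cont_ii: "continuous_on A (\<lambda>x. einner n x x)" for A
    unfolding einner_def by (intro continuous_intros continuous_on_coordinate) 
  have cont_iT: "continuous_on A (\<lambda>x. einner n x (T x))" for A
    unfolding einner_def
    by (intro continuous_intros continuous_on_coordinate continuous_on_subset[OF T_cont]) auto
  have "closed {x. einner n x x = 1}"
    by (intro closed_Collect_eq continuous_on_const cont_ii)
  hence clS: "closed S" unfolding S_def using P_closed by blast
  \<comment> \<open>Vectors are functions on all of \<open>nat\<close>. The box that pins the
    coordinates beyond \<open>n\<close> to \<open>0\<close> is compact as a product of compact sets,
    and it contains the unit sphere of \<open>P\<close>.\<close>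
  have "compact (PiE UNIV (\<lambda>i. if i < n then {-1..1::real} else {0}))"
  proof -
    have "compactin (product_topology (\<lambda>i. euclidean) UNIV) (PiE UNIV (\<lambda>i::nat. if i < n then {-1..1::real} else {0}))"
      by (subst compactin_PiE) auto
    thus ?thesis by (simp add: euclidean_product_topology)
  qed
  moreover have "S \<subseteq> PiE UNIV (\<lambda>i. if i < n then {-1..1::real} else {0})"
  proof
    fix x assume x: "x \<in> S"
    have "x i \<in> {-1..1}" if "i < n" for i
    proof -
      have "x i * x i \<le> (\<Sum>c<n. x c * x c)" using that
        by (intro member_le_sum) auto
      also have "\<dots> = 1" using x by (auto simp: S_def einner_def)
      finally have "(x i)\<^sup>2 \<le> 1" by (simp add: power2_eq_square)
      hence "\<bar>x i\<bar> \<le> 1" by (simp add: abs_square_le_1)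
      thus ?thesis by auto
    qed
    moreover have "x i = 0" if "\<not> i < n" for i using P_sub[of x] x that by (auto simp: S_def)
    ultimately show "x \<in> PiE UNIV (\<lambda>i. if i < n then {-1..1::real} else {0})" by auto
  qed
  ultimately have "compact S" using clS by (metis compact_Int_closed inf.absorb_iff2)
  moreover have "S \<noteq> {}"
  proof -
    have pos: "einner n e e > 0" using P_ne(2) einner_self_nonneg[of n e] by linarith
    have "einner n (\<lambda>i. (1 / sqrt (einner n e e)) * e i) (\<lambda>i. (1 / sqrt (einner n e e)) * e i) = 1"
      unfolding einner_mult_left einner_mult_right using pos by simp
    moreover have "(\<lambda>i. (1 / sqrt (einner n e e)) * e i) \<in> P" by (rule P_scale[OF P_ne(1)])
    ultimately have "(\<lambda>i. (1 / sqrt (einner n e e)) * e i) \<in> S" unfolding S_def by blast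
    thus ?thesis by blast
  qed
  ultimately obtain v where v: "v \<in> S" "\<And>x. x \<in> S \<Longrightarrow> einner n v (T v) \<le> einner n x (T x)"
    using continuous_attains_inf[of S "\<lambda>x. einner n x (T x)"] cont_iT by blast
  define \<mu> where "\<mu> = einner n v (T v)"
  have vP: "v \<in> P" and v1: "einner n v v = 1" using v by (auto simp: S_def)
  have low: "\<mu> * einner n x x \<le> einner n x (T x)" if "x \<in> P" for x
  proof (cases "einner n x x = 0")
    case True
    hence "einner n x (T x) = einner n (\<lambda>i. 0) (T x)"
      by (intro einner_cong) (auto simp: einner_self_eq_0_iff)
    thus ?thesis using True by (simp add: einner_def)
  next
    case False
    hence pos: "einner n x x > 0" using einner_self_nonneg[of n x] by linarith
    let ?y = "\<lambda>i. (1 / sqrt (einner n x x)) * x i"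
    have "einner n ?y ?y = 1"
      unfolding einner_mult_left einner_mult_right using pos by simp
    moreover have "?y \<in> P" by (rule P_scale[OF that])
    ultimately have "?y \<in> S" unfolding S_def by blast
    from v(2)[OF this] have "\<mu> \<le> einner n ?y (T ?y)" by (simp add: \<mu>_def)
    also have "\<dots> = einner n x (T x) / einner n x x"
      unfolding T_scale einner_mult_left einner_mult_right using pos by simp
    finally show ?thesis using pos by (simp add: field_simps)
  qed
  \<comment> \<open>The residual lies in \<open>P\<close> by invariance. Moving from
    \<open>v\<close> to \<open>v + t * z\<close> changes the form minus \<open>\<mu>\<close> times
    the squared norm by \<open>2 * t * einner n z z + t\<^sup>2 * b\<close>, which minimality keeps
    nonnegative for all \<open>t\<close>.\<close>
  define z where "z = (\<lambda>i. T v i - \<mu> * v i)"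
  have z_alt: "z = (\<lambda>i. T v i + (- \<mu>) * v i)" by (simp add: z_def)
  have zP: "z \<in> P" unfolding z_alt by (intro P_add P_T P_scale vP)
  have z0: "einner n z z = 0"
  proof (rule ccontr)
    assume "einner n z z \<noteq> 0"
    hence zpos: "einner n z z > 0" using einner_self_nonneg[of n z] by linarith
    have Bvz: "einner n z (T v) - \<mu> * einner n z v = einner n z z"
    proof -
      have "einner n z z = einner n z (\<lambda>i. T v i - \<mu> * v i)" by (simp add: z_def)
      thus ?thesis by (simp only: einner_diff_right einner_mult_right)
    qed
    define b where "b = einner n z (T z) - \<mu> * einner n z z"
    have b0: "b \<ge> 0" using low[OF zP] by (simp add: b_def)
    have key: "0 \<le> 2 * t * einner n z z + t\<^sup>2 * b" for t
    proof -
      have "\<mu> * einner n (\<lambda>i. v i + t * z i) (\<lambda>i. v i + t * z i)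
            \<le> einner n (\<lambda>i. v i + t * z i) (T (\<lambda>i. v i + t * z i))"
        by (intro low P_add P_scale zP vP)
      moreover have "einner n v (T z) = einner n z (T v)"
        using T_sym[of z v] einner_commute[of n "T z" v] by simp
      ultimately show ?thesis
        using Bvz v1 unfolding T_add T_scale einner_linear b_def
        by (simp add: \<mu>_def[symmetric] einner_commute[of n v z] algebra_simps power2_eq_square)
    qed
    \<comment> \<open>The minimiser of the quadratic would have \<open>b\<close> in the denominator,
      which may be zero; \<open>b + 1\<close> is positive and still gives a negative value.\<close>
    define t where "t = - einner n z z / (b + 1)"
    have tb: "t * (b + 1) = - einner n z z" unfolding t_def using b0 by simp
    have t0: "t < 0" unfolding t_def using b0 zpos by (simp add: divide_neg_pos)
    have "2 * t * einner n z z + t\<^sup>2 * b = 2 * t * einner n z z + t * (t * (b + 1)) - t * t"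
      by (simp add: algebra_simps power2_eq_square)
    also have "\<dots> = t * (einner n z z - t)" unfolding tb by (simp add: algebra_simps)
    also have "\<dots> < 0" using t0 zpos by (intro mult_neg_pos) auto
    finally have "2 * t * einner n z z + t\<^sup>2 * b < 0" .
    thus False using key[of t] by linarith
  qed
  have "z i = 0" for i
    using z0 P_sub[OF zP] by (cases "i < n") (auto simp: einner_self_eq_0_iff)
  hence "T v = (\<lambda>i. \<mu> * v i)" unfolding z_def by (auto simp: fun_eq_iff)
  thus thesis using that vP v1 low by blast
qed

subsection \<open>The graph Laplacian\<close>

text \<open>The value \<open>0\<close> beyond \<open>n\<close> keeps the image among the vectors
  supported on the first \<open>n\<close> coordinates, so the subspaces used for the eigenvectors
  are invariant.\<close>

definition lap :: "nat \<Rightarrow> real mat \<Rightarrow> (nat \<Rightarrow> real) \<Rightarrow> nat \<Rightarrow> real" where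
  "lap n L x i = (if i < n then \<Sum>j<n. L $$ (i, j) * x j else 0)"

lemma lap_add: "lap n L (\<lambda>i. x i + y i) = (\<lambda>i. lap n L x i + lap n L y i)"
  by (auto simp: lap_def fun_eq_iff algebra_simps sum.distrib)

lemma lap_diff: "lap n L (\<lambda>i. x i - y i) = (\<lambda>i. lap n L x i - lap n L y i)"
  by (auto simp: lap_def fun_eq_iff algebra_simps sum_subtractf)

lemma lap_scale: "lap n L (\<lambda>i. c * x i) = (\<lambda>i. c * lap n L x i)"
  by (auto simp: lap_def fun_eq_iff sum_distrib_left algebra_simps)

lemma lap_cong: "(\<And>i. i < n \<Longrightarrow> x i = y i) \<Longrightarrow> lap n L x = lap n L y"
  by (auto simp: lap_def fun_eq_iff)

lemma continuous_on_lap: "continuous_on A (\<lambda>x. lap n L x i)"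
  unfolding lap_def by (cases "i < n") (auto intro!: continuous_intros continuous_on_coordinate)

locale connected_laplacian =
  fixes n :: nat and E a L
  assumes n2: "n \<ge> 2" and wg: "weighted_graph n E a" and cg: "connected_graph n E"
    and L_def: "L = laplacian n a"
begin

lemma a_sym: "i < n \<Longrightarrow> j < n \<Longrightarrow> a i j = a j i"
  using wg by (auto simp: weighted_graph_def)

lemma a_nonneg: "i < n \<Longrightarrow> j < n \<Longrightarrow> 0 \<le> a i j"
  using wg unfolding weighted_graph_def by (metis less_imp_le order_refl)

lemma L_carrier: "L \<in> carrier_mat n n"
  by (simp add: L_def laplacian_def)

lemma lap_eq: assumes "i < n" shows "lap n L x i = (\<Sum>j<n. a i j * (x i - x j))"
proof -
  have "lap n L x i = (\<Sum>j<n. (if i = j then \<Sum>l<n. a i l else 0) * x j - a i j * x j)"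
    using assms by (auto simp: lap_def L_def laplacian_def algebra_simps intro!: sum.cong)
  also have "\<dots> = (\<Sum>l<n. a i l) * x i - (\<Sum>j<n. a i j * x j)"
    using assms by (simp add: sum_subtractf if_distrib[of "\<lambda>z. z * _"] cong: if_cong)
  finally show ?thesis by (simp add: algebra_simps sum_subtractf sum_distrib_left)
qed

lemma lap_sym: "einner n x (lap n L y) = einner n (lap n L x) y"
proof -
  have sw: "(\<Sum>i<n. \<Sum>j<n. a i j * (x i * y j)) = (\<Sum>i<n. \<Sum>j<n. a i j * (x j * y i))"
    by (subst sum.swap) (auto intro!: sum.cong simp: a_sym)
  have "einner n x (lap n L y) = (\<Sum>i<n. \<Sum>j<n. a i j * (x i * y i)) - (\<Sum>i<n. \<Sum>j<n. a i j * (x i * y j))"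
    by (simp add: einner_def lap_eq sum_distrib_left sum_subtractf[symmetric] right_diff_distrib mult_ac)
  moreover have "einner n (lap n L x) y = (\<Sum>i<n. \<Sum>j<n. a i j * (x i * y i)) - (\<Sum>i<n. \<Sum>j<n. a i j * (x j * y i))"
    by (simp add: einner_def lap_eq sum_distrib_right sum_distrib_left sum_subtractf[symmetric] right_diff_distrib left_diff_distrib mult_ac)
  ultimately show ?thesis using sw by simp
qed

text \<open>The Dirichlet form of the graph: symmetry of the weights allows the double sum to be
  averaged with its transpose, which produces the squares.\<close>

lemma lap_quadratic: "einner n x (lap n L x) = (\<Sum>i<n. \<Sum>j<n. a i j * (x i - x j)\<^sup>2) / 2"
proof -
  have sw: "(\<Sum>i<n. \<Sum>j<n. a i j * (x i * (x i - x j))) = (\<Sum>i<n. \<Sum>j<n. a i j * (x j * (x j - x i)))"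
    by (subst sum.swap) (auto intro!: sum.cong simp: a_sym)
  have "einner n x (lap n L x) = (\<Sum>i<n. \<Sum>j<n. a i j * (x i * (x i - x j)))"
    by (simp add: einner_def lap_eq sum_distrib_left algebra_simps)
  hence "2 * einner n x (lap n L x) = (\<Sum>i<n. \<Sum>j<n. a i j * (x i * (x i - x j)))
     + (\<Sum>i<n. \<Sum>j<n. a i j * (x j * (x j - x i)))" using sw by simp
  also have "\<dots> = (\<Sum>i<n. \<Sum>j<n. a i j * (x i - x j)\<^sup>2)"
    by (simp add: sum.distrib[symmetric] power2_eq_square algebra_simps)
  finally show ?thesis by simp
qed

lemma lap_psd: "0 \<le> einner n x (lap n L x)"
  unfolding lap_quadratic using a_nonneg by (auto intro!: sum_nonneg divide_nonneg_nonneg)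

lemma sum_lap: "(\<Sum>i<n. lap n L x i) = 0"
proof -
  have "lap n L (\<lambda>i. 1) = (\<lambda>i. 0)"
    by (rule ext) (metis (no_types, lifting) diff_self lap_def lap_eq mult_zero_right sum.neutral)
  hence "einner n (\<lambda>i. 1) (lap n L x) = 0" unfolding lap_sym by (simp add: einner_def)
  thus ?thesis by (simp add: einner_def)
qed

text \<open>A vanishing Dirichlet form forces equal values along each edge, hence along each path.
  By connectedness the vector is constant, and the sum condition makes it zero.\<close>

lemma lap_quadratic_pos:
  assumes "(\<Sum>i<n. x i) = 0" "einner n x x \<noteq> 0"
  shows "0 < einner n x (lap n L x)"
proof (rule ccontr)
  assume "\<not> ?thesis"
  hence "einner n x (lap n L x) = 0" using lap_psd[of x] by linarith
  hence z: "(\<Sum>i<n. \<Sum>j<n. a i j * (x i - x j)\<^sup>2) = 0" by (simp add: lap_quadratic)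
  have edge: "x i = x j" if "(i, j) \<in> E" for i j
  proof -
    have ij: "i < n" "j < n" using wg that by (auto simp: weighted_graph_def)
    have "if (i, j) \<in> E then a i j > 0 else a i j = 0"
      using wg ij unfolding weighted_graph_def by blast
    hence aij: "a i j > 0" using that by simp
    have "\<forall>i<n. (\<Sum>j<n. a i j * (x i - x j)\<^sup>2) = 0"
      using z by (subst (asm) sum_nonneg_eq_0_iff) (auto intro!: sum_nonneg simp: a_nonneg)
    hence "(\<Sum>j<n. a i j * (x i - x j)\<^sup>2) = 0" using ij by blast
    hence "a i j * (x i - x j)\<^sup>2 = 0" using ij
      by (subst (asm) sum_nonneg_eq_0_iff) (auto simp: a_nonneg)
    thus ?thesis using aij by auto
  qed
  have path: "(i, j) \<in> E\<^sup>* \<Longrightarrow> x i = x j" for i j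
    by (induction rule: rtrancl_induct) (auto dest: edge)
  have const: "x i = x 0" if "i < n" for i
    using cg that n2 path[of i 0] by (auto simp: connected_graph_def)
  have "(\<Sum>i<n. x i) = (\<Sum>i<n. x 0)" by (rule sum.cong) (auto intro: const)
  hence "x 0 = 0" using assms n2 by simp
  hence "\<forall>i<n. x i = 0" using const by metis
  thus False using assms(2) by (simp add: einner_self_eq_0_iff)
qed

lemma lap_eigenvalue:
  assumes "einner n v v = 1" "lap n L v = (\<lambda>i. \<mu> * v i)"
  shows "eigenvalue L \<mu>"
proof -
  have d: "dim_row L = n" "dim_col L = n" using L_carrier by auto
  have "vec n v \<noteq> 0\<^sub>v n"
  proof
    assume "vec n v = 0\<^sub>v n"
    hence "\<forall>i<n. v i = 0" by (metis index_vec index_zero_vec(1))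
    thus False using assms(1) by (simp add: einner_def)
  qed
  moreover have "L *\<^sub>v vec n v = \<mu> \<cdot>\<^sub>v vec n v"
  proof (rule eq_vecI)
    fix i assume "i < dim_vec (\<mu> \<cdot>\<^sub>v vec n v)"
    hence i: "i < n" by simp
    have "(L *\<^sub>v vec n v) $ i = lap n L v i"
      using i d by (simp add: lap_def scalar_prod_def atLeast0LessThan)
    thus "(L *\<^sub>v vec n v) $ i = (\<mu> \<cdot>\<^sub>v vec n v) $ i" using assms(2) i by simp
  qed (simp add: d)
  ultimately have "eigenvector L (vec n v) \<mu>" by (simp add: eigenvector_def d)
  thus ?thesis by (auto simp: eigenvalue_def)
qed

lemma rho2_le: assumes "eigenvalue L \<mu>" "\<mu> > 0" shows "rho2 L \<le> \<mu>"
proof -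
  have "finite {l. eigenvalue L l \<and> l > 0}"
    using card_finite_spectrum(1)[OF L_carrier] by (auto simp: spectrum_def intro: finite_subset)
  thus ?thesis unfolding rho2_def using assms by (intro Min_le) auto
qed

text \<open>The minimiser of the form on sum-zero vectors yields a positive eigenvalue
  \<open>\<mu>\<close>. It makes the set in \<open>rho2\<close> nonempty and, as a member, is at
  least the minimum; so the gap with \<open>\<mu>\<close> implies the gap with
  \<open>rho2 L\<close>.\<close>

lemma
  shows rho2_pos: "0 < rho2 L"
    and spectral_gap: "(\<Sum>i<n. x i) = 0 \<Longrightarrow> rho2 L * einner n x x \<le> einner n x (lap n L x)"
proof -
  define P where "P = {x :: nat \<Rightarrow> real. (\<forall>i\<ge>n. x i = 0) \<and> (\<Sum>i<n. x i) = 0}"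
  have "P = (\<Inter>i\<in>{n..}. {x. x i = 0}) \<inter> {x. (\<Sum>i<n. x i) = 0}" by (auto simp: P_def)
  moreover have "closed \<dots>"
    by (intro closed_Int closed_INT ballI closed_Collect_eq continuous_intros
        continuous_on_coordinate) 
  ultimately have cl: "closed P" by simp
  \<comment> \<open>A nonzero sum-zero vector; it exists because \<open>n\<close> is at least
    \<open>2\<close>.\<close>
  define e :: "nat \<Rightarrow> real" where "e = (\<lambda>i. if i = 0 then 1 else if i = 1 then -1 else 0)"
  have se: "(\<Sum>i<n. e i) = 0"
  proof -
    have "(\<Sum>i<n. e i) = (\<Sum>i\<in>{0,1}. e i)" using n2
      by (intro sum.mono_neutral_right) (auto simp: e_def)
    thus ?thesis by (simp add: e_def)
  qed
  have eP: "e \<in> P" using se n2 by (auto simp: P_def e_def)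
  have ene: "einner n e e \<noteq> 0"
    using n2 by (auto simp: einner_self_eq_0_iff e_def intro!: exI[of _ 0])
  obtain v \<mu> where v: "v \<in> P" "einner n v v = 1" "lap n L v = (\<lambda>i. \<mu> * v i)"
    "\<And>x. x \<in> P \<Longrightarrow> \<mu> * einner n x x \<le> einner n x (lap n L x)"
    by (rule symmetric_minimal_eigenvector[of "lap n L" n P e])
      (auto simp: lap_add lap_scale lap_sym continuous_on_lap cl eP ene,
        auto simp: P_def sum.distrib sum_distrib_left[symmetric] sum_lap, simp add: lap_def)
  have "0 < einner n v (lap n L v)" using v by (intro lap_quadratic_pos) (auto simp: P_def)
  hence \<mu>: "\<mu> > 0" using v by (simp add: einner_mult_right)
  have ev: "eigenvalue L \<mu>" using lap_eigenvalue v by blast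
  have fin: "finite {l. eigenvalue L l \<and> l > 0}"
    using card_finite_spectrum(1)[OF L_carrier] by (auto simp: spectrum_def intro: finite_subset)
  have "rho2 L \<in> {l. eigenvalue L l \<and> l > 0}" unfolding rho2_def
    using fin ev \<mu> by (intro Min_in) auto
  thus pos: "0 < rho2 L" by simp
  have le: "rho2 L \<le> \<mu>" by (rule rho2_le[OF ev \<mu>])
  assume x: "(\<Sum>i<n. x i) = 0"
  let ?x = "\<lambda>i. if i < n then x i else 0"
  have "?x \<in> P" using x by (simp add: P_def)
  from v(4)[OF this] have "\<mu> * einner n ?x ?x \<le> einner n ?x (lap n L ?x)" .
  moreover have "einner n ?x ?x = einner n x x" by (intro einner_cong) auto
  moreover have "lap n L ?x = lap n L x" by (rule lap_cong) auto
  moreover have "einner n ?x (lap n L x) = einner n x (lap n L x)" by (intro einner_cong) auto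
  ultimately have "\<mu> * einner n x x \<le> einner n x (lap n L x)" by simp
  thus "rho2 L * einner n x x \<le> einner n x (lap n L x)"
    using le by (meson einner_self_nonneg mult_right_mono order_trans)
qed

text \<open>One eigenvalue \<open>\<mu>\<close> governs both forms: the negative of the smallest
  eigenvalue of the negated Laplacian. Since \<open>\<mu>\<close> and \<open>\<mu>\<^sup>2\<close>
  are eigenvalues of \<open>L\<close> and \<open>L * L\<close>, the spectral radii dominate
  them.\<close>

lemma spectral_bounds:
  obtains \<mu> where "0 \<le> \<mu>" "\<mu> \<le> rho L" "\<mu>\<^sup>2 \<le> rho (L * L)"
    "\<And>x. einner n x (lap n L x) \<le> \<mu> * einner n x x"
    "\<And>x. einner n (lap n L x) (lap n L x) \<le> \<mu>\<^sup>2 * einner n x x"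
proof -
  define P where "P = {x :: nat \<Rightarrow> real. (\<forall>i\<ge>n. x i = 0)}"
  have "P = (\<Inter>i\<in>{n..}. {x. x i = 0})" by (auto simp: P_def)
  moreover have "closed \<dots>"
    by (intro closed_Int closed_INT ballI closed_Collect_eq continuous_intros
        continuous_on_coordinate) 
  ultimately have cl: "closed P" by simp
  define e :: "nat \<Rightarrow> real" where "e = (\<lambda>i. if i = 0 then 1 else 0)"
  have eP: "e \<in> P" using n2 by (auto simp: P_def e_def)
  have ene: "einner n e e \<noteq> 0"
    using n2 by (auto simp: einner_self_eq_0_iff e_def intro!: exI[of _ 0])
  let ?T = "\<lambda>x i. - lap n L x i"
  have T_sym: "einner n x (?T y) = einner n (?T x) y" for x y
    using lap_sym[of x y] by (simp add: einner_def sum_negf)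
  obtain v m where v: "v \<in> P" "einner n v v = 1" "?T v = (\<lambda>i. m * v i)"
    "\<And>x. x \<in> P \<Longrightarrow> m * einner n x x \<le> einner n x (?T x)"
    by (rule symmetric_minimal_eigenvector[of ?T n P e])
      (auto simp: lap_add lap_scale T_sym cl eP ene intro!: continuous_intros continuous_on_lap,
        auto simp: P_def, simp add: lap_def)
  define \<mu> where "\<mu> = - m"
  have lv: "lap n L v = (\<lambda>i. \<mu> * v i)" using v(3) unfolding \<mu>_def fun_eq_iff
    by (metis minus_minus mult_minus_left)
  have up: "einner n x (lap n L x) \<le> \<mu> * einner n x x" for x
  proof -
    let ?x = "\<lambda>i. if i < n then x i else 0"
    have "?x \<in> P" by (simp add: P_def)
    from v(4)[OF this] have "m * einner n ?x ?x \<le> einner n ?x (?T ?x)" .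
    moreover have "einner n ?x ?x = einner n x x" by (intro einner_cong) auto
    moreover have "lap n L ?x = lap n L x" by (rule lap_cong) auto
    moreover have "einner n ?x (?T x) = einner n x (?T x)" by (intro einner_cong) auto
    moreover have "einner n x (?T x) = - einner n x (lap n L x)" by (simp add: einner_def sum_negf)
    ultimately show ?thesis by (simp add: \<mu>_def)
  qed
  have \<mu>0: "0 \<le> \<mu>" using lap_psd[of v] lv v(2) by (simp add: einner_mult_right)
  have ev: "eigenvalue L \<mu>" using lap_eigenvalue v lv by blast
  have sq: "einner n (lap n L x) (lap n L x) \<le> \<mu>\<^sup>2 * einner n x x" for x
  proof -
    let ?y = "lap n L x"
    define A where "A = einner n x ?y"
    define B where "B = einner n ?y ?y"
    define C where "C = einner n ?y (lap n L ?y)"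
    \<comment> \<open>Positivity of the form at \<open>\<mu> * x\<close> minus the Laplacian of
      \<open>x\<close> bounds \<open>B\<close> by \<open>A\<close> and \<open>C\<close>, and
      \<open>C \<le> \<mu> * B\<close> eliminates \<open>C\<close>. A factor \<open>\<mu>\<close>
      has to be cancelled, so \<open>\<mu> = 0\<close> is treated separately with the weight
      \<open>1\<close> in place of \<open>\<mu>\<close>.\<close>
    have "0 \<le> einner n (\<lambda>i. x i * \<mu> - ?y i) (lap n L (\<lambda>i. x i * \<mu> - ?y i))" by (rule lap_psd)
    also have "\<dots> = \<mu>\<^sup>2 * A - 2 * \<mu> * B + C"
      unfolding mult.commute[of _ \<mu>] lap_diff lap_scale einner_linear
      using lap_sym[of x ?y] by (simp add: A_def B_def C_def power2_eq_square algebra_simps)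
    finally have 1: "2 * \<mu> * B \<le> \<mu>\<^sup>2 * A + C" by simp
    have 2: "C \<le> \<mu> * B" unfolding B_def C_def by (rule up)
    have 3: "A \<le> \<mu> * einner n x x" unfolding A_def by (rule up)
    show ?thesis
    proof (cases "\<mu> = 0")
      case False
      hence "\<mu> > 0" using \<mu>0 by simp
      have "\<mu> * B \<le> \<mu> * (\<mu> * A)" using 1 2 by (simp add: power2_eq_square algebra_simps)
      hence "B \<le> \<mu> * A" using \<open>\<mu> > 0\<close> by simp
      also have "\<dots> \<le> \<mu> * (\<mu> * einner n x x)" using 3 \<mu>0 by (intro mult_left_mono)
      finally show ?thesis by (simp add: B_def power2_eq_square)
    next
      case True
      have q0: "einner n z (lap n L z) = 0" for z
        using up[of z] lap_psd[of z] True by simp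
      have A0: "A = 0" and C0: "C = 0" using q0 by (simp_all add: A_def C_def)
      have "0 \<le> einner n (\<lambda>i. x i - ?y i) (lap n L (\<lambda>i. x i - ?y i))" by (rule lap_psd)
      also have "\<dots> = A - 2 * B + C"
        unfolding lap_diff einner_linear
        using lap_sym[of x ?y] by (simp add: A_def B_def C_def)
      finally show ?thesis using A0 C0 True by (simp add: B_def)
    qed
  qed
  \<comment> \<open>\<open>rho\<close> is the spectral radius of the complexified matrix, so real
    eigenvalues are carried over to it.\<close>
  have cev: "eigenvalue (map_mat complex_of_real K) (complex_of_real l)"
    if "K \<in> carrier_mat n n" "eigenvalue K l" for K l
    using that of_real_hom.eigenvalue_hom by blast
  have rho_ge: "\<bar>l\<bar> \<le> rho K" if K: "K \<in> carrier_mat n n" "eigenvalue K l" for K l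
  proof -
    have "map_mat complex_of_real K \<in> carrier_mat n n" using K by simp
    moreover have "cmod (complex_of_real l) \<in> cmod ` spectrum (map_mat complex_of_real K)"
      unfolding spectrum_def using cev[OF K] by blast
    ultimately have "cmod (complex_of_real l) \<le> spectral_radius (map_mat complex_of_real K)"
      using spectral_radius_mem_max(2)[of _ n] n2 by simp
    thus ?thesis by (simp add: rho_def)
  qed
  obtain vv where vv: "eigenvector L vv \<mu>" using ev by (auto simp: eigenvalue_def)
  have vc: "vv \<in> carrier_vec n" using vv L_carrier by (auto simp: eigenvector_def)
  have "(L * L) *\<^sub>v vv = L *\<^sub>v (L *\<^sub>v vv)" using L_carrier vc by (simp add: assoc_mult_mat_vec)
  also have "\<dots> = \<mu>\<^sup>2 \<cdot>\<^sub>v vv" using vv vc L_carrier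
    by (simp add: eigenvector_def mult_mat_vec smult_smult_assoc power2_eq_square)
  finally have "eigenvalue (L * L) (\<mu>\<^sup>2)"
    using vv L_carrier by (auto simp: eigenvalue_def eigenvector_def)
  hence "\<mu>\<^sup>2 \<le> rho (L * L)" using rho_ge[of "L*L" "\<mu>\<^sup>2"] L_carrier by auto
  moreover have "\<mu> \<le> rho L" using rho_ge[OF L_carrier ev] by simp
  ultimately show thesis using that \<mu>0 up sq by blast
qed

end

subsection \<open>A Lyapunov function for the noiseless consensus dynamics\<close>

definition centered :: "nat \<Rightarrow> (nat \<Rightarrow> real) \<Rightarrow> nat \<Rightarrow> real" where
  "centered n x i = x i - (\<Sum>j<n. x j) / real n"

lemma sum_centered: "n > 0 \<Longrightarrow> (\<Sum>i<n. centered n x i) = 0"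
  by (simp add: centered_def sum_subtractf)

lemma centered_diff: "centered n (\<lambda>i. x i - y i) = (\<lambda>i. centered n x i - centered n y i)"
  by (rule ext) (simp add: centered_def sum_subtractf diff_divide_distrib)

lemma einner_centered_le:
  assumes "n > 0" shows "einner n (centered n x) (centered n x) \<le> einner n x x"
proof -
  let ?m = "(\<Sum>j<n. x j) / real n"
  have "x i * x i = centered n x i * centered n x i + 2 * ?m * centered n x i + ?m\<^sup>2" for i
    unfolding centered_def by (simp only: power2_eq_square) (simp only: algebra_simps, simp)
  hence "einner n x x = einner n (centered n x) (centered n x) + 2 * ?m * (\<Sum>i<n. centered n x i) + n * ?m\<^sup>2"
    by (simp add: einner_def sum.distrib sum_distrib_left)
  thus ?thesis using assms by (simp add: sum_centered)
qed

context connected_laplacian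
begin

abbreviation "\<Lambda> \<equiv> lap n L"

text \<open>Here \<open>y\<close> is the disagreement and \<open>\<Lambda> w\<close> the dual variable. The cross term
  \<open>\<langle>y, \<Lambda> w\<rangle>\<close> produces the decrease in \<open>\<Lambda> w\<close>, and all first-order mixed terms cancel.\<close>

definition lyap :: "real \<Rightarrow> (nat \<Rightarrow> real) \<Rightarrow> (nat \<Rightarrow> real) \<Rightarrow> real" where
  "lyap \<kappa>1 y w = einner n y y / 2 + einner n w (\<Lambda> w) / 2 + \<kappa>1 / 2 * einner n (\<Lambda> w) (\<Lambda> w)
     + einner n y (\<Lambda> w)"

lemma lap_centered: "\<Lambda> (centered n x) = \<Lambda> x"
proof (rule ext)
  fix i show "\<Lambda> (centered n x) i = \<Lambda> x i"
    by (cases "i < n") (simp_all add: lap_eq centered_def, simp add: lap_def)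
qed

lemma lap_zero: "\<Lambda> (\<lambda>i. 0) = (\<lambda>i. 0)"
  by (auto simp: lap_def)

lemma centered_lap: "centered n (\<Lambda> x) = \<Lambda> x"
  by (rule ext) (simp add: centered_def sum_lap)

text \<open>Completing the square. The vector \<open>y + \<Lambda> w\<close> is the derivative of
  \<open>lyap\<close> in \<open>y\<close>, so this controls the first-order effect of perturbing
  \<open>y\<close>.\<close>

lemma lyap_lower1:
  assumes "\<kappa>1 \<ge> 1"
  shows "einner n (\<lambda>i. y i + \<Lambda> w i) (\<lambda>i. y i + \<Lambda> w i) / 2 \<le> lyap \<kappa>1 y w"
proof -
  have "(\<kappa>1 - 1) * einner n (\<Lambda> w) (\<Lambda> w) \<ge> 0" using assms by simp
  thus ?thesis unfolding lyap_def einner_linear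
    using lap_psd[of w] by (simp add: einner_commute[of n "\<Lambda> w" y] algebra_simps)
qed

lemma lyap_lower2:
  assumes "\<kappa>1 > 1"
  shows "(\<kappa>1 - 1) / (4 * (\<kappa>1 + 1)) * einner n y y \<le> lyap \<kappa>1 y w"
proof -
  \<comment> \<open>With this weight the square of \<open>t * y + \<Lambda> w\<close> absorbs the
    cross term at the cost of \<open>t / 2 < 1 / 2\<close> in front of \<open>A\<close> and
    \<open>(\<kappa>1 + 1) / 4 < \<kappa>1 / 2\<close> in front of \<open>R\<close>; because
    \<open>\<kappa>1 > 1\<close>, both keep a positive share.\<close>
  define t where "t = 2 / (\<kappa>1 + 1)"
  define A R P where "A = einner n y y" "R = einner n (\<Lambda> w) (\<Lambda> w)" "P = einner n y (\<Lambda> w)"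
  have t: "t > 0" "t * (\<kappa>1 + 1) = 2" using assms unfolding t_def by (simp, subst nonzero_eq_divide_eq[symmetric]) auto
  have R0: "R \<ge> 0" and A0: "A \<ge> 0" by (auto simp: A_R_P_def)
  have "0 \<le> einner n (\<lambda>i. t * y i + \<Lambda> w i) (\<lambda>i. t * y i + \<Lambda> w i)" by simp
  also have "\<dots> = t\<^sup>2 * A + 2 * t * P + R" unfolding einner_linear
    by (simp add: A_R_P_def einner_commute[of n "\<Lambda> w" y] algebra_simps power2_eq_square)
  finally have "0 \<le> (t\<^sup>2 * A + 2 * t * P + R) * ((\<kappa>1 + 1) / 4)" using assms by simp
  also have "\<dots> = (t * (t * (\<kappa>1 + 1)) / 4) * A + t * (\<kappa>1 + 1) / 2 * P + (\<kappa>1 + 1) / 4 * R"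
    by (simp add: algebra_simps power2_eq_square)
  also have "\<dots> = t / 2 * A + P + (\<kappa>1 + 1) / 4 * R" by (simp add: t)
  finally have *: "0 \<le> t / 2 * A + P + (\<kappa>1 + 1) / 4 * R" .
  have "lyap \<kappa>1 y w \<ge> A / 2 + \<kappa>1 / 2 * R + P"
    unfolding lyap_def A_R_P_def using lap_psd[of w] by simp
  also have "A / 2 + \<kappa>1 / 2 * R + P = (t / 2 * A + P + (\<kappa>1 + 1) / 4 * R) + (1/2 - t/2) * A + (\<kappa>1 - 1) / 4 * R"
    by (simp add: algebra_simps add_divide_distrib diff_divide_distrib)
  also have "\<dots> \<ge> (1/2 - t/2) * A" 
  proof -
    have "0 \<le> (\<kappa>1 - 1) / 4 * R" using R0 assms by simp
    thus ?thesis using * by linarith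
  qed
  also have "1/2 - t/2 = (\<kappa>1 - 1) / (2 * (\<kappa>1 + 1))" using assms by (simp add: t_def field_simps)
  finally have **: "(\<kappa>1 - 1) / (2 * (\<kappa>1 + 1)) * A \<le> lyap \<kappa>1 y w" by simp
  have "(\<kappa>1 - 1) / (4 * (\<kappa>1 + 1)) \<le> (\<kappa>1 - 1) / (2 * (\<kappa>1 + 1))"
    using assms by (intro divide_left_mono) auto
  from mult_right_mono[OF this A0] ** show ?thesis by (simp add: A_R_P_def)
qed

text \<open>The spectral gap for \<open>w\<close>, inserted into the square of
  \<open>rho2 L * w - \<Lambda> w\<close>. It bounds the \<open>w\<close>-part of
  \<open>lyap\<close> by \<open>\<Lambda> w\<close>, the quantity in which the decrease is
  measured.\<close>

lemma lap_form_le: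
  assumes "(\<Sum>i<n. w i) = 0"
  shows "einner n w (\<Lambda> w) \<le> einner n (\<Lambda> w) (\<Lambda> w) / rho2 L"
proof -
  define S where "S = einner n w (\<Lambda> w)"
  define R where "R = einner n (\<Lambda> w) (\<Lambda> w)"
  have "0 \<le> einner n (\<lambda>i. rho2 L * w i - \<Lambda> w i) (\<lambda>i. rho2 L * w i - \<Lambda> w i)" by simp
  also have "\<dots> = rho2 L * (rho2 L * einner n w w) - 2 * rho2 L * S + R"
    unfolding einner_linear by (simp add: S_def R_def einner_commute[of n "\<Lambda> w" w])
  also have "\<dots> \<le> rho2 L * S - 2 * rho2 L * S + R"
    using spectral_gap[OF assms] rho2_pos by (simp add: S_def)
  finally have "rho2 L * S \<le> R" by linarith
  thus ?thesis using rho2_pos by (simp add: S_def R_def field_simps)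
qed

lemma lyap_upper:
  assumes "\<kappa>1 \<ge> 0" "(\<Sum>i<n. w i) = 0"
  shows "lyap \<kappa>1 y w \<le> (1 + 1 / rho2 L + \<kappa>1) * (einner n y y + einner n (\<Lambda> w) (\<Lambda> w))"
proof -
  define A R P S where "A = einner n y y" "R = einner n (\<Lambda> w) (\<Lambda> w)"
    "P = einner n y (\<Lambda> w)" "S = einner n w (\<Lambda> w)"
  have "0 \<le> einner n (\<lambda>i. y i - \<Lambda> w i) (\<lambda>i. y i - \<Lambda> w i)" by simp
  also have "\<dots> = A - 2 * P + R"
    unfolding einner_linear by (simp add: A_R_P_S_def einner_commute[of n "\<Lambda> w" y])
  finally have P: "P \<le> A / 2 + R / 2" by simp
  have S: "S \<le> R / rho2 L" using lap_form_le[OF assms(2)] by (simp add: A_R_P_S_def)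
  have A0: "A \<ge> 0" and R0: "R \<ge> 0" by (auto simp: A_R_P_S_def)
  have nn: "0 \<le> R / rho2 L" "0 \<le> A / rho2 L" "0 \<le> \<kappa>1 * R" "0 \<le> \<kappa>1 * A"
    using A0 R0 rho2_pos assms by auto
  have "lyap \<kappa>1 y w = A / 2 + S / 2 + \<kappa>1 / 2 * R + P" by (simp add: lyap_def A_R_P_S_def)
  also have "\<dots> \<le> (1 + 1 / rho2 L + \<kappa>1) * (A + R)"
    using P S nn A0 R0 by (simp add: algebra_simps add_divide_distrib)
  finally show ?thesis by (simp add: A_R_P_S_def)
qed

text \<open>To first order in \<open>h\<close> the change is
  \<open>- (\<kappa>1 - 1) * B - R\<close>. Hypothesis \<open>small\<close> pays for the
  second-order terms in \<open>y\<close> out of the spectral gap and leaves \<open>- h * A\<close>;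
  the second-order term in \<open>\<Lambda> w\<close> costs at most \<open>h * R / 5\<close> because
  \<open>h < 1 / 5\<close>.\<close>

lemma lyap_noiseless_step:
  assumes y0: "(\<Sum>i<n. y i) = 0"
    and k1: "\<kappa>1 > 1" and h: "0 < h" "h < 1/5"
    and small: "h * (\<kappa>1\<^sup>2 * rho (L * L) + rho L / 2) \<le> (\<kappa>1 - 1) * rho2 L - 1"
  shows "lyap \<kappa>1 (\<lambda>i. y i - h * (\<kappa>1 * \<Lambda> y i + \<Lambda> w i)) (\<lambda>i. w i + h * y i)
    \<le> lyap \<kappa>1 y w - 4 / 5 * h * (einner n y y + einner n (\<Lambda> w) (\<Lambda> w))"
proof -
  obtain \<mu> where \<mu>: "0 \<le> \<mu>" "\<mu> \<le> rho L" "\<mu>\<^sup>2 \<le> rho (L * L)"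
    "\<And>x. einner n x (\<Lambda> x) \<le> \<mu> * einner n x x"
    "\<And>x. einner n (\<Lambda> x) (\<Lambda> x) \<le> \<mu>\<^sup>2 * einner n x x"
    by (rule spectral_bounds) blast
  define A where "A = einner n y y"
  define B where "B = einner n y (\<Lambda> y)"
  define C where "C = einner n (\<Lambda> y) (\<Lambda> y)"
  define P where "P = einner n y (\<Lambda> w)"
  define Q where "Q = einner n (\<Lambda> y) (\<Lambda> w)"
  define R where "R = einner n (\<Lambda> w) (\<Lambda> w)"
  define S where "S = einner n w (\<Lambda> w)"
  have comm: "einner n w (\<Lambda> y) = P" "einner n (\<Lambda> w) y = P" "einner n (\<Lambda> w) (\<Lambda> y) = Q"
     "einner n (\<Lambda> y) y = B"
    using lap_sym[of w y] by (simp_all add: P_def Q_def B_def einner_commute)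
  have eq: "lyap \<kappa>1 (\<lambda>i. y i - h * (\<kappa>1 * \<Lambda> y i + \<Lambda> w i)) (\<lambda>i. w i + h * y i)
    = lyap \<kappa>1 y w - h * (\<kappa>1 - 1) * B - h * R
      + h\<^sup>2 * ((\<kappa>1\<^sup>2 / 2 - \<kappa>1 / 2) * C + (\<kappa>1 - 1) * Q + R / 2 + B / 2)"
    unfolding lyap_def lap_add lap_scale einner_linear comm
    unfolding A_def[symmetric] B_def[symmetric] C_def[symmetric] P_def[symmetric] Q_def[symmetric]
       R_def[symmetric] S_def[symmetric]
    by (simp add: field_simps power2_eq_square)
  have "0 \<le> einner n (\<lambda>i. (\<kappa>1 - 1) * \<Lambda> y i - \<Lambda> w i) (\<lambda>i. (\<kappa>1 - 1) * \<Lambda> y i - \<Lambda> w i)" by simp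
  also have "\<dots> = (\<kappa>1 - 1)\<^sup>2 * C - 2 * (\<kappa>1 - 1) * Q + R"
    unfolding einner_linear comm C_def[symmetric] Q_def[symmetric] R_def[symmetric]
    by (simp add: algebra_simps power2_eq_square)
  finally have Q: "(\<kappa>1 - 1) * Q \<le> (\<kappa>1 - 1)\<^sup>2 / 2 * C + R / 2" by (simp add: algebra_simps)
  have A0: "A \<ge> 0" and R0: "R \<ge> 0" and C0: "C \<ge> 0" by (simp_all add: A_def R_def C_def)
  have C: "C \<le> rho (L * L) * A"
    using \<mu>(5)[of y] mult_right_mono[OF \<mu>(3) A0] by (simp add: C_def A_def)
  have B: "B \<le> rho L * A"
    using \<mu>(4)[of y] mult_right_mono[OF \<mu>(2) A0] by (simp add: B_def A_def)
  have gap: "rho2 L * A \<le> B" using spectral_gap[OF y0] by (simp add: A_def B_def)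
  have "(\<kappa>1\<^sup>2 / 2 - \<kappa>1 / 2) * C + (\<kappa>1 - 1) * Q + R / 2 + B / 2
      \<le> (\<kappa>1\<^sup>2 / 2 - \<kappa>1 / 2) * C + ((\<kappa>1 - 1)\<^sup>2 / 2 * C + R / 2) + R / 2 + B / 2" using Q by simp
  also have "\<dots> = \<kappa>1\<^sup>2 * C - (3 / 2 * \<kappa>1 - 1/2) * C + R + B / 2"
    by (simp add: algebra_simps power2_eq_square add_divide_distrib diff_divide_distrib)
  also have "\<dots> \<le> \<kappa>1\<^sup>2 * C + R + B / 2" using k1 C0 by simp
  also have "\<dots> \<le> \<kappa>1\<^sup>2 * (rho (L * L) * A) + R + rho L * A / 2" using B mult_left_mono[OF C, of "\<kappa>1\<^sup>2"] by simp
  also have "\<dots> = (\<kappa>1\<^sup>2 * rho (L * L) + rho L / 2) * A + R" by (simp add: algebra_simps)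
  finally have "h\<^sup>2 * ((\<kappa>1\<^sup>2 / 2 - \<kappa>1 / 2) * C + (\<kappa>1 - 1) * Q + R / 2 + B / 2)
      \<le> h\<^sup>2 * ((\<kappa>1\<^sup>2 * rho (L * L) + rho L / 2) * A + R)"
    by (intro mult_left_mono) auto
  also have "\<dots> = h * (h * (\<kappa>1\<^sup>2 * rho (L * L) + rho L / 2)) * A + h * h * R"
    by (simp add: algebra_simps power2_eq_square)
  also have "\<dots> \<le> h * ((\<kappa>1 - 1) * rho2 L - 1) * A + h * (1 / 5) * R"
    using small h A0 R0 by (intro add_mono mult_right_mono mult_left_mono) auto
  finally have 1: "h\<^sup>2 * ((\<kappa>1\<^sup>2 / 2 - \<kappa>1 / 2) * C + (\<kappa>1 - 1) * Q + R / 2 + B / 2)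
     \<le> h * ((\<kappa>1 - 1) * rho2 L - 1) * A + h * (1 / 5) * R" .
  have "h * (\<kappa>1 - 1) * (rho2 L * A) \<le> h * (\<kappa>1 - 1) * B"
    using gap k1 h by (intro mult_left_mono) auto
  moreover have "0 \<le> h * A" using h A0 by simp
  moreover have "h * ((\<kappa>1 - 1) * rho2 L - 1) * A = h * (\<kappa>1 - 1) * (rho2 L * A) - h * A"
    by (simp add: algebra_simps)
  moreover have "4 / 5 * h * (A + R) = 4 / 5 * (h * A) + 4 / 5 * (h * R)" "h * (1 / 5) * R = 1 / 5 * (h * R)"
    by (simp_all add: algebra_simps)
  ultimately show ?thesis using 1 unfolding eq A_def[symmetric] R_def[symmetric] by linarith
qed

text \<open>\<open>lyap\<close> is quadratic in \<open>y\<close>, so the expansion is exact. The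
  mixed term with \<open>y + \<Lambda> w\<close> is split by Young's inequality with weight
  \<open>c\<close> and returned to \<open>lyap\<close> through \<open>lyap_lower1\<close>.\<close>

lemma lyap_perturb:
  assumes "\<kappa>1 \<ge> 1" "c > 0"
  shows "lyap \<kappa>1 (\<lambda>i. y i - e i) w \<le> (1 + c) * lyap \<kappa>1 y w + (1 / (2 * c) + 1 / 2) * einner n e e"
proof -
  let ?z = "\<lambda>i. y i + \<Lambda> w i"
  have "0 \<le> einner n (\<lambda>i. c * ?z i + e i) (\<lambda>i. c * ?z i + e i)" by simp
  also have "\<dots> = c\<^sup>2 * einner n ?z ?z + 2 * c * einner n ?z e + einner n e e"
    unfolding einner_add_left[of n "\<lambda>i. c * ?z i"] einner_add_right[of n _ "\<lambda>i. c * ?z i"] 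
      einner_mult_left einner_mult_right
    using einner_commute[of n e ?z] by (simp add: algebra_simps power2_eq_square)
  finally have "0 \<le> (c\<^sup>2 * einner n ?z ?z + 2 * c * einner n ?z e + einner n e e) / (2 * c)"
    using assms by simp
  also have "\<dots> = c * (einner n ?z ?z / 2) + einner n ?z e + einner n e e / (2 * c)"
    using assms by (simp add: field_simps power2_eq_square)
  also have "\<dots> \<le> c * lyap \<kappa>1 y w + einner n ?z e + einner n e e / (2 * c)"
    using lyap_lower1[OF assms(1), of y w] assms(2) by (simp add: mult_left_mono)
  finally have *: "- einner n ?z e \<le> c * lyap \<kappa>1 y w + einner n e e / (2 * c)" by simp
  have "lyap \<kappa>1 (\<lambda>i. y i - e i) w = lyap \<kappa>1 y w - einner n ?z e + einner n e e / 2"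
    unfolding lyap_def einner_linear using einner_commute[of n e y] einner_commute[of n e "\<Lambda> w"]
    by (simp add: algebra_simps add_divide_distrib diff_divide_distrib)
  with * show ?thesis by (simp add: algebra_simps)
qed

text \<open>Dividing the decrease \<open>4 / 5 * h\<close> by the constant of
  \<open>lyap_upper\<close> gives a contraction by \<open>1 - 2 * c\<close>. Half of the gain is
  spent on the perturbation, since \<open>(1 + c) * (1 - 2 * c) \<le> 1 - c\<close>.\<close>

definition contraction :: "real \<Rightarrow> real \<Rightarrow> real" where
  "contraction \<kappa>1 h = 2 / 5 * h / (1 + 1 / rho2 L + \<kappa>1)"

lemma contraction_bounds:
  assumes "\<kappa>1 > 1" "0 < h" "h < 1/5"
  shows "0 < contraction \<kappa>1 h" "contraction \<kappa>1 h < 1 / 2"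
proof -
  have p: "1 + 1 / rho2 L + \<kappa>1 > 1" using rho2_pos assms by (simp add: pos_add_strict)
  show "0 < contraction \<kappa>1 h" unfolding contraction_def using p assms by simp
  have "contraction \<kappa>1 h \<le> 2 / 5 * h" unfolding contraction_def
    using p assms by (subst pos_divide_le_eq) auto
  thus "contraction \<kappa>1 h < 1 / 2" using assms by simp
qed

lemma lyap_step:
  assumes y0: "(\<Sum>i<n. y i) = 0" and w0: "(\<Sum>i<n. w i) = 0"
    and k1: "\<kappa>1 > 1" and h: "0 < h" "h < 1/5"
    and small: "h * (\<kappa>1\<^sup>2 * rho (L * L) + rho L / 2) \<le> (\<kappa>1 - 1) * rho2 L - 1"
    and c: "c = contraction \<kappa>1 h"
  shows "lyap \<kappa>1 (\<lambda>i. y i - h * (\<kappa>1 * \<Lambda> y i + \<Lambda> w i) - e i) (\<lambda>i. w i + h * y i)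
    \<le> (1 - c) * lyap \<kappa>1 y w + (1 / (2 * c) + 1 / 2) * einner n e e"
proof -
  let ?V = "lyap \<kappa>1 y w" 
  let ?y' = "\<lambda>i. y i - h * (\<kappa>1 * \<Lambda> y i + \<Lambda> w i)" and ?w' = "\<lambda>i. w i + h * y i"
  have c0: "0 < c" "c < 1 / 2" using contraction_bounds[OF k1 h] c by auto
  have p: "1 + 1 / rho2 L + \<kappa>1 > 0" using rho2_pos k1 by (simp add: pos_add_strict)
  have V0: "0 \<le> ?V" using lyap_lower1[of \<kappa>1 y w] k1 einner_self_nonneg[of n "\<lambda>i. y i + \<Lambda> w i"] by linarith
  have "lyap \<kappa>1 ?y' ?w' \<le> ?V - 4 / 5 * h * (einner n y y + einner n (\<Lambda> w) (\<Lambda> w))"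
    by (rule lyap_noiseless_step[OF y0 k1 h small])
  also have "\<dots> \<le> ?V - 2 * c * ?V"
  proof -
    have "2 * c * ?V \<le> 2 * c * ((1 + 1 / rho2 L + \<kappa>1) * (einner n y y + einner n (\<Lambda> w) (\<Lambda> w)))"
      using lyap_upper[OF _ w0, of \<kappa>1 y] k1 c0 by (intro mult_left_mono) auto
    also have "\<dots> = 4 / 5 * h * (einner n y y + einner n (\<Lambda> w) (\<Lambda> w))"
    proof -
      have cancel: "q \<noteq> 0 \<Longrightarrow> 2 * (2 / 5 * h / q) * q = 4 / 5 * h" for q :: real by simp
      have "2 * c * (1 + 1 / rho2 L + \<kappa>1) = 4 / 5 * h"
        unfolding c contraction_def using p by (intro cancel) auto
      thus ?thesis by (simp only: mult.assoc[symmetric])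
    qed
    finally show ?thesis by simp
  qed
  finally have "lyap \<kappa>1 ?y' ?w' \<le> (1 - 2 * c) * ?V" by (simp add: algebra_simps)
  hence "(1 + c) * lyap \<kappa>1 ?y' ?w' \<le> (1 + c) * ((1 - 2 * c) * ?V)"
    using c0 by (intro mult_left_mono) auto
  also have "\<dots> = (1 - c) * ?V - 2 * c\<^sup>2 * ?V" by (simp add: algebra_simps power2_eq_square)
  also have "\<dots> \<le> (1 - c) * ?V" using V0 by simp
  finally show ?thesis
    using lyap_perturb[of \<kappa>1 c ?y' e ?w'] k1 c0 by linarith
qed

text \<open>Writing \<open>v = \<Lambda> w\<close>, where \<open>w\<close> sums up the past disagreements, avoids the pseudo-inverse of the
  Laplacian in the Lyapunov function.\<close>

lemma consensus_trajectory:
  fixes X v g :: "nat \<Rightarrow> nat \<Rightarrow> real"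
  assumes k1: "\<kappa>1 > 1" and h: "0 < h" "h < 1/5"
    and small: "h * (\<kappa>1\<^sup>2 * rho (L * L) + rho L / 2) \<le> (\<kappa>1 - 1) * rho2 L - 1"
    and c: "c = contraction \<kappa>1 h"
    and v0: "\<And>i. i < n \<Longrightarrow> v 0 i = 0"
    and X_step: "\<And>k i. i < n \<Longrightarrow> X (Suc k) i = X k i - h * (\<kappa>1 * \<Lambda> (X k) i + v k i) - \<eta> k * g k i"
    and v_step: "\<And>k i. i < n \<Longrightarrow> v (Suc k) i = v k i + h * \<Lambda> (X k) i"
    and U0: "U 0 = einner n (centered n (X 0)) (centered n (X 0)) / 2"
    and U_step: "\<And>k. U (Suc k) = (1 - c) * U k + (1 / (2 * c) + 1 / 2) * ((\<eta> k)\<^sup>2 * einner n (g k) (g k))"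
  shows "(\<kappa>1 - 1) / (4 * (\<kappa>1 + 1)) * einner n (centered n (X T)) (centered n (X T)) \<le> U T"
proof -
  have n0: "n > 0" using n2 by simp
  have c0: "0 < c" "c < 1 / 2" using contraction_bounds[OF k1 h] c by auto
  define y where "y k = centered n (X k)" for k
  define w where "w k i = h * (\<Sum>j<k. y j i)" for k i
  have w_Suc: "w (Suc k) = (\<lambda>i. w k i + h * y k i)" for k by (auto simp: w_def algebra_simps)
  have w_0: "w 0 = (\<lambda>i. 0)" by (simp add: w_def fun_eq_iff)
  have vw: "i < n \<Longrightarrow> v k i = \<Lambda> (w k) i" for k i
    by (induction k) (auto simp: v0 v_step w_Suc w_0 lap_add y_def lap_centered lap_scale[of n L] lap_zero)
  have sw: "(\<Sum>i<n. w k i) = 0" for k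
    by (simp add: w_def sum_distrib_left[symmetric] sum.swap[of _ "{..<k}"] y_def sum_centered n0)
  have y_Suc: "y (Suc k) i = y k i - h * (\<kappa>1 * \<Lambda> (y k) i + \<Lambda> (w k) i) - centered n (\<lambda>i. \<eta> k * g k i) i"
    if "i < n" for k i
  proof -
    have "y (Suc k) i = centered n (\<lambda>i. X k i - (\<lambda>i. h * (\<kappa>1 * \<Lambda> (X k) i + \<Lambda> (w k) i)) i - \<eta> k * g k i) i"
      unfolding y_def centered_def using that by (simp add: X_step vw)
    also have "centered n (\<lambda>i. X k i - (\<lambda>i. h * (\<kappa>1 * \<Lambda> (X k) i + \<Lambda> (w k) i)) i - \<eta> k * g k i)
      = (\<lambda>i. y k i - centered n (\<Lambda> (\<lambda>i. h * (\<kappa>1 * X k i + w k i))) i - centered n (\<lambda>i. \<eta> k * g k i) i)"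
      unfolding centered_diff by (simp add: y_def lap_add lap_scale)
    finally show ?thesis
      unfolding centered_lap by (simp add: lap_add lap_scale y_def lap_centered)
  qed
  have "lyap \<kappa>1 (y k) (w k) \<le> U k" for k
  proof (induction k)
    case 0
    show ?case by (simp add: lyap_def U0 w_0 lap_zero y_def[symmetric]) (simp add: einner_def)
  next
    case (Suc k)
    let ?e = "centered n (\<lambda>i. \<eta> k * g k i)"
    have "einner n ?e ?e \<le> einner n (\<lambda>i. \<eta> k * g k i) (\<lambda>i. \<eta> k * g k i)"
      by (rule einner_centered_le[OF n0])
    also have "\<dots> = (\<eta> k)\<^sup>2 * einner n (g k) (g k)"
      unfolding einner_linear by (simp add: power2_eq_square)
    finally have e: "einner n ?e ?e \<le> (\<eta> k)\<^sup>2 * einner n (g k) (g k)" .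
    have "lyap \<kappa>1 (y (Suc k)) (w (Suc k)) =
       lyap \<kappa>1 (\<lambda>i. y k i - h * (\<kappa>1 * \<Lambda> (y k) i + \<Lambda> (w k) i) - ?e i) (\<lambda>i. w k i + h * y k i)"
      unfolding lyap_def w_Suc by (intro arg_cong2[where f="(+)"] arg_cong[where f="\<lambda>x. x / 2"] refl einner_cong) (auto simp: y_Suc)
    also have "\<dots> \<le> (1 - c) * lyap \<kappa>1 (y k) (w k) + (1 / (2 * c) + 1 / 2) * einner n ?e ?e"
      by (rule lyap_step[OF _ sw k1 h small c]) (simp add: y_def sum_centered n0)
    also have "\<dots> \<le> U (Suc k)" unfolding U_step
      using Suc e c0 by (intro add_mono mult_left_mono) auto
    finally show ?case .
  qed
  thus ?thesis using lyap_lower2[OF k1, of "y T" "w T"] by (force simp: y_def intro: order_trans)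
qed

end

subsection \<open>Gradients and smoothness\<close>

lemma space_R_iff: "x \<in> space_R p \<longleftrightarrow> (\<forall>i\<ge>p. x i = 0)"
  by (auto simp: topspace_Euclidean_space)

lemma space_R_add: "x \<in> space_R p \<Longrightarrow> y \<in> space_R p \<Longrightarrow> (\<lambda>i. x i + y i) \<in> space_R p"
  by (simp add: space_R_iff)

lemma space_R_scale: "x \<in> space_R p \<Longrightarrow> (\<lambda>i. c * x i) \<in> space_R p"
  by (simp add: space_R_iff)

lemma space_R_zero: "(\<lambda>i. 0) \<in> space_R p"
  by (simp add: space_R_iff)

lemma vdiff_add: "vdiff (\<lambda>i. x i + h i) x = h"
  by (simp add: vdiff_def)

lemma enorm_scale: "enorm p (\<lambda>i. c * x i) = \<bar>c\<bar> * enorm p x"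
proof -
  have "(enorm p (\<lambda>i. c * x i))\<^sup>2 = (\<bar>c\<bar> * enorm p x)\<^sup>2"
    by (simp add: einner_self[symmetric] einner_linear power_mult_distrib, simp add: power2_eq_square)
  thus ?thesis by (simp add: power2_eq_iff_nonneg)
qed

lemma enorm_cong: "(\<And>i. i < p \<Longrightarrow> x i = y i) \<Longrightarrow> enorm p x = enorm p y"
  unfolding enorm_def by (intro L2_set_cong) auto

lemma enorm_triangle: "enorm p (\<lambda>i. x i + y i) \<le> enorm p x + enorm p y"
  unfolding enorm_def by (rule L2_set_triangle_ineq)

lemma enorm_eq_0_iff: "enorm p x = 0 \<longleftrightarrow> (\<forall>i<p. x i = 0)"
  by (auto simp: enorm_def L2_set_eq_0_iff)

text \<open>\<open>grad\<close> is a definite description and gets its meaning from this. Both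
  first-order expansions are compared along the difference \<open>d\<close> of the two
  candidates.\<close>

lemma has_gradient_unique:
  assumes g: "has_gradient p f g x" and g': "has_gradient p f g' x" and x: "x \<in> space_R p"
  shows "g = g'"
proof -
  define d where "d = (\<lambda>i. g i - g' i)"
  have dR: "d \<in> space_R p" using g g' by (simp add: has_gradient_def d_def space_R_iff)
  have small: "(enorm p d)\<^sup>2 \<le> 2 * e * enorm p d" if e: "e > 0" for e
  proof (cases "enorm p d = 0")
    case False
    hence nd: "enorm p d > 0" using enorm_nonneg[of p d] by linarith
    obtain r r' where r: "r > 0" "\<And>y. y\<in>space_R p \<Longrightarrow> enorm p (vdiff y x) < r \<Longrightarrow>
        \<bar>f y - f x - einner p g (vdiff y x)\<bar> \<le> e * enorm p (vdiff y x)"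
      and r': "r' > 0" "\<And>y. y\<in>space_R p \<Longrightarrow> enorm p (vdiff y x) < r' \<Longrightarrow>
        \<bar>f y - f x - einner p g' (vdiff y x)\<bar> \<le> e * enorm p (vdiff y x)"
      using g g' e unfolding has_gradient_def by metis
    define t where "t = min r r' / 2 / enorm p d"
    have t: "t > 0" "t * enorm p d < r" "t * enorm p d < r'"
      using r(1) r'(1) nd by (auto simp: t_def)
    let ?y = "\<lambda>i. x i + t * d i"
    have y: "?y \<in> space_R p" by (intro space_R_add space_R_scale x dR)
    have ny: "enorm p (vdiff ?y x) = t * enorm p d" using t by (simp add: vdiff_add enorm_scale)
    have "\<bar>f ?y - f x - einner p g (vdiff ?y x)\<bar> \<le> e * (t * enorm p d)"
      "\<bar>f ?y - f x - einner p g' (vdiff ?y x)\<bar> \<le> e * (t * enorm p d)"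
      using r(2)[OF y] r'(2)[OF y] t ny by auto
    hence "\<bar>einner p g (vdiff ?y x) - einner p g' (vdiff ?y x)\<bar> \<le> 2 * e * (t * enorm p d)" by linarith
    moreover have "einner p g (vdiff ?y x) - einner p g' (vdiff ?y x) = t * (enorm p d)\<^sup>2"
    proof -
      have "einner p g (vdiff ?y x) - einner p g' (vdiff ?y x) = t * einner p d d"
        unfolding vdiff_add einner_mult_right by (simp add: d_def einner_diff_left right_diff_distrib)
      thus ?thesis by (simp add: einner_self)
    qed
    ultimately have "t * (enorm p d)\<^sup>2 \<le> t * (2 * e * enorm p d)" by (simp add: algebra_simps)
    thus ?thesis using t by simp
  qed simp
  have "enorm p d = 0"
  proof (rule ccontr)
    assume "enorm p d \<noteq> 0"
    hence nd: "enorm p d > 0" using enorm_nonneg[of p d] by linarith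
    have "enorm p d * enorm p d \<le> 1 / 2 * enorm p d * enorm p d"
      using small[of "enorm p d / 4"] nd by (simp add: power2_eq_square)
    thus False using nd by simp
  qed
  hence "d i = 0" for i using dR by (cases "i < p") (auto simp: enorm_eq_0_iff space_R_iff)
  thus ?thesis by (auto simp: d_def fun_eq_iff)
qed

lemma grad_eqI: "has_gradient p f g x \<Longrightarrow> x \<in> space_R p \<Longrightarrow> grad p f x = g"
  unfolding grad_def by (rule the_equality) (auto dest: has_gradient_unique)

text \<open>Quadratic error bounds survive averaging and integration, so this criterion gives the
  gradients of the mean costs and of their average. The radius uses \<open>C + 1\<close> because
  \<open>C\<close> may be zero.\<close>

lemma has_gradient_quadraticI:
  assumes g: "g \<in> space_R p" and C: "C \<ge> 0"
    and b: "\<And>y. y \<in> space_R p \<Longrightarrow> \<bar>f y - f x - einner p g (vdiff y x)\<bar> \<le> C * (enorm p (vdiff y x))\<^sup>2"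
  shows "has_gradient p f g x"
  unfolding has_gradient_def
proof (intro conjI allI impI g)
  fix e :: real assume e: "e > 0"
  show "\<exists>d>0. \<forall>y\<in>space_R p. enorm p (vdiff y x) < d \<longrightarrow>
       \<bar>f y - f x - einner p g (vdiff y x)\<bar> \<le> e * enorm p (vdiff y x)"
  proof (intro exI[of _ "e / (C + 1)"] conjI ballI impI)
    show "e / (C + 1) > 0" using e C by simp
    fix y assume y: "y \<in> space_R p" and l: "enorm p (vdiff y x) < e / (C + 1)"
    have "(C + 1) * enorm p (vdiff y x) \<le> e" using l C by (simp add: field_simps)
    hence "C * enorm p (vdiff y x) \<le> e" using enorm_nonneg[of p "vdiff y x"] unfolding distrib_right by linarith
    from mult_right_mono[OF this, of "enorm p (vdiff y x)"] b[OF y]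
    show "\<bar>f y - f x - einner p g (vdiff y x)\<bar> \<le> e * enorm p (vdiff y x)"
      by (simp add: power2_eq_square)
  qed
qed

lemma has_gradient_cong:
  assumes "\<And>y. y \<in> space_R p \<Longrightarrow> f y = f' y" "x \<in> space_R p"
  shows "has_gradient p f g x \<longleftrightarrow> has_gradient p f' g x"
  unfolding has_gradient_def using assms by simp

lemma grad_cong:
  assumes "\<And>y. y \<in> space_R p \<Longrightarrow> f y = f' y" "x \<in> space_R p"
  shows "grad p f x = grad p f' x"
  unfolding grad_def using has_gradient_cong[OF assms] by simp

lemma smooth_on_R_cong:
  assumes "\<And>y. y \<in> space_R p \<Longrightarrow> f y = f' y"
  shows "smooth_on_R p Lf f \<longleftrightarrow> smooth_on_R p Lf f'"
  unfolding smooth_on_R_def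
  using has_gradient_cong[OF assms, of p] grad_cong[OF assms, of p] by simp

lemma smooth_has_gradient:
  assumes "smooth_on_R p Lf f" "x \<in> space_R p"
  shows "has_gradient p f (grad p f x) x"
  using assms grad_eqI unfolding smooth_on_R_def by metis

lemma smooth_grad_space: "smooth_on_R p Lf f \<Longrightarrow> x \<in> space_R p \<Longrightarrow> grad p f x \<in> space_R p"
  using smooth_has_gradient by (auto simp: has_gradient_def)

lemma smooth_grad_Lipschitz:
  "smooth_on_R p Lf f \<Longrightarrow> x \<in> space_R p \<Longrightarrow> y \<in> space_R p \<Longrightarrow>
    enorm p (vdiff (grad p f x) (grad p f y)) \<le> Lf * enorm p (vdiff x y)"
  by (simp add: smooth_on_R_def)

lemma has_gradient_line_derivative:
  assumes g: "has_gradient p f g (\<lambda>i. x i + t * h i)" and x: "x \<in> space_R p" and h: "h \<in> space_R p"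
  shows "((\<lambda>s. f (\<lambda>i. x i + s * h i)) has_real_derivative einner p g h) (at t)"
proof (cases "enorm p h = 0")
  case True
  hence "h i = 0" for i using h by (cases "i < p") (auto simp: enorm_eq_0_iff space_R_iff)
  hence h0: "h = (\<lambda>i. 0)" by auto
  show ?thesis unfolding h0 by (simp add: einner_def)
next
  case False
  hence nh: "enorm p h > 0" using enorm_nonneg[of p h] by linarith
  let ?y = "\<lambda>s i. x i + s * h i"
  have vd: "vdiff (?y s) (?y t) = (\<lambda>i. (s - t) * h i)" for s by (auto simp: vdiff_def algebra_simps)
  show ?thesis
    unfolding has_field_derivative_def has_derivative_at_alt
  proof (intro conjI allI impI)
    show "bounded_linear ((*) (einner p g h))" by (rule bounded_linear_mult_right)
    fix e :: real assume e: "e > 0"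
    obtain r where r: "r > 0" "\<And>y. y\<in>space_R p \<Longrightarrow> enorm p (vdiff y (?y t)) < r \<Longrightarrow>
        \<bar>f y - f (?y t) - einner p g (vdiff y (?y t))\<bar> \<le> (e / enorm p h) * enorm p (vdiff y (?y t))"
      using g divide_pos_pos[OF e nh] unfolding has_gradient_def by blast
    show "\<exists>d>0. \<forall>s. norm (s - t) < d \<longrightarrow>
       norm (f (?y s) - f (?y t) - einner p g h * (s - t)) \<le> e * norm (s - t)"
    proof (intro exI[of _ "r / enorm p h"] conjI allI impI)
      show "r / enorm p h > 0" using r nh by simp
      fix s assume "norm (s - t) < r / enorm p h"
      hence "enorm p (vdiff (?y s) (?y t)) < r" using nh unfolding vd enorm_scale by (simp add: field_simps)
      moreover have "?y s \<in> space_R p" by (intro space_R_add space_R_scale x h)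
      ultimately have "\<bar>f (?y s) - f (?y t) - einner p g (vdiff (?y s) (?y t))\<bar> \<le> (e / enorm p h) * enorm p (vdiff (?y s) (?y t))"
        using r(2) by blast
      thus "norm (f (?y s) - f (?y t) - einner p g h * (s - t)) \<le> e * norm (s - t)"
        unfolding vd enorm_scale einner_mult_right using nh by (simp add: mult.commute)
    qed
  qed
qed

lemma smooth_line_derivative:
  assumes "smooth_on_R p Lf f" "x \<in> space_R p" "h \<in> space_R p"
  shows "((\<lambda>s. f (\<lambda>i. x i + s * h i)) has_real_derivative
      einner p (grad p f (\<lambda>i. x i + t * h i)) h) (at t)"
  by (intro has_gradient_line_derivative smooth_has_gradient[OF assms(1)] assms space_R_add space_R_scale)

text \<open>Instead of integrating the gradient along the segment, the mean value theorem is applied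
  to the error minus its quadratic bound, whose derivative is nonpositive. The sign \<open>s\<close>
  covers both directions of the absolute value.\<close>

lemma smooth_descent:
  assumes f: "smooth_on_R p Lf f" and x: "x \<in> space_R p" and h: "h \<in> space_R p"
  shows "\<bar>f (\<lambda>i. x i + h i) - f x - einner p (grad p f x) h\<bar> \<le> Lf / 2 * (enorm p h)\<^sup>2"
proof -
  let ?G = "\<lambda>t. einner p (grad p f (\<lambda>i. x i + t * h i)) h"
  have G: "\<bar>?G t - einner p (grad p f x) h\<bar> \<le> t * Lf * (enorm p h)\<^sup>2" if "t \<ge> 0" for t
  proof -
    have "\<bar>?G t - einner p (grad p f x) h\<bar> = \<bar>einner p (vdiff (grad p f (\<lambda>i. x i + t * h i)) (grad p f x)) h\<bar>"
      by (simp add: vdiff_def einner_linear)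
    also have "\<dots> \<le> enorm p (vdiff (grad p f (\<lambda>i. x i + t * h i)) (grad p f x)) * enorm p h"
      by (rule einner_Cauchy_Schwarz)
    also have "\<dots> \<le> (Lf * enorm p (vdiff (\<lambda>i. x i + t * h i) x)) * enorm p h"
      by (intro mult_right_mono smooth_grad_Lipschitz[OF f] space_R_add space_R_scale x h) auto
    finally show ?thesis using that by (simp add: vdiff_add enorm_scale power2_eq_square algebra_simps)
  qed
  have "\<exists>t. 0 < t \<and> t < 1 \<and> \<phi> 1 - \<phi> 0 = (1 - 0) * (s * (?G t - einner p (grad p f x) h) - t * Lf * (enorm p h)\<^sup>2)"
    if "\<phi> = (\<lambda>t. s * (f (\<lambda>i. x i + t * h i) - t * einner p (grad p f x) h) - t\<^sup>2 / 2 * (Lf * (enorm p h)\<^sup>2))" for \<phi> and s :: real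
    unfolding that by (rule MVT2) (auto intro!: derivative_eq_intros smooth_line_derivative[OF f x h])
  note M = this[OF refl]
  have "s * (f (\<lambda>i. x i + h i) - f x - einner p (grad p f x) h) \<le> Lf / 2 * (enorm p h)\<^sup>2" if s: "\<bar>s\<bar> = 1" for s :: real
  proof -
    obtain t where t: "0 < t" "t < 1" and e: "s * (f (\<lambda>i. x i + h i) - einner p (grad p f x) h) - Lf * (enorm p h)\<^sup>2 / 2 - s * f x
      = s * (?G t - einner p (grad p f x) h) - t * Lf * (enorm p h)\<^sup>2"
      using M[of s] by auto
    have "s * (?G t - einner p (grad p f x) h) \<le> \<bar>?G t - einner p (grad p f x) h\<bar>"
      using s by (metis abs_ge_self abs_mult mult_1)
    also have "\<dots> \<le> t * Lf * (enorm p h)\<^sup>2" using G t by simp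
    finally show ?thesis using e by (simp add: algebra_simps)
  qed
  from this[of 1] this[of "-1"] show ?thesis by (intro abs_leI) auto
qed

lemma smooth_difference_bound:
  assumes f: "smooth_on_R p Lf f" and x: "x \<in> space_R p" and h: "h \<in> space_R p"
  shows "\<bar>f (\<lambda>i. x i + h i) - f x\<bar> \<le> enorm p (grad p f x) * enorm p h + Lf / 2 * (enorm p h)\<^sup>2"
  using smooth_descent[OF f x h] einner_Cauchy_Schwarz[of p "grad p f x" h] by linarith

text \<open>A gradient step of length \<open>1 / Lf\<close> lowers \<open>f\<close> by at least the
  squared gradient norm over \<open>2 * Lf\<close>, yet cannot lead below \<open>m\<close>.\<close>

lemma smooth_grad_sq_le:
  assumes f: "smooth_on_R p Lf f" and x: "x \<in> space_R p" and Lf: "Lf > 0"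
    and low: "\<And>y. y \<in> space_R p \<Longrightarrow> m \<le> f y"
  shows "(enorm p (grad p f x))\<^sup>2 \<le> 2 * Lf * (f x - m)"
proof -
  let ?g = "grad p f x"
  let ?h = "\<lambda>i. (- 1 / Lf) * ?g i"
  have h: "?h \<in> space_R p" by (rule space_R_scale[OF smooth_grad_space[OF f x]])
  have "\<bar>f (\<lambda>i. x i + ?h i) - f x - einner p ?g ?h\<bar> \<le> Lf / 2 * (enorm p ?h)\<^sup>2"
    by (rule smooth_descent[OF f x h])
  hence "f (\<lambda>i. x i + ?h i) \<le> f x + einner p ?g ?h + Lf / 2 * (enorm p ?h)\<^sup>2" by linarith
  also have "\<dots> = f x - (enorm p ?g)\<^sup>2 / Lf + (enorm p ?g)\<^sup>2 / (2 * Lf)"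
    unfolding einner_mult_right enorm_scale einner_self using Lf
    by (simp add: power_mult_distrib power_divide, simp add: power2_eq_square)
  finally have "m \<le> f x - (enorm p ?g)\<^sup>2 / Lf + (enorm p ?g)\<^sup>2 / (2 * Lf)"
    using low[OF space_R_add[OF x h]] by linarith
  also have "\<dots> = f x - (enorm p ?g)\<^sup>2 / (2 * Lf)" using Lf by (simp add: field_simps)
  finally have "m \<le> f x - (enorm p ?g)\<^sup>2 / (2 * Lf)" .
  thus ?thesis using Lf by (simp add: field_simps)
qed

subsection \<open>Reflection invariance of the uniform distribution on the sphere\<close>

abbreviation lprod :: "nat \<Rightarrow> rvec measure" where
  "lprod p \<equiv> (\<Pi>\<^sub>M c\<in>{..<p}. lborel)"

text \<open>\<^term>\<open>scaling_map p c T\<close>: the map \<open>T\<close> multiplies Lebesgue measure on \<open>p\<close>-space by \<open>1 / c\<close>.\<close>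

definition scaling_map :: "nat \<Rightarrow> ennreal \<Rightarrow> (rvec \<Rightarrow> rvec) \<Rightarrow> bool" where
  "scaling_map p c T \<longleftrightarrow> T \<in> measurable (lprod p) (lprod p) \<and>
     (\<forall>f\<in>borel_measurable (lprod p). (\<integral>\<^sup>+ x. f x \<partial>lprod p) = c * (\<integral>\<^sup>+ x. f (T x) \<partial>lprod p))"

interpretation lborel_product: product_sigma_finite "\<lambda>_ :: nat. lborel :: real measure"
  by standard

lemma scaling_mapD:
  "scaling_map p c T \<Longrightarrow> f \<in> borel_measurable (lprod p) \<Longrightarrow>
    (\<integral>\<^sup>+ x. f x \<partial>lprod p) = c * (\<integral>\<^sup>+ x. f (T x) \<partial>lprod p)"
  unfolding scaling_map_def by blast

lemma scaling_map_comp: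
  assumes S: "scaling_map p c S" and T: "scaling_map p d T"
  shows "scaling_map p (c * d) (\<lambda>x. S (T x))"
proof -
  have [measurable]: "S \<in> measurable (lprod p) (lprod p)" "T \<in> measurable (lprod p) (lprod p)"
    using assms by (auto simp: scaling_map_def)
  have "(\<integral>\<^sup>+ x. f x \<partial>lprod p) = c * d * (\<integral>\<^sup>+ x. f (S (T x)) \<partial>lprod p)"
    if [measurable]: "f \<in> borel_measurable (lprod p)" for f
  proof -
    have "(\<integral>\<^sup>+ x. f x \<partial>lprod p) = c * (\<integral>\<^sup>+ x. f (S x) \<partial>lprod p)"
      by (rule scaling_mapD[OF S]) simp
    also have "(\<integral>\<^sup>+ x. f (S x) \<partial>lprod p) = d * (\<integral>\<^sup>+ x. f (S (T x)) \<partial>lprod p)"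
      by (rule scaling_mapD[OF T]) simp
    finally show ?thesis by (simp add: mult.assoc)
  qed
  moreover have "(\<lambda>x. S (T x)) \<in> measurable (lprod p) (lprod p)" by measurable
  ultimately show ?thesis unfolding scaling_map_def by blast
qed

text \<open>Fubini singles out coordinate \<open>i\<close>; with the others fixed,
  \<open>\<phi>\<close> is a constant and the one-dimensional affine substitution applies.\<close>

lemma scaling_map_coordinate:
  assumes i: "i < p" and c: "c \<noteq> 0" and [measurable]: "\<phi> \<in> borel_measurable (lprod p)"
    and indep: "\<And>x y. \<phi> (x(i := y)) = \<phi> x"
  shows "scaling_map p (ennreal \<bar>c\<bar>) (\<lambda>x. x(i := c * x i + \<phi> x))"
proof -
  have mT: "(\<lambda>x. x(i := c * x i + \<phi> x)) \<in> measurable (lprod p) (lprod p)"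
  proof (rule measurable_PiM_single')
    show "(\<lambda>x. (x(i := c * x i + \<phi> x)) j) \<in> measurable (lprod p) lborel" if "j \<in> {..<p}" for j
      using i that by (cases "j = i") auto
    show "(\<lambda>x. x(i := c * x i + \<phi> x)) \<in> space (lprod p) \<rightarrow> PiE {..<p} (\<lambda>_. space lborel)"
      using i by (auto simp: space_PiM PiE_def extensional_def)
  qed
  have "(\<integral>\<^sup>+ x. f x \<partial>lprod p) = ennreal \<bar>c\<bar> * (\<integral>\<^sup>+ x. f (x(i := c * x i + \<phi> x)) \<partial>lprod p)"
    if f[measurable]: "f \<in> borel_measurable (lprod p)" for f
  proof -
    let ?J = "{..<p} - {i}"
    have ins: "{..<p} = insert i ?J" using i by auto
    have fT: "(\<lambda>x. f (x(i := c * x i + \<phi> x))) \<in> borel_measurable (lprod p)"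
      using measurable_compose[OF mT f] .
    note ins_int = lborel_product.product_nn_integral_insert[of ?J i, OF _ _, folded ins]
    have upd: "(\<lambda>y. x(i := y)) \<in> measurable lborel (lprod p)" if "x \<in> space (Pi\<^sub>M ?J (\<lambda>_. lborel))" for x
    proof -
      have "(\<lambda>y. x(i := y)) \<in> measurable lborel (Pi\<^sub>M (insert i ?J) (\<lambda>_. lborel))"
        using that by (intro measurable_fun_upd[where J="?J"]) auto
      thus ?thesis using ins by simp
    qed
    have "(\<integral>\<^sup>+ x. f x \<partial>lprod p) = (\<integral>\<^sup>+ x. (\<integral>\<^sup>+ y. f (x(i := y)) \<partial>lborel) \<partial>Pi\<^sub>M ?J (\<lambda>_. lborel))"
      by (rule ins_int) auto
    also have "\<dots> = (\<integral>\<^sup>+ x. ennreal \<bar>c\<bar> * (\<integral>\<^sup>+ y. f (x(i := \<phi> x + c * y)) \<partial>lborel) \<partial>Pi\<^sub>M ?J (\<lambda>_. lborel))"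
    proof (rule nn_integral_cong)
      fix x assume x: "x \<in> space (Pi\<^sub>M ?J (\<lambda>_. lborel :: real measure))"
      have "(\<lambda>y. f (x(i := y))) \<in> borel_measurable lborel"
        by (rule measurable_compose[OF upd[OF x] f])
      thus "(\<integral>\<^sup>+ y. f (x(i := y)) \<partial>lborel) = ennreal \<bar>c\<bar> * (\<integral>\<^sup>+ y. f (x(i := \<phi> x + c * y)) \<partial>lborel)"
        by (intro nn_integral_real_affine c) simp
    qed
    also have "\<dots> = ennreal \<bar>c\<bar> * (\<integral>\<^sup>+ x. (\<integral>\<^sup>+ y. f (x(i := \<phi> x + c * y)) \<partial>lborel) \<partial>Pi\<^sub>M ?J (\<lambda>_. lborel))"
    proof (rule nn_integral_cmult)
      have "(\<lambda>(x, y). f ((x(i := y))(i := c * (x(i := y)) i + \<phi> (x(i := y))))) \<in> borel_measurable (Pi\<^sub>M ?J (\<lambda>_. lborel) \<Otimes>\<^sub>M lborel)"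
      proof -
        have "(\<lambda>(x, y). x(i := y)) \<in> measurable (Pi\<^sub>M ?J (\<lambda>_. lborel :: real measure) \<Otimes>\<^sub>M lborel) (Pi\<^sub>M (insert i ?J) (\<lambda>_. lborel))"
          by (rule measurable_add_dim)
        hence "(\<lambda>(x, y). x(i := y)) \<in> measurable (Pi\<^sub>M ?J (\<lambda>_. lborel :: real measure) \<Otimes>\<^sub>M lborel) (lprod p)"
          using ins by simp
        from measurable_compose[OF this fT] show ?thesis by (simp add: case_prod_beta')
      qed
      hence "(\<lambda>(x, y). f (x(i := \<phi> x + c * y))) \<in> borel_measurable (Pi\<^sub>M ?J (\<lambda>_. lborel) \<Otimes>\<^sub>M lborel)"
        by (simp add: indep add.commute)
      from lborel.borel_measurable_nn_integral[OF this] 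
      show "(\<lambda>x. \<integral>\<^sup>+ y. f (x(i := \<phi> x + c * y)) \<partial>lborel) \<in> borel_measurable (Pi\<^sub>M ?J (\<lambda>_. lborel))" .
    qed
    also have "(\<integral>\<^sup>+ x. (\<integral>\<^sup>+ y. f (x(i := \<phi> x + c * y)) \<partial>lborel) \<partial>Pi\<^sub>M ?J (\<lambda>_. lborel))
       = (\<integral>\<^sup>+ x. f (x(i := c * x i + \<phi> x)) \<partial>lprod p)"
      by (subst ins_int) (auto intro!: fT simp: indep add.commute[of "\<phi> _"])
    finally show ?thesis .
  qed
  thus ?thesis using mT unfolding scaling_map_def by blast
qed

lemma scaling_map_id: "scaling_map p 1 (\<lambda>x. x)"
  by (simp add: scaling_map_def)

text \<open>The shear is a composition of one-coordinate maps of factor \<open>1\<close>. They do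
  not interfere, because \<open>x i\<close> itself is never changed.\<close>

lemma scaling_map_shear:
  assumes i: "i < p" and J: "finite J" "J \<subseteq> {..<p} - {i}"
  shows "scaling_map p 1 (\<lambda>x j. if j \<in> J then x j + x i * w j else x j)"
  using J
proof (induction J rule: finite_induct)
  case empty
  show ?case by (simp add: scaling_map_id)
next
  case (insert k J)
  have "scaling_map p (ennreal \<bar>1\<bar>) (\<lambda>x. x(k := 1 * x k + x i * w k))"
    by (rule scaling_map_coordinate) (use insert.prems i in auto)
  from scaling_map_comp[OF this insert.IH]
  have "scaling_map p 1 (\<lambda>x. (\<lambda>j. if j \<in> J then x j + x i * w j else x j)
      (k := (if k \<in> J then x k + x i * w k else x k) + (if i \<in> J then x i + x i * w i else x i) * w k))"
    using insert.prems by simp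
  also have "(\<lambda>x. (\<lambda>j. if j \<in> J then x j + x i * w j else x j)
      (k := (if k \<in> J then x k + x i * w k else x k) + (if i \<in> J then x i + x i * w i else x i) * w k))
    = (\<lambda>x j. if j \<in> insert k J then x j + x i * w j else x j)"
    using insert.prems insert.hyps by (auto simp: fun_eq_iff)
  finally show ?case .
qed

definition reflect :: "nat \<Rightarrow> rvec \<Rightarrow> rvec \<Rightarrow> rvec" where
  "reflect p w x = (\<lambda>c. x c - 2 * einner p w x * w c)"

lemma einner_reflect_left:
  assumes "einner p w w = 1" shows "einner p w (reflect p w x) = - einner p w x"
  using assms by (simp add: reflect_def einner_linear)

lemma enorm_reflect:
  assumes "einner p w w = 1" shows "enorm p (reflect p w x) = enorm p x"
proof -
  have "einner p (reflect p w x) (reflect p w x) = einner p x x"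
    unfolding reflect_def einner_linear assms by (simp add: einner_commute[of p x w])
  hence "(enorm p (reflect p w x))\<^sup>2 = (enorm p x)\<^sup>2" by (simp add: einner_self)
  thus ?thesis by (simp add: power2_eq_iff_nonneg)
qed

text \<open>Choosing a coordinate \<open>i\<close> with \<open>w i \<noteq> 0\<close>, the reflection becomes \<open>s \<mapsto> - s\<close> together with
  a shear along \<open>s\<close> once coordinate \<open>i\<close> is replaced by \<open>s = \<langle>w, x\<rangle>\<close>.\<close>

lemma scaling_map_reflect:
  assumes w: "einner p w w = 1"
  shows "scaling_map p 1 (\<lambda>x c. if c < p then reflect p w x c else x c)"
proof -
  obtain i where i: "i < p" "w i \<noteq> 0"
    using w by (metis einner_self_eq_0_iff zero_neq_one)
  let ?J = "{..<p} - {i}"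
  define \<phi> where "\<phi> x = (\<Sum>j\<in>?J. w j * x j)" for x :: rvec
  have [measurable]: "\<phi> \<in> borel_measurable (lprod p)"
    unfolding \<phi>_def by (intro borel_measurable_sum borel_measurable_times) auto
  have ind: "\<phi> (x(i := y)) = \<phi> x" for x y
    unfolding \<phi>_def by (intro sum.cong) auto
  have ip: "einner p w x = w i * x i + \<phi> x" for x
    unfolding einner_def \<phi>_def using i by (subst sum.remove[of _ i]) auto
  \<comment> \<open>\<open>T1\<close> stores \<open>s = einner p w x\<close> in coordinate
    \<open>i\<close>, \<open>T2\<close> subtracts \<open>2 * s * w j\<close> from the other
    coordinates, and \<open>T3\<close> solves for the coordinate \<open>i\<close> that makes the
    inner product with \<open>w\<close> equal to \<open>- s\<close>. The factors of
    \<open>T1\<close> and \<open>T3\<close> cancel.\<close>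
  define T1 where "T1 = (\<lambda>x :: rvec. x(i := w i * x i + \<phi> x))"
  define T2 where "T2 = (\<lambda>(x :: rvec) j. if j \<in> ?J then x j + x i * (- 2 * w j) else x j)"
  define T3 where "T3 = (\<lambda>x :: rvec. x(i := (- 1 / w i) * x i + (- 1 / w i) * \<phi> x))"
  have s1: "scaling_map p (ennreal \<bar>w i\<bar>) T1"
    unfolding T1_def by (rule scaling_map_coordinate) (auto simp: i ind)
  have s2: "scaling_map p 1 T2"
    unfolding T2_def by (rule scaling_map_shear) (auto simp: i)
  have s3: "scaling_map p (ennreal \<bar>- 1 / w i\<bar>) T3"
    unfolding T3_def by (rule scaling_map_coordinate) (auto simp: i ind)
  have "scaling_map p (ennreal \<bar>- 1 / w i\<bar> * (1 * ennreal \<bar>w i\<bar>)) (\<lambda>x. T3 (T2 (T1 x)))"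
    by (intro scaling_map_comp s1 s2 s3)
  also have "ennreal \<bar>- 1 / w i\<bar> * (1 * ennreal \<bar>w i\<bar>) = 1"
    using i by (simp add: ennreal_mult[symmetric])
  also have "(\<lambda>x. T3 (T2 (T1 x))) = (\<lambda>x c. if c < p then reflect p w x c else x c)"
  proof (intro ext)
    fix x c
    define s where "s = einner p w x"
    have T1: "T1 x = x(i := s)" by (simp add: T1_def ip s_def)
    have T2: "T2 (T1 x) j = (if j \<in> ?J then x j - 2 * s * w j else (x(i := s)) j)" for j
      unfolding T1 by (simp add: T2_def)
    have "\<phi> (T2 (T1 x)) = (\<Sum>j\<in>?J. w j * x j - 2 * s * (w j * w j))"
      unfolding \<phi>_def by (intro sum.cong) (auto simp: T2 algebra_simps)
    also have "\<dots> = \<phi> x - 2 * s * \<phi> w" by (simp add: \<phi>_def sum_subtractf sum_distrib_left)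
    also have "\<phi> w = 1 - w i * w i" using ip[of w] w by simp
    also have "\<phi> x = s - w i * x i" using ip[of x] by (simp add: s_def)
    finally have ph: "\<phi> (T2 (T1 x)) = - s - w i * x i + 2 * s * (w i * w i)" by (simp add: algebra_simps)
    show "T3 (T2 (T1 x)) c = (if c < p then reflect p w x c else x c)"
    proof (cases "c = i")
      case True
      have "T3 (T2 (T1 x)) c = (- 1 / w i) * s + (- 1 / w i) * \<phi> (T2 (T1 x))"
        using True by (simp add: T3_def T2)
      also have "\<dots> = x i - 2 * s * w i" unfolding ph using i(2) by (simp add: field_simps)
      finally show ?thesis using True i by (simp add: reflect_def s_def)
    next
      case False
      thus ?thesis by (auto simp: T3_def T2 reflect_def s_def)
    qed
  qed
  finally show ?thesis .
qed

subsection \<open>Moments of the uniform distribution on the sphere\<close>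

definition unit_ball :: "nat \<Rightarrow> rvec set" where
  "unit_ball p = {x \<in> space (lprod p). enorm p x \<le> 1}"

definition normalized :: "nat \<Rightarrow> rvec \<Rightarrow> rvec" where
  "normalized p x = (\<lambda>c. if c < p then x c / enorm p x else 0)"

lemma uniform_sphere_alt:
  "uniform_sphere p = distr (uniform_measure (lprod p) (unit_ball p)) borel (normalized p)"
  unfolding uniform_sphere_def unit_ball_def by (rule arg_cong[where f="distr _ _"]) (auto simp: normalized_def fun_eq_iff)

lemma measurable_enorm_lprod [measurable]: "enorm p \<in> borel_measurable (lprod p)"
proof -
  have "(\<lambda>x. sqrt (\<Sum>i<p. (x i)\<^sup>2)) \<in> borel_measurable (lprod p)"
    by (intro borel_measurable_sqrt[THEN measurable_compose[rotated]] borel_measurable_sum borel_measurable_power) auto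
  moreover have "enorm p = (\<lambda>x. sqrt (\<Sum>i<p. (x i)\<^sup>2))" by (auto simp: enorm_def L2_set_def)
  ultimately show ?thesis by simp
qed

lemma unit_ball_sets [measurable]: "unit_ball p \<in> sets (lprod p)"
  unfolding unit_ball_def by measurable

lemma measurable_normalized [measurable]: "normalized p \<in> measurable (lprod p) borel"
proof (rule measurable_coordinatewise_then_product)
  fix i show "(\<lambda>x. normalized p x i) \<in> borel_measurable (lprod p)"
    unfolding normalized_def by (cases "i < p") auto
qed

text \<open>The ball lies between two cubes, of side \<open>1 / p\<close> and of side
  \<open>2\<close>. This makes the uniform measure on it a probability measure.\<close>

lemma emeasure_unit_ball:
  assumes p: "p \<ge> 1"
  shows "emeasure (lprod p) (unit_ball p) \<noteq> 0" "emeasure (lprod p) (unit_ball p) \<noteq> \<infinity>"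
proof -
  let ?K = "PiE {..<p} (\<lambda>_. {0..1 / real p})"
  have "?K \<subseteq> unit_ball p"
  proof
    fix x assume x: "x \<in> ?K"
    have "enorm p x \<le> (\<Sum>i<p. \<bar>x i\<bar>)" unfolding enorm_def by (rule L2_set_le_sum_abs)
    also have "\<dots> \<le> (\<Sum>i<p. 1 / real p)" using x by (intro sum_mono) (auto simp: PiE_def Pi_def)
    also have "\<dots> = 1" using p by simp
    finally show "x \<in> unit_ball p" using x by (auto simp: unit_ball_def space_PiM)
  qed
  hence "emeasure (lprod p) ?K \<le> emeasure (lprod p) (unit_ball p)" by (intro emeasure_mono) auto
  moreover have "emeasure (lprod p) ?K = (\<Prod>i<p. ennreal (1 / real p))"
    by (subst lborel_product.emeasure_PiM) auto
  moreover have "(\<Prod>i<p. ennreal (1 / real p)) \<noteq> 0" using p by simp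
  ultimately show "emeasure (lprod p) (unit_ball p) \<noteq> 0" by auto
  let ?K = "PiE {..<p} (\<lambda>_. {-1..1 :: real})"
  have "unit_ball p \<subseteq> ?K"
  proof
    fix x assume x: "x \<in> unit_ball p"
    have "\<bar>x i\<bar> \<le> 1" if "i < p" for i
    proof -
      have "\<bar>x i\<bar> \<le> L2_set (\<lambda>i. \<bar>x i\<bar>) {..<p}" by (rule member_le_L2_set) (use that in auto)
      also have "\<dots> = enorm p x" by (simp add: enorm_def L2_set_def)
      finally show ?thesis using x by (simp add: unit_ball_def)
    qed
    thus "x \<in> ?K" using x by (auto simp: unit_ball_def space_PiM PiE_iff abs_le_iff minus_le_iff)
  qed
  hence "emeasure (lprod p) (unit_ball p) \<le> emeasure (lprod p) ?K" by (intro emeasure_mono) auto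
  moreover have "emeasure (lprod p) ?K = (\<Prod>i<p. ennreal 2)"
    by (subst lborel_product.emeasure_PiM) auto
  ultimately show "emeasure (lprod p) (unit_ball p) \<noteq> \<infinity>"
    by (simp add: ennreal_power[symmetric] top_unique flip: ennreal_numeral) (metis ennreal_less_top linorder_not_le power_eq_top_ennreal top.not_eq_extremum top_greatest ennreal_numeral)
qed

lemma prob_space_uniform_sphere: "p \<ge> 1 \<Longrightarrow> prob_space (uniform_sphere p)"
  unfolding uniform_sphere_alt
  by (intro prob_space.prob_space_distr prob_space_uniform_measure emeasure_unit_ball)
    (auto simp: measurable_cong_sets[OF sets_uniform_measure refl])

lemma sets_uniform_sphere [simp, measurable_cong]: "sets (uniform_sphere p) = sets borel"
  by (simp add: uniform_sphere_def)

lemma space_uniform_sphere [simp]: "space (uniform_sphere p) = UNIV"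
  by (simp add: uniform_sphere_def)

lemma AE_uniform_sphere:
  assumes p: "p \<ge> 1"
  shows "AE u in uniform_sphere p. enorm p u = 1 \<and> u \<in> space_R p"
proof -
  \<comment> \<open>At the origin \<open>normalized\<close> divides by zero and returns the zero
    vector instead of a unit vector; as \<open>p\<close> is at least \<open>1\<close>, this point is
    a null set.\<close>
  have "AE x in lprod p. enorm p x \<noteq> 0"
  proof (rule AE_I)
    show "{x \<in> space (lprod p). \<not> enorm p x \<noteq> 0} \<subseteq> PiE {..<p} (\<lambda>_. {0})"
      by (auto simp: enorm_def L2_set_eq_0_iff space_PiM PiE_iff extensional_def fun_eq_iff)
    show "PiE {..<p} (\<lambda>_. {0}) \<in> sets (lprod p)" by (intro sets_PiM_I_finite) auto
    show "emeasure (lprod p) (PiE {..<p} (\<lambda>_. {0})) = 0"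
      using p by (subst lborel_product.emeasure_PiM) auto
  qed
  hence "AE x in uniform_measure (lprod p) (unit_ball p). enorm p x \<noteq> 0"
    by (intro AE_uniform_measureI) auto
  moreover have "enorm p (normalized p x) = 1 \<and> normalized p x \<in> space_R p" if "enorm p x \<noteq> 0" for x
  proof -
    have "enorm p (normalized p x) = enorm p (\<lambda>c. (1 / enorm p x) * x c)"
      unfolding enorm_def by (intro L2_set_cong) (auto simp: normalized_def enorm_def)
    also have "(\<dots>)\<^sup>2 = 1" using that
      unfolding einner_self[symmetric] einner_linear by (simp add: einner_self power2_eq_square)
    finally have "enorm p (normalized p x) = 1" by (simp add: power2_eq_1_iff) (use enorm_nonneg[of p "normalized p x"] in linarith)
    thus ?thesis by (simp add: topspace_Euclidean_space normalized_def)
  qed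
  ultimately have "AE x in uniform_measure (lprod p) (unit_ball p).
      enorm p (normalized p x) = 1 \<and> normalized p x \<in> space_R p" by auto
  moreover have "normalized p \<in> measurable (uniform_measure (lprod p) (unit_ball p)) borel"
    by (simp add: measurable_cong_sets[OF sets_uniform_measure refl])
  ultimately show ?thesis
    unfolding uniform_sphere_alt by (subst AE_distr_iff) 
      (auto simp: enorm_def L2_set_def topspace_Euclidean_space)
qed

lemma space_R_borel [measurable]: "space_R p \<in> sets borel"
  by (rule borel_closed, rule closedin_Euclidean_imp_closed[of p]) simp

lemma continuous_on_enorm: "continuous_on A (enorm p)"
  unfolding enorm_def L2_set_def by (intro continuous_intros continuous_on_coordinate)

lemma borel_measurable_coordinate [measurable]: "(\<lambda>x :: rvec. x i) \<in> borel_measurable borel"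
  by (rule borel_measurable_continuous_onI) (rule continuous_on_coordinate)

lemma borel_measurable_enorm [measurable]: "enorm p \<in> borel_measurable borel"
  by (rule borel_measurable_continuous_onI) (rule continuous_on_enorm)

lemma borel_measurable_einner [measurable]:
  assumes "\<And>i. (\<lambda>z. f z i) \<in> borel_measurable M" "\<And>i. (\<lambda>z. g z i) \<in> borel_measurable M"
  shows "(\<lambda>z. einner p (f z) (g z)) \<in> borel_measurable M"
  unfolding einner_def using assms by measurable

lemma measurable_reflect [measurable]: "reflect p w \<in> measurable borel borel"
  unfolding reflect_def
  by (rule measurable_coordinatewise_then_product) measurable

text \<open>A reflection preserves Lebesgue measure and the ball, and it commutes with
  normalisation; hence it preserves the image measure on the sphere.\<close>

lemma distr_uniform_sphere_reflect:
  assumes p: "p \<ge> 1" and w: "einner p w w = 1" "w \<in> space_R p"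
  shows "distr (uniform_sphere p) borel (reflect p w) = uniform_sphere p"
proof (rule measure_eqI)
  fix A assume "A \<in> sets (distr (uniform_sphere p) borel (reflect p w))"
  hence A[measurable]: "A \<in> sets borel" by simp
  \<comment> \<open>Points of the product space are \<open>undefined\<close> beyond
    \<open>p\<close>. The map leaves these entries alone so that it stays inside the product
    space.\<close>
  let ?T = "\<lambda>x c. if c < p then reflect p w x c else x c"
  have nT: "enorm p (?T x) = enorm p x" for x
    unfolding enorm_reflect[OF w(1), of x, symmetric] unfolding enorm_def by (rule L2_set_cong) auto
  have int: "emeasure (uniform_sphere p) B =
      (\<integral>\<^sup>+ x. indicator B (normalized p x) * indicator (unit_ball p) x \<partial>lprod p) / emeasure (lprod p) (unit_ball p)"
    if [measurable]: "B \<in> sets borel" for B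
  proof -
    have "emeasure (uniform_sphere p) B = (\<integral>\<^sup>+ u. indicator B u \<partial>uniform_sphere p)" by simp
    also have "\<dots> = (\<integral>\<^sup>+ x. indicator B (normalized p x) \<partial>uniform_measure (lprod p) (unit_ball p))"
      unfolding uniform_sphere_alt
      by (subst nn_integral_distr) (auto simp: measurable_cong_sets[OF sets_uniform_measure refl])
    also have "\<dots> = (\<integral>\<^sup>+ x. indicator B (normalized p x) * indicator (unit_ball p) x \<partial>lprod p) / emeasure (lprod p) (unit_ball p)"
      by (subst nn_integral_uniform_measure) auto
    finally show ?thesis .
  qed
  let ?f = "\<lambda>x. indicator A (normalized p x) * indicator (unit_ball p) x :: ennreal"
  have "emeasure (distr (uniform_sphere p) borel (reflect p w)) A = emeasure (uniform_sphere p) (reflect p w -` A)"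
    by (subst emeasure_distr) auto
  also have "\<dots> = (\<integral>\<^sup>+ x. indicator (reflect p w -` A) (normalized p x) * indicator (unit_ball p) x \<partial>lprod p) / emeasure (lprod p) (unit_ball p)"
    by (rule int) (use measurable_sets[OF measurable_reflect A, of p w] in simp)
  also have "(\<integral>\<^sup>+ x. indicator (reflect p w -` A) (normalized p x) * indicator (unit_ball p) x \<partial>lprod p)
     = (\<integral>\<^sup>+ x. ?f (?T x) \<partial>lprod p)"
  proof (rule nn_integral_cong)
    fix x assume x: "x \<in> space (lprod p)"
    have "normalized p (?T x) = reflect p w (normalized p x)"
    proof
      fix c
      have "einner p w (normalized p x) = einner p w (\<lambda>c. (1 / enorm p x) * x c)"
        by (intro einner_cong) (auto simp: normalized_def)
      also have "\<dots> = einner p w x / enorm p x" by (simp only: einner_linear) simp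
      finally have "einner p w (normalized p x) = einner p w x / enorm p x" .
      thus "normalized p (?T x) c = reflect p w (normalized p x) c"
        unfolding normalized_def[of p "?T x"] nT using w(2)
        by (auto simp: reflect_def normalized_def topspace_Euclidean_space diff_divide_distrib)
    qed
    moreover have "?T x \<in> unit_ball p \<longleftrightarrow> x \<in> unit_ball p"
      using x by (auto simp: unit_ball_def nT space_PiM PiE_def extensional_def)
    ultimately show "indicator (reflect p w -` A) (normalized p x) * indicator (unit_ball p) x = ?f (?T x)"
      by (auto simp: indicator_def)
  qed
  also have "\<dots> = (\<integral>\<^sup>+ x. ?f x \<partial>lprod p)"
  proof -
    have "?f \<in> borel_measurable (lprod p)" by measurable
    from scaling_mapD[OF scaling_map_reflect[OF w(1)] this] show ?thesis by simp
  qed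
  also have "\<dots> / emeasure (lprod p) (unit_ball p) = emeasure (uniform_sphere p) A"
    by (rule int[symmetric]) simp
  finally show "emeasure (distr (uniform_sphere p) borel (reflect p w)) A = emeasure (uniform_sphere p) A" .
qed simp

lemma integral_uniform_sphere_reflect:
  fixes h :: "rvec \<Rightarrow> real"
  assumes "p \<ge> 1" "einner p w w = 1" "w \<in> space_R p" and [measurable]: "h \<in> borel_measurable borel"
  shows "(\<integral>u. h (reflect p w u) \<partial>uniform_sphere p) = (\<integral>u. h u \<partial>uniform_sphere p)"
proof -
  have "(\<integral>u. h u \<partial>uniform_sphere p) = (\<integral>u. h u \<partial>distr (uniform_sphere p) borel (reflect p w))"
    using distr_uniform_sphere_reflect[OF assms(1-3)] by simp
  also have "\<dots> = (\<integral>u. h (reflect p w u) \<partial>uniform_sphere p)"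
    by (rule integral_distr) auto
  finally show ?thesis by simp
qed

lemma abs_coordinate_le_enorm: "c < p \<Longrightarrow> \<bar>u c\<bar> \<le> enorm p u"
proof -
  assume c: "c < p"
  have "\<bar>u c\<bar> \<le> L2_set (\<lambda>i. \<bar>u i\<bar>) {..<p}" by (rule member_le_L2_set) (use c in auto)
  thus ?thesis by (simp add: enorm_def L2_set_def)
qed

lemma sphere_integrable_bounded:
  fixes h :: "rvec \<Rightarrow> real"
  assumes p: "p \<ge> 1" and [measurable]: "h \<in> borel_measurable borel"
    and b: "\<And>u. enorm p u = 1 \<Longrightarrow> u \<in> space_R p \<Longrightarrow> \<bar>h u\<bar> \<le> B"
  shows "integrable (uniform_sphere p) h"
proof -
  interpret prob_space "uniform_sphere p" by (rule prob_space_uniform_sphere[OF p])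
  show ?thesis
    by (rule integrable_const_bound[where B = B]) (use AE_uniform_sphere[OF p] b in auto)
qed

lemma sphere_integrable_einner:
  assumes p: "p \<ge> 1" shows "integrable (uniform_sphere p) (\<lambda>u. einner p g u * einner p h u)"
proof (rule sphere_integrable_bounded[OF p])
  fix u assume u: "enorm p u = 1"
  have "\<bar>einner p g u\<bar> \<le> enorm p g" "\<bar>einner p h u\<bar> \<le> enorm p h"
    using einner_Cauchy_Schwarz[of p g u] einner_Cauchy_Schwarz[of p h u] u by simp_all
  thus "\<bar>einner p g u * einner p h u\<bar> \<le> enorm p g * enorm p h"
    unfolding abs_mult by (intro mult_mono) auto
qed measurable

text \<open>Reflecting along axis \<open>c\<close> flips the sign of one coordinate, so mixed
  moments vanish. Reflecting along the difference of two axis vectors swaps the coordinates, so the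
  \<open>p\<close> pure moments coincide, and they add up to \<open>1\<close>.\<close>

lemma sphere_second_moments:
  assumes p: "p \<ge> 1" and cd: "c < p" "d < p"
  shows "(\<integral>u. u c * u d \<partial>uniform_sphere p) = (if c = d then 1 / real p else 0)"
proof -
  interpret prob_space "uniform_sphere p" by (rule prob_space_uniform_sphere[OF p])
  let ?e = "\<lambda>a i. if i = a then 1 else 0 :: real"
  have e: "einner p (?e a) x = x a" if "a < p" for a x
    using that by (simp add: einner_def if_distrib[of "\<lambda>z. z * _"] cong: if_cong)
  have int: "integrable (uniform_sphere p) (\<lambda>u. u a * u b)" if "a < p" "b < p" for a b
    by (rule sphere_integrable_bounded[OF p, where B = 1])
      (use abs_coordinate_le_enorm that in \<open>auto simp: abs_mult intro!: mult_le_one, metis, metis\<close>)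
  show ?thesis
  proof (cases "c = d")
    case False
    have "(\<integral>u. (reflect p (?e c) u) c * (reflect p (?e c) u) d \<partial>uniform_sphere p) = (\<integral>u. u c * u d \<partial>uniform_sphere p)"
      by (rule integral_uniform_sphere_reflect[OF p]) (use cd in \<open>auto simp: e topspace_Euclidean_space\<close>)
    thus ?thesis using False cd by (simp add: reflect_def e)
  next
    case True
    have eq: "(\<integral>u. u a * u a \<partial>uniform_sphere p) = (\<integral>u. u c * u c \<partial>uniform_sphere p)" if a: "a < p" for a
    proof (cases "a = c")
      case False
      let ?w = "\<lambda>i. (1 / sqrt 2) * (?e c i - ?e a i)"
      have ipw: "einner p ?w x = (1 / sqrt 2) * (x c - x a)" for x
        unfolding einner_linear using e cd a by simp
      have w1: "einner p ?w ?w = 1" unfolding ipw using False by simp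
      have "(\<integral>u. (reflect p ?w u) c * (reflect p ?w u) c \<partial>uniform_sphere p) = (\<integral>u. u c * u c \<partial>uniform_sphere p)"
        by (rule integral_uniform_sphere_reflect[OF p w1]) (use cd a in \<open>auto simp: topspace_Euclidean_space\<close>)
      moreover have "(reflect p ?w u) c = u a" for u
        unfolding reflect_def ipw using False by (simp add: field_simps)
      ultimately show ?thesis by simp
    qed simp
    have "1 = (\<integral>u. einner p u u \<partial>uniform_sphere p)"
    proof -
      have "(\<integral>u. einner p u u \<partial>uniform_sphere p) = (\<integral>u. 1 \<partial>uniform_sphere p)"
        by (rule integral_cong_AE) (use AE_uniform_sphere[OF p] in \<open>auto simp: einner_self\<close>)
      thus ?thesis using prob_space[unfolded space_uniform_sphere] by simp
    qed
    also have "\<dots> = (\<Sum>a<p. (\<integral>u. u a * u a \<partial>uniform_sphere p))"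
      unfolding einner_def by (rule Bochner_Integration.integral_sum) (auto intro: int)
    also have "\<dots> = real p * (\<integral>u. u c * u c \<partial>uniform_sphere p)" using eq by simp
    finally show ?thesis using True p by (simp add: field_simps)
  qed
qed

lemma sphere_einner_coordinate:
  assumes p: "p \<ge> 1" and c: "c < p"
  shows "(\<integral>u. einner p g u * u c \<partial>uniform_sphere p) = g c / real p"
proof -
  have int: "integrable (uniform_sphere p) (\<lambda>u. u a * u c)" if "a < p" for a
    by (rule sphere_integrable_bounded[OF p, where B = 1])
      (use abs_coordinate_le_enorm that c in \<open>auto simp: abs_mult intro!: mult_le_one, metis, metis\<close>)
  have "(\<integral>u. einner p g u * u c \<partial>uniform_sphere p) = (\<integral>u. (\<Sum>a<p. g a * (u a * u c)) \<partial>uniform_sphere p)"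
    by (simp add: einner_def sum_distrib_right mult.assoc)
  also have "\<dots> = (\<Sum>a<p. (\<integral>u. g a * (u a * u c) \<partial>uniform_sphere p))"
    by (rule Bochner_Integration.integral_sum) (auto intro: int)
  also have "\<dots> = (\<Sum>a<p. g a * (if a = c then 1 / real p else 0))"
    by (intro sum.cong) (auto simp: sphere_second_moments p c)
  also have "\<dots> = (\<Sum>a<p. if a = c then g a / real p else 0)" by (intro sum.cong) auto
  also have "\<dots> = g c / real p" using c by simp
  finally show ?thesis .
qed

lemma sphere_einner_einner:
  assumes p: "p \<ge> 1"
  shows "(\<integral>u. einner p g u * einner p h u \<partial>uniform_sphere p) = einner p g h / real p"
proof -
  have int: "integrable (uniform_sphere p) (\<lambda>u. einner p g u * u c)" if "c < p" for c
  proof (rule sphere_integrable_bounded[OF p, where B = "enorm p g"])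
    fix u assume u: "enorm p u = 1"
    have "\<bar>einner p g u\<bar> \<le> enorm p g" using einner_Cauchy_Schwarz[of p g u] u by simp
    moreover have "\<bar>u c\<bar> \<le> 1" using abs_coordinate_le_enorm[OF that, of u] u by simp
    ultimately show "\<bar>einner p g u * u c\<bar> \<le> enorm p g"
      using mult_mono[of "\<bar>einner p g u\<bar>" "enorm p g" "\<bar>u c\<bar>" 1] by (simp add: abs_mult)
  qed measurable
  have "(\<integral>u. einner p g u * einner p h u \<partial>uniform_sphere p) = (\<integral>u. (\<Sum>c<p. h c * (einner p g u * u c)) \<partial>uniform_sphere p)"
    unfolding einner_def[of p h] by (simp add: sum_distrib_left mult_ac)
  also have "\<dots> = (\<Sum>c<p. (\<integral>u. h c * (einner p g u * u c) \<partial>uniform_sphere p))"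
    by (rule Bochner_Integration.integral_sum) (auto intro: int)
  also have "\<dots> = (\<Sum>c<p. g c * h c / real p)"
    by (intro sum.cong) (auto simp: sphere_einner_coordinate p)
  finally show ?thesis by (simp add: einner_def sum_divide_distrib)
qed

subsection \<open>The two-point estimator on the sphere\<close>

text \<open>The projection onto \<open>space_R p\<close>. Composing with it extends functions that
  matter only on this subspace to the whole type, where the Borel structure lives.\<close>

definition trunc :: "nat \<Rightarrow> rvec \<Rightarrow> rvec" where
  "trunc p x = (\<lambda>i. if i < p then x i else 0)"

lemma trunc_space: "trunc p x \<in> space_R p"
  by (simp add: trunc_def space_R_iff)

lemma trunc_id: "x \<in> space_R p \<Longrightarrow> trunc p x = x"
  by (auto simp: trunc_def space_R_iff fun_eq_iff)

text \<open>Continuity refers to the product topology on all of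
  \<open>nat \<Rightarrow> real\<close>; by \<open>tr\<close> only the first \<open>p\<close>
  coordinates count, and these are controlled by \<open>enorm p\<close>.\<close>

lemma smooth_continuous:
  assumes f: "smooth_on_R p Lf f" and tr: "\<And>y. f (trunc p y) = f y"
  shows "continuous_on A f"
proof (rule continuous_at_imp_continuous_on, rule ballI)
  fix x
  let ?g = "grad p f (trunc p x)"
  let ?d = "\<lambda>y. enorm p (\<lambda>i. y i - x i)"
  have "((\<lambda>y. ?d y) \<longlongrightarrow> enorm p (\<lambda>i. x i - x i)) (at x)"
  proof -
    have "continuous_on UNIV ?d"
      unfolding enorm_def L2_set_def by (intro continuous_intros continuous_on_coordinate)
    thus ?thesis unfolding continuous_on_eq_continuous_at[OF open_UNIV] isCont_def by blast
  qed
  hence d0: "(?d \<longlongrightarrow> 0) (at x)" by (simp add: enorm_def L2_set_def)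
  have "((\<lambda>y. enorm p ?g * ?d y + Lf / 2 * (?d y)\<^sup>2) \<longlongrightarrow> enorm p ?g * 0 + Lf / 2 * 0\<^sup>2) (at x)"
    by (intro tendsto_intros d0)
  hence lim: "((\<lambda>y. enorm p ?g * ?d y + Lf / 2 * (?d y)\<^sup>2) \<longlongrightarrow> 0) (at x)" by simp
  have "((\<lambda>y. f y - f x) \<longlongrightarrow> 0) (at x)"
  proof (rule Lim_null_comparison[OF _ lim], rule always_eventually, rule allI)
    fix y
    let ?h = "trunc p (\<lambda>i. y i - x i)"
    have nh: "enorm p ?h = ?d y" by (intro enorm_cong) (simp add: trunc_def)
    have "(\<lambda>i. trunc p x i + ?h i) = trunc p y" by (auto simp: trunc_def)
    thus "norm (f y - f x) \<le> enorm p ?g * ?d y + Lf / 2 * (?d y)\<^sup>2"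
      using smooth_difference_bound[OF f trunc_space[of p x] trunc_space[of p "\<lambda>i. y i - x i"]]
      by (simp add: tr nh)
  qed
  thus "isCont f x" by (simp add: isCont_def LIM_zero_iff)
qed

text \<open>The segment between the two points stays in the ball of radius \<open>r\<close> around
  \<open>x\<close>, where the gradient varies by at most \<open>Lf * r\<close>. A bound linear in
  the distance of the points is what a nearby pair of reflected directions needs.\<close>

lemma smooth_increment:
  assumes f: "smooth_on_R p Lf f" and x: "x \<in> space_R p" and a: "a \<in> space_R p" "enorm p a \<le> r"
    and b: "b \<in> space_R p" "enorm p b \<le> r" and Lf: "Lf \<ge> 0"
  shows "\<bar>f (\<lambda>i. x i + a i) - f (\<lambda>i. x i + b i) - einner p (grad p f x) (\<lambda>i. a i - b i)\<bar>
     \<le> Lf * r * enorm p (\<lambda>i. a i - b i)"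
proof -
  let ?h = "\<lambda>i. a i - b i" and ?y = "\<lambda>i. x i + b i"
  have h: "?h \<in> space_R p" using a b by (simp add: space_R_iff)
  have y: "?y \<in> space_R p" using x b by (simp add: space_R_iff)
  let ?\<phi> = "\<lambda>t. f (\<lambda>i. ?y i + t * ?h i) - t * einner p (grad p f x) ?h"
  have "\<exists>t. 0 < t \<and> t < 1 \<and> ?\<phi> 1 - ?\<phi> 0 = (1 - 0) * (einner p (grad p f (\<lambda>i. ?y i + t * ?h i)) ?h - einner p (grad p f x) ?h)"
    by (rule MVT2) (auto intro!: derivative_eq_intros smooth_line_derivative[OF f y h])
  then obtain t where t: "0 < t" "t < 1" and
    e: "?\<phi> 1 - ?\<phi> 0 = einner p (grad p f (\<lambda>i. ?y i + t * ?h i)) ?h - einner p (grad p f x) ?h" by auto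
  let ?z = "\<lambda>i. ?y i + t * ?h i"
  have z: "?z \<in> space_R p" using y h by (simp add: space_R_iff)
  have "enorm p (vdiff ?z x) = enorm p (\<lambda>i. (1 - t) * b i + t * a i)"
    by (intro enorm_cong) (simp add: vdiff_def algebra_simps)
  also have "\<dots> \<le> (1 - t) * enorm p b + t * enorm p a"
    using enorm_triangle[of p "\<lambda>i. (1 - t) * b i" "\<lambda>i. t * a i"] t by (simp add: enorm_scale)
  also have "\<dots> \<le> (1 - t) * r + t * r" using t a b by (intro add_mono mult_left_mono) auto
  finally have nz: "enorm p (vdiff ?z x) \<le> r" by (simp add: algebra_simps)
  have "\<bar>?\<phi> 1 - ?\<phi> 0\<bar> = \<bar>einner p (vdiff (grad p f ?z) (grad p f x)) ?h\<bar>"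
    unfolding e by (simp add: vdiff_def einner_diff_left)
  also have "\<dots> \<le> enorm p (vdiff (grad p f ?z) (grad p f x)) * enorm p ?h"
    by (rule einner_Cauchy_Schwarz)
  also have "\<dots> \<le> (Lf * r) * enorm p ?h"
  proof (rule mult_right_mono)
    have "enorm p (vdiff (grad p f ?z) (grad p f x)) \<le> Lf * enorm p (vdiff ?z x)"
      by (rule smooth_grad_Lipschitz[OF f z x])
    also have "\<dots> \<le> Lf * r" using nz Lf by (rule mult_left_mono)
    finally show "enorm p (vdiff (grad p f ?z) (grad p f x)) \<le> Lf * r" .
  qed simp
  finally show ?thesis by (simp add: algebra_simps)
qed

locale smooth_trunc =
  fixes p :: nat and Lf :: real and f :: "rvec \<Rightarrow> real"
  assumes p1: "p \<ge> 1" and Lf0: "Lf \<ge> 0" and smooth: "smooth_on_R p Lf f"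
    and tr: "f (trunc p y) = f y"
begin

lemma f_measurable [measurable]: "f \<in> borel_measurable borel"
  by (rule borel_measurable_continuous_onI) (rule smooth_continuous[OF smooth tr])

lemma measurable_line [measurable]: "(\<lambda>u :: rvec. (\<lambda>b. x b + d * u b)) \<in> measurable borel borel"
  by (rule measurable_coordinatewise_then_product) measurable

text \<open>Averaging over the reflection in \<open>w\<close> replaces the Taylor remainder \<open>R u\<close> by half of
  \<open>R u - R (reflect p w u)\<close>, which is of order \<open>Lf * d\<^sup>2 * \<bar>\<langle>w, u\<rangle>\<bar>\<close>. The factor \<open>p\<close> of the
  estimator then cancels against the mean \<open>1 / p\<close> of \<open>\<langle>w, u\<rangle>\<^sup>2\<close>; bounding \<open>R\<close> directly would lose
  a factor \<open>sqrt p\<close>.\<close>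

lemma sphere_estimator_bias_unit:
  assumes x: "x \<in> space_R p" and d: "d > 0" and w: "w \<in> space_R p" "einner p w w = 1"
  shows "\<bar>(\<integral>u. real p * (f (\<lambda>b. x b + d * u b) - f x) / d * einner p w u \<partial>uniform_sphere p)
      - einner p (grad p f x) w\<bar> \<le> Lf * d"
proof -
  interpret prob_space "uniform_sphere p" by (rule prob_space_uniform_sphere[OF p1])
  let ?g = "grad p f x"
  let ?U = "uniform_sphere p"
  define R where "R u = f (\<lambda>b. x b + d * u b) - f x - d * einner p ?g u" for u
  have [measurable]: "R \<in> borel_measurable borel" unfolding R_def by measurable
  have nw: "enorm p w = 1" using w(2) enorm_nonneg[of p w] by (simp add: einner_self power2_eq_1_iff)
  have wu: "\<bar>einner p w u\<bar> \<le> 1" if "enorm p u = 1" for u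
    using einner_Cauchy_Schwarz[of p w u] that nw by simp
  have Rb: "\<bar>R u\<bar> \<le> Lf / 2 * d\<^sup>2" if "enorm p u = 1" "u \<in> space_R p" for u
    using smooth_descent[OF smooth x space_R_scale[OF that(2), of d]] that d
    by (simp add: R_def enorm_scale einner_linear)
  have intR: "integrable ?U (\<lambda>u. R u * einner p w u)"
  proof (rule sphere_integrable_bounded[OF p1])
    fix u assume u: "enorm p u = 1" "u \<in> space_R p"
    show "\<bar>R u * einner p w u\<bar> \<le> Lf / 2 * d\<^sup>2"
      using mult_mono[OF Rb[OF u] wu[OF u(1)]] Lf0 by (simp add: abs_mult)
  qed measurable
  have intR': "integrable ?U (\<lambda>u. R (reflect p w u) * einner p w u)"
  proof (rule sphere_integrable_bounded[OF p1])
    fix u assume u: "enorm p u = 1" "u \<in> space_R p"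
    have "enorm p (reflect p w u) = 1" "reflect p w u \<in> space_R p"
      using u w enorm_reflect[OF w(2), of u] by (simp_all add: space_R_iff) (simp add: reflect_def)
    from mult_mono[OF Rb[OF this] wu[OF u(1)]] Lf0 show "\<bar>R (reflect p w u) * einner p w u\<bar> \<le> Lf / 2 * d\<^sup>2"
      by (simp add: abs_mult)
  qed measurable
  have intg: "integrable ?U (\<lambda>u. einner p ?g u * einner p w u)"
    by (rule sphere_integrable_einner[OF p1])
  define I where "I = (\<integral>u. R u * einner p w u \<partial>?U)"
  have "(\<integral>u. real p * (f (\<lambda>b. x b + d * u b) - f x) / d * einner p w u \<partial>?U)
      = (\<integral>u. real p / d * (R u * einner p w u) + real p * (einner p ?g u * einner p w u) \<partial>?U)"
    using d by (intro Bochner_Integration.integral_cong) (auto simp: R_def field_simps)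
  also have "\<dots> = real p / d * I + real p * (einner p ?g w / real p)"
    using intR intg by (simp add: I_def sphere_einner_einner[OF p1])
  finally have eq: "(\<integral>u. real p * (f (\<lambda>b. x b + d * u b) - f x) / d * einner p w u \<partial>?U)
      = real p / d * I + einner p ?g w" using p1 by simp
  have "I = (\<integral>u. R (reflect p w u) * einner p w (reflect p w u) \<partial>?U)"
    unfolding I_def by (rule integral_uniform_sphere_reflect[symmetric, OF p1 w(2,1)]) measurable
  hence "2 * I = (\<integral>u. R u * einner p w u - R (reflect p w u) * einner p w u \<partial>?U)"
    using intR intR' by (simp add: einner_reflect_left[OF w(2)] I_def)
  also have "norm \<dots> \<le> (\<integral>u. 2 * Lf * d\<^sup>2 * (einner p w u * einner p w u) \<partial>?U)"
  proof (rule order_trans[OF integral_norm_bound integral_mono_AE])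
    show "integrable ?U (\<lambda>u. norm (R u * einner p w u - R (reflect p w u) * einner p w u))"
      using intR intR' by (intro integrable_norm) simp
    show "integrable ?U (\<lambda>u. 2 * Lf * d\<^sup>2 * (einner p w u * einner p w u))"
      by (rule integrable_mult_right[OF sphere_integrable_einner[OF p1]])
    have "norm (R u * einner p w u - R (reflect p w u) * einner p w u) \<le> 2 * Lf * d\<^sup>2 * (einner p w u * einner p w u)"
      if u: "enorm p u = 1" "u \<in> space_R p" for u
    proof -
      have u': "enorm p (reflect p w u) = 1" "reflect p w u \<in> space_R p"
        using u w enorm_reflect[OF w(2), of u] by (simp_all add: space_R_iff) (simp add: reflect_def)
      have df: "(\<lambda>i. d * u i - d * reflect p w u i) = (\<lambda>i. (2 * d * einner p w u) * w i)"
        by (auto simp: reflect_def algebra_simps)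
      have "R u - R (reflect p w u) = f (\<lambda>i. x i + d * u i) - f (\<lambda>i. x i + d * reflect p w u i)
          - einner p ?g (\<lambda>i. d * u i - d * reflect p w u i)"
        unfolding einner_diff_right einner_mult_right by (simp add: R_def)
      moreover have "\<bar>\<dots>\<bar> \<le> Lf * d * enorm p (\<lambda>i. d * u i - d * reflect p w u i)"
        using u u' d by (intro smooth_increment[OF smooth x] space_R_scale Lf0) (auto simp: enorm_scale)
      ultimately have "\<bar>R u - R (reflect p w u)\<bar> \<le> Lf * d * (2 * d * \<bar>einner p w u\<bar>)"
        unfolding df enorm_scale using nw d by (simp add: abs_mult)
      from mult_right_mono[OF this, of "\<bar>einner p w u\<bar>"]
      have "\<bar>R u - R (reflect p w u)\<bar> * \<bar>einner p w u\<bar> \<le> 2 * Lf * d\<^sup>2 * (einner p w u * einner p w u)"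
        by (simp add: power2_eq_square mult_ac)
      thus ?thesis by (simp only: left_diff_distrib[symmetric] abs_mult real_norm_def)
    qed
    thus "AE u in ?U. norm (R u * einner p w u - R (reflect p w u) * einner p w u) \<le> 2 * Lf * d\<^sup>2 * (einner p w u * einner p w u)"
      using AE_uniform_sphere[OF p1] by auto
  qed
  also have "\<dots> = 2 * Lf * d\<^sup>2 / real p"
    using sphere_einner_einner[OF p1, of w w] w(2) by simp
  finally have "\<bar>I\<bar> \<le> Lf * d\<^sup>2 / real p" by simp
  hence "real p / d * \<bar>I\<bar> \<le> real p / d * (Lf * d\<^sup>2 / real p)" using d by (intro mult_left_mono) auto
  also have "\<dots> = Lf * d" using d p1 by (simp add: power2_eq_square)
  finally show ?thesis unfolding eq using d by (simp add: abs_mult)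
qed

lemma sphere_estimator_bias:
  assumes x: "x \<in> space_R p" and d: "d > 0" and w: "w \<in> space_R p"
  shows "\<bar>(\<integral>u. real p * (f (\<lambda>b. x b + d * u b) - f x) / d * einner p w u \<partial>uniform_sphere p)
      - einner p (grad p f x) w\<bar> \<le> Lf * d * enorm p w"
proof (cases "enorm p w = 0")
  case True
  have "einner p w v = 0" "einner p v w = 0" for v
    using einner_Cauchy_Schwarz[of p w v] einner_Cauchy_Schwarz[of p v w] True by auto
  thus ?thesis using True by simp
next
  case False
  hence nw: "enorm p w > 0" using enorm_nonneg[of p w] by linarith
  let ?w = "\<lambda>i. (1 / enorm p w) * w i"
  have w1: "einner p ?w ?w = 1" unfolding einner_mult_left einner_mult_right einner_self
    using nw by (simp add: power2_eq_square)
  have "\<bar>(\<integral>u. real p * (f (\<lambda>b. x b + d * u b) - f x) / d * einner p ?w u \<partial>uniform_sphere p)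
      - einner p (grad p f x) ?w\<bar> \<le> Lf * d"
    by (rule sphere_estimator_bias_unit[OF x d space_R_scale[OF w] w1])
  also have "(\<integral>u. real p * (f (\<lambda>b. x b + d * u b) - f x) / d * einner p ?w u \<partial>uniform_sphere p)
     = (1 / enorm p w) * (\<integral>u. real p * (f (\<lambda>b. x b + d * u b) - f x) / d * einner p w u \<partial>uniform_sphere p)"
    unfolding einner_mult_left by (subst integral_mult_right_zero[symmetric]) (simp add: mult_ac)
  also have "einner p (grad p f x) ?w = (1 / enorm p w) * einner p (grad p f x) w"
    by (rule einner_mult_right)
  finally show ?thesis using nw unfolding right_diff_distrib[symmetric] abs_mult by (simp add: field_simps)
qed

text \<open>The linear part of the increment brings the mean \<open>1 / p\<close> of a squared inner
  product, which reduces \<open>p\<^sup>2\<close> to \<open>p\<close>. The Taylor remainder keeps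
  \<open>p\<^sup>2\<close> but carries \<open>d\<^sup>2\<close>.\<close>

lemma sphere_estimator_second_moment:
  assumes x: "x \<in> space_R p" and d: "d > 0"
  shows "(\<integral>\<^sup>+u. ennreal ((enorm p (\<lambda>c. real p * (f (\<lambda>b. x b + d * u b) - f x) / d * u c))\<^sup>2) \<partial>uniform_sphere p)
      \<le> ennreal (2 * real p * (enorm p (grad p f x))\<^sup>2 + (real p)\<^sup>2 * Lf\<^sup>2 * d\<^sup>2 / 2)"
proof -
  interpret prob_space "uniform_sphere p" by (rule prob_space_uniform_sphere[OF p1])
  let ?g = "grad p f x" and ?U = "uniform_sphere p"
  have intg: "integrable ?U (\<lambda>u. einner p ?g u * einner p ?g u)"
    by (rule sphere_integrable_einner[OF p1])
  have pw: "(enorm p (\<lambda>c. real p * (f (\<lambda>b. x b + d * u b) - f x) / d * u c))\<^sup>2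
     \<le> 2 * (real p)\<^sup>2 * (einner p ?g u * einner p ?g u) + (real p)\<^sup>2 * Lf\<^sup>2 * d\<^sup>2 / 2"
    if u: "enorm p u = 1" "u \<in> space_R p" for u
  proof -
    define \<Delta> where "\<Delta> = f (\<lambda>b. x b + d * u b) - f x"
    have "\<bar>\<Delta> - d * einner p ?g u\<bar> \<le> Lf / 2 * d\<^sup>2"
      using smooth_descent[OF smooth x space_R_scale[OF u(2), of d]] u d
      by (simp add: \<Delta>_def enorm_scale einner_linear)
    from power_mono[OF this, of 2] have r: "(\<Delta> - d * einner p ?g u)\<^sup>2 \<le> (Lf / 2 * d\<^sup>2)\<^sup>2" by simp
    have "\<Delta>\<^sup>2 \<le> 2 * (d * einner p ?g u)\<^sup>2 + 2 * (\<Delta> - d * einner p ?g u)\<^sup>2"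
    proof -
      have "0 \<le> (2 * (d * einner p ?g u) - \<Delta>)\<^sup>2" by simp
      thus ?thesis by (simp add: power2_eq_square algebra_simps)
    qed
    also have "\<dots> \<le> 2 * (d * einner p ?g u)\<^sup>2 + 2 * (Lf / 2 * d\<^sup>2)\<^sup>2" using r by simp
    finally have \<Delta>: "\<Delta>\<^sup>2 \<le> d\<^sup>2 * (2 * (einner p ?g u * einner p ?g u) + Lf\<^sup>2 * d\<^sup>2 / 2)"
      by (simp add: power2_eq_square algebra_simps)
    have "(enorm p (\<lambda>c. real p * \<Delta> / d * u c))\<^sup>2 = (real p)\<^sup>2 * (\<Delta>\<^sup>2 / d\<^sup>2)"
      unfolding enorm_scale using u d by (simp add: power_mult_distrib power_divide)
    also have "\<dots> \<le> (real p)\<^sup>2 * (2 * (einner p ?g u * einner p ?g u) + Lf\<^sup>2 * d\<^sup>2 / 2)"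
      using \<Delta> d by (intro mult_left_mono) (auto simp: field_simps)
    finally show ?thesis unfolding \<Delta>_def by (simp add: algebra_simps)
  qed
  have "(\<integral>\<^sup>+u. ennreal ((enorm p (\<lambda>c. real p * (f (\<lambda>b. x b + d * u b) - f x) / d * u c))\<^sup>2) \<partial>?U)
    \<le> (\<integral>\<^sup>+u. ennreal (2 * (real p)\<^sup>2 * (einner p ?g u * einner p ?g u) + (real p)\<^sup>2 * Lf\<^sup>2 * d\<^sup>2 / 2) \<partial>?U)"
  proof (rule nn_integral_mono_AE)
    show "AE u in ?U. ennreal ((enorm p (\<lambda>c. real p * (f (\<lambda>b. x b + d * u b) - f x) / d * u c))\<^sup>2)
      \<le> ennreal (2 * (real p)\<^sup>2 * (einner p ?g u * einner p ?g u) + (real p)\<^sup>2 * Lf\<^sup>2 * d\<^sup>2 / 2)"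
      using AE_uniform_sphere[OF p1] by eventually_elim (intro ennreal_leI pw, auto)
  qed
  also have "\<dots> = ennreal (\<integral>u. 2 * (real p)\<^sup>2 * (einner p ?g u * einner p ?g u) + (real p)\<^sup>2 * Lf\<^sup>2 * d\<^sup>2 / 2 \<partial>?U)"
    using intg by (intro nn_integral_eq_integral) auto
  also have "(\<integral>u. 2 * (real p)\<^sup>2 * (einner p ?g u * einner p ?g u) + (real p)\<^sup>2 * Lf\<^sup>2 * d\<^sup>2 / 2 \<partial>?U)
     = 2 * (real p)\<^sup>2 * (einner p ?g ?g / real p) + (real p)\<^sup>2 * Lf\<^sup>2 * d\<^sup>2 / 2"
    using intg prob_space[unfolded space_uniform_sphere] by (simp add: sphere_einner_einner[OF p1])
  also have "\<dots> = 2 * real p * (enorm p ?g)\<^sup>2 + (real p)\<^sup>2 * Lf\<^sup>2 * d\<^sup>2 / 2"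
    using p1 by (simp add: einner_self power2_eq_square)
  finally show ?thesis .
qed

end

subsection \<open>Measurability and expected gradients\<close>

text \<open>Each \<open>y\<close> is replaced by the first point of a dense sequence within distance
  \<open>1 / (m + 1)\<close>. This choice is measurable with countably many values, and continuity
  in \<open>y\<close> gives the limit. It makes the costs measurable at random arguments.\<close>

lemma Caratheodory_measurable:
  fixes G :: "'a :: {metric_space, second_countable_topology} \<Rightarrow> 'c \<Rightarrow> real"
  assumes meas: "\<And>y. G y \<in> borel_measurable D"
    and cont: "\<And>z. z \<in> space D \<Longrightarrow> continuous_on UNIV (\<lambda>y. G y z)"
  shows "(\<lambda>(y, z). G y z) \<in> borel_measurable (borel \<Otimes>\<^sub>M D)"
proof -
  obtain S :: "'a set" where S: "countable S" "\<And>X. open X \<Longrightarrow> X \<noteq> {} \<Longrightarrow> \<exists>d \<in> S. d \<in> X"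
    by (rule countable_dense_setE) blast
  have Sne: "S \<noteq> {}" using S(2)[of UNIV] by auto
  define e where "e = from_nat_into S"
  have ran: "range e = S" unfolding e_def by (rule range_from_nat_into[OF Sne S(1)])
  have near: "\<exists>j. dist y (e j) < 1 / real (Suc m)" for y m
  proof -
    have "\<exists>d\<in>S. d \<in> ball y (1 / real (Suc m))" by (rule S(2)) auto
    thus ?thesis using ran by (metis imageE mem_ball)
  qed
  define g where "g m y = (LEAST j. dist y (e j) < 1 / real (Suc m))" for m y
  have g: "dist y (e (g m y)) < 1 / real (Suc m)" for m y
    unfolding g_def using near by (rule LeastI_ex)
  have gm: "g m \<in> measurable borel (count_space UNIV)" for m
    unfolding g_def by measurable
  show ?thesis
  proof (rule borel_measurable_LIMSEQ_real)
    fix yz assume yz: "yz \<in> space (borel \<Otimes>\<^sub>M D :: ('a \<times> 'c) measure)"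
    obtain y z where [simp]: "yz = (y, z)" by force
    have z: "z \<in> space D" using yz by (simp add: space_pair_measure)
    have "(\<lambda>m. e (g m y)) \<longlonglongrightarrow> y"
    proof (rule tendstoI)
      fix r :: real assume r: "r > 0"
      have "\<forall>\<^sub>F m in sequentially. 1 / real (Suc m) < r"
        using LIMSEQ_Suc[OF lim_1_over_n] r by (rule order_tendstoD(2))
      thus "\<forall>\<^sub>F m in sequentially. dist (e (g m y)) y < r"
        by eventually_elim (use g in \<open>metis dist_commute less_trans\<close>)
    qed
    moreover have "isCont (\<lambda>y. G y z) y" using cont[OF z] by (simp add: continuous_on_eq_continuous_at)
    ultimately show "(\<lambda>m. (\<lambda>(y, z). G (e (g m y)) z) yz) \<longlonglongrightarrow> (\<lambda>(y, z). G y z) yz"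
      by (simp add: isCont_tendsto_compose[of y "\<lambda>y. G y z"])
  next
    fix m
    have "(\<lambda>yz. G (e (g m (fst yz))) (snd yz)) \<in> borel_measurable (borel \<Otimes>\<^sub>M D)"
    proof (rule measurable_compose_countable[of "\<lambda>j yz. G (e j) (snd yz)"])
      show "(\<lambda>yz. G (e j) (snd yz)) \<in> borel_measurable (borel \<Otimes>\<^sub>M D)" for j
        using meas by measurable
      show "(\<lambda>yz. g m (fst yz)) \<in> measurable (borel \<Otimes>\<^sub>M D) (count_space UNIV)"
        using gm by measurable
    qed
    thus "(\<lambda>(y, z). G (e (g m y)) z) \<in> borel_measurable (borel \<Otimes>\<^sub>M D)"
      by (simp add: case_prod_beta')
  qed
qed

definition axis_vec :: "nat \<Rightarrow> rvec" where
  "axis_vec c = (\<lambda>i. if i = c then 1 else 0)"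

lemma axis_vec_space: "c < p \<Longrightarrow> axis_vec c \<in> space_R p"
  by (simp add: axis_vec_def space_R_iff)

lemma einner_axis_vec: "c < p \<Longrightarrow> einner p x (axis_vec c) = x c"
  by (simp add: einner_def axis_vec_def if_distrib[of "\<lambda>z. _ * z"] cong: if_cong)

lemma enorm_axis_vec: "c < p \<Longrightarrow> enorm p (axis_vec c) = 1"
proof -
  assume "c < p"
  hence "(enorm p (axis_vec c))\<^sup>2 = 1"
    unfolding einner_self[symmetric] by (simp add: einner_axis_vec) (simp add: axis_vec_def)
  thus ?thesis using enorm_nonneg[of p "axis_vec c"] by (simp add: power2_eq_1_iff)
qed

text \<open>An idealised cost, smooth for every sample and blind to the coordinates beyond
  \<open>p\<close>. The given costs are smooth only almost surely and are adapted to this form at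
  the end.\<close>

locale random_cost = prob_space D for D :: "'c measure" +
  fixes p :: nat and Lf :: real and F :: "rvec \<Rightarrow> 'c \<Rightarrow> real"
  assumes p1: "p \<ge> 1" and Lf0: "Lf \<ge> 0"
    and smooth: "smooth_on_R p Lf (\<lambda>y. F y z)"
    and tr: "F (trunc p y) z = F y z"
    and integrable_F: "integrable D (F y)"
begin

sublocale st: smooth_trunc p Lf "\<lambda>y. F y z" for z
  by unfold_locales (use p1 Lf0 smooth tr in auto)

abbreviation G :: "rvec \<Rightarrow> 'c \<Rightarrow> rvec" where
  "G y z \<equiv> grad p (\<lambda>w. F w z) y"

definition mean_cost :: "rvec \<Rightarrow> real" where
  "mean_cost y = (\<integral>z. F y z \<partial>D)"

definition mean_grad :: "rvec \<Rightarrow> rvec" where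
  "mean_grad y = (\<lambda>c. \<integral>z. G y z c \<partial>D)"

lemma measurable_F_pair: "(\<lambda>(y, z). F y z) \<in> borel_measurable (borel \<Otimes>\<^sub>M D)"
  by (rule Caratheodory_measurable) (use integrable_F in \<open>auto intro: smooth_continuous[OF smooth tr]\<close>)

lemma measurable_F [measurable (raw)]:
  assumes "f \<in> measurable M borel" "g \<in> measurable M D"
  shows "(\<lambda>x. F (f x) (g x)) \<in> borel_measurable M"
  using measurable_compose[OF measurable_Pair[OF assms] measurable_F_pair] by simp

lemma G_space: "y \<in> space_R p \<Longrightarrow> G y z \<in> space_R p"
  by (rule smooth_grad_space[OF smooth])

text \<open>Difference quotients along the axes are measurable in the sample, so their limit, the
  gradient coordinate, is measurable too.\<close>

lemma G_limit:
  assumes y: "y \<in> space_R p" and c: "c < p"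
  shows "(\<lambda>m. (F (\<lambda>i. y i + 1 / real (Suc m) * axis_vec c i) z - F y z) / (1 / real (Suc m))) \<longlonglongrightarrow> G y z c"
proof -
  have "((\<lambda>s. F (\<lambda>i. y i + s * axis_vec c i) z) has_real_derivative einner p (G (\<lambda>i. y i + 0 * axis_vec c i) z) (axis_vec c)) (at 0)"
    by (rule smooth_line_derivative[OF smooth y axis_vec_space[OF c]])
  hence "((\<lambda>s. F (\<lambda>i. y i + s * axis_vec c i) z) has_real_derivative G y z c) (at 0)"
    by (simp add: einner_axis_vec c)
  hence "((\<lambda>h. (F (\<lambda>i. y i + h * axis_vec c i) z - F y z) / h) \<longlongrightarrow> G y z c) (at 0)"
    by (simp add: DERIV_def)
  moreover have "filterlim (\<lambda>m. 1 / real (Suc m)) (at 0) sequentially"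
    using LIMSEQ_Suc[OF lim_1_over_n] by (auto simp: filterlim_at intro!: always_eventually)
  ultimately show ?thesis by (rule filterlim_compose)
qed

lemma measurable_G [measurable]: "y \<in> space_R p \<Longrightarrow> (\<lambda>z. G y z c) \<in> borel_measurable D"
proof (cases "c < p")
  case True
  assume y: "y \<in> space_R p"
  show ?thesis
    by (rule borel_measurable_LIMSEQ_real[OF G_limit[OF y True]]) measurable
next
  case False
  assume y: "y \<in> space_R p"
  have "G y z c = 0" for z using G_space[OF y, of z] False by (simp add: space_R_iff)
  thus ?thesis by simp
qed

text \<open>By smoothness a gradient coordinate differs from the increment of the cost over a unit
  step by at most \<open>Lf / 2\<close>; hence integrability of the costs is enough.\<close>

lemma integrable_G:
  assumes y: "y \<in> space_R p"
  shows "integrable D (\<lambda>z. G y z c)"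
proof (cases "c < p")
  case True
  let ?d = "\<lambda>z. F (\<lambda>i. y i + axis_vec c i) z - F y z"
  show ?thesis
  proof (rule Bochner_Integration.integrable_bound)
    show "integrable D (\<lambda>z. \<bar>?d z\<bar> + Lf / 2)" using integrable_F by auto
    show "(\<lambda>z. G y z c) \<in> borel_measurable D" by (rule measurable_G[OF y])
    show "AE z in D. norm (G y z c) \<le> norm (\<bar>?d z\<bar> + Lf / 2)"
    proof (rule AE_I2)
      fix z
      have "\<bar>?d z - G y z c\<bar> \<le> Lf / 2"
        using smooth_descent[OF smooth y axis_vec_space[OF True], of z] True
        by (simp add: einner_axis_vec enorm_axis_vec)
      hence "\<bar>G y z c\<bar> \<le> \<bar>?d z\<bar> + Lf / 2" by linarith
      thus "norm (G y z c) \<le> norm (\<bar>?d z\<bar> + Lf / 2)" by simp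
    qed
  qed
next
  case False
  have "G y z c = 0" for z using G_space[OF y, of z] False by (simp add: space_R_iff)
  thus ?thesis by simp
qed

lemma mean_grad_space: "y \<in> space_R p \<Longrightarrow> mean_grad y \<in> space_R p"
  using G_space by (simp add: space_R_iff mean_grad_def)

lemma einner_mean_grad:
  assumes y: "y \<in> space_R p"
  shows "einner p (mean_grad y) w = (\<integral>z. einner p (G y z) w \<partial>D)"
  unfolding einner_def mean_grad_def using integrable_G[OF y] by simp

lemma integrable_einner_G:
  assumes y: "y \<in> space_R p"
  shows "integrable D (\<lambda>z. einner p (G y z) w)"
  unfolding einner_def using integrable_G[OF y] by simp

text \<open>Differentiation under the integral: the quadratic error bound is uniform in the sample,
  so it can simply be integrated.\<close>

lemma has_gradient_mean_cost:
  assumes y: "y \<in> space_R p"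
  shows "has_gradient p mean_cost (mean_grad y) y"
proof (rule has_gradient_quadraticI[OF mean_grad_space[OF y]])
  show "0 \<le> Lf / 2" using Lf0 by simp
  fix x assume x: "x \<in> space_R p"
  let ?h = "vdiff x y"
  have h: "?h \<in> space_R p" using x y by (simp add: vdiff_def space_R_iff)
  have xh: "(\<lambda>i. y i + ?h i) = x" by (simp add: vdiff_def)
  have "mean_cost x - mean_cost y - einner p (mean_grad y) ?h = (\<integral>z. F x z - F y z - einner p (G y z) ?h \<partial>D)"
    unfolding mean_cost_def einner_mean_grad[OF y] using integrable_F integrable_einner_G[OF y] by simp
  also have "\<bar>\<dots>\<bar> \<le> (\<integral>z. \<bar>F x z - F y z - einner p (G y z) ?h\<bar> \<partial>D)"
    by (rule integral_abs_bound)
  also have "\<dots> \<le> (\<integral>z. Lf / 2 * (enorm p ?h)\<^sup>2 \<partial>D)"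
    using integrable_F integrable_einner_G[OF y] smooth_descent[OF smooth y h, unfolded xh]
    by (intro integral_mono) auto
  finally show "\<bar>mean_cost x - mean_cost y - einner p (mean_grad y) ?h\<bar> \<le> Lf / 2 * (enorm p ?h)\<^sup>2"
    using prob_space by simp
qed

lemma grad_mean_cost: "y \<in> space_R p \<Longrightarrow> grad p mean_cost y = mean_grad y"
  by (rule grad_eqI[OF has_gradient_mean_cost])

text \<open>Testing against the difference \<open>?w\<close> itself turns the claim into an
  inequality between scalar integrals.\<close>

lemma mean_grad_Lipschitz:
  assumes x: "x \<in> space_R p" and y: "y \<in> space_R p"
  shows "enorm p (vdiff (mean_grad x) (mean_grad y)) \<le> Lf * enorm p (vdiff x y)"
proof -
  let ?w = "vdiff (mean_grad x) (mean_grad y)"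
  have "(enorm p ?w)\<^sup>2 = einner p (mean_grad x) ?w - einner p (mean_grad y) ?w"
    unfolding einner_self[symmetric] by (subst (1) vdiff_def) (rule einner_diff_left)
  also have "\<dots> = (\<integral>z. einner p (G x z) ?w - einner p (G y z) ?w \<partial>D)"
    unfolding einner_mean_grad[OF x] einner_mean_grad[OF y]
    using integrable_einner_G[OF x] integrable_einner_G[OF y] by simp
  also have "\<dots> \<le> (\<integral>z. Lf * enorm p (vdiff x y) * enorm p ?w \<partial>D)"
  proof (rule integral_mono)
    fix z
    have "einner p (G x z) ?w - einner p (G y z) ?w = einner p (vdiff (G x z) (G y z)) ?w"
      by (simp add: vdiff_def einner_diff_left)
    also have "\<dots> \<le> enorm p (vdiff (G x z) (G y z)) * enorm p ?w"
      using einner_Cauchy_Schwarz[of p "vdiff (G x z) (G y z)" ?w] by linarith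
    also have "\<dots> \<le> Lf * enorm p (vdiff x y) * enorm p ?w"
      by (intro mult_right_mono smooth_grad_Lipschitz[OF smooth x y]) simp
    finally show "einner p (G x z) ?w - einner p (G y z) ?w \<le> Lf * enorm p (vdiff x y) * enorm p ?w" .
  qed (use integrable_einner_G[OF x] integrable_einner_G[OF y] in auto)
  also have "\<dots> = Lf * enorm p (vdiff x y) * enorm p ?w" using prob_space by simp
  finally have "enorm p ?w * enorm p ?w \<le> (Lf * enorm p (vdiff x y)) * enorm p ?w"
    by (simp add: power2_eq_square)
  moreover have "0 \<le> Lf * enorm p (vdiff x y)" using Lf0 by simp
  ultimately show ?thesis using enorm_nonneg[of p ?w] by (cases "enorm p ?w = 0") auto
qed

lemma smooth_mean_cost: "smooth_on_R p Lf mean_cost"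
  unfolding smooth_on_R_def using has_gradient_mean_cost mean_grad_Lipschitz grad_mean_cost by auto

subsection \<open>Bias and second moment of the zeroth-order estimator\<close>

abbreviation draw_law :: "(rvec \<times> 'c) measure" where
  "draw_law \<equiv> uniform_sphere p \<Otimes>\<^sub>M D"

lemma prob_space_draw_law: "prob_space draw_law"
proof -
  interpret U: prob_space "uniform_sphere p" by (rule prob_space_uniform_sphere[OF p1])
  interpret pair_prob_space "uniform_sphere p" D ..
  show ?thesis by unfold_locales
qed

lemma measurable_zo_gradient [measurable (raw)]:
  assumes "f \<in> measurable M borel" "g \<in> measurable M borel" "h \<in> measurable M D"
  shows "(\<lambda>w. zo_gradient p F d (f w) (g w) (h w) c) \<in> borel_measurable M"
proof -
  have [measurable]: "(\<lambda>w. (\<lambda>b. f w b + d * g w b)) \<in> measurable M borel"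
  proof (rule measurable_coordinatewise_then_product)
    fix i
    have "(\<lambda>w. f w i) \<in> borel_measurable M" "(\<lambda>w. g w i) \<in> borel_measurable M"
      using measurable_compose[OF assms(1) borel_measurable_coordinate]
        measurable_compose[OF assms(2) borel_measurable_coordinate] by auto
    thus "(\<lambda>w. f w i + d * g w i) \<in> borel_measurable M" by measurable
  qed
  have [measurable]: "(\<lambda>w. g w c) \<in> borel_measurable M"
    using measurable_compose[OF assms(2) borel_measurable_coordinate] by auto
  show ?thesis unfolding zo_gradient_def using assms by measurable
qed

text \<open>For a fixed sample the sphere estimate involves the squared gradient of that sample,
  which is split into deviation and mean; integration over samples then brings in \<open>V\<close>.
  Nonnegative integrals are used because integrability is only a consequence.\<close>

lemma estimator_second_moment:
  assumes x: "x \<in> space_R p" and d: "d > 0"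
    and var: "(\<integral>\<^sup>+ z. ennreal ((enorm p (vdiff (G x z) (mean_grad x)))\<^sup>2) \<partial>D) \<le> ennreal V" and V: "V \<ge> 0"
  shows "(\<integral>\<^sup>+ uz. ennreal ((enorm p (zo_gradient p F d x (fst uz) (snd uz)))\<^sup>2) \<partial>draw_law)
     \<le> ennreal (4 * real p * (enorm p (mean_grad x))\<^sup>2 + 4 * real p * V + (real p)\<^sup>2 * Lf\<^sup>2 * d\<^sup>2 / 2)"
proof -
  interpret U: prob_space "uniform_sphere p" by (rule prob_space_uniform_sphere[OF p1])
  interpret P: pair_sigma_finite "uniform_sphere p" D ..
  let ?q = "\<lambda>u z. ennreal ((enorm p (zo_gradient p F d x u z))\<^sup>2)"
  let ?k = "(real p)\<^sup>2 * Lf\<^sup>2 * d\<^sup>2 / 2"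
  have en: "(enorm p v)\<^sup>2 = (\<Sum>c<p. v c * v c)" for v by (simp add: einner_self[symmetric] einner_def)
  have meas: "(\<lambda>uz. ?q (fst uz) (snd uz)) \<in> borel_measurable draw_law"
    unfolding en by measurable
  have "(\<integral>\<^sup>+ uz. ?q (fst uz) (snd uz) \<partial>draw_law) = (\<integral>\<^sup>+ z. (\<integral>\<^sup>+ u. ?q u z \<partial>uniform_sphere p) \<partial>D)"
    using P.nn_integral_snd[of "\<lambda>uz. ?q (fst uz) (snd uz)"] meas by (simp add: case_prod_beta')
  also have "\<dots> \<le> (\<integral>\<^sup>+ z. (ennreal (4 * real p * (enorm p (mean_grad x))\<^sup>2 + ?k)
      + ennreal (4 * real p) * ennreal ((enorm p (vdiff (G x z) (mean_grad x)))\<^sup>2)) \<partial>D)"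
  proof (rule nn_integral_mono)
    fix z
    have "(enorm p (G x z))\<^sup>2 = (enorm p (\<lambda>i. vdiff (G x z) (mean_grad x) i + mean_grad x i))\<^sup>2"
      by (simp add: vdiff_def)
    also have "\<dots> \<le> (enorm p (vdiff (G x z) (mean_grad x)) + enorm p (mean_grad x))\<^sup>2"
      by (intro power_mono enorm_triangle) simp
    also have "\<dots> \<le> 2 * (enorm p (vdiff (G x z) (mean_grad x)))\<^sup>2 + 2 * (enorm p (mean_grad x))\<^sup>2"
      by (rule sum_squares_bound[THEN order_trans[rotated]] | simp add: power2_sum)+
    finally have g: "(enorm p (G x z))\<^sup>2 \<le> 2 * (enorm p (vdiff (G x z) (mean_grad x)))\<^sup>2 + 2 * (enorm p (mean_grad x))\<^sup>2" .
    have "(\<integral>\<^sup>+ u. ?q u z \<partial>uniform_sphere p) \<le> ennreal (2 * real p * (enorm p (G x z))\<^sup>2 + ?k)"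
      using st.sphere_estimator_second_moment[OF x d, of z] by (simp add: zo_gradient_def[abs_def])
    also have "\<dots> \<le> ennreal (2 * real p * (2 * (enorm p (vdiff (G x z) (mean_grad x)))\<^sup>2 + 2 * (enorm p (mean_grad x))\<^sup>2) + ?k)"
      using g by (intro ennreal_leI add_right_mono mult_left_mono) auto
    also have "\<dots> = ennreal ((4 * real p * (enorm p (mean_grad x))\<^sup>2 + ?k) + 4 * real p * (enorm p (vdiff (G x z) (mean_grad x)))\<^sup>2)"
      by (simp add: algebra_simps)
    also have "\<dots> = ennreal (4 * real p * (enorm p (mean_grad x))\<^sup>2 + ?k) + ennreal (4 * real p * (enorm p (vdiff (G x z) (mean_grad x)))\<^sup>2)"
      by (rule ennreal_plus) auto
    finally show "(\<integral>\<^sup>+ u. ?q u z \<partial>uniform_sphere p) \<le> ennreal (4 * real p * (enorm p (mean_grad x))\<^sup>2 + ?k)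
      + ennreal (4 * real p) * ennreal ((enorm p (vdiff (G x z) (mean_grad x)))\<^sup>2)"
      by (simp add: ennreal_mult')
  qed
  also have "\<dots> = ennreal (4 * real p * (enorm p (mean_grad x))\<^sup>2 + ?k)
      + ennreal (4 * real p) * (\<integral>\<^sup>+ z. ennreal ((enorm p (vdiff (G x z) (mean_grad x)))\<^sup>2) \<partial>D)"
  proof -
    have m: "(\<lambda>z. ennreal ((enorm p (vdiff (G x z) (mean_grad x)))\<^sup>2)) \<in> borel_measurable D"
      unfolding en vdiff_def using measurable_G[OF x] by measurable
    note [measurable] = m
    have m': "(\<lambda>z. ennreal (4 * real p) * ennreal ((enorm p (vdiff (G x z) (mean_grad x)))\<^sup>2)) \<in> borel_measurable D"
      by measurable
    show ?thesis unfolding nn_integral_add[OF borel_measurable_const m'] nn_integral_cmult[OF m]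
      by (simp add: emeasure_space_1)
  qed
  also have "\<dots> \<le> ennreal (4 * real p * (enorm p (mean_grad x))\<^sup>2 + ?k) + ennreal (4 * real p) * ennreal V"
    using var by (intro add_left_mono mult_left_mono) auto
  also have "\<dots> = ennreal (4 * real p * (enorm p (mean_grad x))\<^sup>2 + 4 * real p * V + ?k)"
    using V by (simp add: ennreal_mult[symmetric] ennreal_plus[symmetric] algebra_simps del: ennreal_plus)
  finally show ?thesis .
qed

definition mean_estimator :: "real \<Rightarrow> rvec \<Rightarrow> rvec" where
  "mean_estimator d x = (\<lambda>c. \<integral>uz. zo_gradient p F d x (fst uz) (snd uz) c \<partial>draw_law)"

text \<open>Averaging over the sphere first bounds the bias for each sample separately, hence for
  the mean. Testing against the error vector itself recovers its norm.\<close>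

lemma estimator_bias:
  assumes x: "x \<in> space_R p" and d: "d > 0"
    and int: "\<And>c. integrable draw_law (\<lambda>uz. zo_gradient p F d x (fst uz) (snd uz) c)"
  shows "enorm p (vdiff (mean_estimator d x) (mean_grad x)) \<le> Lf * d"
proof -
  interpret U: prob_space "uniform_sphere p" by (rule prob_space_uniform_sphere[OF p1])
  interpret P: pair_sigma_finite "uniform_sphere p" D ..
  \<comment> \<open>The bias bound on the sphere requires a test vector in \<open>space_R p\<close>;
    \<open>enorm p\<close> does not notice the truncation.\<close>
  let ?w = "\<lambda>c. if c < p then mean_estimator d x c - mean_grad x c else 0"
  have w: "?w \<in> space_R p" by (simp add: space_R_iff)
  let ?e = "\<lambda>u z. einner p (zo_gradient p F d x u z) ?w"
  have inte: "integrable draw_law (\<lambda>(u, z). ?e u z)"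
    unfolding einner_def case_prod_beta' using int by simp
  have ie: "integrable D (\<lambda>z. \<integral>u. ?e u z \<partial>uniform_sphere p)"
    using P.integrable_snd[OF inte] .
  have "einner p (mean_estimator d x) ?w = (\<integral>uz. ?e (fst uz) (snd uz) \<partial>draw_law)"
    unfolding einner_def mean_estimator_def using int by simp
  also have "\<dots> = (\<integral>z. (\<integral>u. ?e u z \<partial>uniform_sphere p) \<partial>D)"
    using P.integral_snd[OF inte] by (simp add: case_prod_beta')
  finally have "einner p (mean_estimator d x) ?w - einner p (mean_grad x) ?w =
      (\<integral>z. (\<integral>u. ?e u z \<partial>uniform_sphere p) - einner p (G x z) ?w \<partial>D)"
    unfolding einner_mean_grad[OF x] using ie integrable_einner_G[OF x] by simp
  also have "\<dots> \<le> (\<integral>z. Lf * d * enorm p ?w \<partial>D)"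
  proof (rule integral_mono)
    fix z
    have "(\<integral>u. ?e u z \<partial>uniform_sphere p) = (\<integral>u. real p * (F (\<lambda>b. x b + d * u b) z - F x z) / d * einner p ?w u \<partial>uniform_sphere p)"
      unfolding zo_gradient_def einner_mult_left einner_commute[of p ?w] ..
    thus "(\<integral>u. ?e u z \<partial>uniform_sphere p) - einner p (G x z) ?w \<le> Lf * d * enorm p ?w"
      using st.sphere_estimator_bias[OF x d w, of z] by linarith
  qed (use ie integrable_einner_G[OF x] in auto)
  also have "\<dots> = Lf * d * enorm p ?w" using prob_space by simp
  also have "einner p (mean_estimator d x) ?w - einner p (mean_grad x) ?w = einner p ?w ?w"
    unfolding einner_diff_left[symmetric] by (rule einner_cong) auto
  finally have "enorm p ?w * enorm p ?w \<le> (Lf * d) * enorm p ?w"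
    by (simp add: einner_self power2_eq_square)
  moreover have "0 \<le> Lf * d" using Lf0 d by simp
  ultimately have "enorm p ?w \<le> Lf * d" using enorm_nonneg[of p ?w] by (cases "enorm p ?w = 0") auto
  moreover have "enorm p (vdiff (mean_estimator d x) (mean_grad x)) = enorm p ?w"
    by (rule enorm_cong) (simp add: vdiff_def)
  ultimately show ?thesis by simp
qed

end

subsection \<open>Independence of the draws\<close>

locale zo_draws =
  fixes n p :: nat and D :: "nat \<Rightarrow> 'c measure" and M :: "'w measure"
    and u :: "nat \<Rightarrow> nat \<Rightarrow> 'w \<Rightarrow> rvec" and \<xi> :: "nat \<Rightarrow> nat \<Rightarrow> 'w \<Rightarrow> 'c"
  assumes p1: "p \<ge> 1" and sampling: "zo_sampling n p D M u \<xi>"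
begin

sublocale prob_space M
  using sampling by (simp add: zo_sampling_def)

definition draw_events :: "nat \<times> nat + nat \<times> nat \<Rightarrow> 'w set set" where
  "draw_events s = (case s of
          Inl (i, k) \<Rightarrow> {u i k -` A \<inter> space M | A. A \<in> sets borel}
        | Inr (i, k) \<Rightarrow> {\<xi> i k -` B \<inter> space M | B. B \<in> sets (D i)})"

text \<open>The information in the draws with indices in \<open>K\<close>. Conditioning will be on
  all earlier steps, or on these together with the current draw of one further agent.\<close>

definition draw_algebra :: "(nat \<times> nat) set \<Rightarrow> 'w measure" where
  "draw_algebra K = sigma (space M) (\<Union>s\<in>K <+> K. draw_events s)"

lemma indep_draws: "indep_sets draw_events (({..<n} \<times> UNIV) <+> ({..<n} \<times> UNIV))"
  using sampling unfolding zo_sampling_def draw_events_def[abs_def] by simp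

lemma prob_D: "i < n \<Longrightarrow> prob_space (D i)"
  using sampling by (simp add: zo_sampling_def)

lemma measurable_u: "i < n \<Longrightarrow> u i k \<in> measurable M borel"
  using sampling by (simp add: zo_sampling_def)

lemma measurable_xi: "i < n \<Longrightarrow> \<xi> i k \<in> measurable M (D i)"
  using sampling by (simp add: zo_sampling_def)

lemma distr_u: "i < n \<Longrightarrow> distr M borel (u i k) = uniform_sphere p"
  using sampling by (simp add: zo_sampling_def)

lemma distr_xi: "i < n \<Longrightarrow> distr M (D i) (\<xi> i k) = D i"
  using sampling by (simp add: zo_sampling_def)

lemma draw_events_Pow: "draw_events s \<subseteq> Pow (space M)"
  by (auto simp: draw_events_def split: sum.splits)

lemma space_draw_algebra [simp]: "space (draw_algebra K) = space M"
  by (simp add: draw_algebra_def space_measure_of_conv)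

lemma sets_draw_algebra: "sets (draw_algebra K) = sigma_sets (space M) (\<Union>s\<in>K <+> K. draw_events s)"
  unfolding draw_algebra_def using draw_events_Pow by (intro sets_measure_of) auto

lemma Int_stable_draw_events: "Int_stable (draw_events s)"
proof (rule Int_stableI)
  fix a b assume ab: "a \<in> draw_events s" "b \<in> draw_events s"
  show "a \<inter> b \<in> draw_events s"
  proof (cases s)
    case (Inl ik)
    then obtain i k where s: "s = Inl (i, k)" by (cases ik) auto
    obtain A B where "a = u i k -` A \<inter> space M" "b = u i k -` B \<inter> space M" "A \<in> sets borel" "B \<in> sets borel"
      using ab by (auto simp: s draw_events_def)
    thus ?thesis by (auto simp: s draw_events_def intro!: exI[of _ "A \<inter> B"])
  next
    case (Inr ik)
    then obtain i k where s: "s = Inr (i, k)" by (cases ik) auto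
    obtain A B where "a = \<xi> i k -` A \<inter> space M" "b = \<xi> i k -` B \<inter> space M" "A \<in> sets (D i)" "B \<in> sets (D i)"
      using ab by (auto simp: s draw_events_def)
    thus ?thesis by (auto simp: s draw_events_def intro!: exI[of _ "A \<inter> B"])
  qed
qed

lemma draw_algebra_mono: "K \<subseteq> K' \<Longrightarrow> sets (draw_algebra K) \<subseteq> sets (draw_algebra K')"
  unfolding sets_draw_algebra by (intro sigma_sets_mono') auto

lemma measurable_draw_algebra_mono:
  assumes "K \<subseteq> K'" "f \<in> measurable (draw_algebra K) S" shows "f \<in> measurable (draw_algebra K') S"
  using assms draw_algebra_mono[OF assms(1)] unfolding measurable_def by auto

lemma draw_events_draw_algebra:
  "s \<in> K <+> K \<Longrightarrow> A \<in> draw_events s \<Longrightarrow> A \<in> sets (draw_algebra K)"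
  unfolding sets_draw_algebra by (rule sigma_sets.Basic) blast

lemma u_draw_algebra:
  assumes "(i, k) \<in> K" shows "u i k \<in> measurable (draw_algebra K) borel"
proof (rule measurableI)
  fix A :: "rvec set" assume "A \<in> sets borel"
  hence "u i k -` A \<inter> space M \<in> draw_events (Inl (i, k))" unfolding draw_events_def by auto
  thus "u i k -` A \<inter> space (draw_algebra K) \<in> sets (draw_algebra K)"
    using draw_events_draw_algebra[OF InlI[OF assms]] by simp
qed simp

lemma xi_draw_algebra:
  assumes "i < n" "(i, k) \<in> K" shows "\<xi> i k \<in> measurable (draw_algebra K) (D i)"
proof (rule measurableI)
  show "\<xi> i k w \<in> space (D i)" if "w \<in> space (draw_algebra K)" for w
    using measurable_space[OF measurable_xi[OF assms(1)]] that by simp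
  fix A assume "A \<in> sets (D i)"
  hence "\<xi> i k -` A \<inter> space M \<in> draw_events (Inr (i, k))" unfolding draw_events_def by auto
  thus "\<xi> i k -` A \<inter> space (draw_algebra K) \<in> sets (draw_algebra K)"
    using draw_events_draw_algebra[OF InrI[OF assms(2)]] by simp
qed

lemma draw_algebra_sets_M:
  assumes "K \<subseteq> {..<n} \<times> UNIV" shows "sets (draw_algebra K) \<subseteq> sets M"
proof -
  have "draw_events s \<subseteq> sets M" if "s \<in> K <+> K" for s
  proof -
    have "i < n" if "(i, k) \<in> K" for i k using that assms by auto
    thus ?thesis using that measurable_sets[OF measurable_u] measurable_sets[OF measurable_xi]
      by (auto simp: draw_events_def)
  qed
  hence "(\<Union>s\<in>K <+> K. draw_events s) \<subseteq> sets M" by blast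
  thus ?thesis unfolding sets_draw_algebra by (rule sets.sigma_sets_subset)
qed

lemma measurable_draw_algebraD:
  assumes "K \<subseteq> {..<n} \<times> UNIV" "f \<in> measurable (draw_algebra K) S" shows "f \<in> measurable M S"
  using assms(2) draw_algebra_sets_M[OF assms(1)] unfolding measurable_def by auto

text \<open>Independence of the single draws extends to the algebras of disjoint blocks of draws,
  because the generating families are closed under intersection. Two blocks are indexed by
  \<open>bool\<close>.\<close>

lemma prob_Int_draw_algebra:
  assumes K: "K \<subseteq> {..<n} \<times> UNIV" "K' \<subseteq> {..<n} \<times> UNIV" "K \<inter> K' = {}"
    and A: "A \<in> sets (draw_algebra K)" and B: "B \<in> sets (draw_algebra K')"
  shows "prob (A \<inter> B) = prob A * prob B"
proof -
  define I where "I b = (if b then K <+> K else K' <+> K')" for b :: bool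
  have "indep_sets draw_events (\<Union>b\<in>UNIV. I b)"
    by (rule indep_sets_mono_index[OF _ indep_draws]) (use K in \<open>auto simp: I_def split: if_splits\<close>)
  moreover have "disjoint_family_on I UNIV"
    using K(3) by (auto simp: disjoint_family_on_def I_def)
  ultimately have ind: "indep_sets (\<lambda>b. sigma_sets (space M) (\<Union>i\<in>I b. draw_events i)) UNIV"
    by (intro indep_sets_collect_sigma Int_stable_draw_events)
  define X where "X b = (if b then A else B)" for b :: bool
  have "prob (\<Inter>b\<in>UNIV. X b) = (\<Prod>b\<in>UNIV. prob (X b))"
    by (rule indep_setsD[OF ind]) (use A B in \<open>auto simp: X_def I_def sets_draw_algebra\<close>)
  thus ?thesis by (simp add: X_def UNIV_bool Int_commute mult.commute)
qed

lemma distr_pair_draw_algebra: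
  assumes K: "K \<subseteq> {..<n} \<times> UNIV" "K' \<subseteq> {..<n} \<times> UNIV" "K \<inter> K' = {}"
    and Y: "Y \<in> measurable (draw_algebra K) S" and Z: "Z \<in> measurable (draw_algebra K') T"
  shows "distr M S Y \<Otimes>\<^sub>M distr M T Z = distr M (S \<Otimes>\<^sub>M T) (\<lambda>w. (Y w, Z w))"
proof -
  have [measurable]: "Y \<in> measurable M S" "Z \<in> measurable M T"
    using measurable_draw_algebraD K Y Z by blast+
  interpret Y: prob_space "distr M S Y" by (rule prob_space_distr) simp
  interpret Z: prob_space "distr M T Z" by (rule prob_space_distr) simp
  show ?thesis
  proof (rule pair_measure_eqI)
    fix A B assume AB: "A \<in> sets (distr M S Y)" "B \<in> sets (distr M T Z)"
    hence [measurable]: "A \<in> sets S" "B \<in> sets T" by auto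
    have "prob ((Y -` A \<inter> space M) \<inter> (Z -` B \<inter> space M)) = prob (Y -` A \<inter> space M) * prob (Z -` B \<inter> space M)"
      using measurable_sets[OF Y, of A] measurable_sets[OF Z, of B] AB
      by (intro prob_Int_draw_algebra[OF K]) auto
    moreover have "(\<lambda>w. (Y w, Z w)) -` (A \<times> B) \<inter> space M = (Y -` A \<inter> space M) \<inter> (Z -` B \<inter> space M)" by auto
    ultimately show "emeasure (distr M S Y) A * emeasure (distr M T Z) B = emeasure (distr M (S \<Otimes>\<^sub>M T) (\<lambda>w. (Y w, Z w))) (A \<times> B)"
      by (simp add: emeasure_distr emeasure_eq_measure ennreal_mult)
  qed (auto intro: Y.sigma_finite_measure_axioms Z.sigma_finite_measure_axioms)
qed

text \<open>Direction and sample with the same index belong to one block, so their independence of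
  each other is taken directly from the family of draws.\<close>

lemma distr_draw:
  assumes i: "i < n"
  shows "distr M (borel \<Otimes>\<^sub>M D i) (\<lambda>w. (u i k w, \<xi> i k w)) = uniform_sphere p \<Otimes>\<^sub>M D i"
proof -
  interpret U: prob_space "uniform_sphere p" by (rule prob_space_uniform_sphere[OF p1])
  interpret D: prob_space "D i" by (rule prob_D[OF i])
  have [measurable]: "u i k \<in> measurable M borel" "\<xi> i k \<in> measurable M (D i)"
    using measurable_u measurable_xi i by auto
  show ?thesis
  proof (rule pair_measure_eqI[symmetric])
    fix A B assume AB[measurable]: "A \<in> sets (uniform_sphere p)" "B \<in> sets (D i)"
    let ?a = "u i k -` A \<inter> space M" and ?b = "\<xi> i k -` B \<inter> space M"
    have "prob (\<Inter>s\<in>{Inl (i, k), Inr (i, k)}. case s of Inl _ \<Rightarrow> ?a | Inr _ \<Rightarrow> ?b) =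
       (\<Prod>s\<in>{Inl (i, k), Inr (i, k)}. prob (case s of Inl _ \<Rightarrow> ?a | Inr _ \<Rightarrow> ?b))"
      by (rule indep_setsD[OF indep_draws]) (use i AB in \<open>auto simp: draw_events_def\<close>)
    hence "prob (?a \<inter> ?b) = prob ?a * prob ?b" by simp
    moreover have "emeasure (uniform_sphere p) A = emeasure M ?a"
      using AB unfolding distr_u[OF i, of k, symmetric] by (subst emeasure_distr) auto
    moreover have "emeasure (D i) B = emeasure M ?b"
      using AB by (subst distr_xi[OF i, of k, symmetric], subst emeasure_distr) auto
    moreover have "(\<lambda>w. (u i k w, \<xi> i k w)) -` (A \<times> B) \<inter> space M = ?a \<inter> ?b" by auto
    ultimately show "emeasure (uniform_sphere p) A * emeasure (D i) B =
        emeasure (distr M (borel \<Otimes>\<^sub>M D i) (\<lambda>w. (u i k w, \<xi> i k w))) (A \<times> B)"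
      using AB by (simp add: emeasure_distr emeasure_eq_measure ennreal_mult)
  next
    show "sets (uniform_sphere p \<Otimes>\<^sub>M D i) = sets (distr M (borel \<Otimes>\<^sub>M D i) (\<lambda>w. (u i k w, \<xi> i k w)))"
      by (simp cong: sets_pair_measure_cong)
  qed (auto intro: U.sigma_finite_measure_axioms D.sigma_finite_measure_axioms)
qed

text \<open>Past and current draw have a product law, so conditioning on the past becomes Fubini's
  theorem: the past is frozen and the draw integrated out. This is applied below to nonnegative and
  to integrable functions.\<close>

lemma distr_past_draw:
  assumes i: "i < n" and K: "K \<subseteq> {..<n} \<times> UNIV" "(i, k) \<notin> K"
    and Y: "Y \<in> measurable (draw_algebra K) S"
  shows "distr M (S \<Otimes>\<^sub>M (borel \<Otimes>\<^sub>M D i)) (\<lambda>w. (Y w, (u i k w, \<xi> i k w)))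
     = distr M S Y \<Otimes>\<^sub>M (uniform_sphere p \<Otimes>\<^sub>M D i)"
proof -
  have "(\<lambda>w. (u i k w, \<xi> i k w)) \<in> measurable (draw_algebra {(i, k)}) (borel \<Otimes>\<^sub>M D i)"
    by (intro measurable_Pair u_draw_algebra xi_draw_algebra i) auto
  from distr_pair_draw_algebra[OF K(1) _ _ Y this] K i show ?thesis
    unfolding distr_draw[OF i] by auto
qed

lemma nn_integral_past_draw:
  assumes i: "i < n" and K: "K \<subseteq> {..<n} \<times> UNIV" "(i, k) \<notin> K"
    and Y: "Y \<in> measurable (draw_algebra K) S"
    and h: "h \<in> borel_measurable (S \<Otimes>\<^sub>M (borel \<Otimes>\<^sub>M D i))"
  shows "(\<integral>\<^sup>+ w. h (Y w, (u i k w, \<xi> i k w)) \<partial>M) = (\<integral>\<^sup>+ w. (\<integral>\<^sup>+ uz. h (Y w, uz) \<partial>(uniform_sphere p \<Otimes>\<^sub>M D i)) \<partial>M)"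
proof -
  interpret U: prob_space "uniform_sphere p" by (rule prob_space_uniform_sphere[OF p1])
  interpret D: prob_space "D i" by (rule prob_D[OF i])
  interpret UD: pair_prob_space "uniform_sphere p" "D i" ..
  have [measurable]: "u i k \<in> measurable M borel" "\<xi> i k \<in> measurable M (D i)" "Y \<in> measurable M S"
    using measurable_u measurable_xi i measurable_draw_algebraD[OF K(1) Y] by auto
  have "(\<integral>\<^sup>+ w. h (Y w, (u i k w, \<xi> i k w)) \<partial>M) = (\<integral>\<^sup>+ x. h x \<partial>distr M (S \<Otimes>\<^sub>M (borel \<Otimes>\<^sub>M D i)) (\<lambda>w. (Y w, (u i k w, \<xi> i k w))))"
    by (rule nn_integral_distr[symmetric]) (use h in measurable)
  also have "\<dots> = (\<integral>\<^sup>+ x. h x \<partial>(distr M S Y \<Otimes>\<^sub>M (uniform_sphere p \<Otimes>\<^sub>M D i)))"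
    unfolding distr_past_draw[OF i K Y] ..
  also have "\<dots> = (\<integral>\<^sup>+ y. (\<integral>\<^sup>+ uz. h (y, uz) \<partial>(uniform_sphere p \<Otimes>\<^sub>M D i)) \<partial>distr M S Y)"
    using h by (intro UD.nn_integral_fst[symmetric]) (simp cong: measurable_cong_sets sets_pair_measure_cong)
  also have "\<dots> = (\<integral>\<^sup>+ w. (\<integral>\<^sup>+ uz. h (Y w, uz) \<partial>(uniform_sphere p \<Otimes>\<^sub>M D i)) \<partial>M)"
  proof -
    have "h \<in> borel_measurable (S \<Otimes>\<^sub>M (uniform_sphere p \<Otimes>\<^sub>M D i))"
      using h by (simp cong: measurable_cong_sets sets_pair_measure_cong)
    hence "(\<lambda>y. \<integral>\<^sup>+ uz. h (y, uz) \<partial>(uniform_sphere p \<Otimes>\<^sub>M D i)) \<in> borel_measurable S"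
      by (rule UD.borel_measurable_nn_integral_fst)
    thus ?thesis by (subst nn_integral_distr) auto
  qed
  finally show ?thesis .
qed

lemma integral_past_draw:
  fixes h :: "'s \<times> rvec \<times> 'c \<Rightarrow> real"
  assumes i: "i < n" and K: "K \<subseteq> {..<n} \<times> UNIV" "(i, k) \<notin> K"
    and Y: "Y \<in> measurable (draw_algebra K) S"
    and h: "h \<in> borel_measurable (S \<Otimes>\<^sub>M (borel \<Otimes>\<^sub>M D i))"
    and int: "integrable M (\<lambda>w. h (Y w, (u i k w, \<xi> i k w)))"
  shows "(\<integral> w. h (Y w, (u i k w, \<xi> i k w)) \<partial>M) = (\<integral> w. (\<integral> uz. h (Y w, uz) \<partial>(uniform_sphere p \<Otimes>\<^sub>M D i)) \<partial>M)"
proof -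
  interpret U: prob_space "uniform_sphere p" by (rule prob_space_uniform_sphere[OF p1])
  interpret D: prob_space "D i" by (rule prob_D[OF i])
  interpret UD: pair_prob_space "uniform_sphere p" "D i" ..
  have [measurable]: "u i k \<in> measurable M borel" "\<xi> i k \<in> measurable M (D i)" "Y \<in> measurable M S"
    using measurable_u measurable_xi i measurable_draw_algebraD[OF K(1) Y] by auto
  interpret Y: prob_space "distr M S Y" by (rule prob_space_distr) simp
  interpret P: pair_sigma_finite "distr M S Y" "uniform_sphere p \<Otimes>\<^sub>M D i" ..
  have mp: "(\<lambda>w. (Y w, (u i k w, \<xi> i k w))) \<in> measurable M (S \<Otimes>\<^sub>M (borel \<Otimes>\<^sub>M D i))" by measurable
  have int': "integrable (distr M S Y \<Otimes>\<^sub>M (uniform_sphere p \<Otimes>\<^sub>M D i)) h"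
    unfolding distr_past_draw[OF i K Y, symmetric]
    by (subst integrable_distr_eq[OF mp h]) (rule int)
  have "(\<integral> w. h (Y w, (u i k w, \<xi> i k w)) \<partial>M) = (\<integral> x. h x \<partial>distr M (S \<Otimes>\<^sub>M (borel \<Otimes>\<^sub>M D i)) (\<lambda>w. (Y w, (u i k w, \<xi> i k w))))"
    by (rule integral_distr[symmetric, OF mp h])
  also have "\<dots> = (\<integral> y. (\<integral> uz. h (y, uz) \<partial>(uniform_sphere p \<Otimes>\<^sub>M D i)) \<partial>distr M S Y)"
    unfolding distr_past_draw[OF i K Y] using P.integral_fst'[OF int'] by simp
  also have "\<dots> = (\<integral> w. (\<integral> uz. h (Y w, uz) \<partial>(uniform_sphere p \<Otimes>\<^sub>M D i)) \<partial>M)"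
  proof -
    have "h \<in> borel_measurable (S \<Otimes>\<^sub>M (uniform_sphere p \<Otimes>\<^sub>M D i))"
      using h by (simp cong: measurable_cong_sets sets_pair_measure_cong)
    hence "(\<lambda>y. \<integral> uz. h (y, uz) \<partial>(uniform_sphere p \<Otimes>\<^sub>M D i)) \<in> borel_measurable S"
      by (intro UD.borel_measurable_lebesgue_integral) simp
    thus ?thesis by (subst integral_distr) auto
  qed
  finally show ?thesis .
qed

end

subsection \<open>Square-integrable random vectors\<close>

lemma enorm_sq_add_le: "(enorm p (\<lambda>c. x c + y c))\<^sup>2 \<le> 2 * (enorm p x)\<^sup>2 + 2 * (enorm p y)\<^sup>2"
proof -
  have "0 \<le> einner p (\<lambda>c. x c - y c) (\<lambda>c. x c - y c)" by simp
  thus ?thesis unfolding einner_self[symmetric] einner_linear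
    by (simp add: einner_commute[of p y x])
qed

lemma enorm_sq_sum: "(enorm p x)\<^sup>2 = (\<Sum>c<p. x c * x c)"
  by (simp add: einner_self[symmetric] einner_def)

lemma abs_einner_le_sq: "\<bar>einner p x y\<bar> \<le> ((enorm p x)\<^sup>2 + (enorm p y)\<^sup>2) / 2"
proof -
  have "enorm p x * enorm p y \<le> ((enorm p x)\<^sup>2 + (enorm p y)\<^sup>2) / 2"
    using sum_squares_bound[of "enorm p x" "enorm p y"] by simp
  thus ?thesis using einner_Cauchy_Schwarz[of p x y] by linarith
qed

lemma continuous_grad_coordinate:
  assumes f: "smooth_on_R p Lf f"
  shows "continuous_on A (\<lambda>y. grad p f (trunc p y) c)"
proof (cases "c < p")
  case False
  have "grad p f (trunc p y) c = 0" for y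
    using smooth_grad_space[OF f trunc_space[of p y]] False by (simp add: space_R_iff)
  thus ?thesis by simp
next
  case True
  show ?thesis
  proof (rule continuous_at_imp_continuous_on, rule ballI)
    fix x
    let ?d = "\<lambda>y. enorm p (\<lambda>i. y i - x i)"
    have "continuous_on UNIV ?d"
      unfolding enorm_def L2_set_def by (intro continuous_intros continuous_on_coordinate)
    hence "(?d \<longlongrightarrow> ?d x) (at x)"
      unfolding continuous_on_eq_continuous_at[OF open_UNIV] isCont_def by blast
    hence "((\<lambda>y. Lf * ?d y) \<longlongrightarrow> Lf * ?d x) (at x)" by (intro tendsto_intros)
    hence lim: "((\<lambda>y. Lf * ?d y) \<longlongrightarrow> 0) (at x)" by (simp add: enorm_def L2_set_def)
    have "((\<lambda>y. grad p f (trunc p y) c - grad p f (trunc p x) c) \<longlongrightarrow> 0) (at x)"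
    proof (rule Lim_null_comparison[OF _ lim], rule always_eventually, rule allI)
      fix y
      have "\<bar>vdiff (grad p f (trunc p y)) (grad p f (trunc p x)) c\<bar> \<le> Lf * enorm p (vdiff (trunc p y) (trunc p x))"
        using abs_coordinate_le_enorm[OF True] smooth_grad_Lipschitz[OF f trunc_space trunc_space]
        by (rule order_trans)
      moreover have "enorm p (vdiff (trunc p y) (trunc p x)) = ?d y"
        by (rule enorm_cong) (simp add: vdiff_def trunc_def)
      ultimately show "norm (grad p f (trunc p y) c - grad p f (trunc p x) c) \<le> Lf * ?d y"
        by (simp add: vdiff_def)
    qed
    thus "isCont (\<lambda>y. grad p f (trunc p y) c) x" by (simp add: isCont_def LIM_zero_iff)
  qed
qed

text \<open>A class closed under all operations of the algorithm, and one in which every inner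
  product is integrable.\<close>

definition sqint :: "nat \<Rightarrow> 'w measure \<Rightarrow> ('w \<Rightarrow> rvec) \<Rightarrow> bool" where
  "sqint p M Y \<longleftrightarrow> Y \<in> measurable M borel \<and> integrable M (\<lambda>w. (enorm p (Y w))\<^sup>2)"

lemma measurable_rvecI:
  "(\<And>c. (\<lambda>w. Y w c) \<in> borel_measurable M) \<Longrightarrow> (Y :: 'w \<Rightarrow> rvec) \<in> measurable M borel"
  by (rule measurable_coordinatewise_then_product)

lemma measurable_rvecD:
  "(Y :: 'w \<Rightarrow> rvec) \<in> measurable M borel \<Longrightarrow> (\<lambda>w. Y w c) \<in> borel_measurable M"
  using measurable_compose[OF _ borel_measurable_coordinate] by auto

lemma measurable_enorm_comp [measurable (raw)]:
  "(Y :: 'w \<Rightarrow> rvec) \<in> measurable M borel \<Longrightarrow> (\<lambda>w. enorm p (Y w)) \<in> borel_measurable M"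
  using measurable_compose[OF _ borel_measurable_enorm] by auto

lemma measurable_einner_comp:
  "(X :: 'w \<Rightarrow> rvec) \<in> measurable M borel \<Longrightarrow> (Y :: 'w \<Rightarrow> rvec) \<in> measurable M borel \<Longrightarrow>
    (\<lambda>w. einner p (X w) (Y w)) \<in> borel_measurable M"
  by (intro borel_measurable_einner measurable_rvecD)

lemma measurable_trunc: "(Y :: 'w \<Rightarrow> rvec) \<in> measurable M borel \<Longrightarrow> (\<lambda>w. trunc p (Y w)) \<in> measurable M borel"
  unfolding trunc_def by (rule measurable_rvecI) (auto intro: measurable_rvecD)

lemma sqint_measurable: "sqint p M Y \<Longrightarrow> Y \<in> measurable M borel"
  by (simp add: sqint_def)

lemma sqint_integrable: "sqint p M Y \<Longrightarrow> integrable M (\<lambda>w. (enorm p (Y w))\<^sup>2)"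
  by (simp add: sqint_def)

lemma sqint_bound:
  assumes "Y \<in> measurable M borel" "integrable M b" "\<And>w. (enorm p (Y w))\<^sup>2 \<le> b w"
  shows "sqint p M Y"
  unfolding sqint_def
proof (intro conjI assms(1) Bochner_Integration.integrable_bound[OF assms(2)])
  show "(\<lambda>w. (enorm p (Y w))\<^sup>2) \<in> borel_measurable M" using assms(1) by measurable
  show "AE w in M. norm ((enorm p (Y w))\<^sup>2) \<le> norm (b w)"
  proof (rule AE_I2)
    fix w show "norm ((enorm p (Y w))\<^sup>2) \<le> norm (b w)"
      using assms(3)[of w] by simp
  qed
qed

lemma sqint_add:
  assumes "sqint p M X" "sqint p M Y" shows "sqint p M (\<lambda>w c. X w c + Y w c)"
proof (rule sqint_bound)
  show "(\<lambda>w c. X w c + Y w c) \<in> measurable M borel"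
    by (rule measurable_rvecI, rule borel_measurable_add; rule measurable_rvecD, rule sqint_measurable, rule assms)
  show "integrable M (\<lambda>w. 2 * (enorm p (X w))\<^sup>2 + 2 * (enorm p (Y w))\<^sup>2)"
    using assms by (simp add: sqint_def)
qed (rule enorm_sq_add_le)

lemma sqint_scale:
  assumes "sqint p M X" shows "sqint p M (\<lambda>w c. a * X w c)"
proof (rule sqint_bound)
  show "(\<lambda>w c. a * X w c) \<in> measurable M borel"
    by (rule measurable_rvecI, rule borel_measurable_times, rule borel_measurable_const,
        rule measurable_rvecD, rule sqint_measurable, rule assms)
  show "integrable M (\<lambda>w. a\<^sup>2 * (enorm p (X w))\<^sup>2)"
    using assms by (simp add: sqint_def)
qed (simp add: enorm_scale power_mult_distrib)

lemma sqint_diff: "sqint p M X \<Longrightarrow> sqint p M Y \<Longrightarrow> sqint p M (\<lambda>w c. X w c - Y w c)"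
  using sqint_add[of p M X "\<lambda>w c. (-1) * Y w c"] sqint_scale[of p M Y "-1"] by simp

lemma (in prob_space) sqint_const: "sqint p M (\<lambda>w. y)"
  by (simp add: sqint_def)

lemma (in prob_space) sqint_sum:
  assumes "\<And>i. i \<in> I \<Longrightarrow> sqint p M (X i)"
  shows "sqint p M (\<lambda>w c. \<Sum>i\<in>I. X i w c)"
  using assms
proof (induction I rule: infinite_finite_induct)
  case (insert i I)
  thus ?case using sqint_add[of p M "X i" "\<lambda>w c. \<Sum>i\<in>I. X i w c"] by simp
qed (simp_all add: sqint_const)

lemma integrable_einner_sqint:
  assumes "sqint p M X" "sqint p M Y" shows "integrable M (\<lambda>w. einner p (X w) (Y w))"
proof (rule Bochner_Integration.integrable_bound)
  show "integrable M (\<lambda>w. ((enorm p (X w))\<^sup>2 + (enorm p (Y w))\<^sup>2) / 2)"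
    using assms by (auto simp: sqint_def)
  show "(\<lambda>w. einner p (X w) (Y w)) \<in> borel_measurable M"
    using assms by (auto simp: sqint_def intro: measurable_einner_comp)
qed (use abs_einner_le_sq[of p] in \<open>auto intro!: AE_I2\<close>)

text \<open>Comparison with the gradient at the origin: a Lipschitz gradient grows at most
  linearly.\<close>

lemma (in prob_space) sqint_grad:
  assumes f: "smooth_on_R p Lf f" and X: "sqint p M X" and XR: "\<And>w. X w \<in> space_R p" 
  shows "sqint p M (\<lambda>w. grad p f (X w))"
proof (rule sqint_bound)
  let ?z = "\<lambda>c. 0 :: real"
  let ?b = "\<lambda>w. 2 * Lf\<^sup>2 * (enorm p (X w))\<^sup>2 + 2 * (enorm p (grad p f ?z))\<^sup>2"
  show "integrable M ?b" using X by (auto simp: sqint_def)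
  have "(\<lambda>w. grad p f (trunc p (X w)) c) \<in> borel_measurable M" for c
    using measurable_compose[OF sqint_measurable[OF X] borel_measurable_continuous_onI[OF continuous_grad_coordinate[OF f]]]
    by simp
  thus "(\<lambda>w. grad p f (X w)) \<in> measurable M borel"
    by (intro measurable_rvecI) (simp add: trunc_id[OF XR])
  fix w
  have "(enorm p (grad p f (X w)))\<^sup>2 = (enorm p (\<lambda>c. vdiff (grad p f (X w)) (grad p f ?z) c + grad p f ?z c))\<^sup>2"
    by (simp add: vdiff_def)
  also have "\<dots> \<le> 2 * (enorm p (vdiff (grad p f (X w)) (grad p f ?z)))\<^sup>2 + 2 * (enorm p (grad p f ?z))\<^sup>2"
    by (rule enorm_sq_add_le)
  also have "(enorm p (vdiff (grad p f (X w)) (grad p f ?z)))\<^sup>2 \<le> (Lf * enorm p (X w))\<^sup>2"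
    using smooth_grad_Lipschitz[OF f XR[of w] space_R_zero] by (intro power_mono) (simp_all add: vdiff_def)
  finally show "(enorm p (grad p f (X w)))\<^sup>2 \<le> ?b w" by (simp add: power_mult_distrib)
qed

lemma (in prob_space) integrable_smooth_sqint:
  assumes f: "smooth_on_R p Lf f" and X: "sqint p M X" and XR: "\<And>w. X w \<in> space_R p" 
  shows "integrable M (\<lambda>w. f (X w))"
proof (rule Bochner_Integration.integrable_bound)
  let ?z = "\<lambda>c. 0 :: real"
  let ?b = "\<lambda>w. \<bar>f ?z\<bar> + ((enorm p (grad p f ?z))\<^sup>2 + (enorm p (X w))\<^sup>2) / 2 + \<bar>Lf\<bar> / 2 * (enorm p (X w))\<^sup>2"
  show "integrable M ?b" using X by (auto simp: sqint_def)
  have "continuous_on UNIV (\<lambda>y. f (trunc p y))"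
  proof (rule smooth_continuous)
    show "smooth_on_R p Lf (\<lambda>y. f (trunc p y))"
      using f by (subst smooth_on_R_cong[where f' = f]) (auto simp: trunc_id)
  qed (simp add: trunc_id trunc_space)
  from measurable_compose[OF sqint_measurable[OF X] borel_measurable_continuous_onI[OF this]]
  show "(\<lambda>w. f (X w)) \<in> borel_measurable M" by (simp add: trunc_id[OF XR])
  show "AE w in M. norm (f (X w)) \<le> norm (?b w)"
  proof (rule AE_I2)
    fix w
    have "\<bar>f (X w) - f ?z - einner p (grad p f ?z) (X w)\<bar> \<le> Lf / 2 * (enorm p (X w))\<^sup>2"
      using smooth_descent[OF f space_R_zero XR[of w]] by simp
    moreover have "Lf / 2 * (enorm p (X w))\<^sup>2 \<le> \<bar>Lf\<bar> / 2 * (enorm p (X w))\<^sup>2" by (intro mult_right_mono) auto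
    ultimately have "\<bar>f (X w)\<bar> \<le> ?b w" using abs_einner_le_sq[of p "grad p f ?z" "X w"] by linarith
    thus "norm (f (X w)) \<le> norm (?b w)" by simp
  qed
qed

subsection \<open>The iterates as random vectors\<close>

lemma random_cost_zo_gradient_trunc:
  assumes "random_cost D p Lf F"
  shows "zo_gradient p F d (trunc p x) u z = zo_gradient p F d x u z"
proof -
  interpret random_cost D p Lf F by fact
  have "trunc p (\<lambda>b. trunc p x b + d * u b) = trunc p (\<lambda>b. x b + d * u b)"
    by (auto simp: trunc_def)
  hence "F (\<lambda>b. trunc p x b + d * u b) z = F (\<lambda>b. x b + d * u b) z" using tr by metis
  thus ?thesis by (simp add: zo_gradient_def tr)
qed

locale zo_process = zo_draws n p D M u \<xi> + connected_laplacian n E a L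
  for n p :: nat and D :: "nat \<Rightarrow> 'c measure" and M :: "'w measure" and u \<xi> E a L +
  fixes Lf s0 s1 st0 s2 :: real and F :: "nat \<Rightarrow> rvec \<Rightarrow> 'c \<Rightarrow> real"
    and \<alpha> \<beta> \<eta> :: "nat \<Rightarrow> real" and \<delta> :: "nat \<Rightarrow> nat \<Rightarrow> real" and x0 :: "nat \<Rightarrow> rvec"
  assumes cost: "i < n \<Longrightarrow> random_cost (D i) p Lf (F i)" and Lf_pos: "Lf > 0"
    and variance: "i < n \<Longrightarrow> y \<in> space_R p \<Longrightarrow>
       (\<integral>\<^sup>+ z. ennreal ((enorm p (vdiff (grad p (\<lambda>w. F i w z) y) (random_cost.mean_grad (D i) p (F i) y)))\<^sup>2) \<partial>D i)
           \<le> ennreal (s0\<^sup>2 * (enorm p (random_cost.mean_grad (D i) p (F i) y))\<^sup>2 + s1\<^sup>2)"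
    and x0: "i < n \<Longrightarrow> x0 i \<in> space_R p"
    and \<delta>_pos: "i < n \<Longrightarrow> 0 < \<delta> i k"
    and \<eta>_nonneg: "0 \<le> \<eta> k"
begin

lemma n_pos: "n > 0" using n2 by simp

abbreviation fi :: "nat \<Rightarrow> rvec \<Rightarrow> real" where "fi i \<equiv> random_cost.mean_cost (D i) (F i)"
abbreviation gi :: "nat \<Rightarrow> rvec \<Rightarrow> rvec" where "gi i \<equiv> random_cost.mean_grad (D i) p (F i)"
abbreviation mi :: "nat \<Rightarrow> nat \<Rightarrow> rvec \<Rightarrow> rvec" where
  "mi k i \<equiv> random_cost.mean_estimator (D i) p (F i) (\<delta> i k)"

definition iter :: "nat \<Rightarrow> 'w \<Rightarrow> (nat \<Rightarrow> rvec) \<times> (nat \<Rightarrow> rvec)" where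
  "iter k w = zo_iterates n p L F \<alpha> \<beta> \<eta> \<delta> x0 (\<lambda>i k. u i k w) (\<lambda>i k. \<xi> i k w) k"

text \<open>The recursion leaves \<open>space_R p\<close> on the null event that some direction
  does; truncation makes membership hold everywhere.\<close>

definition x :: "nat \<Rightarrow> nat \<Rightarrow> 'w \<Rightarrow> rvec" where "x k i w = trunc p (fst (iter k w) i)"
definition v :: "nat \<Rightarrow> nat \<Rightarrow> 'w \<Rightarrow> rvec" where "v k i w = trunc p (snd (iter k w) i)"
definition g :: "nat \<Rightarrow> nat \<Rightarrow> 'w \<Rightarrow> rvec" where
  "g k i w = zo_gradient p (F i) (\<delta> i k) (x k i w) (u i k w) (\<xi> i k w)"
definition m :: "nat \<Rightarrow> nat \<Rightarrow> 'w \<Rightarrow> rvec" where "m k i w = mi k i (x k i w)"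
definition past :: "nat \<Rightarrow> (nat \<times> nat) set" where "past k = {..<n} \<times> {..<k}"

lemma past_sub: "past k \<subseteq> {..<n} \<times> UNIV" by (auto simp: past_def)
lemma past_mono: "past k \<subseteq> past (Suc k)" by (auto simp: past_def)
lemma not_past: "(i, k) \<notin> past k" by (auto simp: past_def)

lemma x_space: "x k i w \<in> space_R p" by (simp add: x_def trunc_space)

lemma x_0: "i < n \<Longrightarrow> x 0 i w = x0 i"
  by (simp add: x_def iter_def trunc_id x0)

lemma v_0: "v 0 i w = (\<lambda>c. 0)"
  by (auto simp: v_def iter_def trunc_def)

lemma x_Suc:
  assumes "i < n"
  shows "x (Suc k) i w = (\<lambda>c. if c < p then x k i w c - \<eta> k * (\<alpha> k * \<Lambda> (\<lambda>j. x k j w c) i + \<beta> k * v k i w c + g k i w c) else 0)"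
proof
  fix c
  show "x (Suc k) i w c = (if c < p then x k i w c - \<eta> k * (\<alpha> k * \<Lambda> (\<lambda>j. x k j w c) i + \<beta> k * v k i w c + g k i w c) else 0)"
    using assms random_cost_zo_gradient_trunc[OF cost[OF assms], of "\<delta> i k" "fst (iter k w) i"]
    by (simp add: x_def v_def g_def iter_def trunc_def lap_def case_prod_beta Let_def)
qed

lemma v_Suc:
  assumes "i < n"
  shows "v (Suc k) i w = (\<lambda>c. if c < p then v k i w c + \<eta> k * \<beta> k * \<Lambda> (\<lambda>j. x k j w c) i else 0)"
  using assms by (auto simp: x_def v_def iter_def trunc_def lap_def case_prod_beta Let_def fun_eq_iff)

lemma g_draw_algebra:
  assumes i: "i < n" and X: "x k i \<in> measurable (draw_algebra K) borel" and K: "(i, k) \<in> K"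
  shows "g k i \<in> measurable (draw_algebra K) borel"
proof -
  interpret C: random_cost "D i" p Lf "F i" by (rule cost[OF i])
  show ?thesis unfolding g_def
    by (intro measurable_rvecI C.measurable_zo_gradient X u_draw_algebra[OF K] xi_draw_algebra[OF i K])
qed

text \<open>Adaptedness: the iterates of step \<open>k\<close> are built from draws of earlier steps
  only, which makes them independent of the draws of step \<open>k\<close>.\<close>

lemma xv_measurable:
  assumes "i < n"
  shows "x k i \<in> measurable (draw_algebra (past k)) borel \<and> v k i \<in> measurable (draw_algebra (past k)) borel"
  using assms
proof (induction k arbitrary: i)
  case 0
  have "x 0 i = (\<lambda>w. x0 i)" "v 0 i = (\<lambda>w c. 0)" using 0 by (auto simp: x_0 v_0)
  thus ?case by simp
next
  case (Suc k)
  let ?A = "draw_algebra (past (Suc k))"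
  have X: "x k j \<in> measurable ?A borel" and V: "v k j \<in> measurable ?A borel" if "j < n" for j
    using Suc.IH[OF that] by (blast intro: measurable_draw_algebra_mono[OF past_mono])+
  have G: "g k i \<in> measurable ?A borel"
    by (rule g_draw_algebra[OF Suc.prems X[OF Suc.prems]]) (use Suc.prems in \<open>simp add: past_def\<close>)
  have Xc: "(\<lambda>w. x k j w c) \<in> borel_measurable ?A" and Vc: "(\<lambda>w. v k j w c) \<in> borel_measurable ?A" if "j < n" for j c
    by (rule measurable_rvecD[OF X[OF that]], rule measurable_rvecD[OF V[OF that]])
  have Gc: "(\<lambda>w. g k i w c) \<in> borel_measurable ?A" for c
    using measurable_rvecD[OF G] .
  have lm: "(\<lambda>w. \<Lambda> (\<lambda>j. x k j w c) i) \<in> borel_measurable ?A" for c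
    unfolding lap_def if_P[OF Suc.prems]
    by (rule borel_measurable_sum, rule borel_measurable_times, rule borel_measurable_const, rule Xc) simp
  have "(\<lambda>w. x k i w c - \<eta> k * (\<alpha> k * \<Lambda> (\<lambda>j. x k j w c) i + \<beta> k * v k i w c + g k i w c)) \<in> borel_measurable ?A" for c
    by (intro borel_measurable_diff borel_measurable_times borel_measurable_add borel_measurable_const Xc Vc Gc lm Suc.prems)
  note mx = this
  have "(\<lambda>w. x (Suc k) i w c) \<in> borel_measurable ?A" for c
  proof (cases "c < p")
    case True show ?thesis unfolding x_Suc[OF Suc.prems] if_P[OF True] by (rule mx)
  next
    case False show ?thesis unfolding x_Suc[OF Suc.prems] if_not_P[OF False] by (rule borel_measurable_const)
  qed
  have "(\<lambda>w. v k i w c + \<eta> k * \<beta> k * \<Lambda> (\<lambda>j. x k j w c) i) \<in> borel_measurable ?A" for c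
    by (intro borel_measurable_times borel_measurable_add borel_measurable_const Vc lm Suc.prems)
  note mv = this
  have "(\<lambda>w. v (Suc k) i w c) \<in> borel_measurable ?A" for c
  proof (cases "c < p")
    case True show ?thesis unfolding v_Suc[OF Suc.prems] if_P[OF True] by (rule mv)
  next
    case False show ?thesis unfolding v_Suc[OF Suc.prems] if_not_P[OF False] by (rule borel_measurable_const)
  qed
  show ?case by (intro conjI measurable_rvecI) fact+
qed

lemmas x_measurable = xv_measurable[THEN conjunct1]

lemma fi_smooth: "i < n \<Longrightarrow> smooth_on_R p Lf (fi i)"
  using random_cost.smooth_mean_cost[OF cost] .

lemma grad_fi: "i < n \<Longrightarrow> y \<in> space_R p \<Longrightarrow> grad p (fi i) y = gi i y"
  using random_cost.grad_mean_cost[OF cost] .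

lemma gi_space: "i < n \<Longrightarrow> y \<in> space_R p \<Longrightarrow> gi i y \<in> space_R p"
  using random_cost.mean_grad_space[OF cost] .

definition estimator_bound :: "nat \<Rightarrow> nat \<Rightarrow> rvec \<Rightarrow> real" where
  "estimator_bound k i y = 4 * real p * (enorm p (gi i y))\<^sup>2 +
      4 * real p * (s0\<^sup>2 * (enorm p (gi i y))\<^sup>2 + s1\<^sup>2) + (real p)\<^sup>2 * Lf\<^sup>2 * (\<delta> i k)\<^sup>2 / 2"

lemma estimator_bound_nonneg: "0 \<le> estimator_bound k i y"
  by (simp add: estimator_bound_def)

lemma estimator_nn_integral:
  assumes i: "i < n" and y: "y \<in> space_R p"
  shows "(\<integral>\<^sup>+ uz. ennreal ((enorm p (zo_gradient p (F i) (\<delta> i k) y (fst uz) (snd uz)))\<^sup>2) \<partial>(uniform_sphere p \<Otimes>\<^sub>M D i))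
     \<le> ennreal (estimator_bound k i y)"
  unfolding estimator_bound_def
  by (rule random_cost.estimator_second_moment[OF cost[OF i] y \<delta>_pos[OF i] variance[OF i y]]) simp

lemma estimator_integrable:
  assumes i: "i < n" and y: "y \<in> space_R p"
  shows "sqint p (uniform_sphere p \<Otimes>\<^sub>M D i) (\<lambda>uz. zo_gradient p (F i) (\<delta> i k) y (fst uz) (snd uz))"
    (is "sqint p ?P ?e")
    and "c < p \<Longrightarrow> integrable (uniform_sphere p \<Otimes>\<^sub>M D i) (\<lambda>uz. zo_gradient p (F i) (\<delta> i k) y (fst uz) (snd uz) c)"
proof -
  interpret C: random_cost "D i" p Lf "F i" by (rule cost[OF i])
  interpret P: prob_space ?P by (rule C.prob_space_draw_law)
  have me: "?e \<in> measurable ?P borel"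
    by (intro measurable_rvecI C.measurable_zo_gradient) auto
  have "integrable ?P (\<lambda>uz. (enorm p (?e uz))\<^sup>2)"
  proof (rule integrableI_bounded)
    show "(\<lambda>uz. (enorm p (?e uz))\<^sup>2) \<in> borel_measurable ?P"
      using measurable_enorm_comp[OF me] by measurable
    have "(\<integral>\<^sup>+ uz. ennreal (norm ((enorm p (?e uz))\<^sup>2)) \<partial>?P) \<le> ennreal (estimator_bound k i y)"
      using estimator_nn_integral[OF i y, of k] by simp
    thus "(\<integral>\<^sup>+ uz. ennreal (norm ((enorm p (?e uz))\<^sup>2)) \<partial>?P) < \<infinity>"
      by (rule order.strict_trans1) simp
  qed
  thus sq: "sqint p ?P ?e" using me by (simp add: sqint_def)
  assume c: "c < p"
  have "integrable ?P (\<lambda>uz. einner p (?e uz) (axis_vec c))"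
    by (rule integrable_einner_sqint[OF sq P.sqint_const])
  thus "integrable ?P (\<lambda>uz. ?e uz c)" by (simp add: einner_axis_vec[OF c])
qed

lemma mi_bound:
  assumes i: "i < n" and y: "y \<in> space_R p"
  shows "enorm p (vdiff (mi k i y) (gi i y)) \<le> Lf * \<delta> i k"
proof -
  interpret C: random_cost "D i" p Lf "F i" by (rule cost[OF i])
  show ?thesis
  proof (rule C.estimator_bias[OF y \<delta>_pos[OF i]])
    fix c
    show "integrable C.draw_law (\<lambda>uz. zo_gradient p (F i) (\<delta> i k) y (fst uz) (snd uz) c)"
    proof (cases "c < p")
      case True thus ?thesis by (rule estimator_integrable(2)[OF i y])
    next
      \<comment> \<open>The mean estimator is defined for every coordinate. Beyond \<open>p\<close>
        the integrand vanishes almost surely, since the directions lie in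
        \<open>space_R p\<close>.\<close>
      case False
      interpret P: prob_space C.draw_law by (rule C.prob_space_draw_law)
      interpret U: prob_space "uniform_sphere p" by (rule prob_space_uniform_sphere[OF p1])
      interpret PP: pair_sigma_finite "uniform_sphere p" "D i" ..
      have "AE uz in C.draw_law. fst uz \<in> space_R p"
      proof (rule PP.AE_pair_measure)
        have "fst -` space_R p \<inter> space C.draw_law \<in> sets C.draw_law"
          by (rule measurable_sets[of _ _ borel]) auto
        thus "{uz \<in> space C.draw_law. fst uz \<in> space_R p} \<in> sets C.draw_law"
          by (simp add: vimage_def Int_def conj_commute)
        show "AE u in uniform_sphere p. AE z in D i. fst (u, z) \<in> space_R p"
          using AE_uniform_sphere[OF p1] by eventually_elim simp
      qed
      hence "AE uz in C.draw_law. zo_gradient p (F i) (\<delta> i k) y (fst uz) (snd uz) c = 0"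
        by eventually_elim (use False in \<open>simp add: zo_gradient_def space_R_iff\<close>)
      moreover have "(\<lambda>uz. zo_gradient p (F i) (\<delta> i k) y (fst uz) (snd uz) c) \<in> borel_measurable C.draw_law"
        by (intro C.measurable_zo_gradient) auto
      ultimately show ?thesis by (subst integrable_cong_AE[where g = "\<lambda>_. 0"]) auto
    qed
  qed
qed

lemma mi_measurable: "i < n \<Longrightarrow> mi k i \<in> measurable borel borel"
proof -
  assume i: "i < n"
  interpret C: random_cost "D i" p Lf "F i" by (rule cost[OF i])
  interpret P: prob_space C.draw_law by (rule C.prob_space_draw_law)
  show ?thesis unfolding C.mean_estimator_def
  proof (rule measurable_rvecI)
    fix c
    show "(\<lambda>y. \<integral>uz. zo_gradient p (F i) (\<delta> i k) y (fst uz) (snd uz) c \<partial>C.draw_law) \<in> borel_measurable borel"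
    proof (rule P.borel_measurable_lebesgue_integral)
      have "(\<lambda>q. zo_gradient p (F i) (\<delta> i k) (fst q) (fst (snd q)) (snd (snd q)) c) \<in> borel_measurable (borel \<Otimes>\<^sub>M C.draw_law)"
        by (intro C.measurable_zo_gradient) auto
      thus "(\<lambda>(y, uz). zo_gradient p (F i) (\<delta> i k) y (fst uz) (snd uz) c) \<in> borel_measurable (borel \<Otimes>\<^sub>M C.draw_law)"
        by (simp add: case_prod_beta')
    qed
  qed
qed

lemma m_measurable: "i < n \<Longrightarrow> m k i \<in> measurable (draw_algebra (past k)) borel"
  unfolding m_def by (rule measurable_compose[OF x_measurable mi_measurable])

lemma sqint_gi_x:
  assumes "i < n" "sqint p M Y" "\<And>w. Y w \<in> space_R p" shows "sqint p M (\<lambda>w. gi i (Y w))"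
  using sqint_grad[OF fi_smooth[OF assms(1)] assms(2,3)] by (simp add: grad_fi assms)

lemma integrable_estimator_bound:
  assumes "i < n" "sqint p M (x k i)"
  shows "integrable M (\<lambda>w. estimator_bound k i (x k i w))"
  using sqint_integrable[OF sqint_gi_x[OF assms x_space]] unfolding estimator_bound_def by simp

lemma g_measurable_M: "i < n \<Longrightarrow> g k i \<in> measurable M borel"
proof -
  assume i: "i < n"
  have "g k i \<in> measurable (draw_algebra (past (Suc k))) borel"
    by (rule g_draw_algebra[OF i measurable_draw_algebra_mono[OF past_mono x_measurable[OF i]]])
      (use i in \<open>simp add: past_def\<close>)
  thus ?thesis by (rule measurable_draw_algebraD[OF past_sub])
qed

lemma g_second_moment:
  assumes i: "i < n" and X: "sqint p M (x k i)"
  shows "sqint p M (g k i)"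
    and "(\<integral>w. (enorm p (g k i w))\<^sup>2 \<partial>M) \<le> (\<integral>w. estimator_bound k i (x k i w) \<partial>M)"
proof -
  interpret C: random_cost "D i" p Lf "F i" by (rule cost[OF i])
  let ?h = "\<lambda>(y, uz). ennreal ((enorm p (zo_gradient p (F i) (\<delta> i k) y (fst uz) (snd uz)))\<^sup>2)"
  have h: "?h \<in> borel_measurable (borel \<Otimes>\<^sub>M (borel \<Otimes>\<^sub>M D i))"
  proof -
    have "(\<lambda>q. zo_gradient p (F i) (\<delta> i k) (fst q) (fst (snd q)) (snd (snd q))) \<in> measurable (borel \<Otimes>\<^sub>M (borel \<Otimes>\<^sub>M D i)) borel"
      by (intro measurable_rvecI C.measurable_zo_gradient) auto
    from measurable_enorm_comp[OF this] show ?thesis by (simp add: case_prod_beta')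
  qed
  have "(\<integral>\<^sup>+ w. ennreal ((enorm p (g k i w))\<^sup>2) \<partial>M) = (\<integral>\<^sup>+ w. ?h (x k i w, (u i k w, \<xi> i k w)) \<partial>M)"
    by (simp add: g_def)
  also have "\<dots> = (\<integral>\<^sup>+ w. (\<integral>\<^sup>+ uz. ?h (x k i w, uz) \<partial>C.draw_law) \<partial>M)"
    by (rule nn_integral_past_draw[OF i past_sub not_past x_measurable[OF i] h])
  also have "\<dots> \<le> (\<integral>\<^sup>+ w. ennreal (estimator_bound k i (x k i w)) \<partial>M)"
    using estimator_nn_integral[OF i x_space, of k] by (intro nn_integral_mono) simp
  also have "\<dots> = ennreal (\<integral>w. estimator_bound k i (x k i w) \<partial>M)"
    by (intro nn_integral_eq_integral integrable_estimator_bound i X) (auto simp: estimator_bound_nonneg)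
  finally have le: "(\<integral>\<^sup>+ w. ennreal ((enorm p (g k i w))\<^sup>2) \<partial>M) \<le> ennreal (\<integral>w. estimator_bound k i (x k i w) \<partial>M)" .
  have int: "integrable M (\<lambda>w. (enorm p (g k i w))\<^sup>2)"
  proof (rule integrableI_bounded)
    show "(\<lambda>w. (enorm p (g k i w))\<^sup>2) \<in> borel_measurable M"
      using measurable_enorm_comp[OF g_measurable_M[OF i]] by measurable
    show "(\<integral>\<^sup>+ w. ennreal (norm ((enorm p (g k i w))\<^sup>2)) \<partial>M) < \<infinity>"
      using order.strict_trans1[OF le ennreal_less_top] by simp
  qed
  thus "sqint p M (g k i)" using g_measurable_M[OF i] by (simp add: sqint_def)
  have "ennreal (\<integral>w. (enorm p (g k i w))\<^sup>2 \<partial>M) \<le> ennreal (\<integral>w. estimator_bound k i (x k i w) \<partial>M)"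
    using le by (subst nn_integral_eq_integral[symmetric, OF int]) auto
  thus "(\<integral>w. (enorm p (g k i w))\<^sup>2 \<partial>M) \<le> (\<integral>w. estimator_bound k i (x k i w) \<partial>M)"
    by (subst (asm) ennreal_le_iff) (auto intro!: integral_nonneg_AE simp: estimator_bound_nonneg)
qed

lemma sqint_restrict: "sqint p M Y \<Longrightarrow> sqint p M (\<lambda>w c. if c < p then Y w c else 0)"
proof -
  assume Y: "sqint p M Y"
  have "enorm p (\<lambda>c. if c < p then Y w c else 0) = enorm p (Y w)" for w by (rule enorm_cong) simp
  thus ?thesis using Y measurable_trunc[of Y M p] by (simp add: sqint_def trunc_def)
qed

text \<open>The second moment of an estimator is controlled by that of the gradient at the iterate,
  which grows at most linearly; square integrability is therefore passed on from step to
  step.\<close>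

lemma xv_sqint: "i < n \<Longrightarrow> sqint p M (x k i) \<and> sqint p M (v k i)"
proof (induction k arbitrary: i)
  case 0
  have "x 0 i = (\<lambda>w. x0 i)" "v 0 i = (\<lambda>w c. 0)" using 0 by (auto simp: x_0 v_0)
  thus ?case by (simp add: sqint_const)
next
  case (Suc k)
  have X: "sqint p M (x k j)" and V: "sqint p M (v k j)" if "j < n" for j using Suc.IH[OF that] by auto
  have G: "sqint p M (g k i)" by (rule g_second_moment(1)[OF Suc.prems X[OF Suc.prems]])
  have lap: "sqint p M (\<lambda>w c. \<Lambda> (\<lambda>j. x k j w c) i)"
    unfolding lap_def if_P[OF Suc.prems] by (rule sqint_sum, rule sqint_scale, rule X) simp
  have "x (Suc k) i = (\<lambda>w c. if c < p then x k i w c - \<eta> k * (\<alpha> k * \<Lambda> (\<lambda>j. x k j w c) i + \<beta> k * v k i w c + g k i w c) else 0)"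
    using x_Suc[OF Suc.prems] by auto
  moreover have "sqint p M \<dots>"
    by (intro sqint_restrict sqint_diff sqint_scale sqint_add lap G X V Suc.prems)
  moreover have "v (Suc k) i = (\<lambda>w c. if c < p then v k i w c + (\<eta> k * \<beta> k) * \<Lambda> (\<lambda>j. x k j w c) i else 0)"
    using v_Suc[OF Suc.prems] by auto
  moreover have "sqint p M \<dots>"
    by (intro sqint_restrict sqint_scale sqint_add lap V Suc.prems)
  ultimately show ?case by metis
qed

lemma x_sqint: "i < n \<Longrightarrow> sqint p M (x k i)" using xv_sqint by blast
lemma g_sqint: "i < n \<Longrightarrow> sqint p M (g k i)" using g_second_moment(1) x_sqint by blast

lemma m_sqint:
  assumes i: "i < n" shows "sqint p M (m k i)"
proof (rule sqint_bound)
  show "m k i \<in> measurable M borel" by (rule measurable_draw_algebraD[OF past_sub m_measurable[OF i]])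
  show "integrable M (\<lambda>w. 2 * (Lf * \<delta> i k)\<^sup>2 + 2 * (enorm p (gi i (x k i w)))\<^sup>2)"
    using sqint_integrable[OF sqint_gi_x[OF i x_sqint[OF i] x_space]] by simp
  fix w
  have "(enorm p (m k i w))\<^sup>2 = (enorm p (\<lambda>c. vdiff (m k i w) (gi i (x k i w)) c + gi i (x k i w) c))\<^sup>2"
    by (simp add: vdiff_def)
  also have "\<dots> \<le> 2 * (enorm p (vdiff (m k i w) (gi i (x k i w))))\<^sup>2 + 2 * (enorm p (gi i (x k i w)))\<^sup>2"
    by (rule enorm_sq_add_le)
  also have "(enorm p (vdiff (m k i w) (gi i (x k i w))))\<^sup>2 \<le> (Lf * \<delta> i k)\<^sup>2"
    unfolding m_def by (intro power_mono mi_bound i x_space) simp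
  finally show "(enorm p (m k i w))\<^sup>2 \<le> 2 * (Lf * \<delta> i k)\<^sup>2 + 2 * (enorm p (gi i (x k i w)))\<^sup>2" by simp
qed

text \<open>In particular the noises \<open>g - m\<close> of different agents are uncorrelated; this is where the
  factor \<open>1 / n\<close> in the leading term of the rate comes from.\<close>

lemma noise_orthogonal:
  assumes i: "i < n" and K: "past k \<subseteq> K" "K \<subseteq> {..<n} \<times> UNIV" "(i, k) \<notin> K"
    and Y: "Y \<in> measurable (draw_algebra K) borel" and sq: "sqint p M Y"
  shows "(\<integral>w. einner p (Y w) (g k i w) \<partial>M) = (\<integral>w. einner p (Y w) (m k i w) \<partial>M)"
proof -
  interpret C: random_cost "D i" p Lf "F i" by (rule cost[OF i])
  let ?h = "\<lambda>(yx, uz). einner p (fst yx) (zo_gradient p (F i) (\<delta> i k) (snd yx) (fst uz) (snd uz))"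
  have h: "?h \<in> borel_measurable ((borel \<Otimes>\<^sub>M borel) \<Otimes>\<^sub>M (borel \<Otimes>\<^sub>M D i))"
  proof -
    have "(\<lambda>q. einner p (fst (fst q)) (zo_gradient p (F i) (\<delta> i k) (snd (fst q)) (fst (snd q)) (snd (snd q))))
        \<in> borel_measurable ((borel \<Otimes>\<^sub>M borel) \<Otimes>\<^sub>M (borel \<Otimes>\<^sub>M D i))"
      by (intro measurable_einner_comp measurable_rvecI C.measurable_zo_gradient) auto
    thus ?thesis by (simp add: case_prod_beta')
  qed
  \<comment> \<open>The iterate is frozen together with \<open>Y\<close>, because the estimator
    depends on both it and the draw that is integrated out.\<close>
  have Z: "(\<lambda>w. (Y w, x k i w)) \<in> measurable (draw_algebra K) (borel \<Otimes>\<^sub>M borel)"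
    by (intro measurable_Pair Y measurable_draw_algebra_mono[OF K(1) x_measurable[OF i]])
  have "(\<integral>w. einner p (Y w) (g k i w) \<partial>M) = (\<integral>w. ?h ((Y w, x k i w), (u i k w, \<xi> i k w)) \<partial>M)"
    by (simp add: g_def)
  also have "\<dots> = (\<integral>w. (\<integral>uz. ?h ((Y w, x k i w), uz) \<partial>C.draw_law) \<partial>M)"
  proof (rule integral_past_draw[OF i K(2,3) Z h])
    show "integrable M (\<lambda>w. ?h ((Y w, x k i w), (u i k w, \<xi> i k w)))"
      using integrable_einner_sqint[OF sq g_sqint[OF i], of k] by (simp add: g_def)
  qed
  also have "\<dots> = (\<integral>w. einner p (Y w) (m k i w) \<partial>M)"
  proof (rule Bochner_Integration.integral_cong[OF refl])
    fix w
    have "(\<integral>uz. ?h ((Y w, x k i w), uz) \<partial>C.draw_law) = (\<Sum>c<p. \<integral>uz. Y w c * zo_gradient p (F i) (\<delta> i k) (x k i w) (fst uz) (snd uz) c \<partial>C.draw_law)"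
      unfolding einner_def case_prod_conv fst_conv snd_conv
      by (rule Bochner_Integration.integral_sum) (auto intro!: estimator_integrable(2)[OF i x_space])
    also have "\<dots> = einner p (Y w) (m k i w)"
      by (simp add: einner_def m_def C.mean_estimator_def)
    finally show "(\<integral>uz. ?h ((Y w, x k i w), uz) \<partial>C.draw_law) = einner p (Y w) (m k i w)" .
  qed
  finally show ?thesis .
qed

end

subsection \<open>One-step inequalities in expectation\<close>

lemma enorm_average_sq_le:
  assumes "n > 0"
  shows "(enorm p (\<lambda>c. 1 / real n * (\<Sum>i<n. a i c)))\<^sup>2 \<le> 1 / real n * (\<Sum>i<n. (enorm p (a i))\<^sup>2)"
proof -
  have "(enorm p (\<lambda>c. 1 / real n * (\<Sum>i<n. a i c)))\<^sup>2 = (\<Sum>c<p. (1 / real n)\<^sup>2 * (\<Sum>i<n. a i c)\<^sup>2)"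
    unfolding enorm_sq_sum by (simp add: power2_eq_square mult_ac)
  also have "\<dots> \<le> (\<Sum>c<p. (1 / real n)\<^sup>2 * (real n * (\<Sum>i<n. (a i c)\<^sup>2)))"
    using sum_squared_le_sum_of_squares[of "\<lambda>i. a i c" "{..<n}" for c]
    by (intro sum_mono mult_left_mono) (auto simp: mult.commute)
  also have "\<dots> = 1 / real n * (\<Sum>c<p. \<Sum>i<n. (a i c)\<^sup>2)"
    using assms by (simp add: power2_eq_square sum_distrib_left)
  also have "(\<Sum>c<p. \<Sum>i<n. (a i c)\<^sup>2) = (\<Sum>i<n. (enorm p (a i))\<^sup>2)"
    unfolding enorm_sq_sum by (subst sum.swap) (simp add: power2_eq_square)
  finally show ?thesis .
qed

lemma einner_sum_left: "einner p (\<lambda>c. \<Sum>i\<in>I. a i c) y = (\<Sum>i\<in>I. einner p (a i) y)"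
  unfolding einner_def by (simp add: sum_distrib_right) (rule sum.swap)

lemma einner_sum_right: "einner p y (\<lambda>c. \<Sum>i\<in>I. a i c) = (\<Sum>i\<in>I. einner p y (a i))"
  by (simp add: einner_commute[of p y] einner_sum_left)

text \<open>The Lyapunov function is bounded path by path and coordinate by coordinate. Its bound is
  the solution of a linear recursion, so summing over coordinates and taking expectations commute
  with it.\<close>

fun decay_rec :: "real \<Rightarrow> real \<Rightarrow> (nat \<Rightarrow> real) \<Rightarrow> nat \<Rightarrow> real" where
  "decay_rec c b e 0 = b"
| "decay_rec c b e (Suc k) = (1 - c) * decay_rec c b e k + e k"

lemma decay_rec_sum: "(\<Sum>i\<in>I. decay_rec c (b i) (e i) k) = decay_rec c (\<Sum>i\<in>I. b i) (\<lambda>k. \<Sum>i\<in>I. e i k) k"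
  by (induction k) (simp_all add: sum.distrib sum_distrib_left[symmetric])

lemma decay_rec_scale: "a * decay_rec c b e k = decay_rec c (a * b) (\<lambda>k. a * e k) k"
proof (induction k)
  case (Suc k)
  have "a * decay_rec c b e (Suc k) = (1 - c) * (a * decay_rec c b e k) + a * e k"
    by (simp add: algebra_simps)
  thus ?case unfolding Suc by simp
qed simp

lemma (in prob_space) decay_rec_integral:
  assumes "integrable M b" "\<And>k. integrable M (\<lambda>w. e w k)"
  shows "integrable M (\<lambda>w. decay_rec c (b w) (e w) k)"
    and "(\<integral>w. decay_rec c (b w) (e w) k \<partial>M) = decay_rec c (\<integral>w. b w \<partial>M) (\<lambda>k. \<integral>w. e w k \<partial>M) k"
proof (induction k)
  case (Suc k)
  { case 1 thus ?case using Suc assms by simp }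
  { case 2 thus ?case using Suc assms by simp }
qed (use assms in simp_all)

lemma integral_double_average:
  fixes h :: "nat \<Rightarrow> nat \<Rightarrow> 'w \<Rightarrow> real"
  assumes int: "\<And>i j. i < n \<Longrightarrow> j < n \<Longrightarrow> integrable M (h i j)"
  shows "(\<integral>w. 1 / real n * (\<Sum>i<n. 1 / real n * (\<Sum>j<n. h i j w)) \<partial>M)
     = 1 / real n * (\<Sum>i<n. 1 / real n * (\<Sum>j<n. \<integral>w. h i j w \<partial>M))"
proof -
  have 1: "integrable M (\<lambda>w. \<Sum>j<n. h i j w)" if "i < n" for i
    by (rule Bochner_Integration.integrable_sum) (simp add: int that)
  have 2: "(\<integral>w. 1 / real n * (\<Sum>j<n. h i j w) \<partial>M) = 1 / real n * (\<Sum>j<n. \<integral>w. h i j w \<partial>M)" if "i < n" for i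
    unfolding integral_mult_right_zero
    by (subst Bochner_Integration.integral_sum) (auto simp: int that)
  have "(\<integral>w. (\<Sum>i<n. 1 / real n * (\<Sum>j<n. h i j w)) \<partial>M) = (\<Sum>i<n. \<integral>w. 1 / real n * (\<Sum>j<n. h i j w) \<partial>M)"
    by (rule Bochner_Integration.integral_sum) (simp add: 1)
  thus ?thesis unfolding integral_mult_right_zero using 2 by simp
qed

context zo_process
begin

definition fbar :: "rvec \<Rightarrow> real" where "fbar y = 1 / real n * (\<Sum>i<n. fi i y)"
definition Gf :: "rvec \<Rightarrow> rvec" where "Gf y = average n (\<lambda>i. gi i y)"

lemma average_space: "(\<And>i. i < n \<Longrightarrow> y i \<in> space_R p) \<Longrightarrow> average n y \<in> space_R p"
  by (simp add: average_def space_R_iff)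

lemma Gf_space: "y \<in> space_R p \<Longrightarrow> Gf y \<in> space_R p"
  unfolding Gf_def by (rule average_space) (rule gi_space)

lemma has_gradient_fbar:
  assumes y: "y \<in> space_R p" shows "has_gradient p fbar (Gf y) y"
proof (rule has_gradient_quadraticI[OF Gf_space[OF y]])
  show "0 \<le> Lf / 2" using Lf_pos by simp
  fix z assume z: "z \<in> space_R p"
  have h: "vdiff z y \<in> space_R p" using z y by (simp add: vdiff_def space_R_iff)
  have yz: "(\<lambda>c. y c + vdiff z y c) = z" by (simp add: vdiff_def)
  have "einner p (Gf y) (vdiff z y) = 1 / real n * (\<Sum>i<n. einner p (gi i y) (vdiff z y))"
    unfolding Gf_def average_def einner_mult_left einner_sum_left ..
  hence eq: "fbar z - fbar y - einner p (Gf y) (vdiff z y) = 1 / real n * (\<Sum>i<n. fi i z - fi i y - einner p (gi i y) (vdiff z y))"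
    by (simp add: fbar_def sum_subtractf right_diff_distrib diff_divide_distrib)
  have "\<bar>1 / real n * (\<Sum>i<n. fi i z - fi i y - einner p (gi i y) (vdiff z y))\<bar>
      \<le> 1 / real n * (\<Sum>i<n. Lf / 2 * (enorm p (vdiff z y))\<^sup>2)"
  proof -
    have t: "\<bar>fi i z - fi i y - einner p (gi i y) (vdiff z y)\<bar> \<le> Lf / 2 * (enorm p (vdiff z y))\<^sup>2" if i: "i < n" for i
      using smooth_descent[OF fi_smooth[OF i] y h, unfolded yz] by (simp add: grad_fi[OF i y])
    have "\<bar>\<Sum>i<n. fi i z - fi i y - einner p (gi i y) (vdiff z y)\<bar> \<le> (\<Sum>i<n. Lf / 2 * (enorm p (vdiff z y))\<^sup>2)"
    proof (rule order_trans[OF sum_abs sum_mono])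
      fix i assume "i \<in> {..<n}"
      thus "\<bar>fi i z - fi i y - einner p (gi i y) (vdiff z y)\<bar> \<le> Lf / 2 * (enorm p (vdiff z y))\<^sup>2"
        by (intro t) simp
    qed
    hence "1 / real n * \<bar>\<Sum>i<n. fi i z - fi i y - einner p (gi i y) (vdiff z y)\<bar>
        \<le> 1 / real n * (\<Sum>i<n. Lf / 2 * (enorm p (vdiff z y))\<^sup>2)" by (rule mult_left_mono) simp
    thus ?thesis unfolding abs_mult by (simp only: abs_of_nonneg[of "1 / real n"] zero_le_divide_1_iff of_nat_0_le_iff)
  qed
  also have "\<dots> = Lf / 2 * (enorm p (vdiff z y))\<^sup>2" using n_pos by (simp only: sum_constant) simp
  finally show "\<bar>fbar z - fbar y - einner p (Gf y) (vdiff z y)\<bar> \<le> Lf / 2 * (enorm p (vdiff z y))\<^sup>2"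
    unfolding eq .
qed

lemma grad_fbar: "y \<in> space_R p \<Longrightarrow> grad p fbar y = Gf y"
  by (rule grad_eqI[OF has_gradient_fbar])

end

section \<open>The averaged iterate and its expected suboptimality\<close>

locale zo_descent = zo_process n p D M u \<xi> E a L Lf s0 s1 st0 s2 F \<alpha> \<beta> \<eta> \<delta> x0
  for n p :: nat and D :: "nat \<Rightarrow> 'c measure" and M :: "'w measure" and u \<xi> E a L Lf s0 s1 st0 s2 F \<alpha> \<beta> \<eta> \<delta> x0 +
  fixes db :: "nat \<Rightarrow> real" and fs :: real
  assumes hetero: "i < n \<Longrightarrow> y \<in> space_R p \<Longrightarrow>
      (enorm p (vdiff (gi i y) (Gf y)))\<^sup>2 \<le> st0\<^sup>2 * (enorm p (Gf y))\<^sup>2 + s2\<^sup>2"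
    and fbar_ge: "y \<in> space_R p \<Longrightarrow> fs \<le> fbar y"
    and \<delta>_le: "i < n \<Longrightarrow> (\<delta> i k)\<^sup>2 \<le> db k"
begin

definition xb :: "nat \<Rightarrow> 'w \<Rightarrow> rvec" where "xb k w = average n (\<lambda>i. x k i w)"
definition gb :: "nat \<Rightarrow> 'w \<Rightarrow> rvec" where "gb k w = trunc p (average n (\<lambda>i. g k i w))"
definition mb :: "nat \<Rightarrow> 'w \<Rightarrow> rvec" where "mb k w = average n (\<lambda>i. m k i w)"
definition cons :: "nat \<Rightarrow> 'w \<Rightarrow> real" where "cons k w = consensus_error n p (\<lambda>i. x k i w)"

lemma xb_space: "xb k w \<in> space_R p"
  unfolding xb_def by (rule average_space) (rule x_space)

lemma gi_Lipschitz:
  assumes "i < n" "y \<in> space_R p" "z \<in> space_R p"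
  shows "enorm p (vdiff (gi i y) (gi i z)) \<le> Lf * enorm p (vdiff y z)"
  using random_cost.mean_grad_Lipschitz[OF cost[OF assms(1)] assms(2,3)] .

lemma Gf_Lipschitz:
  assumes y: "y \<in> space_R p" and z: "z \<in> space_R p"
  shows "enorm p (vdiff (Gf y) (Gf z)) \<le> Lf * enorm p (vdiff y z)"
proof -
  have "vdiff (Gf y) (Gf z) = (\<lambda>c. 1 / real n * (\<Sum>i<n. vdiff (gi i y) (gi i z) c))"
    by (auto simp: vdiff_def Gf_def average_def sum_subtractf diff_divide_distrib)
  hence "(enorm p (vdiff (Gf y) (Gf z)))\<^sup>2 \<le> 1 / real n * (\<Sum>i<n. (enorm p (vdiff (gi i y) (gi i z)))\<^sup>2)"
    using enorm_average_sq_le[OF n_pos, of p "\<lambda>i. vdiff (gi i y) (gi i z)"] by (simp only:)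
  also have "\<dots> \<le> 1 / real n * (\<Sum>i<n. (Lf * enorm p (vdiff y z))\<^sup>2)"
    using gi_Lipschitz[OF _ y z] by (intro mult_left_mono sum_mono power_mono) auto
  also have "\<dots> = (Lf * enorm p (vdiff y z))\<^sup>2" using n_pos by simp
  finally show ?thesis using Lf_pos by (auto intro: power2_le_imp_le)
qed

lemma smooth_fbar: "smooth_on_R p Lf fbar"
  unfolding smooth_on_R_def using has_gradient_fbar Gf_Lipschitz grad_fbar by auto

text \<open>Laplacian terms sum to zero over the agents and the dual variables start at zero.
  Therefore the average iterate is driven by the gradient estimators alone.\<close>

lemma sum_v: "(\<Sum>i<n. v k i w c) = 0"
proof (induction k)
  case (Suc k)
  show ?case
  proof (cases "c < p")
    case True
    have "(\<Sum>i<n. v (Suc k) i w c) = (\<Sum>i<n. v k i w c + \<eta> k * \<beta> k * \<Lambda> (\<lambda>j. x k j w c) i)"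
      using True by (intro sum.cong) (auto simp: v_Suc)
    thus ?thesis by (simp add: sum.distrib Suc sum_distrib_left[symmetric] sum_lap)
  qed (simp add: v_Suc)
qed (simp add: v_0)

lemma xb_Suc: "xb (Suc k) w = (\<lambda>c. xb k w c + (- \<eta> k) * gb k w c)"
proof
  fix c
  show "xb (Suc k) w c = xb k w c + (- \<eta> k) * gb k w c"
  proof (cases "c < p")
    case True
    have "(\<Sum>i<n. x (Suc k) i w c) = (\<Sum>i<n. x k i w c - \<eta> k * (\<alpha> k * \<Lambda> (\<lambda>j. x k j w c) i + \<beta> k * v k i w c + g k i w c))"
      using True by (intro sum.cong) (auto simp: x_Suc)
    also have "\<dots> = (\<Sum>i<n. x k i w c) - \<eta> k * (\<alpha> k * (\<Sum>i<n. \<Lambda> (\<lambda>j. x k j w c) i) + \<beta> k * (\<Sum>i<n. v k i w c) + (\<Sum>i<n. g k i w c))"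
      by (simp add: sum_subtractf sum.distrib sum_distrib_left[symmetric])
    finally have "(\<Sum>i<n. x (Suc k) i w c) = (\<Sum>i<n. x k i w c) - \<eta> k * (\<Sum>i<n. g k i w c)"
      by (simp add: sum_lap sum_v)
    thus ?thesis using True by (simp add: xb_def gb_def average_def trunc_def diff_divide_distrib)
  next
    case False
    thus ?thesis using xb_space[of k w] xb_space[of "Suc k" w] by (simp add: space_R_iff gb_def trunc_def)
  qed
qed

lemma descent_path:
  "fbar (xb (Suc k) w) \<le> fbar (xb k w) - \<eta> k * einner p (Gf (xb k w)) (gb k w) + Lf / 2 * (\<eta> k)\<^sup>2 * (enorm p (gb k w))\<^sup>2"
proof -
  have gbR: "gb k w \<in> space_R p" by (simp add: gb_def trunc_space)
  have "\<bar>fbar (xb (Suc k) w) - fbar (xb k w) - einner p (grad p fbar (xb k w)) (\<lambda>c. (- \<eta> k) * gb k w c)\<bar>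
     \<le> Lf / 2 * (enorm p (\<lambda>c. (- \<eta> k) * gb k w c))\<^sup>2"
    unfolding xb_Suc by (rule smooth_descent[OF smooth_fbar xb_space space_R_scale[OF gbR]])
  hence "fbar (xb (Suc k) w) - fbar (xb k w) - (- \<eta> k) * einner p (Gf (xb k w)) (gb k w)
      \<le> Lf / 2 * (\<bar>- \<eta> k\<bar> * enorm p (gb k w))\<^sup>2"
    unfolding einner_mult_right enorm_scale grad_fbar[OF xb_space] by (rule abs_le_D1)
  thus ?thesis by (simp add: power_mult_distrib algebra_simps)
qed

lemma sqint_average:
  assumes "\<And>i. i < n \<Longrightarrow> sqint p M (y i)" shows "sqint p M (\<lambda>w. average n (\<lambda>i. y i w))"
  unfolding average_def by (rule sqint_scale, rule sqint_sum) (use assms in auto)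

lemma xb_sqint: "sqint p M (xb k)"
  unfolding xb_def[abs_def] by (rule sqint_average[OF x_sqint])

lemma mb_sqint: "sqint p M (mb k)"
  unfolding mb_def[abs_def] by (rule sqint_average[OF m_sqint])

lemma gb_sqint: "sqint p M (gb k)"
  unfolding gb_def[abs_def] trunc_def by (rule sqint_restrict[OF sqint_average[OF g_sqint]])

lemma Gf_sqint: "sqint p M (\<lambda>w. Gf (xb k w))"
  using sqint_grad[OF smooth_fbar xb_sqint xb_space, of k] by (simp add: grad_fbar xb_space)

lemma fbar_integrable: "integrable M (\<lambda>w. fbar (xb k w))"
  by (rule integrable_smooth_sqint[OF smooth_fbar xb_sqint xb_space])

lemma xb_measurable: "xb k \<in> measurable (draw_algebra (past k)) borel"
  unfolding xb_def[abs_def] average_def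
  by (rule measurable_rvecI, rule borel_measurable_times, rule borel_measurable_const,
      rule borel_measurable_sum, rule measurable_rvecD, rule x_measurable) simp

lemma Gf_measurable: "(\<lambda>w. Gf (xb k w)) \<in> measurable (draw_algebra (past k)) borel"
proof (rule measurable_rvecI)
  fix c
  have "(\<lambda>y. grad p fbar (trunc p y) c) \<in> borel_measurable borel"
    by (rule borel_measurable_continuous_onI[OF continuous_grad_coordinate[OF smooth_fbar]])
  from measurable_compose[OF xb_measurable this]
  have "(\<lambda>w. grad p fbar (trunc p (xb k w)) c) \<in> borel_measurable (draw_algebra (past k))" .
  moreover have "grad p fbar (trunc p (xb k w)) c = Gf (xb k w) c" for w
    by (simp only: trunc_id[OF xb_space] grad_fbar[OF xb_space])
  ultimately show "(\<lambda>w. Gf (xb k w) c) \<in> borel_measurable (draw_algebra (past k))" by (simp only:)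
qed

lemma einner_gb_right: "einner p y (gb k w) = 1 / real n * (\<Sum>i<n. einner p y (g k i w))"
proof -
  have "einner p y (gb k w) = einner p y (average n (\<lambda>i. g k i w))"
    by (rule einner_cong) (auto simp: gb_def trunc_def)
  thus ?thesis unfolding average_def einner_mult_right einner_sum_right .
qed

lemma einner_gb_left: "einner p (gb k w) y = 1 / real n * (\<Sum>i<n. einner p (g k i w) y)"
  using einner_gb_right[of y k w] by (simp add: einner_commute[of p y])

lemma einner_mb_right: "einner p y (mb k w) = 1 / real n * (\<Sum>i<n. einner p y (m k i w))"
  unfolding mb_def average_def einner_mult_right einner_sum_right ..

lemma einner_mb_left: "einner p (mb k w) y = 1 / real n * (\<Sum>i<n. einner p (m k i w) y)"
  unfolding mb_def average_def einner_mult_left einner_sum_left ..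

lemma expectation_Gf_gb:
  "(\<integral>w. einner p (Gf (xb k w)) (gb k w) \<partial>M) = (\<integral>w. einner p (Gf (xb k w)) (mb k w) \<partial>M)"
proof -
  have "(\<integral>w. einner p (Gf (xb k w)) (gb k w) \<partial>M) = 1 / real n * (\<Sum>i<n. \<integral>w. einner p (Gf (xb k w)) (g k i w) \<partial>M)"
    unfolding einner_gb_right using integrable_einner_sqint[OF Gf_sqint g_sqint] by simp
  also have "\<dots> = 1 / real n * (\<Sum>i<n. \<integral>w. einner p (Gf (xb k w)) (m k i w) \<partial>M)"
    using noise_orthogonal[OF _ order_refl past_sub not_past Gf_measurable Gf_sqint] by simp
  also have "\<dots> = (\<integral>w. einner p (Gf (xb k w)) (mb k w) \<partial>M)"
    unfolding einner_mb_right using integrable_einner_sqint[OF Gf_sqint m_sqint] by simp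
  finally show ?thesis .
qed

definition Qk :: "nat \<Rightarrow> real" where
  "Qk k = 1 / real n * (\<Sum>i<n. \<integral>w. (enorm p (g k i w))\<^sup>2 \<partial>M)"

text \<open>Two conditionings: when the draw of agent \<open>j\<close> is integrated out, that of
  agent \<open>i\<close> counts as known; what remains of \<open>j\<close> depends on the past only,
  so the draw of \<open>i\<close> can be integrated out next.\<close>

lemma expectation_pair:
  assumes i: "i < n" and j: "j < n" and ij: "i \<noteq> j"
  shows "(\<integral>w. einner p (g k i w) (g k j w) \<partial>M) = (\<integral>w. einner p (m k i w) (m k j w) \<partial>M)"
proof -
  let ?K = "insert (i, k) (past k)"
  have K: "past k \<subseteq> ?K" "?K \<subseteq> {..<n} \<times> UNIV" "(j, k) \<notin> ?K"
    using i ij past_sub not_past[of j k] by auto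
  have gi: "g k i \<in> measurable (draw_algebra ?K) borel"
    by (rule g_draw_algebra[OF i measurable_draw_algebra_mono[OF K(1) x_measurable[OF i]]]) simp
  have "(\<integral>w. einner p (g k i w) (g k j w) \<partial>M) = (\<integral>w. einner p (g k i w) (m k j w) \<partial>M)"
    by (rule noise_orthogonal[OF j K gi g_sqint[OF i]])
  also have "\<dots> = (\<integral>w. einner p (m k j w) (g k i w) \<partial>M)" by (simp add: einner_commute)
  also have "\<dots> = (\<integral>w. einner p (m k j w) (m k i w) \<partial>M)"
    by (rule noise_orthogonal[OF i order_refl past_sub not_past m_measurable[OF j] m_sqint[OF j]])
  finally show ?thesis by (simp add: einner_commute)
qed

text \<open>Of the \<open>n * n\<close> terms in the expanded square only the \<open>n\<close>
  diagonal ones differ from those of the conditional means; weighted by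
  \<open>1 / n\<^sup>2\<close>, they contribute at most \<open>Qk k / real n\<close>.\<close>

lemma expectation_gb_sq:
  "(\<integral>w. (enorm p (gb k w))\<^sup>2 \<partial>M) \<le> (\<integral>w. (enorm p (mb k w))\<^sup>2 \<partial>M) + Qk k / real n"
proof -
  have le: "(\<integral>w. einner p (g k i w) (g k j w) \<partial>M) \<le> (\<integral>w. einner p (m k i w) (m k j w) \<partial>M)
      + (if i = j then \<integral>w. (enorm p (g k i w))\<^sup>2 \<partial>M else 0)" if "i < n" "j < n" for i j
  proof (cases "i = j")
    case True
    have "0 \<le> (\<integral>w. einner p (m k i w) (m k i w) \<partial>M)" by (rule integral_nonneg_AE) simp
    thus ?thesis using True by (simp add: einner_self)
  qed (use expectation_pair that in simp)
  have "(\<integral>w. (enorm p (gb k w))\<^sup>2 \<partial>M) = (\<integral>w. 1 / real n * (\<Sum>i<n. 1 / real n * (\<Sum>j<n. einner p (g k i w) (g k j w))) \<partial>M)"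
    unfolding einner_self[symmetric] by (subst (1) einner_gb_left, subst einner_gb_right) simp
  also have "\<dots> = 1 / real n * (\<Sum>i<n. 1 / real n * (\<Sum>j<n. \<integral>w. einner p (g k i w) (g k j w) \<partial>M))"
    by (rule integral_double_average) (rule integrable_einner_sqint[OF g_sqint g_sqint])
  also have "\<dots> \<le> 1 / real n * (\<Sum>i<n. 1 / real n * (\<Sum>j<n. (\<integral>w. einner p (m k i w) (m k j w) \<partial>M)
      + (if i = j then \<integral>w. (enorm p (g k i w))\<^sup>2 \<partial>M else 0)))"
    by (intro mult_left_mono sum_mono le) auto
  also have "\<dots> = 1 / real n * (\<Sum>i<n. 1 / real n * (\<Sum>j<n. \<integral>w. einner p (m k i w) (m k j w) \<partial>M))
      + 1 / real n * (\<Sum>i<n. 1 / real n * (\<integral>w. (enorm p (g k i w))\<^sup>2 \<partial>M))"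
    by (simp add: sum.distrib distrib_left add_divide_distrib)
  also have "1 / real n * (\<Sum>i<n. 1 / real n * (\<Sum>j<n. \<integral>w. einner p (m k i w) (m k j w) \<partial>M))
     = (\<integral>w. 1 / real n * (\<Sum>i<n. 1 / real n * (\<Sum>j<n. einner p (m k i w) (m k j w))) \<partial>M)"
    by (rule integral_double_average[symmetric]) (rule integrable_einner_sqint[OF m_sqint m_sqint])
  also have "\<dots> = (\<integral>w. (enorm p (mb k w))\<^sup>2 \<partial>M)"
    unfolding einner_self[symmetric] by (subst (1) einner_mb_left, subst einner_mb_right) simp
  also have "1 / real n * (\<Sum>i<n. 1 / real n * (\<integral>w. (enorm p (g k i w))\<^sup>2 \<partial>M)) = Qk k / real n"
    by (simp add: Qk_def sum_distrib_left[symmetric] sum_divide_distrib[symmetric])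
  finally show ?thesis .
qed

lemma cons_alt: "cons k w = 1 / real n * (\<Sum>i<n. (enorm p (vdiff (x k i w) (xb k w)))\<^sup>2)"
  by (simp add: cons_def consensus_error_def xb_def)

lemma cons_nonneg: "0 \<le> cons k w"
  by (simp add: cons_alt sum_nonneg)

lemma cons_integrable: "integrable M (cons k)"
  unfolding cons_alt[abs_def] vdiff_def
  by (rule integrable_mult_right, rule Bochner_Integration.integrable_sum, rule sqint_integrable,
      rule sqint_diff, rule x_sqint, simp, rule xb_sqint)

text \<open>The conditional mean misses the gradient at the average for two reasons: the smoothing
  bias, and the evaluation at the agents' own points. Averaging the squares turns the latter into
  the consensus error.\<close>

lemma mean_error_path:
  "(enorm p (vdiff (mb k w) (Gf (xb k w))))\<^sup>2 \<le> 2 * Lf\<^sup>2 * db k + 2 * Lf\<^sup>2 * cons k w"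
proof -
  let ?a = "\<lambda>i c. vdiff (m k i w) (gi i (x k i w)) c + vdiff (gi i (x k i w)) (gi i (xb k w)) c"
  have "vdiff (mb k w) (Gf (xb k w)) = (\<lambda>c. 1 / real n * (\<Sum>i<n. ?a i c))"
    by (auto simp: vdiff_def mb_def Gf_def average_def sum_subtractf diff_divide_distrib)
  hence "(enorm p (vdiff (mb k w) (Gf (xb k w))))\<^sup>2 \<le> 1 / real n * (\<Sum>i<n. (enorm p (?a i))\<^sup>2)"
    using enorm_average_sq_le[OF n_pos, of p ?a] by simp
  also have "\<dots> \<le> 1 / real n * (\<Sum>i<n. 2 * Lf\<^sup>2 * db k + 2 * Lf\<^sup>2 * (enorm p (vdiff (x k i w) (xb k w)))\<^sup>2)"
  proof (intro mult_left_mono sum_mono)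
    fix i assume "i \<in> {..<n}"
    hence i: "i < n" by simp
    have 1: "(enorm p (vdiff (m k i w) (gi i (x k i w))))\<^sup>2 \<le> (Lf * \<delta> i k)\<^sup>2"
      unfolding m_def by (intro power_mono mi_bound i x_space) simp
    have 2: "(enorm p (vdiff (gi i (x k i w)) (gi i (xb k w))))\<^sup>2 \<le> (Lf * enorm p (vdiff (x k i w) (xb k w)))\<^sup>2"
      by (intro power_mono gi_Lipschitz i x_space xb_space) simp
    have "(Lf * \<delta> i k)\<^sup>2 \<le> Lf\<^sup>2 * db k" using \<delta>_le[OF i] by (simp add: power_mult_distrib mult_left_mono)
    thus "(enorm p (?a i))\<^sup>2 \<le> 2 * Lf\<^sup>2 * db k + 2 * Lf\<^sup>2 * (enorm p (vdiff (x k i w) (xb k w)))\<^sup>2"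
      using enorm_sq_add_le[of p "vdiff (m k i w) (gi i (x k i w))" "vdiff (gi i (x k i w)) (gi i (xb k w))"] 1 2
      by (simp add: power_mult_distrib)
  qed simp
  also have "\<dots> = 2 * Lf\<^sup>2 * db k + 2 * Lf\<^sup>2 * cons k w"
    using n_pos by (simp add: cons_alt sum.distrib sum_distrib_left[symmetric] distrib_left)
  finally show ?thesis .
qed

definition Dk :: "nat \<Rightarrow> real" where "Dk k = (\<integral>w. fbar (xb k w) - fs \<partial>M)"
definition Gk :: "nat \<Rightarrow> real" where "Gk k = (\<integral>w. (enorm p (Gf (xb k w)))\<^sup>2 \<partial>M)"
definition Yk :: "nat \<Rightarrow> real" where "Yk k = (\<integral>w. cons k w \<partial>M)"

lemma Gk_nonneg: "0 \<le> Gk k" unfolding Gk_def by (rule integral_nonneg_AE) simp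
lemma Yk_nonneg: "0 \<le> Yk k" unfolding Yk_def by (rule integral_nonneg_AE) (simp add: cons_nonneg)
lemma Qk_nonneg: "0 \<le> Qk k" unfolding Qk_def by (intro mult_nonneg_nonneg sum_nonneg integral_nonneg_AE) auto

lemma Dk_nonneg: "0 \<le> Dk k" unfolding Dk_def
  by (rule integral_nonneg_AE) (use fbar_ge[OF xb_space] in simp)

lemma Gk_le: "Gk k \<le> 2 * Lf * Dk k"
proof -
  have "Gk k \<le> (\<integral>w. 2 * Lf * (fbar (xb k w) - fs) \<partial>M)" unfolding Gk_def
  proof (rule integral_mono)
    show "integrable M (\<lambda>w. (enorm p (Gf (xb k w)))\<^sup>2)" by (rule sqint_integrable[OF Gf_sqint])
    show "integrable M (\<lambda>w. 2 * Lf * (fbar (xb k w) - fs))" using fbar_integrable by simp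
    show "(enorm p (Gf (xb k w)))\<^sup>2 \<le> 2 * Lf * (fbar (xb k w) - fs)" for w
      using smooth_grad_sq_le[OF smooth_fbar xb_space Lf_pos fbar_ge, of k w] by (simp add: grad_fbar xb_space)
  qed
  thus ?thesis by (simp add: Dk_def)
qed

text \<open>Polarisation writes the inner product of gradient and conditional mean through their
  distance, giving \<open>- Gk k / 2\<close> at the price of half the squared error. The
  second-order term is split by \<open>expectation_gb_sq\<close> into a mean part and a variance
  part with factor \<open>1 / n\<close>.\<close>

lemma descent_expectation:
  "Dk (Suc k) \<le> Dk k - \<eta> k / 2 * Gk k + (\<eta> k / 2 + Lf * (\<eta> k)\<^sup>2) * (2 * Lf\<^sup>2 * db k + 2 * Lf\<^sup>2 * Yk k)
     + Lf * (\<eta> k)\<^sup>2 * Gk k + Lf / 2 * (\<eta> k)\<^sup>2 * (Qk k / real n)"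
proof -
  let ?e = "\<lambda>w. vdiff (mb k w) (Gf (xb k w))"
  let ?E = "2 * Lf\<^sup>2 * db k + 2 * Lf\<^sup>2 * Yk k"
  have ie: "integrable M (\<lambda>w. (enorm p (?e w))\<^sup>2)"
    unfolding vdiff_def by (rule sqint_integrable[OF sqint_diff[OF mb_sqint Gf_sqint]])
  have Ee: "(\<integral>w. (enorm p (?e w))\<^sup>2 \<partial>M) \<le> ?E"
  proof -
    have "(\<integral>w. (enorm p (?e w))\<^sup>2 \<partial>M) \<le> (\<integral>w. 2 * Lf\<^sup>2 * db k + 2 * Lf\<^sup>2 * cons k w \<partial>M)"
      by (rule integral_mono[OF ie _ mean_error_path]) (use cons_integrable in simp)
    thus ?thesis using cons_integrable[of k] by (simp add: Yk_def prob_space)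
  qed
  have iG: "integrable M (\<lambda>w. (enorm p (Gf (xb k w)))\<^sup>2)" by (rule sqint_integrable[OF Gf_sqint])
  have 1: "- (\<integral>w. einner p (Gf (xb k w)) (mb k w) \<partial>M) \<le> - Gk k / 2 + ?E / 2"
  proof -
    have "- Gk k / 2 + (\<integral>w. (enorm p (?e w))\<^sup>2 \<partial>M) / 2 = (\<integral>w. - (enorm p (Gf (xb k w)))\<^sup>2 / 2 + (enorm p (?e w))\<^sup>2 / 2 \<partial>M)"
      unfolding Gk_def using ie iG by simp
    also have "\<dots> \<ge> (\<integral>w. - einner p (Gf (xb k w)) (mb k w) \<partial>M)"
    proof (rule integral_mono)
      show "integrable M (\<lambda>w. - einner p (Gf (xb k w)) (mb k w))"
        using integrable_einner_sqint[OF Gf_sqint mb_sqint, of k k] by simp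
      show "integrable M (\<lambda>w. - (enorm p (Gf (xb k w)))\<^sup>2 / 2 + (enorm p (?e w))\<^sup>2 / 2)" using ie iG by simp
      fix w
      have "0 \<le> (enorm p (mb k w))\<^sup>2" by simp
      moreover have "(enorm p (?e w))\<^sup>2 = (enorm p (mb k w))\<^sup>2 - 2 * einner p (Gf (xb k w)) (mb k w) + (enorm p (Gf (xb k w)))\<^sup>2"
        unfolding einner_self[symmetric] vdiff_def einner_linear by (simp add: einner_commute[of p "mb k w" "Gf (xb k w)"])
      ultimately show "- einner p (Gf (xb k w)) (mb k w) \<le> - (enorm p (Gf (xb k w)))\<^sup>2 / 2 + (enorm p (?e w))\<^sup>2 / 2" by linarith
    qed
    finally have "- (\<integral>w. einner p (Gf (xb k w)) (mb k w) \<partial>M) \<le> - Gk k / 2 + (\<integral>w. (enorm p (?e w))\<^sup>2 \<partial>M) / 2"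
      by simp
    also have "\<dots> \<le> - Gk k / 2 + ?E / 2" by (intro add_left_mono divide_right_mono Ee) simp
    finally show ?thesis .
  qed
  have 2: "(\<integral>w. (enorm p (mb k w))\<^sup>2 \<partial>M) \<le> 2 * ?E + 2 * Gk k"
  proof -
    have "(\<integral>w. (enorm p (mb k w))\<^sup>2 \<partial>M) \<le> (\<integral>w. 2 * (enorm p (?e w))\<^sup>2 + 2 * (enorm p (Gf (xb k w)))\<^sup>2 \<partial>M)"
    proof (rule integral_mono)
      show "integrable M (\<lambda>w. (enorm p (mb k w))\<^sup>2)" by (rule sqint_integrable[OF mb_sqint])
      show "integrable M (\<lambda>w. 2 * (enorm p (?e w))\<^sup>2 + 2 * (enorm p (Gf (xb k w)))\<^sup>2)" using ie iG by simp
      show "(enorm p (mb k w))\<^sup>2 \<le> 2 * (enorm p (?e w))\<^sup>2 + 2 * (enorm p (Gf (xb k w)))\<^sup>2" for w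
        using enorm_sq_add_le[of p "?e w" "Gf (xb k w)"] by (simp add: vdiff_def)
    qed
    also have "\<dots> = 2 * (\<integral>w. (enorm p (?e w))\<^sup>2 \<partial>M) + 2 * Gk k" unfolding Gk_def using ie iG by simp
    also have "\<dots> \<le> 2 * ?E + 2 * Gk k" by (intro add_right_mono mult_left_mono Ee) simp
    finally show ?thesis .
  qed
  have "Dk (Suc k) \<le> (\<integral>w. (fbar (xb k w) - fs) - \<eta> k * einner p (Gf (xb k w)) (gb k w) + Lf / 2 * (\<eta> k)\<^sup>2 * (enorm p (gb k w))\<^sup>2 \<partial>M)"
    unfolding Dk_def
  proof (rule integral_mono)
    show "integrable M (\<lambda>w. fbar (xb (Suc k) w) - fs)" using fbar_integrable by simp
    show "integrable M (\<lambda>w. (fbar (xb k w) - fs) - \<eta> k * einner p (Gf (xb k w)) (gb k w) + Lf / 2 * (\<eta> k)\<^sup>2 * (enorm p (gb k w))\<^sup>2)"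
      using fbar_integrable integrable_einner_sqint[OF Gf_sqint gb_sqint, of k k] sqint_integrable[OF gb_sqint[of k]] by simp
    show "fbar (xb (Suc k) w) - fs \<le> (fbar (xb k w) - fs) - \<eta> k * einner p (Gf (xb k w)) (gb k w) + Lf / 2 * (\<eta> k)\<^sup>2 * (enorm p (gb k w))\<^sup>2" for w
      using descent_path[of k w] by linarith
  qed
  also have "\<dots> = Dk k - \<eta> k * (\<integral>w. einner p (Gf (xb k w)) (gb k w) \<partial>M) + Lf / 2 * (\<eta> k)\<^sup>2 * (\<integral>w. (enorm p (gb k w))\<^sup>2 \<partial>M)"
    unfolding Dk_def using fbar_integrable integrable_einner_sqint[OF Gf_sqint gb_sqint, of k k] sqint_integrable[OF gb_sqint[of k]] by simp
  also have "\<dots> = Dk k + \<eta> k * (- (\<integral>w. einner p (Gf (xb k w)) (mb k w) \<partial>M)) + Lf / 2 * (\<eta> k)\<^sup>2 * (\<integral>w. (enorm p (gb k w))\<^sup>2 \<partial>M)"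
    by (simp add: expectation_Gf_gb)
  also have "\<dots> \<le> Dk k + \<eta> k * (- Gk k / 2 + ?E / 2) + Lf / 2 * (\<eta> k)\<^sup>2 * (2 * ?E + 2 * Gk k + Qk k / real n)"
    using expectation_gb_sq[of k] 2 Lf_pos \<eta>_nonneg 1
    by (intro add_mono mult_left_mono order_refl) auto
  finally show ?thesis by (simp add: algebra_simps add_divide_distrib)
qed

text \<open>The local gradient at the agent's point is moved to the average by smoothness and then
  to the global gradient by the heterogeneity bound. Each passage doubles the squares, whence the
  factors \<open>2\<close> and \<open>4\<close>.\<close>

lemma Qk_le:
  "Qk k \<le> 4 * real p * (1 + s0\<^sup>2) * (2 * Lf\<^sup>2 * Yk k + 4 * (1 + st0\<^sup>2) * Gk k + 4 * s2\<^sup>2)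
     + 4 * real p * s1\<^sup>2 + (real p)\<^sup>2 * Lf\<^sup>2 * db k / 2"
proof -
  let ?A = "4 * real p * (1 + s0\<^sup>2)"
  let ?B = "4 * real p * s1\<^sup>2 + (real p)\<^sup>2 * Lf\<^sup>2 * db k / 2"
  have path: "estimator_bound k i (x k i w) \<le> ?A * (2 * Lf\<^sup>2 * (enorm p (vdiff (x k i w) (xb k w)))\<^sup>2
      + 4 * (1 + st0\<^sup>2) * (enorm p (Gf (xb k w)))\<^sup>2 + 4 * s2\<^sup>2) + ?B" if i: "i < n" for i w
  proof -
    let ?g = "gi i (x k i w)" and ?h = "gi i (xb k w)" and ?G = "Gf (xb k w)"
    have "(enorm p ?g)\<^sup>2 \<le> 2 * (enorm p (vdiff ?g ?h))\<^sup>2 + 2 * (enorm p ?h)\<^sup>2"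
      using enorm_sq_add_le[of p "vdiff ?g ?h" ?h] by (simp add: vdiff_def)
    moreover have "(enorm p (vdiff ?g ?h))\<^sup>2 \<le> (Lf * enorm p (vdiff (x k i w) (xb k w)))\<^sup>2"
      by (intro power_mono gi_Lipschitz i x_space xb_space) simp
    moreover have "(enorm p ?h)\<^sup>2 \<le> 2 * (enorm p (vdiff ?h ?G))\<^sup>2 + 2 * (enorm p ?G)\<^sup>2"
      using enorm_sq_add_le[of p "vdiff ?h ?G" ?G] by (simp add: vdiff_def)
    moreover have "(enorm p (vdiff ?h ?G))\<^sup>2 \<le> st0\<^sup>2 * (enorm p ?G)\<^sup>2 + s2\<^sup>2"
      by (rule hetero[OF i xb_space])
    ultimately have g: "(enorm p ?g)\<^sup>2 \<le> 2 * Lf\<^sup>2 * (enorm p (vdiff (x k i w) (xb k w)))\<^sup>2 + 4 * (1 + st0\<^sup>2) * (enorm p ?G)\<^sup>2 + 4 * s2\<^sup>2"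
      by (simp add: power_mult_distrib algebra_simps)
    have "estimator_bound k i (x k i w) = ?A * (enorm p ?g)\<^sup>2 + (4 * real p * s1\<^sup>2 + (real p)\<^sup>2 * Lf\<^sup>2 * (\<delta> i k)\<^sup>2 / 2)"
      by (simp add: estimator_bound_def algebra_simps)
    also have "\<dots> \<le> ?A * (2 * Lf\<^sup>2 * (enorm p (vdiff (x k i w) (xb k w)))\<^sup>2 + 4 * (1 + st0\<^sup>2) * (enorm p ?G)\<^sup>2 + 4 * s2\<^sup>2) + ?B"
      using g \<delta>_le[OF i, of k] by (intro add_mono mult_left_mono divide_right_mono) auto
    finally show ?thesis .
  qed
  have iG: "integrable M (\<lambda>w. (enorm p (Gf (xb k w)))\<^sup>2)" by (rule sqint_integrable[OF Gf_sqint])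
  have ix: "integrable M (\<lambda>w. (enorm p (vdiff (x k i w) (xb k w)))\<^sup>2)" if "i < n" for i
    unfolding vdiff_def by (rule sqint_integrable[OF sqint_diff[OF x_sqint[OF that] xb_sqint]])
  have "Qk k \<le> 1 / real n * (\<Sum>i<n. \<integral>w. ?A * (2 * Lf\<^sup>2 * (enorm p (vdiff (x k i w) (xb k w)))\<^sup>2
      + 4 * (1 + st0\<^sup>2) * (enorm p (Gf (xb k w)))\<^sup>2 + 4 * s2\<^sup>2) + ?B \<partial>M)"
    unfolding Qk_def
  proof (intro mult_left_mono sum_mono)
    fix i assume "i \<in> {..<n}"
    hence i: "i < n" by simp
    have "(\<integral>w. (enorm p (g k i w))\<^sup>2 \<partial>M) \<le> (\<integral>w. estimator_bound k i (x k i w) \<partial>M)"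
      by (rule g_second_moment(2)[OF i x_sqint[OF i]])
    also have "\<dots> \<le> (\<integral>w. ?A * (2 * Lf\<^sup>2 * (enorm p (vdiff (x k i w) (xb k w)))\<^sup>2
      + 4 * (1 + st0\<^sup>2) * (enorm p (Gf (xb k w)))\<^sup>2 + 4 * s2\<^sup>2) + ?B \<partial>M)"
      by (rule integral_mono[OF integrable_estimator_bound[OF i x_sqint[OF i]] _ path[OF i]])
        (use iG ix[OF i] in simp)
    finally show "(\<integral>w. (enorm p (g k i w))\<^sup>2 \<partial>M) \<le> \<dots>" .
  qed simp
  also have "\<dots> = (\<integral>w. 1 / real n * (\<Sum>i<n. ?A * (2 * Lf\<^sup>2 * (enorm p (vdiff (x k i w) (xb k w)))\<^sup>2
      + 4 * (1 + st0\<^sup>2) * (enorm p (Gf (xb k w)))\<^sup>2 + 4 * s2\<^sup>2) + ?B) \<partial>M)"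
    using iG ix by (subst integral_mult_right_zero, subst Bochner_Integration.integral_sum) auto
  also have "\<dots> = (\<integral>w. ?A * (2 * Lf\<^sup>2 * cons k w + 4 * (1 + st0\<^sup>2) * (enorm p (Gf (xb k w)))\<^sup>2 + 4 * s2\<^sup>2) + ?B \<partial>M)"
    using n_pos by (simp add: cons_alt sum.distrib sum_distrib_left[symmetric] distrib_left mult_ac)
  also have "\<dots> = ?A * (2 * Lf\<^sup>2 * Yk k + 4 * (1 + st0\<^sup>2) * Gk k + 4 * s2\<^sup>2) + ?B"
    unfolding Yk_def Gk_def using iG cons_integrable[of k] by (simp add: prob_space)
  finally show ?thesis by simp
qed

section \<open>The expected consensus error\<close>

lemma cons_coordinates:
  "cons k w = 1 / real n * (\<Sum>c<p. einner n (centered n (\<lambda>i. x k i w c)) (centered n (\<lambda>i. x k i w c)))"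
  unfolding cons_alt enorm_sq_sum einner_def
  by (subst sum.swap) (simp add: vdiff_def xb_def average_def centered_def)

text \<open>With the estimators regarded as given inputs, the recursion acts on each of the
  \<open>p\<close> coordinates separately, and each is an instance of
  \<open>consensus_trajectory\<close>.\<close>

lemma consensus_expectation:
  assumes k1: "\<kappa>1 > 1" and h: "0 < h" "h < 1/5"
    and small: "h * (\<kappa>1\<^sup>2 * rho (L * L) + rho L / 2) \<le> (\<kappa>1 - 1) * rho2 L - 1"
    and c: "c = contraction \<kappa>1 h"
    and ab: "\<And>k. \<eta> k * \<alpha> k = \<kappa>1 * h" "\<And>k. \<eta> k * \<beta> k = h"
  shows "(\<kappa>1 - 1) / (4 * (\<kappa>1 + 1)) * Yk T \<le>
    decay_rec c (Yk 0 / 2) (\<lambda>k. (1 / (2 * c) + 1 / 2) * ((\<eta> k)\<^sup>2 * Qk k)) T"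
proof -
  let ?C = "(\<kappa>1 - 1) / (4 * (\<kappa>1 + 1))" and ?B = "1 / (2 * c) + 1 / 2"
  let ?q = "\<lambda>k w. 1 / real n * (\<Sum>i<n. (enorm p (g k i w))\<^sup>2)"
  have path: "?C * cons T w \<le> decay_rec c (cons 0 w / 2) (\<lambda>k. ?B * ((\<eta> k)\<^sup>2 * ?q k w)) T" for w
  proof -
    let ?y = "\<lambda>k c. centered n (\<lambda>i. x k i w c)"
    have co: "?C * einner n (?y T d) (?y T d) \<le> decay_rec c (einner n (?y 0 d) (?y 0 d) / 2)
       (\<lambda>k. ?B * ((\<eta> k)\<^sup>2 * einner n (\<lambda>i. g k i w d) (\<lambda>i. g k i w d))) T" if d: "d < p" for d
    proof (rule consensus_trajectory[OF k1 h small c, where X = "\<lambda>k i. x k i w d" and v = "\<lambda>k i. v k i w d"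
          and g = "\<lambda>k i. g k i w d" and \<eta> = \<eta> and T = T])
      show "v 0 i w d = 0" for i by (simp add: v_0)
      show "x (Suc k) i w d = x k i w d - h * (\<kappa>1 * \<Lambda> (\<lambda>i. x k i w d) i + v k i w d) - \<eta> k * g k i w d" if "i < n" for k i
      proof -
        have "x (Suc k) i w d = x k i w d - ((\<eta> k * \<alpha> k) * \<Lambda> (\<lambda>j. x k j w d) i + (\<eta> k * \<beta> k) * v k i w d + \<eta> k * g k i w d)"
          using that d by (simp add: x_Suc algebra_simps)
        thus ?thesis unfolding ab by (simp add: algebra_simps)
      qed
      show "v (Suc k) i w d = v k i w d + h * \<Lambda> (\<lambda>i. x k i w d) i" if "i < n" for k i
        using that d ab(2)[of k] by (simp add: v_Suc)
    qed simp_all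
    have "?C * cons T w = 1 / real n * (\<Sum>d<p. ?C * einner n (?y T d) (?y T d))"
      unfolding cons_coordinates sum_distrib_left[symmetric] by (rule mult.left_commute)
    also have "\<dots> \<le> 1 / real n * (\<Sum>d<p. decay_rec c (einner n (?y 0 d) (?y 0 d) / 2)
       (\<lambda>k. ?B * ((\<eta> k)\<^sup>2 * einner n (\<lambda>i. g k i w d) (\<lambda>i. g k i w d))) T)"
      by (intro mult_left_mono sum_mono co) auto
    also have "\<dots> = decay_rec c (1 / real n * (\<Sum>d<p. einner n (?y 0 d) (?y 0 d) / 2))
       (\<lambda>k. 1 / real n * (\<Sum>d<p. ?B * ((\<eta> k)\<^sup>2 * einner n (\<lambda>i. g k i w d) (\<lambda>i. g k i w d)))) T"
      unfolding decay_rec_sum decay_rec_scale ..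
    also have "1 / real n * (\<Sum>d<p. einner n (?y 0 d) (?y 0 d) / 2) = cons 0 w / 2"
      unfolding cons_coordinates by (simp add: sum_divide_distrib[symmetric])
    also have "(\<lambda>k. 1 / real n * (\<Sum>d<p. ?B * ((\<eta> k)\<^sup>2 * einner n (\<lambda>i. g k i w d) (\<lambda>i. g k i w d))))
       = (\<lambda>k. ?B * ((\<eta> k)\<^sup>2 * ?q k w))"
    proof
      fix k
      have "(\<Sum>d<p. einner n (\<lambda>i. g k i w d) (\<lambda>i. g k i w d)) = (\<Sum>i<n. (enorm p (g k i w))\<^sup>2)"
        unfolding enorm_sq_sum einner_def by (rule sum.swap)
      thus "1 / real n * (\<Sum>d<p. ?B * ((\<eta> k)\<^sup>2 * einner n (\<lambda>i. g k i w d) (\<lambda>i. g k i w d)))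
          = ?B * ((\<eta> k)\<^sup>2 * ?q k w)"
        unfolding sum_distrib_left[symmetric] by (simp only: mult_ac)
    qed
    finally show ?thesis .
  qed
  have iq: "integrable M (?q k)" for k
    by (rule integrable_mult_right, rule Bochner_Integration.integrable_sum, rule sqint_integrable, rule g_sqint) simp
  have ie: "integrable M (\<lambda>w. ?B * ((\<eta> k)\<^sup>2 * ?q k w))" for k
    by (intro integrable_mult_right iq)
  have i0: "integrable M (\<lambda>w. cons 0 w / 2)" using cons_integrable by simp
  have "?C * Yk T = (\<integral>w. ?C * cons T w \<partial>M)" by (simp add: Yk_def)
  also have "\<dots> \<le> (\<integral>w. decay_rec c (cons 0 w / 2) (\<lambda>k. ?B * ((\<eta> k)\<^sup>2 * ?q k w)) T \<partial>M)"
    by (rule integral_mono[OF _ decay_rec_integral(1)[OF i0 ie] path]) (use cons_integrable in simp)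
  also have "\<dots> = decay_rec c (\<integral>w. cons 0 w / 2 \<partial>M) (\<lambda>k. \<integral>w. ?B * ((\<eta> k)\<^sup>2 * ?q k w) \<partial>M) T"
    by (rule decay_rec_integral(2)[OF i0 ie])
  also have "(\<lambda>k. \<integral>w. ?B * ((\<eta> k)\<^sup>2 * ?q k w) \<partial>M) = (\<lambda>k. ?B * ((\<eta> k)\<^sup>2 * Qk k))"
  proof
    fix k
    have "(\<integral>w. ?q k w \<partial>M) = Qk k" unfolding Qk_def integral_mult_right_zero
      by (subst Bochner_Integration.integral_sum) (auto intro: sqint_integrable[OF g_sqint])
    thus "(\<integral>w. ?B * ((\<eta> k)\<^sup>2 * ?q k w) \<partial>M) = ?B * ((\<eta> k)\<^sup>2 * Qk k)"
      by (simp only: integral_mult_right_zero)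
  qed
  also have "(\<integral>w. cons 0 w / 2 \<partial>M) = Yk 0 / 2" by (simp add: Yk_def)
  finally show ?thesis .
qed

end

subsection \<open>Solving the coupled recursions\<close>

text \<open>Tangent bounds of the convex functions \<open>1 / s\<close> and
  \<open>1 / s\<^sup>2\<close>; they compare a target rate with the same rate one step
  later.\<close>

lemma inverse_succ_bounds:
  fixes s :: real assumes "s > 0"
  shows "1 / s - 1 / s\<^sup>2 \<le> 1 / (s + 1)" "1 / s\<^sup>2 - 2 / s ^ 3 \<le> 1 / (s + 1)\<^sup>2"
proof -
  have "(1 / s - 1 / s\<^sup>2) * (s + 1) = 1 - 1 / s\<^sup>2"
    using assms by (simp add: field_simps power2_eq_square)
  also have "\<dots> \<le> 1" by simp
  finally show "1 / s - 1 / s\<^sup>2 \<le> 1 / (s + 1)" using assms by (subst pos_le_divide_eq) auto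
  have "(1 / s\<^sup>2 - 2 / s ^ 3) * (s + 1)\<^sup>2 = 1 - (3 * s + 2) / s ^ 3"
    using assms by (simp add: field_simps power2_eq_square power3_eq_cube)
  also have "\<dots> \<le> 1" using assms by simp
  finally show "1 / s\<^sup>2 - 2 / s ^ 3 \<le> 1 / (s + 1)\<^sup>2" using assms by (subst pos_le_divide_eq) auto
qed

text \<open>Joint induction. For \<open>D\<close> the \<open>1 / s\<close> part needs only
  \<open>a \<ge> 2\<close>, which keeps its coefficient exactly \<open>A * r\<close>; in the
  \<open>1 / s\<^sup>2\<close> part the margin \<open>a - 2 \<ge> 2 / 3\<close> and
  \<open>R = 3 * Mc\<close> absorb \<open>Mc * (B + 1) \<le> 2 * Mc * B\<close>. For
  \<open>W\<close> the gain \<open>c * B\<close> is halved: one half absorbs the constant forcing,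
  the other the feedback proportional to \<open>B\<close>, which comes with \<open>1 / s\<close> and
  is small once \<open>s\<close> is large. The threshold on \<open>s\<close> does not involve
  \<open>B\<close>.\<close>

lemma coupled_rates_late:
  fixes a c t A Mc B r P R :: real and D W :: "nat \<Rightarrow> real"
  assumes a: "a \<ge> 8 / 3" and c: "0 < c" "c < 1" and t: "t > 0" and A: "A \<ge> 0" and Mc: "Mc \<ge> 0"
    and r: "0 \<le> r" "r \<le> P"
    and R: "R = 3 * Mc" and B: "B \<ge> 1" "B \<ge> 2 * Mc * (1 + A * P) / c"
    and s: "real K + t \<ge> a" "real K + t \<ge> 2 * (Mc * (R + 1) + 2) / c"
    and base: "D K \<le> A * r / (real K + t) + R * B / (real K + t)\<^sup>2" "W K \<le> B / (real K + t)\<^sup>2"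
    and D_step: "\<And>k. k \<ge> K \<Longrightarrow> D (Suc k) \<le> (1 - a / (real k + t)) * D k + A * r / (real k + t)\<^sup>2
        + Mc * (W k / (real k + t) + 1 / (real k + t) ^ 3)"
    and W_step: "\<And>k. k \<ge> K \<Longrightarrow> W (Suc k) \<le> (1 - c) * W k + Mc / (real k + t)\<^sup>2 * (1 + D k + W k)"
  shows "k \<ge> K \<Longrightarrow> D k \<le> A * r / (real k + t) + R * B / (real k + t)\<^sup>2 \<and> W k \<le> B / (real k + t)\<^sup>2"
proof (induction k rule: dec_induct)
  case base
  show ?case using assms by blast
next
  case (step k)
  define s where "s = real k + t"
  have sK: "s \<ge> real K + t" using step by (simp add: s_def)
  have sa: "s \<ge> a" and sc: "s \<ge> 2 * (Mc * (R + 1) + 2) / c" using sK s by linarith+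
  have s1: "s \<ge> 1" using sa a by linarith
  hence s0: "s > 0" by simp
  have R0: "R \<ge> 0" using R Mc by simp
  have Suc: "real (Suc k) + t = s + 1" by (simp add: s_def)
  have IHD: "D k \<le> A * r / s + R * B / s\<^sup>2" and IHW: "W k \<le> B / s\<^sup>2" using step by (auto simp: s_def)
  have "D (Suc k) \<le> (1 - a / s) * D k + A * r / s\<^sup>2 + Mc * (W k / s + 1 / s ^ 3)"
    using D_step[of k] step by (simp add: s_def)
  also have "\<dots> \<le> (1 - a / s) * (A * r / s + R * B / s\<^sup>2) + A * r / s\<^sup>2 + Mc * (B / s\<^sup>2 / s + 1 / s ^ 3)"
    using IHD IHW s0 sa Mc by (intro add_mono mult_left_mono divide_right_mono order_refl) auto
  also have "\<dots> = A * r * (1 / s - (a - 1) / s\<^sup>2) + (R * B * (1 / s\<^sup>2 - a / s ^ 3) + Mc * (B + 1) / s ^ 3)"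
    using s0 by (simp add: field_simps power2_eq_square power3_eq_cube)
  also have "\<dots> \<le> A * r * (1 / (s + 1)) + R * B * (1 / (s + 1)\<^sup>2)"
  proof (rule add_mono)
    have "1 / s - (a - 1) / s\<^sup>2 \<le> 1 / s - 1 / s\<^sup>2" using a s0 by (simp add: divide_right_mono)
    also have "\<dots> \<le> 1 / (s + 1)" by (rule inverse_succ_bounds[OF s0])
    finally show "A * r * (1 / s - (a - 1) / s\<^sup>2) \<le> A * r * (1 / (s + 1))"
      using A r by (intro mult_left_mono) auto
    have "Mc * (B + 1) \<le> R * B * (a - 2)"
    proof -
      have "Mc * (B + 1) \<le> Mc * (2 * B)" using B Mc by (intro mult_left_mono) auto
      also have "\<dots> = R * B * (2 / 3)" by (simp add: R)
      also have "\<dots> \<le> R * B * (a - 2)" using a R0 B by (intro mult_left_mono) auto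
      finally show ?thesis .
    qed
    hence "Mc * (B + 1) / s ^ 3 \<le> R * B * (a - 2) / s ^ 3" using s0 by (intro divide_right_mono) auto
    hence "R * B * (1 / s\<^sup>2 - a / s ^ 3) + Mc * (B + 1) / s ^ 3 \<le> R * B * (1 / s\<^sup>2 - a / s ^ 3) + R * B * (a - 2) / s ^ 3"
      by simp
    also have "\<dots> = R * B * (1 / s\<^sup>2 - 2 / s ^ 3)" by (simp add: algebra_simps diff_divide_distrib)
    also have "\<dots> \<le> R * B * (1 / (s + 1)\<^sup>2)"
      using R0 B inverse_succ_bounds(2)[OF s0] by (intro mult_left_mono) auto
    finally show "R * B * (1 / s\<^sup>2 - a / s ^ 3) + Mc * (B + 1) / s ^ 3 \<le> R * B * (1 / (s + 1)\<^sup>2)" .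
  qed
  finally have D: "D (Suc k) \<le> A * r / (s + 1) + R * B / (s + 1)\<^sup>2" by simp
  have "W (Suc k) \<le> (1 - c) * W k + Mc / s\<^sup>2 * (1 + D k + W k)"
    using W_step[of k] step by (simp add: s_def)
  also have "\<dots> \<le> (1 - c) * (B / s\<^sup>2) + Mc / s\<^sup>2 * (1 + (A * P + R * B / s) + B / s)"
  proof (intro add_mono mult_left_mono order_refl)
    have "A * r / s \<le> A * P / 1" using A r s1 by (intro frac_le mult_left_mono) auto
    moreover have "R * B / s\<^sup>2 \<le> R * B / s" using s1 R0 B
      by (intro divide_left_mono) (auto simp: power2_eq_square)
    ultimately show "D k \<le> A * P + R * B / s" using IHD by simp
    have "B / s\<^sup>2 \<le> B / s" using s1 B
      by (intro divide_left_mono) (auto simp: power2_eq_square)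
    thus "W k \<le> B / s" using IHW by simp
  qed (use IHW c Mc s0 in auto)
  also have "\<dots> = (1 / s\<^sup>2) * ((1 - c) * B + Mc * (1 + A * P) + Mc * (R + 1) * B / s)"
    using s0 by (simp add: field_simps)
  also have "\<dots> \<le> (1 / s\<^sup>2) * (B - 2 * B / s)"
  proof (rule mult_left_mono)
    have "Mc * (1 + A * P) \<le> c / 2 * B" using B(2) c by (simp add: field_simps)
    moreover have "Mc * (R + 1) * B / s + 2 * B / s \<le> c / 2 * B"
    proof -
      have "2 * (Mc * (R + 1) + 2) \<le> s * c" using sc c by (simp add: pos_divide_le_eq)
      hence "(Mc * (R + 1) + 2) / s \<le> c / 2" using s0 by (simp add: field_simps)
      from mult_right_mono[OF this, of B] B show ?thesis by (simp add: algebra_simps add_divide_distrib)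
    qed
    ultimately show "(1 - c) * B + Mc * (1 + A * P) + Mc * (R + 1) * B / s \<le> B - 2 * B / s"
      unfolding left_diff_distrib mult_1 by linarith
  qed simp
  also have "\<dots> = B * (1 / s\<^sup>2 - 2 / s ^ 3)" by (simp add: algebra_simps power2_eq_square power3_eq_cube)
  also have "\<dots> \<le> B * (1 / (s + 1)\<^sup>2)"
    using B inverse_succ_bounds(2)[OF s0] by (intro mult_left_mono) auto
  finally have W: "W (Suc k) \<le> B / (s + 1)\<^sup>2" by simp
  show ?case unfolding Suc using D W by simp
qed

text \<open>The growth clause with \<open>\<Gamma>\<close> serves the steps before
  \<open>K0\<close>, where the inequality for \<open>D\<close> is not yet assumed. The number
  \<open>r\<close> will be \<open>p / n\<close> and is kept apart from the constants.\<close>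

definition coupled_recursion ::
  "real \<Rightarrow> real \<Rightarrow> real \<Rightarrow> real \<Rightarrow> real \<Rightarrow> real \<Rightarrow> real \<Rightarrow> nat \<Rightarrow> real \<Rightarrow> (nat \<Rightarrow> real) \<Rightarrow> (nat \<Rightarrow> real) \<Rightarrow> bool" where
  "coupled_recursion a c t A Mc \<Gamma> Z0 K0 r D W \<longleftrightarrow> (\<forall>k. 0 \<le> D k \<and> 0 \<le> W k) \<and>
     D 0 + W 0 + 1 \<le> Z0 \<and>
     (\<forall>k. D (Suc k) + W (Suc k) + 1 \<le> \<Gamma> * (D k + W k + 1)) \<and>
     (\<forall>k\<ge>K0. D (Suc k) \<le> (1 - a / (real k + t)) * D k + A * r / (real k + t)\<^sup>2
        + Mc * (W k / (real k + t) + 1 / (real k + t) ^ 3)) \<and>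
     (\<forall>k. W (Suc k) \<le> (1 - c) * W k + Mc / (real k + t)\<^sup>2 * (1 + D k + W k))"

text \<open>The constant is chosen before the sequences and \<open>r\<close>, hence uniformly in the
  problem. Up to a fixed index \<open>J\<close> crude geometric growth suffices; its bound then
  serves as base case of the late regime.\<close>

lemma coupled_rates:
  fixes a c t A Mc P \<Gamma> Z0 :: real
  assumes a: "a \<ge> 8 / 3" and c: "0 < c" "c < 1" and t: "t > 0" and A: "A \<ge> 0" and Mc: "Mc \<ge> 0"
    and P: "P \<ge> 0" and \<Gamma>: "\<Gamma> \<ge> 1" and Z0: "Z0 \<ge> 0"
  shows "\<exists>C>0. \<forall>D W r. 0 \<le> r \<longrightarrow> r \<le> P \<longrightarrow> coupled_recursion a c t A Mc \<Gamma> Z0 K0 r D W \<longrightarrow>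
     (\<forall>T\<ge>1. D T \<le> A * r / real T + C / (real T)\<^sup>2 \<and> W T \<le> C / (real T)\<^sup>2)"
proof -
  define Mc' where "Mc' = Mc + 1 / 3"
    \<comment> \<open>enlarging \<open>Mc\<close> makes the ratio \<open>3 * Mc'\<close> of the two bounds at least \<open>1\<close>, so that one \<open>B\<close> serves both\<close>
  have Mc': "Mc' \<ge> 0" "Mc \<le> Mc'" using Mc by (auto simp: Mc'_def)
  define R2 where "R2 = 3 * Mc'"
  have R2: "R2 \<ge> 1" using Mc by (simp add: R2_def Mc'_def)
  obtain K2 :: nat where K2: "real K2 \<ge> max a (2 * (Mc' * (R2 + 1) + 2) / c)"
    using real_arch_simple by blast
  define J where "J = max K0 K2"
  have J: "J \<ge> K0" "real J + t \<ge> a" "real J + t \<ge> 2 * (Mc' * (R2 + 1) + 2) / c"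
    using K2 t by (auto simp: J_def)
  define z where "z = \<Gamma> ^ J * Z0"
  have z: "z \<ge> 0" using Z0 \<Gamma> by (simp add: z_def)
  \<comment> \<open>One summand for each of the two lower bounds on \<open>B\<close>, and one that
    puts the crude bound \<open>z\<close> under the target at \<open>J\<close>. Enlarging
    \<open>B\<close> is harmless because \<open>J\<close> was fixed without it.\<close>
  define b where "b = 1 + 2 * Mc' * (1 + A * P) / c + z * (real J + t)\<^sup>2"
  have p1: "0 \<le> 2 * Mc' * (1 + A * P) / c" using A P Mc' c by simp
  have p2: "0 \<le> z * (real J + t)\<^sup>2" using z by simp
  have b: "b \<ge> 1" "b \<ge> 2 * Mc' * (1 + A * P) / c" "b \<ge> z * (real J + t)\<^sup>2"
    using p1 p2 unfolding b_def by linarith+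
  \<comment> \<open>The second summand serves \<open>T < J\<close>, where only the bound
    \<open>z\<close> is available: there
    \<open>z \<le> z * (real J)\<^sup>2 / (real T)\<^sup>2\<close>.\<close>
  define C where "C = R2 * b + z * (real J)\<^sup>2"
  have bC: "R2 * b \<le> C" using z by (simp add: C_def)
  have "1 * b \<le> R2 * b" using R2 b by (intro mult_right_mono) auto
  hence bC': "b \<le> C" using bC by simp
  have C0: "C > 0" using bC' b by simp
  show ?thesis
  proof (rule exI[of _ C], rule conjI[OF C0], intro allI impI)
    fix D W :: "nat \<Rightarrow> real" and r :: real and T :: nat
    assume r: "0 \<le> r" "r \<le> P" and rec: "coupled_recursion a c t A Mc \<Gamma> Z0 K0 r D W" and T: "1 \<le> T"
    have nn: "\<forall>k. 0 \<le> D k \<and> 0 \<le> W k" and init: "D 0 + W 0 + 1 \<le> Z0"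
      and early: "\<forall>k. D (Suc k) + W (Suc k) + 1 \<le> \<Gamma> * (D k + W k + 1)"
      and D_step: "\<forall>k\<ge>K0. D (Suc k) \<le> (1 - a / (real k + t)) * D k + A * r / (real k + t)\<^sup>2
        + Mc * (W k / (real k + t) + 1 / (real k + t) ^ 3)"
      and W_step: "\<forall>k. W (Suc k) \<le> (1 - c) * W k + Mc / (real k + t)\<^sup>2 * (1 + D k + W k)"
      using rec unfolding coupled_recursion_def by blast+
    have st: "real k + t > 0" for k using t by simp
    have grow: "D k + W k + 1 \<le> \<Gamma> ^ k * Z0" for k
    proof (induction k)
      case (Suc k)
      have "D (Suc k) + W (Suc k) + 1 \<le> \<Gamma> * (D k + W k + 1)" using early by blast
      also have "\<dots> \<le> \<Gamma> * (\<Gamma> ^ k * Z0)" using Suc \<Gamma> by (intro mult_left_mono) auto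
      finally show ?case by simp
    qed (use init in simp)
    have zJ: "D k + W k \<le> z" if "k \<le> J" for k
    proof -
      have "D k + W k \<le> \<Gamma> ^ k * Z0" using grow[of k] by linarith
      also have "\<dots> \<le> z" unfolding z_def using that \<Gamma> Z0 by (intro mult_right_mono power_increasing) auto
      finally show ?thesis .
    qed
    show "D T \<le> A * r / real T + C / (real T)\<^sup>2 \<and> W T \<le> C / (real T)\<^sup>2"
    proof (cases "T \<ge> J")
      case True
      have zb: "z \<le> b / (real J + t)\<^sup>2" using b(3) st[of J] by (simp add: pos_le_divide_eq)
      have "D T \<le> A * r / (real T + t) + R2 * b / (real T + t)\<^sup>2 \<and> W T \<le> b / (real T + t)\<^sup>2"
      proof (rule coupled_rates_late[OF a c t A Mc'(1) r R2_def b(1,2) J(2,3) _ _ _ _ True])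
        have "D J \<le> z" "W J \<le> z" using zJ[of J] nn[rule_format, of J] by linarith+
        have "D J \<le> b / (real J + t)\<^sup>2" using zb \<open>D J \<le> z\<close> by simp
        also have "\<dots> \<le> R2 * b / (real J + t)\<^sup>2" using R2 b by (intro divide_right_mono) auto
        also have "\<dots> \<le> A * r / (real J + t) + R2 * b / (real J + t)\<^sup>2" using A r st[of J] by simp
        finally show "D J \<le> A * r / (real J + t) + R2 * b / (real J + t)\<^sup>2" .
        show "W J \<le> b / (real J + t)\<^sup>2" using zb \<open>W J \<le> z\<close> by simp
        fix k assume k: "J \<le> k"
        have "D (Suc k) \<le> (1 - a / (real k + t)) * D k + A * r / (real k + t)\<^sup>2
          + Mc * (W k / (real k + t) + 1 / (real k + t) ^ 3)" using D_step J(1) k by simp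
        also have "\<dots> \<le> (1 - a / (real k + t)) * D k + A * r / (real k + t)\<^sup>2
          + Mc' * (W k / (real k + t) + 1 / (real k + t) ^ 3)"
          using Mc' nn st[of k] by (intro add_left_mono mult_right_mono) (auto intro!: add_nonneg_nonneg)
        finally show "D (Suc k) \<le> (1 - a / (real k + t)) * D k + A * r / (real k + t)\<^sup>2
          + Mc' * (W k / (real k + t) + 1 / (real k + t) ^ 3)" .
        have "W (Suc k) \<le> (1 - c) * W k + Mc / (real k + t)\<^sup>2 * (1 + D k + W k)" using W_step by blast
        also have "\<dots> \<le> (1 - c) * W k + Mc' / (real k + t)\<^sup>2 * (1 + D k + W k)"
          using Mc' nn by (intro add_left_mono mult_right_mono divide_right_mono) (auto intro!: add_nonneg_nonneg)
        finally show "W (Suc k) \<le> (1 - c) * W k + Mc' / (real k + t)\<^sup>2 * (1 + D k + W k)" .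
      qed
      moreover have "A * r / (real T + t) \<le> A * r / real T"
        using A r T t by (intro divide_left_mono) auto
      moreover have "R2 * b / (real T + t)\<^sup>2 \<le> C / (real T)\<^sup>2"
        using bC T t C0 by (intro frac_le power_mono) auto
      moreover have "b / (real T + t)\<^sup>2 \<le> C / (real T)\<^sup>2"
        using bC' T t C0 by (intro frac_le power_mono) auto
      ultimately show ?thesis by linarith
    next
      case False
      hence TJ: "T \<le> J" by simp
      have "z * (real T)\<^sup>2 \<le> z * (real J)\<^sup>2" using TJ z by (intro mult_left_mono power_mono) auto
      also have "\<dots> \<le> C" using R2 b by (simp add: C_def)
      finally have "z \<le> C / (real T)\<^sup>2" using T by (simp add: pos_le_divide_eq)
      moreover have "D T \<le> z" "W T \<le> z" using zJ[OF TJ] nn[rule_format, of T] by linarith+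
      moreover have "0 \<le> A * r / real T" using A r by simp
      ultimately show ?thesis by linarith
    qed
  qed
qed

text \<open>In the application \<open>D\<close> is the expected suboptimality of the average, \<open>G\<close> the expected squared
  gradient there, \<open>Y\<close> the expected consensus error, \<open>Q\<close> the mean second moment of the estimators,
  \<open>W\<close> a bound for the Lyapunov function per agent, and \<open>db\<close> bounds the squared smoothing radii.\<close>

definition zo_recursion where
  "zo_recursion Lf \<nu> \<kappa>\<delta> s0 s1 st0 s2 q t c cV B (n :: nat) (p :: nat) D G Y Q W \<eta> db \<longleftrightarrow>
    (\<forall>k. \<eta> k = q / (real k + t)) \<and>
    (\<forall>k. db k = \<kappa>\<delta>\<^sup>2 * real p * \<eta> k / (real n + real p)) \<and>
    (\<forall>k. 0 \<le> D k \<and> 0 \<le> G k \<and> 0 \<le> Y k \<and> 0 \<le> Q k \<and> 0 \<le> W k) \<and>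
    (\<forall>k. D (Suc k) \<le> D k - \<eta> k / 2 * G k + (\<eta> k / 2 + Lf * (\<eta> k)\<^sup>2) * (2 * Lf\<^sup>2 * db k + 2 * Lf\<^sup>2 * Y k)
       + Lf * (\<eta> k)\<^sup>2 * G k + Lf / 2 * (\<eta> k)\<^sup>2 * (Q k / real n)) \<and>
    (\<forall>k. Q k \<le> 4 * real p * (1 + s0\<^sup>2) * (2 * Lf\<^sup>2 * Y k + 4 * (1 + st0\<^sup>2) * G k + 4 * s2\<^sup>2)
       + 4 * real p * s1\<^sup>2 + (real p)\<^sup>2 * Lf\<^sup>2 * db k / 2) \<and>
    (\<forall>k. G k \<le> 2 * Lf * D k) \<and> (\<forall>k. 2 * \<nu> * D k \<le> G k) \<and>
    (\<forall>k. cV * Y k \<le> W k) \<and>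
    (\<forall>k. W (Suc k) = (1 - c) * W k + B * ((\<eta> k)\<^sup>2 * Q k))"

text \<open>The factor \<open>p / n\<close> has to be kept in two places: in the squared bias, which
  gives \<open>Lf\<^sup>2 * \<kappa>\<delta>\<^sup>2\<close>, and in the part \<open>p * K0\<close>
  of the second moment that does not decay, which gives \<open>Lf * K0 / 2\<close>. All other terms
  carry a further \<open>\<eta>\<close>, \<open>G\<close> or \<open>Y\<close>, and there
  \<open>p\<close> is replaced by its bound \<open>P\<close>.\<close>

lemma rate_bound:
  fixes Lf \<nu> \<kappa>\<delta> s0 s1 st0 s2 q t P c cV B \<Delta>f \<Delta>x :: real
  assumes Lf: "Lf > 0" and \<nu>: "\<nu> > 0" and q: "q > 0" "8 / 3 \<le> q * \<nu> / 2" and t: "t > 0" and P: "P \<ge> 0"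
    and c: "0 < c" "c < 1" and cV: "cV > 0" and B: "B \<ge> 0"
  defines "K0 \<equiv> 16 * (1 + s0\<^sup>2) * s2\<^sup>2 + 4 * s1\<^sup>2"
  shows "\<exists>C>0. \<forall>n p D G Y Q W \<eta> db. n \<ge> 1 \<longrightarrow> p \<ge> 1 \<longrightarrow> real p \<le> P \<longrightarrow> D 0 \<le> \<Delta>f \<longrightarrow> W 0 \<le> \<Delta>x \<longrightarrow>
    zo_recursion Lf \<nu> \<kappa>\<delta> s0 s1 st0 s2 q t c cV B n p D G Y Q W \<eta> db \<longrightarrow>
    (\<forall>T\<ge>1. D T \<le> q\<^sup>2 * (Lf\<^sup>2 * \<kappa>\<delta>\<^sup>2 + Lf * K0 / 2) * (real p / (real n * real T)) + C * (real p / (real T)\<^sup>2)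
       \<and> Y T \<le> C * (real p / (real T)\<^sup>2))"
proof -
  define e where "e = q / t"
  define K1 where "K1 = 8 * P * (1 + s0\<^sup>2) * Lf\<^sup>2 + 16 * P * (1 + s0\<^sup>2) * (1 + st0\<^sup>2) + P\<^sup>2 * Lf\<^sup>2 * \<kappa>\<delta>\<^sup>2 / 2"
  define K2 where "K2 = 2 * Lf ^ 3 * \<kappa>\<delta>\<^sup>2 * P + Lf / 2 * K1 + Lf\<^sup>2 + 2 * Lf ^ 3"
  define K3 where "K3 = Lf + Lf * K1 / 2"
  define Ca where "Ca = Lf\<^sup>2 * \<kappa>\<delta>\<^sup>2 + Lf * K0 / 2"
  \<comment> \<open>All coefficients that must lie below one common constant; being nonnegative,
    each is bounded by the sum.\<close>
  define Mc where "Mc = K2 * q * (1 + e) / cV + K2 * q ^ 3 + B * q\<^sup>2 * (P * K0 + K1 * e)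
      + B * q\<^sup>2 * K1 * (2 * Lf) + B * q\<^sup>2 * K1 / cV"
  define \<Gamma> where "\<Gamma> = 1 + Mc / t\<^sup>2 + 2 * Lf * K3 * e\<^sup>2 + Ca * e\<^sup>2 * P + Mc / t + Mc / t ^ 3"
  define a where "a = q * \<nu> / 2"
  define A where "A = q\<^sup>2 * Ca"
  define Z0 where "Z0 = \<bar>\<Delta>f\<bar> + \<bar>\<Delta>x\<bar> + 1"
  have K0: "K0 \<ge> 0" by (simp add: K0_def)
  have K1: "K1 \<ge> 0" using P by (simp add: K1_def)
  have K2: "K2 \<ge> 0" using P Lf K1 by (simp add: K2_def)
  have K3: "K3 \<ge> 0" using Lf K1 by (simp add: K3_def)
  have Ca: "Ca \<ge> 0" using Lf K0 by (simp add: Ca_def)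
  have e: "e \<ge> 0" using q t by (simp add: e_def)
  have M_parts: "0 \<le> K2 * q * (1 + e) / cV" "0 \<le> K2 * q ^ 3" "0 \<le> B * q\<^sup>2 * (P * K0 + K1 * e)"
      "0 \<le> B * q\<^sup>2 * K1 * (2 * Lf)" "0 \<le> B * q\<^sup>2 * K1 / cV"
    using K0 K1 K2 e q cV B P Lf by auto
  have Mc: "Mc \<ge> 0" using M_parts unfolding Mc_def by linarith
  have \<Gamma>_parts: "0 \<le> Mc / t\<^sup>2" "0 \<le> 2 * Lf * K3 * e\<^sup>2" "0 \<le> Ca * e\<^sup>2 * P" "0 \<le> Mc / t" "0 \<le> Mc / t ^ 3"
    using Mc t Lf K3 Ca P by auto
  have \<Gamma>: "\<Gamma> \<ge> 1" using \<Gamma>_parts unfolding \<Gamma>_def by linarith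
  have A0: "A \<ge> 0" using Ca by (simp add: A_def)
  have a: "a \<ge> 8 / 3" using q by (simp add: a_def)
  \<comment> \<open>From \<open>J\<close> on \<open>K3 * \<eta> k \<le> 1 / 4\<close>, so the
    second-order gradient terms consume at most half of the decrease
    \<open>\<eta> k / 2 * G k\<close>. The Polyak-Lojasiewicz inequality turns the other half into
    \<open>a / (real k + t) * D k\<close>.\<close>
  obtain J :: nat where J: "real J \<ge> 4 * K3 * q" using real_arch_simple by blast
  have Z0: "Z0 \<ge> 0" by (simp add: Z0_def)
  obtain C where C: "C > 0" and main: "\<And>D W r T. 0 \<le> r \<Longrightarrow> r \<le> P \<Longrightarrow>
      coupled_recursion a c t A Mc \<Gamma> Z0 J r D W \<Longrightarrow> 1 \<le> T \<Longrightarrow>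
      D T \<le> A * r / real T + C / (real T)\<^sup>2 \<and> W T \<le> C / (real T)\<^sup>2"
    using coupled_rates[OF a c t A0 Mc P \<Gamma> Z0, of J] by blast
  define C' where "C' = C + C / cV"
  have C': "C' > 0" "C \<le> C'" "C / cV \<le> C'" using C cV by (auto simp: C'_def intro!: add_pos_nonneg)
  show ?thesis
  proof (rule exI[of _ C'], rule conjI[OF C'(1)], intro allI impI)
    fix n p :: nat and D G Y Q W \<eta> db :: "nat \<Rightarrow> real" and T :: nat
    assume n: "n \<ge> 1" and p: "p \<ge> 1" and pP: "real p \<le> P" and D0: "D 0 \<le> \<Delta>f" and W0: "W 0 \<le> \<Delta>x"
      and rec: "zo_recursion Lf \<nu> \<kappa>\<delta> s0 s1 st0 s2 q t c cV B n p D G Y Q W \<eta> db" and T: "1 \<le> T"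
    have \<eta>': "\<forall>k. \<eta> k = q / (real k + t)" and db': "\<forall>k. db k = \<kappa>\<delta>\<^sup>2 * real p * \<eta> k / (real n + real p)"
      and nn: "\<forall>k. 0 \<le> D k \<and> 0 \<le> G k \<and> 0 \<le> Y k \<and> 0 \<le> Q k \<and> 0 \<le> W k"
      and D': "\<forall>k. D (Suc k) \<le> D k - \<eta> k / 2 * G k + (\<eta> k / 2 + Lf * (\<eta> k)\<^sup>2) * (2 * Lf\<^sup>2 * db k + 2 * Lf\<^sup>2 * Y k)
       + Lf * (\<eta> k)\<^sup>2 * G k + Lf / 2 * (\<eta> k)\<^sup>2 * (Q k / real n)"
      and Q': "\<forall>k. Q k \<le> 4 * real p * (1 + s0\<^sup>2) * (2 * Lf\<^sup>2 * Y k + 4 * (1 + st0\<^sup>2) * G k + 4 * s2\<^sup>2)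
       + 4 * real p * s1\<^sup>2 + (real p)\<^sup>2 * Lf\<^sup>2 * db k / 2"
      and G': "\<forall>k. G k \<le> 2 * Lf * D k" and PL': "\<forall>k. 2 * \<nu> * D k \<le> G k" and Y': "\<forall>k. cV * Y k \<le> W k"
      and W': "\<forall>k. W (Suc k) = (1 - c) * W k + B * ((\<eta> k)\<^sup>2 * Q k)"
      using rec unfolding zo_recursion_def by blast+
    define r where "r = real p / real n"
    have r0: "0 \<le> r" by (simp add: r_def)
    have rp: "r \<le> real p" using n divide_left_mono[of 1 "real n" "real p"] by (simp add: r_def)
    have rP: "r \<le> P" using rp pP by simp
    have s0': "real k + t > 0" for k using t by simp
    have \<eta>0: "0 \<le> \<eta> k" for k using \<eta>' q s0'[of k] by (simp add: less_imp_le)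
    have \<eta>e: "\<eta> k \<le> e" for k unfolding \<eta>'[rule_format] e_def using q t by (intro divide_left_mono) auto
    have nnk: "0 \<le> D k" "0 \<le> G k" "0 \<le> Y k" "0 \<le> Q k" "0 \<le> W k" for k using nn by auto
    \<comment> \<open>Two readings of \<open>p / (n + p)\<close>: the first feeds the leading term
      through the squared bias, the second keeps the contribution to the second moment of order
      \<open>\<eta> k\<close>.\<close>
    have db1: "db k \<le> \<kappa>\<delta>\<^sup>2 * r * \<eta> k" and db2: "db k \<le> \<kappa>\<delta>\<^sup>2 * \<eta> k" for k
    proof -
      have "real p / (real n + real p) \<le> r" unfolding r_def using n by (intro divide_left_mono) auto
      moreover have "real p / (real n + real p) \<le> 1" using n by simp
      moreover have "db k = \<kappa>\<delta>\<^sup>2 * \<eta> k * (real p / (real n + real p))" using db' by simp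
      moreover have "0 \<le> \<kappa>\<delta>\<^sup>2 * \<eta> k" using \<eta>0 by simp
      ultimately show "db k \<le> \<kappa>\<delta>\<^sup>2 * r * \<eta> k" "db k \<le> \<kappa>\<delta>\<^sup>2 * \<eta> k"
        using mult_left_mono[of "real p / (real n + real p)" r "\<kappa>\<delta>\<^sup>2 * \<eta> k"]
          mult_left_mono[of "real p / (real n + real p)" 1 "\<kappa>\<delta>\<^sup>2 * \<eta> k"] by (simp_all add: mult_ac)
    qed
    have Qb: "Q k \<le> real p * K0 + K1 * (G k + Y k + \<eta> k)" for k
    proof -
      have 1: "8 * real p * (1 + s0\<^sup>2) * Lf\<^sup>2 * Y k \<le> 8 * P * (1 + s0\<^sup>2) * Lf\<^sup>2 * Y k"
        using pP nnk[of k] by (intro mult_right_mono) auto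
      have 2: "16 * real p * (1 + s0\<^sup>2) * (1 + st0\<^sup>2) * G k \<le> 16 * P * (1 + s0\<^sup>2) * (1 + st0\<^sup>2) * G k"
        using pP nnk[of k] by (intro mult_right_mono) auto
      have "(real p)\<^sup>2 * Lf\<^sup>2 * db k / 2 \<le> P\<^sup>2 * Lf\<^sup>2 * (\<kappa>\<delta>\<^sup>2 * \<eta> k) / 2"
        using pP db2[of k] \<eta>0[of k] db' n Lf by (intro divide_right_mono mult_mono power_mono) auto
      hence 3: "(real p)\<^sup>2 * Lf\<^sup>2 * db k / 2 \<le> P\<^sup>2 * Lf\<^sup>2 * \<kappa>\<delta>\<^sup>2 / 2 * \<eta> k" by (simp add: mult_ac)
      define k1 where "k1 = 8 * P * (1 + s0\<^sup>2) * Lf\<^sup>2"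
      define k2 where "k2 = 16 * P * (1 + s0\<^sup>2) * (1 + st0\<^sup>2)"
      define k3 where "k3 = P\<^sup>2 * Lf\<^sup>2 * \<kappa>\<delta>\<^sup>2 / 2"
      have k123: "0 \<le> k1" "0 \<le> k2" "0 \<le> k3" "K1 = k1 + k2 + k3" using P by (auto simp: k1_def k2_def k3_def K1_def)
      have 4: "k1 * Y k \<le> K1 * Y k" "k2 * G k \<le> K1 * G k" "k3 * \<eta> k \<le> K1 * \<eta> k"
        using k123 nnk[of k] \<eta>0[of k] by (auto intro!: mult_right_mono)
      have "Q k \<le> (8 * real p * (1 + s0\<^sup>2) * Lf\<^sup>2 * Y k) + (16 * real p * (1 + s0\<^sup>2) * (1 + st0\<^sup>2) * G k) + real p * K0
          + (real p)\<^sup>2 * Lf\<^sup>2 * db k / 2"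
        using Q'[rule_format, of k] by (simp add: K0_def algebra_simps)
      also have "\<dots> \<le> K1 * Y k + K1 * G k + real p * K0 + K1 * \<eta> k"
        using 1 2 3 4 unfolding k1_def k2_def k3_def by linarith
      finally show ?thesis by (simp add: algebra_simps)
    qed
    \<comment> \<open>The factor \<open>1 / n\<close> is kept only where it matters; in the
      remaining part \<open>n \<ge> 1\<close> is enough.\<close>
    have Qn: "Q k / real n \<le> r * K0 + K1 * (G k + Y k + \<eta> k)" for k
    proof -
      have "Q k / real n \<le> (real p * K0 + K1 * (G k + Y k + \<eta> k)) / real n"
        by (intro divide_right_mono Qb) simp
      also have "\<dots> = r * K0 + K1 * (G k + Y k + \<eta> k) / real n" by (simp add: r_def add_divide_distrib)
      also have "K1 * (G k + Y k + \<eta> k) / real n \<le> K1 * (G k + Y k + \<eta> k) / 1"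
        using K1 nnk[of k] \<eta>0[of k] n by (intro divide_left_mono) auto
      finally show ?thesis by simp
    qed
    have D1: "D (Suc k) \<le> D k - (\<eta> k / 2 - K3 * (\<eta> k)\<^sup>2) * G k + Ca * (\<eta> k)\<^sup>2 * r
        + K2 * (\<eta> k * Y k + (\<eta> k)\<^sup>2 * Y k + (\<eta> k) ^ 3)" for k
    proof -
      define h where "h = \<eta> k"
      have h0: "0 \<le> h" using \<eta>0 by (simp add: h_def)
      have "D (Suc k) \<le> D k - h / 2 * G k + (h / 2 + Lf * h\<^sup>2) * (2 * Lf\<^sup>2 * db k + 2 * Lf\<^sup>2 * Y k)
         + Lf * h\<^sup>2 * G k + Lf / 2 * h\<^sup>2 * (Q k / real n)" using D' by (simp add: h_def)
      also have "\<dots> \<le> D k - h / 2 * G k + (h / 2 + Lf * h\<^sup>2) * (2 * Lf\<^sup>2 * (\<kappa>\<delta>\<^sup>2 * r * h) + 2 * Lf\<^sup>2 * Y k)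
         + Lf * h\<^sup>2 * G k + Lf / 2 * h\<^sup>2 * (r * K0 + K1 * (G k + Y k + h))"
        using db1[of k] Qn[of k] h0 Lf unfolding h_def
        by (intro add_mono mult_left_mono order_refl) auto
      also have "\<dots> = D k - (h / 2 - K3 * h\<^sup>2) * G k + Ca * h\<^sup>2 * r
         + ((Lf\<^sup>2) * (h * Y k) + (2 * Lf ^ 3 + Lf / 2 * K1) * (h\<^sup>2 * Y k) + (2 * Lf ^ 3 * \<kappa>\<delta>\<^sup>2 * r + Lf / 2 * K1) * h ^ 3)"
        by (simp add: K3_def Ca_def algebra_simps power2_eq_square power3_eq_cube add_divide_distrib)
      also have "(Lf\<^sup>2) * (h * Y k) + (2 * Lf ^ 3 + Lf / 2 * K1) * (h\<^sup>2 * Y k) + (2 * Lf ^ 3 * \<kappa>\<delta>\<^sup>2 * r + Lf / 2 * K1) * h ^ 3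
         \<le> K2 * (h * Y k) + K2 * (h\<^sup>2 * Y k) + K2 * h ^ 3"
      proof (intro add_mono mult_right_mono)
        have z: "0 \<le> 2 * Lf ^ 3 * \<kappa>\<delta>\<^sup>2 * P" "0 \<le> Lf / 2 * K1" "0 \<le> Lf\<^sup>2" "0 \<le> 2 * Lf ^ 3"
          using Lf P K1 by auto
        show "Lf\<^sup>2 \<le> K2" "2 * Lf ^ 3 + Lf / 2 * K1 \<le> K2" using z unfolding K2_def by linarith+
        have "2 * Lf ^ 3 * \<kappa>\<delta>\<^sup>2 * r \<le> 2 * Lf ^ 3 * \<kappa>\<delta>\<^sup>2 * P" using rP Lf by (intro mult_left_mono) auto
        thus "2 * Lf ^ 3 * \<kappa>\<delta>\<^sup>2 * r + Lf / 2 * K1 \<le> K2" using z unfolding K2_def by linarith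
      qed (use h0 nnk[of k] in auto)
      finally show ?thesis by (simp add: h_def algebra_simps)
    qed
    have YW: "Y k \<le> W k / cV" for k using Y' cV by (simp add: pos_le_divide_eq mult.commute)
    have noise: "K2 * (\<eta> k * Y k + (\<eta> k)\<^sup>2 * Y k + (\<eta> k) ^ 3)
        \<le> Mc * (W k / (real k + t) + 1 / (real k + t) ^ 3)" for k
    proof -
      define s where "s = real k + t"
      have s: "s > 0" using s0' by (simp add: s_def)
      have h: "\<eta> k = q / s" using \<eta>' by (simp add: s_def)
      have "\<eta> k * Y k + (\<eta> k)\<^sup>2 * Y k = \<eta> k * (1 + \<eta> k) * Y k" by (simp add: algebra_simps power2_eq_square)
      also have "\<dots> \<le> \<eta> k * (1 + e) * (W k / cV)"
        using \<eta>e[of k] \<eta>0[of k] YW[of k] nnk[of k] e by (intro mult_mono) auto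
      also have "\<dots> = q * (1 + e) / cV * (W k / s)" by (simp add: h)
      finally have "K2 * (\<eta> k * Y k + (\<eta> k)\<^sup>2 * Y k) \<le> K2 * (q * (1 + e) / cV * (W k / s))"
        using K2 by (rule mult_left_mono)
      moreover have "K2 * (\<eta> k * Y k + (\<eta> k)\<^sup>2 * Y k + (\<eta> k) ^ 3)
          = K2 * (\<eta> k * Y k + (\<eta> k)\<^sup>2 * Y k) + (K2 * q ^ 3) * (1 / s ^ 3)"
        unfolding distrib_left[of K2 _ "(\<eta> k) ^ 3"] by (simp add: h power_divide)
      moreover have "K2 * (q * (1 + e) / cV * (W k / s)) = (K2 * q * (1 + e) / cV) * (W k / s)" by simp
      ultimately have "K2 * (\<eta> k * Y k + (\<eta> k)\<^sup>2 * Y k + (\<eta> k) ^ 3)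
          \<le> (K2 * q * (1 + e) / cV) * (W k / s) + (K2 * q ^ 3) * (1 / s ^ 3)"
        by linarith
      also have "\<dots> \<le> Mc * (W k / s) + Mc * (1 / s ^ 3)"
      proof (intro add_mono mult_right_mono)
        show "K2 * q * (1 + e) / cV \<le> Mc" "K2 * q ^ 3 \<le> Mc" using M_parts unfolding Mc_def by linarith+
      qed (use s nnk[of k] in auto)
      finally show ?thesis by (simp add: s_def distrib_left)
    qed
    have Ws: "W (Suc k) \<le> (1 - c) * W k + Mc / (real k + t)\<^sup>2 * (1 + D k + W k)" for k
    proof -
      define s where "s = real k + t"
      have s: "s > 0" using s0' by (simp add: s_def)
      have h: "\<eta> k = q / s" using \<eta>' by (simp add: s_def)
      have "Q k \<le> P * K0 + K1 * (2 * Lf * D k + W k / cV + e)"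
        using Qb[of k] G'[rule_format, of k] YW[of k] \<eta>e[of k] K1 mult_right_mono[OF pP K0]
          mult_left_mono[of "G k + Y k + \<eta> k" "2 * Lf * D k + W k / cV + e" K1] by linarith
      hence "B * ((\<eta> k)\<^sup>2 * Q k) \<le> B * ((\<eta> k)\<^sup>2 * (P * K0 + K1 * (2 * Lf * D k + W k / cV + e)))"
        using B by (intro mult_left_mono) auto
      also have "\<dots> = (1 / s\<^sup>2) * ((B * q\<^sup>2 * (P * K0 + K1 * e)) * 1 + (B * q\<^sup>2 * K1 * (2 * Lf)) * D k + (B * q\<^sup>2 * K1 / cV) * W k)"
        by (simp add: h power_divide algebra_simps)
      also have "\<dots> \<le> (1 / s\<^sup>2) * (Mc * 1 + Mc * D k + Mc * W k)"
      proof (intro add_mono mult_right_mono mult_left_mono)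
        show "B * q\<^sup>2 * (P * K0 + K1 * e) \<le> Mc" "B * q\<^sup>2 * K1 * (2 * Lf) \<le> Mc" "B * q\<^sup>2 * K1 / cV \<le> Mc"
          using M_parts unfolding Mc_def by linarith+
      qed (use nnk[of k] in auto)
      finally show ?thesis using W'[rule_format, of k] by (simp add: s_def distrib_left)
    qed
    have "coupled_recursion a c t A Mc \<Gamma> Z0 J r D W" unfolding coupled_recursion_def
    proof (intro conjI)
      show "\<forall>k. 0 \<le> D k \<and> 0 \<le> W k" using nn by blast
      show "D 0 + W 0 + 1 \<le> Z0" unfolding Z0_def using D0 W0 abs_ge_self[of \<Delta>f] abs_ge_self[of \<Delta>x] by linarith
      show "\<forall>k. D (Suc k) + W (Suc k) + 1 \<le> \<Gamma> * (D k + W k + 1)"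
      proof
        fix k
        define s where "s = real k + t"
        have s: "s > 0" "s \<ge> t" using s0' by (auto simp: s_def)
        define z where "z = D k + W k + 1"
        have z: "D k \<le> z" "W k \<le> z" "1 \<le> z" using nnk[of k] by (auto simp: z_def)
        have e2: "(\<eta> k)\<^sup>2 \<le> e\<^sup>2" using \<eta>e \<eta>0 by (intro power_mono) auto
        have "- (\<eta> k / 2 - K3 * (\<eta> k)\<^sup>2) * G k \<le> K3 * (\<eta> k)\<^sup>2 * G k"
          using \<eta>0[of k] nnk[of k] by (intro mult_right_mono) auto
        also have "\<dots> \<le> K3 * e\<^sup>2 * (2 * Lf * D k)"
          using e2 K3 G' nnk[of k] Lf by (intro mult_mono mult_left_mono) auto
        also have "\<dots> \<le> K3 * e\<^sup>2 * (2 * Lf * z)" using K3 Lf z by (intro mult_left_mono) auto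
        finally have 1: "- (\<eta> k / 2 - K3 * (\<eta> k)\<^sup>2) * G k \<le> 2 * Lf * K3 * e\<^sup>2 * z" by (simp add: mult_ac)
        have "Ca * (\<eta> k)\<^sup>2 * r \<le> Ca * e\<^sup>2 * P * 1" using e2 Ca rP r0 by (simp, intro mult_mono mult_left_mono) auto
        also have "\<dots> \<le> Ca * e\<^sup>2 * P * z" using z Ca P by (intro mult_left_mono) auto
        finally have 2: "Ca * (\<eta> k)\<^sup>2 * r \<le> Ca * e\<^sup>2 * P * z" .
        have "Mc * (W k / s + 1 / s ^ 3) \<le> Mc * (z / t + z / t ^ 3)"
          using Mc s t z nnk[of k] by (intro mult_left_mono add_mono frac_le power_mono) auto
        hence 3: "Mc * (W k / s + 1 / s ^ 3) \<le> Mc / t * z + Mc / t ^ 3 * z" by (simp add: distrib_left)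
        have "Mc / s\<^sup>2 * (1 + D k + W k) \<le> Mc / t\<^sup>2 * z"
          using Mc s t z by (intro mult_mono frac_le power_mono) (auto simp: z_def)
        moreover have "0 \<le> c * W k" using c nnk[of k] by simp
        moreover have "(1 - c) * W k = W k - c * W k" by (simp add: algebra_simps)
        ultimately have 4: "W (Suc k) \<le> W k + Mc / t\<^sup>2 * z"
          using Ws[of k] unfolding s_def by linarith
        have "D (Suc k) \<le> D k + 2 * Lf * K3 * e\<^sup>2 * z + Ca * e\<^sup>2 * P * z + (Mc / t * z + Mc / t ^ 3 * z)"
          using D1[of k] noise[of k] 1 2 3 unfolding s_def by linarith
        with 4 have "D (Suc k) + W (Suc k) + 1 \<le> z + Mc / t\<^sup>2 * z + 2 * Lf * K3 * e\<^sup>2 * z + Ca * e\<^sup>2 * P * z + Mc / t * z + Mc / t ^ 3 * z"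
          unfolding z_def by linarith
        also have "\<dots> = \<Gamma> * z" unfolding \<Gamma>_def distrib_right by simp
        finally show "D (Suc k) + W (Suc k) + 1 \<le> \<Gamma> * (D k + W k + 1)" by (simp add: z_def)
      qed
      show "\<forall>k\<ge>J. D (Suc k) \<le> (1 - a / (real k + t)) * D k + A * r / (real k + t)\<^sup>2
        + Mc * (W k / (real k + t) + 1 / (real k + t) ^ 3)"
      proof (intro allI impI)
        fix k assume k: "J \<le> k"
        define s where "s = real k + t"
        have s: "s > 0" using s0' by (auto simp: s_def)
        have h: "\<eta> k = q / s" using \<eta>' by (simp add: s_def)
        have "4 * K3 * q \<le> s" using J k t by (simp add: s_def)
        hence "K3 * \<eta> k \<le> 1 / 4" using s by (simp add: h field_simps)
        from mult_right_mono[OF this \<eta>0[of k]] have "K3 * (\<eta> k)\<^sup>2 \<le> \<eta> k / 4" by (simp add: power2_eq_square)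
        hence "\<eta> k / 4 * G k \<le> (\<eta> k / 2 - K3 * (\<eta> k)\<^sup>2) * G k"
          using nnk[of k] by (intro mult_right_mono) auto
        moreover have "\<eta> k / 4 * (2 * \<nu> * D k) \<le> \<eta> k / 4 * G k"
          using PL' \<eta>0[of k] by (intro mult_left_mono) auto
        moreover have "\<eta> k / 4 * (2 * \<nu> * D k) = a / s * D k" by (simp add: h a_def)
        ultimately have "- ((\<eta> k / 2 - K3 * (\<eta> k)\<^sup>2) * G k) \<le> - (a / s * D k)" by linarith
        moreover have "Ca * (\<eta> k)\<^sup>2 * r = A * r / s\<^sup>2" by (simp add: h A_def power_divide)
        moreover have "(1 - a / s) * D k = D k - a / s * D k" by (simp add: algebra_simps)
        ultimately show "D (Suc k) \<le> (1 - a / (real k + t)) * D k + A * r / (real k + t)\<^sup>2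
          + Mc * (W k / (real k + t) + 1 / (real k + t) ^ 3)"
          using D1[of k] noise[of k] unfolding s_def by linarith
      qed
    qed (use Ws in blast)
    note step = main[OF r0 rP this T]
    have p1: "1 \<le> real p" using p by simp
    have up: "C0 / (real T)\<^sup>2 \<le> C' * (real p / (real T)\<^sup>2)" if "C0 \<le> C'" "0 \<le> C'" for C0
    proof -
      have "C0 / (real T)\<^sup>2 \<le> C' * real p / (real T)\<^sup>2"
        using that p1 mult_left_mono[of 1 "real p" C'] by (intro divide_right_mono) auto
      thus ?thesis by simp
    qed
    have "D T \<le> A * r / real T + C / (real T)\<^sup>2" "W T \<le> C / (real T)\<^sup>2" using step by auto
    moreover have "A * r / real T = q\<^sup>2 * (Lf\<^sup>2 * \<kappa>\<delta>\<^sup>2 + Lf * K0 / 2) * (real p / (real n * real T))"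
      by (simp add: A_def Ca_def r_def)
    moreover have "Y T \<le> C / cV / (real T)\<^sup>2"
    proof -
      have "Y T \<le> W T / cV" by (rule YW)
      also have "\<dots> \<le> C / (real T)\<^sup>2 / cV" using \<open>W T \<le> C / (real T)\<^sup>2\<close> cV by (intro divide_right_mono) auto
      finally show ?thesis by (simp add: mult.commute)
    qed
    ultimately show "D T \<le> q\<^sup>2 * (Lf\<^sup>2 * \<kappa>\<delta>\<^sup>2 + Lf * K0 / 2) * (real p / (real n * real T)) + C' * (real p / (real T)\<^sup>2)
       \<and> Y T \<le> C' * (real p / (real T)\<^sup>2)"
      using up[OF C'(2)] up[OF C'(3)] C'(1) by linarith
  qed
qed

subsection \<open>Removing the exceptional null sets\<close>

lemma smooth_on_R_zero: assumes "Lf \<ge> 0" shows "smooth_on_R p Lf (\<lambda>y. 0)"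
proof -
  have g: "has_gradient p (\<lambda>y. 0) (\<lambda>c. 0) y" if "y \<in> space_R p" for y
    by (rule has_gradient_quadraticI[where C = 0]) (auto simp: space_R_zero einner_def)
  hence "grad p (\<lambda>y. 0) y = (\<lambda>c. 0)" if "y \<in> space_R p" for y
    using grad_eqI that by blast
  thus ?thesis using g assms enorm_nonneg by (auto simp: smooth_on_R_def vdiff_def enorm_eq_0_iff[THEN iffD2])
qed

locale zo_problem = connected_laplacian n E a L + zo_draws n p D M u \<xi>
  for n p :: nat and D :: "nat \<Rightarrow> 'c measure" and M :: "'w measure" and u \<xi> E a L +
  fixes Lf s0 s1 st0 s2 :: real and F :: "nat \<Rightarrow> rvec \<Rightarrow> 'c \<Rightarrow> real"
    and \<alpha> \<beta> \<eta> :: "nat \<Rightarrow> real" and \<delta> :: "nat \<Rightarrow> nat \<Rightarrow> real" and x0 :: "nat \<Rightarrow> rvec" and db :: "nat \<Rightarrow> real"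
  assumes Lf_pos: "Lf > 0"
    and F_int: "\<forall>i<n. \<forall>y\<in>space_R p. integrable (D i) (F i y)"
    and bdd: "bdd_below (global_cost n D F ` space_R p)"
    and F_smooth: "\<forall>i<n. AE z in D i. smooth_on_R p Lf (\<lambda>y. F i y z)"
    and F_var: "\<forall>i<n. \<forall>y\<in>space_R p.
         (\<integral>\<^sup>+ z. ennreal ((enorm p (vdiff (grad p (\<lambda>w. F i w z) y) (grad p (local_cost D F i) y)))\<^sup>2) \<partial>D i)
           \<le> ennreal (s0\<^sup>2 * (enorm p (grad p (local_cost D F i) y))\<^sup>2 + s1\<^sup>2)"
    and F_hetero: "\<forall>i<n. \<forall>y\<in>space_R p.
         (enorm p (vdiff (grad p (local_cost D F i) y) (grad p (global_cost n D F) y)))\<^sup>2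
           \<le> st0\<^sup>2 * (enorm p (grad p (global_cost n D F) y))\<^sup>2 + s2\<^sup>2"
    and x0_space: "\<forall>i<n. x0 i \<in> space_R p"
    and \<eta>0: "\<And>k. 0 \<le> \<eta> k" and \<delta>0: "\<And>i k. i < n \<Longrightarrow> 0 < \<delta> i k" and \<delta>b: "\<And>i k. i < n \<Longrightarrow> (\<delta> i k)\<^sup>2 \<le> db k"
begin

text \<open>An almost-everywhere statement provides no measurable set of smooth samples by itself;
  here a measurable one of full measure is fixed, so that the costs can be modified outside it
  without losing measurability.\<close>

definition good :: "nat \<Rightarrow> 'c set" where
  "good i = (SOME S. S \<in> sets (D i) \<and> (AE z in D i. z \<in> S) \<and> (\<forall>z\<in>S. smooth_on_R p Lf (\<lambda>y. F i y z)))"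

lemma good:
  assumes i: "i < n"
  shows "good i \<in> sets (D i)" "AE z in D i. z \<in> good i" "z \<in> good i \<Longrightarrow> smooth_on_R p Lf (\<lambda>y. F i y z)"
proof -
  obtain N where N: "N \<in> null_sets (D i)" "{z \<in> space (D i). \<not> smooth_on_R p Lf (\<lambda>y. F i y z)} \<subseteq> N"
    using F_smooth i by (auto simp: eventually_ae_filter)
  have "space (D i) - N \<in> sets (D i) \<and> (AE z in D i. z \<in> space (D i) - N)
      \<and> (\<forall>z\<in>space (D i) - N. smooth_on_R p Lf (\<lambda>y. F i y z))"
  proof (intro conjI ballI)
    show "AE z in D i. z \<in> space (D i) - N" using AE_not_in[OF N(1)] by (auto intro: AE_mp)
  qed (use N in auto)
  hence "good i \<in> sets (D i) \<and> (AE z in D i. z \<in> good i) \<and> (\<forall>z\<in>good i. smooth_on_R p Lf (\<lambda>y. F i y z))"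
    unfolding good_def by (rule someI)
  thus "good i \<in> sets (D i)" "AE z in D i. z \<in> good i" "z \<in> good i \<Longrightarrow> smooth_on_R p Lf (\<lambda>y. F i y z)" by auto
qed

text \<open>Smooth for every sample and independent of the coordinates beyond \<open>p\<close>, hence jointly measurable.\<close>

definition F' :: "nat \<Rightarrow> rvec \<Rightarrow> 'c \<Rightarrow> real" where
  "F' i y z = (if z \<in> good i then F i (trunc p y) z else 0)"

lemma F'_eq: "z \<in> good i \<Longrightarrow> y \<in> space_R p \<Longrightarrow> F' i y z = F i y z"
  by (simp add: F'_def trunc_id)

lemma F'_measurable:
  assumes i: "i < n" shows "F' i y \<in> borel_measurable (D i)"
proof -
  have "F i (trunc p y) \<in> borel_measurable (D i)" using F_int i trunc_space[of p y] by blast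
  hence "(\<lambda>z. if z \<in> good i then F i (trunc p y) z else 0) \<in> borel_measurable (D i)"
    using good(1)[OF i] by (intro measurable_If_set) (auto simp: sets.Int)
  thus ?thesis by (simp add: F'_def[abs_def])
qed

lemma AE_F':
  assumes i: "i < n" shows "AE z in D i. F' i y z = F i (trunc p y) z"
  using good(2)[OF i] by eventually_elim (simp add: F'_def)

lemma F'_cost:
  assumes i: "i < n" shows "random_cost (D i) p Lf (F' i)"
proof -
  interpret D: prob_space "D i" by (rule prob_D[OF i])
  show ?thesis
  proof unfold_locales
    show "1 \<le> p" by (rule p1)
    show "0 \<le> Lf" using Lf_pos by simp
    show "smooth_on_R p Lf (\<lambda>y. F' i y z)" for z
    proof (cases "z \<in> good i")
      case True
      thus ?thesis using good(3)[OF i True] by (subst smooth_on_R_cong[where f' = "\<lambda>y. F i y z"]) (auto simp: F'_eq)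
    next
      case False
      thus ?thesis using smooth_on_R_zero[of Lf p] Lf_pos by (simp add: F'_def)
    qed
    show "F' i (trunc p y) z = F' i y z" for y z
      by (simp add: F'_def trunc_id trunc_space)
    show "integrable (D i) (F' i y)" for y
    proof (rule integrable_cong_AE[THEN iffD1])
      show "integrable (D i) (F i (trunc p y))" using F_int i trunc_space[of p y] by blast
      thus "F i (trunc p y) \<in> borel_measurable (D i)" by (rule borel_measurable_integrable)
      show "F' i y \<in> borel_measurable (D i)" by (rule F'_measurable[OF i])
      show "AE z in D i. F i (trunc p y) z = F' i y z" using AE_F'[OF i, of y] by eventually_elim simp
    qed
  qed
qed

lemma mean_cost_F':
  assumes i: "i < n" and y: "y \<in> space_R p"
  shows "random_cost.mean_cost (D i) (F' i) y = local_cost D F i y"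
  unfolding random_cost.mean_cost_def[OF F'_cost[OF i]] local_cost_def
proof (rule integral_cong_AE)
  show "F' i y \<in> borel_measurable (D i)" by (rule F'_measurable[OF i])
  show "F i y \<in> borel_measurable (D i)" using F_int i y by blast
  show "AE z in D i. F' i y z = F i y z" using AE_F'[OF i, of y] by (simp add: trunc_id[OF y])
qed

lemma mean_grad_F':
  assumes i: "i < n" and y: "y \<in> space_R p"
  shows "random_cost.mean_grad (D i) p (F' i) y = grad p (local_cost D F i) y"
  unfolding random_cost.grad_mean_cost[OF F'_cost[OF i] y, symmetric]
  by (rule grad_cong[OF mean_cost_F'[OF i] y])

sublocale proc: zo_process n p D M u \<xi> E a L Lf s0 s1 st0 s2 F' \<alpha> \<beta> \<eta> \<delta> x0
proof (intro zo_process.intro zo_process_axioms.intro zo_draws_axioms connected_laplacian_axioms)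
  fix i k y
  assume i: "i < n"
  show "random_cost (D i) p Lf (F' i)" by (rule F'_cost[OF i])
  show "x0 i \<in> space_R p" using x0_space i by blast
  show "0 < \<delta> i k" by (rule \<delta>0[OF i])
  assume y: "y \<in> space_R p"
  have "(\<integral>\<^sup>+ z. ennreal ((enorm p (vdiff (grad p (\<lambda>w. F' i w z) y) (grad p (local_cost D F i) y)))\<^sup>2) \<partial>D i)
     = (\<integral>\<^sup>+ z. ennreal ((enorm p (vdiff (grad p (\<lambda>w. F i w z) y) (grad p (local_cost D F i) y)))\<^sup>2) \<partial>D i)"
  proof (rule nn_integral_cong_AE)
    show "AE z in D i. ennreal ((enorm p (vdiff (grad p (\<lambda>w. F' i w z) y) (grad p (local_cost D F i) y)))\<^sup>2)
       = ennreal ((enorm p (vdiff (grad p (\<lambda>w. F i w z) y) (grad p (local_cost D F i) y)))\<^sup>2)"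
      using good(2)[OF i]
    proof eventually_elim
      fix z assume "z \<in> good i"
      hence "grad p (\<lambda>w. F' i w z) y = grad p (\<lambda>w. F i w z) y"
        by (intro grad_cong[OF F'_eq y])
      thus "ennreal ((enorm p (vdiff (grad p (\<lambda>w. F' i w z) y) (grad p (local_cost D F i) y)))\<^sup>2)
         = ennreal ((enorm p (vdiff (grad p (\<lambda>w. F i w z) y) (grad p (local_cost D F i) y)))\<^sup>2)" by simp
    qed
  qed
  also have "\<dots> \<le> ennreal (s0\<^sup>2 * (enorm p (grad p (local_cost D F i) y))\<^sup>2 + s1\<^sup>2)"
    using F_var i y by blast
  finally show "(\<integral>\<^sup>+ z. ennreal ((enorm p (vdiff (grad p (\<lambda>w. F' i w z) y) (random_cost.mean_grad (D i) p (F' i) y)))\<^sup>2) \<partial>D i)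
           \<le> ennreal (s0\<^sup>2 * (enorm p (random_cost.mean_grad (D i) p (F' i) y))\<^sup>2 + s1\<^sup>2)"
    unfolding mean_grad_F'[OF i y] .
qed (use Lf_pos \<eta>0 in auto)

lemma fbar_eq: "y \<in> space_R p \<Longrightarrow> proc.fbar y = global_cost n D F y"
  unfolding proc.fbar_def global_cost_def using mean_cost_F' by simp

lemma Gf_eq: "y \<in> space_R p \<Longrightarrow> proc.Gf y = grad p (global_cost n D F) y"
  unfolding proc.grad_fbar[symmetric] by (rule grad_cong[OF fbar_eq])

sublocale desc: zo_descent n p D M u \<xi> E a L Lf s0 s1 st0 s2 F' \<alpha> \<beta> \<eta> \<delta> x0 db "opt_value p (global_cost n D F)"
proof unfold_locales
  fix i k y
  show "i < n \<Longrightarrow> (\<delta> i k)\<^sup>2 \<le> db k" by (rule \<delta>b)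
  assume y: "y \<in> space_R p"
  show "opt_value p (global_cost n D F) \<le> proc.fbar y"
    unfolding fbar_eq[OF y] opt_value_def by (rule cINF_lower[OF bdd y])
  assume i: "i < n"
  show "(enorm p (vdiff (random_cost.mean_grad (D i) p (F' i) y) (proc.Gf y)))\<^sup>2 \<le> st0\<^sup>2 * (enorm p (proc.Gf y))\<^sup>2 + s2\<^sup>2"
    using F_hetero i y unfolding Gf_eq[OF y] mean_grad_F'[OF i y] by blast
qed

section \<open>Transfer to the iterates of the given costs\<close>

abbreviation raw_iter :: "nat \<Rightarrow> 'w \<Rightarrow> (nat \<Rightarrow> rvec) \<times> (nat \<Rightarrow> rvec)" where
  "raw_iter k w \<equiv> zo_iterates n p L F \<alpha> \<beta> \<eta> \<delta> x0 (\<lambda>i k. u i k w) (\<lambda>i k. \<xi> i k w) k"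

lemma AE_good_draws:
  "AE w in M. \<forall>i<n. \<forall>k. u i k w \<in> space_R p \<and> \<xi> i k w \<in> good i"
proof -
  have "AE w in M. u i k w \<in> space_R p" if i: "i < n" for i k
  proof -
    have "AE v in distr M borel (u i k). v \<in> space_R p"
      unfolding distr_u[OF i] using AE_uniform_sphere[OF p1] by auto
    moreover have "{v \<in> space borel. v \<in> space_R p} \<in> sets (borel :: rvec measure)"
      using space_R_borel[of p] by simp
    ultimately show ?thesis using AE_distr_iff[OF measurable_u[OF i, of k], of "\<lambda>v. v \<in> space_R p"] by simp
  qed
  moreover have "AE w in M. \<xi> i k w \<in> good i" if i: "i < n" for i k
  proof -
    have "AE z in distr M (D i) (\<xi> i k). z \<in> good i"
      unfolding distr_xi[OF i] by (rule good(2)[OF i])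
    moreover have "{z \<in> space (D i). z \<in> good i} \<in> sets (D i)" using good(1)[OF i] by (simp add: sets.Int_space_eq1 Collect_conj_eq)
    ultimately show ?thesis using AE_distr_iff[OF measurable_xi[OF i, of k], of "\<lambda>z. z \<in> good i"] by simp
  qed
  ultimately have "AE w in M. \<forall>k. u i k w \<in> space_R p \<and> \<xi> i k w \<in> good i" if "i < n" for i
    using that by (simp add: AE_all_countable)
  hence "AE w in M. \<forall>i\<in>{..<n}. \<forall>k. u i k w \<in> space_R p \<and> \<xi> i k w \<in> good i"
    by (intro AE_ball_countable[THEN iffD2]) auto
  thus ?thesis by eventually_elim simp
qed

text \<open>On this event the iterates and the perturbed points stay in \<open>space_R p\<close> and
  all samples are good, so only function values common to both costs are ever queried. Countably
  many draws are involved, hence the event has probability one.\<close>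

lemma raw_iter_eq:
  assumes w: "\<forall>i<n. \<forall>k. u i k w \<in> space_R p \<and> \<xi> i k w \<in> good i" and i: "i < n"
  shows "fst (raw_iter k w) i = fst (proc.iter k w) i \<and> snd (raw_iter k w) i = snd (proc.iter k w) i
    \<and> fst (raw_iter k w) i \<in> space_R p \<and> snd (raw_iter k w) i \<in> space_R p"
  using i
proof (induction k arbitrary: i)
  case 0
  thus ?case using x0_space by (auto simp: proc.iter_def space_R_iff)
next
  case (Suc k)
  let ?X = "fst (raw_iter k w)" and ?V = "snd (raw_iter k w)"
  have IH: "fst (proc.iter k w) j = ?X j" "snd (proc.iter k w) j = ?V j" "?X j \<in> space_R p" "?V j \<in> space_R p"
    if "j < n" for j using Suc.IH[OF that] by auto
  have u: "u i k w \<in> space_R p" and z: "\<xi> i k w \<in> good i" using w Suc.prems by auto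
  have line: "(\<lambda>b. ?X i b + \<delta> i k * u i k w b) \<in> space_R p"
    using IH(3)[OF Suc.prems] u by (simp add: space_R_iff)
  have zg: "zo_gradient p (F' i) (\<delta> i k) (?X i) (u i k w) (\<xi> i k w) = zo_gradient p (F i) (\<delta> i k) (?X i) (u i k w) (\<xi> i k w)"
    unfolding zo_gradient_def F'_eq[OF z line] F'_eq[OF z IH(3)[OF Suc.prems]] ..
  have lp: "(\<Sum>j<n. L $$ (i, j) * fst (proc.iter k w) j c) = (\<Sum>j<n. L $$ (i, j) * ?X j c)" for c
    by (intro sum.cong) (auto simp: IH)
  have lp0: "(\<Sum>j<n. L $$ (i, j) * ?X j c) = 0" if "c \<ge> p" for c
    using IH(3) that by (intro sum.neutral) (auto simp: space_R_iff)
  have raw: "raw_iter (Suc k) w = (\<lambda>i c. ?X i c - \<eta> k * (\<alpha> k * (\<Sum>j<n. L $$ (i, j) * ?X j c) + \<beta> k * ?V i c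
                 + zo_gradient p (F i) (\<delta> i k) (?X i) (u i k w) (\<xi> i k w) c),
        \<lambda>i c. ?V i c + \<eta> k * \<beta> k * (\<Sum>j<n. L $$ (i, j) * ?X j c))"
    by (simp add: case_prod_beta Let_def)
  let ?X' = "fst (proc.iter k w)" and ?V' = "snd (proc.iter k w)"
  have new: "proc.iter (Suc k) w = (\<lambda>i c. ?X' i c - \<eta> k * (\<alpha> k * (\<Sum>j<n. L $$ (i, j) * ?X' j c) + \<beta> k * ?V' i c
                 + zo_gradient p (F' i) (\<delta> i k) (?X' i) (u i k w) (\<xi> i k w) c),
        \<lambda>i c. ?V' i c + \<eta> k * \<beta> k * (\<Sum>j<n. L $$ (i, j) * ?X' j c))"
    by (simp add: proc.iter_def case_prod_beta Let_def)
  have "fst (raw_iter (Suc k) w) i \<in> space_R p" "snd (raw_iter (Suc k) w) i \<in> space_R p"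
    unfolding raw space_R_iff fst_conv snd_conv
    using IH(3,4)[OF Suc.prems] u lp0 by (simp_all add: space_R_iff zo_gradient_def)
  thus ?case
    unfolding raw new fst_conv snd_conv IH(1,2)[OF Suc.prems] lp zg by simp
qed

lemma x_eq_raw:
  assumes w: "\<forall>i<n. \<forall>k. u i k w \<in> space_R p \<and> \<xi> i k w \<in> good i" and i: "i < n"
  shows "proc.x k i w = fst (raw_iter k w) i"
proof -
  have 1: "fst (raw_iter k w) i = fst (proc.iter k w) i" and 2: "fst (raw_iter k w) i \<in> space_R p"
    using raw_iter_eq[OF w i, of k] by blast+
  show ?thesis unfolding proc.x_def 1[symmetric] by (rule trunc_id[OF 2])
qed

text \<open>Almost sure equality with the analysed iterates is all that the nonnegative integral
  asks for; no measurability of the given iterates enters.\<close>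

lemma consensus_bound:
  assumes "desc.Yk T \<le> b"
  shows "(\<integral>\<^sup>+ w. ennreal (consensus_error n p (fst (raw_iter T w))) \<partial>M) \<le> ennreal b"
proof -
  have "(\<integral>\<^sup>+ w. ennreal (consensus_error n p (fst (raw_iter T w))) \<partial>M) = (\<integral>\<^sup>+ w. ennreal (desc.cons T w) \<partial>M)"
  proof (rule nn_integral_cong_AE)
    show "AE w in M. ennreal (consensus_error n p (fst (raw_iter T w))) = ennreal (desc.cons T w)"
      using AE_good_draws
    proof eventually_elim
      fix w assume w: "\<forall>i<n. \<forall>k. u i k w \<in> space_R p \<and> \<xi> i k w \<in> good i"
      have "proc.x T i w = fst (raw_iter T w) i" if "i < n" for i
        by (rule x_eq_raw[OF w that])
      hence "consensus_error n p (fst (raw_iter T w)) = desc.cons T w"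
        by (simp add: desc.cons_def consensus_error_def average_def)
      thus "ennreal (consensus_error n p (fst (raw_iter T w))) = ennreal (desc.cons T w)" by simp
    qed
  qed
  also have "\<dots> = ennreal (desc.Yk T)" unfolding desc.Yk_def
    by (rule nn_integral_eq_integral[OF desc.cons_integrable]) (simp add: desc.cons_nonneg)
  also have "\<dots> \<le> ennreal b" using assms by (rule ennreal_leI)
  finally show ?thesis .
qed

lemma suboptimality_bound:
  assumes "desc.Dk T \<le> b"
  shows "(\<integral>\<^sup>+ w. ennreal (global_cost n D F (average n (fst (raw_iter T w))) - opt_value p (global_cost n D F)) \<partial>M) \<le> ennreal b"
proof -
  let ?fs = "opt_value p (global_cost n D F)"
  have "(\<integral>\<^sup>+ w. ennreal (global_cost n D F (average n (fst (raw_iter T w))) - ?fs) \<partial>M)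
      = (\<integral>\<^sup>+ w. ennreal (proc.fbar (desc.xb T w) - ?fs) \<partial>M)"
  proof (rule nn_integral_cong_AE)
    show "AE w in M. ennreal (global_cost n D F (average n (fst (raw_iter T w))) - ?fs) = ennreal (proc.fbar (desc.xb T w) - ?fs)"
      using AE_good_draws
    proof eventually_elim
      fix w assume w: "\<forall>i<n. \<forall>k. u i k w \<in> space_R p \<and> \<xi> i k w \<in> good i"
      have "proc.x T i w = fst (raw_iter T w) i" if "i < n" for i
        by (rule x_eq_raw[OF w that])
      hence "desc.xb T w = average n (fst (raw_iter T w))"
        by (simp add: desc.xb_def average_def)
      thus "ennreal (global_cost n D F (average n (fst (raw_iter T w))) - ?fs) = ennreal (proc.fbar (desc.xb T w) - ?fs)"
        using fbar_eq[OF desc.xb_space[of T w]] by simp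
    qed
  qed
  also have "\<dots> = ennreal (desc.Dk T)" unfolding desc.Dk_def
  proof (rule nn_integral_eq_integral)
    show "integrable M (\<lambda>w. proc.fbar (desc.xb T w) - ?fs)" using desc.fbar_integrable by simp
    show "AE w in M. 0 \<le> proc.fbar (desc.xb T w) - ?fs" using desc.fbar_ge[OF desc.xb_space] by simp
  qed
  also have "\<dots> \<le> ennreal b" using assms by (rule ennreal_leI)
  finally show ?thesis .
qed

lemma initial_values:
  "desc.Dk 0 = global_cost n D F (average n x0) - opt_value p (global_cost n D F)"
  "desc.Yk 0 = consensus_error n p x0"
proof -
  have "desc.xb 0 w = average n x0" for w
    by (simp add: desc.xb_def average_def proc.x_0)
  hence x0b: "desc.xb 0 = (\<lambda>w. average n x0)" by auto
  have "average n x0 \<in> space_R p" using x0_space by (auto simp: average_def space_R_iff)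
  thus "desc.Dk 0 = global_cost n D F (average n x0) - opt_value p (global_cost n D F)"
    by (simp add: desc.Dk_def x0b fbar_eq prob_space)
  have "desc.cons 0 w = consensus_error n p x0" for w
    by (simp add: desc.cons_def consensus_error_def average_def proc.x_0)
  thus "desc.Yk 0 = consensus_error n p x0" by (simp add: desc.Yk_def prob_space)
qed

lemma PL_expectation:
  assumes "polyak_lojasiewicz p \<nu> (global_cost n D F)"
  shows "2 * \<nu> * desc.Dk k \<le> desc.Gk k"
proof -
  let ?fs = "opt_value p (global_cost n D F)"
  have "2 * \<nu> * desc.Dk k = (\<integral>w. 2 * \<nu> * (proc.fbar (desc.xb k w) - ?fs) \<partial>M)" by (simp add: desc.Dk_def)
  also have "\<dots> \<le> desc.Gk k" unfolding desc.Gk_def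
  proof (rule integral_mono)
    show "integrable M (\<lambda>w. 2 * \<nu> * (proc.fbar (desc.xb k w) - ?fs))" using desc.fbar_integrable by simp
    show "integrable M (\<lambda>w. (enorm p (proc.Gf (desc.xb k w)))\<^sup>2)" by (rule sqint_integrable[OF desc.Gf_sqint])
    fix w
    have "\<nu> * (global_cost n D F (desc.xb k w) - ?fs) \<le> 1 / 2 * (enorm p (grad p (global_cost n D F) (desc.xb k w)))\<^sup>2"
      using assms desc.xb_space[of k w] unfolding polyak_lojasiewicz_def by blast
    thus "2 * \<nu> * (proc.fbar (desc.xb k w) - ?fs) \<le> (enorm p (proc.Gf (desc.xb k w)))\<^sup>2"
      unfolding fbar_eq[OF desc.xb_space] Gf_eq[OF desc.xb_space] by simp
  qed
  finally show ?thesis .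
qed

end

subsection \<open>Consequences of the parameter conditions\<close>

text \<open>\<open>c2\<close> makes \<open>\<kappa>2 * eps3\<close> smaller than
  \<open>eps2\<close>, and \<open>eps3\<close> dominates the coefficient of the second-order terms
  in \<open>lyap_noiseless_step\<close>; this yields the smallness condition there.\<close>

lemma (in connected_laplacian) parameter_conditions:
  assumes k1: "\<kappa>1 > zo_constants.c1 L" and k2: "0 < \<kappa>2" "\<kappa>2 < zo_constants.c2 L \<kappa>1"
  shows "\<kappa>1 > 1" "\<kappa>2 < 1 / 5"
    and "\<kappa>2 * (\<kappa>1\<^sup>2 * rho (L * L) + rho L / 2) \<le> (\<kappa>1 - 1) * rho2 L - 1"
proof -
  obtain \<mu> where \<mu>: "0 \<le> \<mu>" "\<mu> \<le> rho L" "\<mu>\<^sup>2 \<le> rho (L * L)"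
    by (rule spectral_bounds) blast
  have r: "0 \<le> rho L" "0 \<le> rho (L * L)" using \<mu> zero_le_power2[of \<mu>] by linarith+
  have "0 < 1 / rho2 L" using rho2_pos by simp
  thus k1': "\<kappa>1 > 1" using k1 unfolding zo_constants.c1_def by linarith
  show "\<kappa>2 < 1 / 5" using k2 unfolding zo_constants.c2_def by simp
  let ?e3 = "zo_constants.eps3 L \<kappa>1"
  have "0 \<le> \<kappa>1\<^sup>2 * rho (L * L)" using r by simp
  hence e3: "?e3 > 0" "\<kappa>1\<^sup>2 * rho (L * L) + rho L / 2 \<le> ?e3"
    unfolding zo_constants.eps3_def distrib_right using r by linarith+
  have "\<kappa>2 < zo_constants.eps2 L \<kappa>1 / ?e3" using k2 unfolding zo_constants.c2_def by simp
  hence "\<kappa>2 * ?e3 < zo_constants.eps2 L \<kappa>1" using e3 by (simp add: pos_less_divide_eq)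
  moreover have "\<kappa>2 * (\<kappa>1\<^sup>2 * rho (L * L) + rho L / 2) \<le> \<kappa>2 * ?e3"
    using e3 k2 by (intro mult_left_mono) auto
  ultimately show "\<kappa>2 * (\<kappa>1\<^sup>2 * rho (L * L) + rho L / 2) \<le> (\<kappa>1 - 1) * rho2 L - 1"
    unfolding zo_constants.eps2_def by linarith
qed

text \<open>Because of this bound the constants of the \<open>1 / T\<^sup>2\<close> terms may depend on \<open>p\<close>.\<close>

lemma (in connected_laplacian) dimension_le:
  assumes k0: "\<kappa>0 > 0" and k1: "\<kappa>1 > 1" and t: "t1 \<ge> zo_constants.c3_hat L p Lf s0 st0 \<kappa>0 \<kappa>1 \<kappa>2"
  shows "real p \<le> t1 * \<kappa>0"
proof -
  have "real p * zo_constants.kappa3 L \<kappa>1 \<le> zo_constants.eps1 L p Lf s0 st0 \<kappa>1"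
    unfolding zo_constants.eps1_def by (rule Max_ge) auto
  also have "\<dots> \<le> zo_constants.c0 L p Lf s0 st0 \<kappa>1 \<kappa>2"
    unfolding zo_constants.c0_def by (rule Max_ge) auto
  finally have c0: "real p * zo_constants.kappa3 L \<kappa>1 \<le> zo_constants.c0 L p Lf s0 st0 \<kappa>1 \<kappa>2" .
  have "1 \<le> zo_constants.kappa3 L \<kappa>1"
    unfolding zo_constants.kappa3_def using rho2_pos k1 by simp
  from mult_left_mono[OF this, of "real p"] c0
  have "real p \<le> zo_constants.c0 L p Lf s0 st0 \<kappa>1 \<kappa>2" by simp
  hence "real p / \<kappa>0 \<le> zo_constants.c0 L p Lf s0 st0 \<kappa>1 \<kappa>2 / \<kappa>0" using k0 by (intro divide_right_mono) auto
  also have "\<dots> \<le> zo_constants.c3_hat L p Lf s0 st0 \<kappa>0 \<kappa>1 \<kappa>2"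
    unfolding zo_constants.c3_hat_def by (rule Max_ge) auto
  also note t
  finally show ?thesis using k0 by (simp add: pos_divide_le_eq)
qed

section \<open>Convergence rates with uniform constants\<close>

theorem theorem4:
  fixes Lf \<sigma>0 \<sigma>1 \<sigma>t0 \<sigma>2 \<nu> \<kappa>\<delta> c0hat :: real
  assumes "Lf > 0" and "\<nu> > 0" and "\<kappa>\<delta> > 0" and "0 < c0hat" and "c0hat < 1"
  shows "\<exists>C1>0.
    \<forall>\<kappa>0 \<kappa>1 \<kappa>2 t1 r2 r \<Delta>f \<Delta>x :: real. \<exists>C2>0. \<exists>C3>0.
    \<forall>(n :: nat) (p :: nat) E a L (D :: nat \<Rightarrow> 'c measure) F f fi
      (M :: 'w measure) u \<xi> \<alpha> \<beta> \<eta> \<delta> x0 x.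
      n \<ge> 2 \<longrightarrow> p \<ge> 1 \<longrightarrow>
      \<comment> \<open>network\<close>
      weighted_graph n E a \<longrightarrow> connected_graph n E \<longrightarrow> L = laplacian n a \<longrightarrow>
      rho2 L = r2 \<longrightarrow> rho L = r \<longrightarrow>
      \<comment> \<open>costs\<close>
      fi = local_cost D F \<longrightarrow> f = global_cost n D F \<longrightarrow>
      (\<forall>i<n. \<forall>y\<in>space_R p. integrable (D i) (F i y)) \<longrightarrow>
      minimizers p f \<noteq> {} \<longrightarrow> bdd_below (f ` space_R p) \<longrightarrow>
      (\<forall>i<n. AE z in D i. smooth_on_R p Lf (\<lambda>y. F i y z)) \<longrightarrow>
      (\<forall>i<n. \<forall>y\<in>space_R p.
         (\<integral>\<^sup>+ z. ennreal ((enorm p (vdiff (grad p (\<lambda>w. F i w z) y) (grad p (fi i) y)))\<^sup>2) \<partial>D i)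
           \<le> ennreal (\<sigma>0\<^sup>2 * (enorm p (grad p (fi i) y))\<^sup>2 + \<sigma>1\<^sup>2)) \<longrightarrow>
      (\<forall>i<n. \<forall>y\<in>space_R p.
         (enorm p (vdiff (grad p (fi i) y) (grad p f y)))\<^sup>2
           \<le> \<sigma>t0\<^sup>2 * (enorm p (grad p f y))\<^sup>2 + \<sigma>2\<^sup>2) \<longrightarrow>
      polyak_lojasiewicz p \<nu> f \<longrightarrow>
      \<comment> \<open>algorithm\<close>
      zo_sampling n p D M u \<xi> \<longrightarrow>
      (\<forall>i<n. x0 i \<in> space_R p) \<longrightarrow>
      (\<forall>\<omega> k i. x \<omega> k i =
         fst (zo_iterates n p L F \<alpha> \<beta> \<eta> \<delta> x0 (\<lambda>i k. u i k \<omega>) (\<lambda>i k. \<xi> i k \<omega>) k) i) \<longrightarrow>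
      \<comment> \<open>parameters\<close>
      (\<forall>k. \<alpha> k = \<kappa>1 * \<beta> k) \<longrightarrow>
      (\<forall>k. \<beta> k = \<kappa>0 * (real k + t1)) \<longrightarrow>
      (\<forall>k. \<eta> k = \<kappa>2 / \<beta> k) \<longrightarrow>
      (\<forall>i<n. \<forall>k. 0 < \<delta> i k \<and>
         \<delta> i k \<le> \<kappa>\<delta> * sqrt (real p * \<eta> k) / sqrt (real n + real p)) \<longrightarrow>
      \<kappa>1 > zo_constants.c1 L \<longrightarrow>
      0 < \<kappa>2 \<longrightarrow> \<kappa>2 < zo_constants.c2 L \<kappa>1 \<longrightarrow>
      3 * c0hat * \<nu> * \<kappa>2 / 16 \<le> \<kappa>0 \<longrightarrow> \<kappa>0 < 3 * \<nu> * \<kappa>2 / 16 \<longrightarrow>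
      t1 \<ge> zo_constants.c3_hat L p Lf \<sigma>0 \<sigma>t0 \<kappa>0 \<kappa>1 \<kappa>2 \<longrightarrow>
      \<comment> \<open>size of the initial data\<close>
      f (average n x0) - opt_value p f \<le> \<Delta>f \<longrightarrow> consensus_error n p x0 \<le> \<Delta>x \<longrightarrow>
      (\<forall>T\<ge>1 :: nat.
         (\<integral>\<^sup>+ \<omega>. ennreal (consensus_error n p (x \<omega> T)) \<partial>M)
           \<le> ennreal (C3 * (real p / (real T)\<^sup>2)) \<and>
         (\<integral>\<^sup>+ \<omega>. ennreal (f (average n (x \<omega> T)) - opt_value p f) \<partial>M)
           \<le> ennreal (C1 * (real p / (real n * real T)) + C2 * (real p / (real T)\<^sup>2)))"
proof -
  define K0 where "K0 = 16 * (1 + \<sigma>0\<^sup>2) * \<sigma>2\<^sup>2 + 4 * \<sigma>1\<^sup>2"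
  \<comment> \<open>The lower bound on \<open>\<kappa>0\<close> gives
    \<open>\<kappa>2 / \<kappa>0 \<le> 16 / (3 * c0hat * \<nu>)\<close>. Replacing \<open>q\<close>
    by this number in the leading coefficient of \<open>rate_bound\<close> leaves no quantity of the
    network or the step sizes.\<close>
  define C1 where "C1 = (16 / (3 * c0hat * \<nu>))\<^sup>2 * (Lf\<^sup>2 * \<kappa>\<delta>\<^sup>2 + Lf * K0 / 2)"
  have K0: "K0 \<ge> 0" by (simp add: K0_def)
  hence "Lf * K0 / 2 \<ge> 0" using assms by simp
  moreover have "Lf\<^sup>2 * \<kappa>\<delta>\<^sup>2 > 0" using assms by simp
  ultimately have S: "Lf\<^sup>2 * \<kappa>\<delta>\<^sup>2 + Lf * K0 / 2 > 0" by linarith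
  have C1: "C1 > 0" unfolding C1_def using assms S by (intro mult_pos_pos) auto
  show ?thesis
  proof (rule exI[of _ C1], rule conjI[OF C1], intro allI)
    fix \<kappa>0 \<kappa>1 \<kappa>2 t1 r2 r \<Delta>f \<Delta>x :: real
    define q where "q = \<kappa>2 / \<kappa>0"
    define cV where "cV = (\<kappa>1 - 1) / (4 * (\<kappa>1 + 1))"
    \<comment> \<open>This is \<open>contraction \<kappa>1 \<kappa>2\<close> with \<open>r2\<close>
      for the spectral gap, as the graph is not fixed yet.\<close>
    define c where "c = 2 / 5 * \<kappa>2 / (1 + 1 / r2 + \<kappa>1)"
    define B where "B = 1 / (2 * c) + 1 / 2"
    \<comment> \<open>The constant must be produced before any hypothesis on the parameters is
      available. \<open>valid\<close> collects what these hypotheses will imply; if it fails, the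
      claim about \<open>C\<close> is vacuous and \<open>1\<close> serves.\<close>
    define valid where "valid \<longleftrightarrow> q > 0 \<and> 8 / 3 \<le> q * \<nu> / 2 \<and> t1 > 0 \<and> t1 * \<kappa>0 \<ge> 0 \<and> 0 < c \<and> c < 1 \<and> cV > 0 \<and> B \<ge> 0"
    obtain C where C: "C > 0" and rates: "\<And>n p D G Y Q W \<eta> db T. valid \<Longrightarrow> n \<ge> 1 \<Longrightarrow> p \<ge> 1 \<Longrightarrow> real p \<le> t1 * \<kappa>0 \<Longrightarrow>
      D 0 \<le> \<Delta>f \<Longrightarrow> W 0 \<le> \<Delta>x / 2 \<Longrightarrow>
      zo_recursion Lf \<nu> \<kappa>\<delta> \<sigma>0 \<sigma>1 \<sigma>t0 \<sigma>2 q t1 c cV B n p D G Y Q W \<eta> db \<Longrightarrow> T \<ge> 1 \<Longrightarrow>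
      D T \<le> q\<^sup>2 * (Lf\<^sup>2 * \<kappa>\<delta>\<^sup>2 + Lf * K0 / 2) * (real p / (real n * real T)) + C * (real p / (real T)\<^sup>2)
       \<and> Y T \<le> C * (real p / (real T)\<^sup>2)"
    proof (cases valid)
      case True
      hence v: "q > 0" "8 / 3 \<le> q * \<nu> / 2" "t1 > 0" "t1 * \<kappa>0 \<ge> 0" "0 < c" "c < 1" "cV > 0" "B \<ge> 0"
        by (auto simp: valid_def)
      show thesis
        using rate_bound[OF assms(1,2) v, where \<kappa>\<delta> = \<kappa>\<delta> and ?s0.0 = \<sigma>0 and ?s1.0 = \<sigma>1 and ?s2.0 = \<sigma>2
            and ?st0.0 = \<sigma>t0 and \<Delta>f = \<Delta>f and \<Delta>x = "\<Delta>x / 2"]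
        unfolding K0_def[symmetric] by (elim exE conjE) (rule that, assumption, blast)
    qed (use that[of 1] in simp)
    show "\<exists>C2>0. \<exists>C3>0. \<forall>(n :: nat) (p :: nat) E a L (D :: nat \<Rightarrow> 'c measure) F f fi
      (M :: 'w measure) u \<xi> \<alpha> \<beta> \<eta> \<delta> x0 x.
      n \<ge> 2 \<longrightarrow> p \<ge> 1 \<longrightarrow>
      weighted_graph n E a \<longrightarrow> connected_graph n E \<longrightarrow> L = laplacian n a \<longrightarrow>
      rho2 L = r2 \<longrightarrow> rho L = r \<longrightarrow>
      fi = local_cost D F \<longrightarrow> f = global_cost n D F \<longrightarrow>
      (\<forall>i<n. \<forall>y\<in>space_R p. integrable (D i) (F i y)) \<longrightarrow>
      minimizers p f \<noteq> {} \<longrightarrow> bdd_below (f ` space_R p) \<longrightarrow>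
      (\<forall>i<n. AE z in D i. smooth_on_R p Lf (\<lambda>y. F i y z)) \<longrightarrow>
      (\<forall>i<n. \<forall>y\<in>space_R p.
         (\<integral>\<^sup>+ z. ennreal ((enorm p (vdiff (grad p (\<lambda>w. F i w z) y) (grad p (fi i) y)))\<^sup>2) \<partial>D i)
           \<le> ennreal (\<sigma>0\<^sup>2 * (enorm p (grad p (fi i) y))\<^sup>2 + \<sigma>1\<^sup>2)) \<longrightarrow>
      (\<forall>i<n. \<forall>y\<in>space_R p.
         (enorm p (vdiff (grad p (fi i) y) (grad p f y)))\<^sup>2
           \<le> \<sigma>t0\<^sup>2 * (enorm p (grad p f y))\<^sup>2 + \<sigma>2\<^sup>2) \<longrightarrow>
      polyak_lojasiewicz p \<nu> f \<longrightarrow>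
      zo_sampling n p D M u \<xi> \<longrightarrow>
      (\<forall>i<n. x0 i \<in> space_R p) \<longrightarrow>
      (\<forall>\<omega> k i. x \<omega> k i =
         fst (zo_iterates n p L F \<alpha> \<beta> \<eta> \<delta> x0 (\<lambda>i k. u i k \<omega>) (\<lambda>i k. \<xi> i k \<omega>) k) i) \<longrightarrow>
      (\<forall>k. \<alpha> k = \<kappa>1 * \<beta> k) \<longrightarrow>
      (\<forall>k. \<beta> k = \<kappa>0 * (real k + t1)) \<longrightarrow>
      (\<forall>k. \<eta> k = \<kappa>2 / \<beta> k) \<longrightarrow>
      (\<forall>i<n. \<forall>k. 0 < \<delta> i k \<and>
         \<delta> i k \<le> \<kappa>\<delta> * sqrt (real p * \<eta> k) / sqrt (real n + real p)) \<longrightarrow>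
      \<kappa>1 > zo_constants.c1 L \<longrightarrow>
      0 < \<kappa>2 \<longrightarrow> \<kappa>2 < zo_constants.c2 L \<kappa>1 \<longrightarrow>
      3 * c0hat * \<nu> * \<kappa>2 / 16 \<le> \<kappa>0 \<longrightarrow> \<kappa>0 < 3 * \<nu> * \<kappa>2 / 16 \<longrightarrow>
      t1 \<ge> zo_constants.c3_hat L p Lf \<sigma>0 \<sigma>t0 \<kappa>0 \<kappa>1 \<kappa>2 \<longrightarrow>
      f (average n x0) - opt_value p f \<le> \<Delta>f \<longrightarrow> consensus_error n p x0 \<le> \<Delta>x \<longrightarrow>
      (\<forall>T\<ge>1 :: nat.
         (\<integral>\<^sup>+ \<omega>. ennreal (consensus_error n p (x \<omega> T)) \<partial>M)
           \<le> ennreal (C3 * (real p / (real T)\<^sup>2)) \<and>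
         (\<integral>\<^sup>+ \<omega>. ennreal (f (average n (x \<omega> T)) - opt_value p f) \<partial>M)
           \<le> ennreal (C1 * (real p / (real n * real T)) + C2 * (real p / (real T)\<^sup>2)))"
    proof (rule exI[of _ C], rule conjI[OF C], rule exI[of _ C], rule conjI[OF C], intro allI impI)
      fix n p :: nat and E a L and D :: "nat \<Rightarrow> 'c measure" and F :: "nat \<Rightarrow> rvec \<Rightarrow> 'c \<Rightarrow> real" and f fi
        and M :: "'w measure" and u \<xi> and \<alpha> \<beta> \<eta> :: "nat \<Rightarrow> real" and \<delta> :: "nat \<Rightarrow> nat \<Rightarrow> real" and x0 and x and T :: nat
      assume n: "n \<ge> 2" and p: "p \<ge> 1" and net: "weighted_graph n E a" "connected_graph n E" "L = laplacian n a"
        and r2: "rho2 L = r2" and "rho L = r"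
        and fi: "fi = local_cost D F" and f: "f = global_cost n D F"
        and int: "\<forall>i<n. \<forall>y\<in>space_R p. integrable (D i) (F i y)"
        and "minimizers p f \<noteq> {}" and bdd: "bdd_below (f ` space_R p)"
        and sm: "\<forall>i<n. AE z in D i. smooth_on_R p Lf (\<lambda>y. F i y z)"
        and var: "\<forall>i<n. \<forall>y\<in>space_R p.
         (\<integral>\<^sup>+ z. ennreal ((enorm p (vdiff (grad p (\<lambda>w. F i w z) y) (grad p (fi i) y)))\<^sup>2) \<partial>D i)
           \<le> ennreal (\<sigma>0\<^sup>2 * (enorm p (grad p (fi i) y))\<^sup>2 + \<sigma>1\<^sup>2)"
        and het: "\<forall>i<n. \<forall>y\<in>space_R p.
         (enorm p (vdiff (grad p (fi i) y) (grad p f y)))\<^sup>2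
           \<le> \<sigma>t0\<^sup>2 * (enorm p (grad p f y))\<^sup>2 + \<sigma>2\<^sup>2"
        and PL: "polyak_lojasiewicz p \<nu> f"
        and samp: "zo_sampling n p D M u \<xi>" and x0: "\<forall>i<n. x0 i \<in> space_R p"
        and x: "\<forall>\<omega> k i. x \<omega> k i =
         fst (zo_iterates n p L F \<alpha> \<beta> \<eta> \<delta> x0 (\<lambda>i k. u i k \<omega>) (\<lambda>i k. \<xi> i k \<omega>) k) i"
        and \<alpha>: "\<forall>k. \<alpha> k = \<kappa>1 * \<beta> k" and \<beta>: "\<forall>k. \<beta> k = \<kappa>0 * (real k + t1)" and \<eta>: "\<forall>k. \<eta> k = \<kappa>2 / \<beta> k"
        and \<delta>: "\<forall>i<n. \<forall>k. 0 < \<delta> i k \<and> \<delta> i k \<le> \<kappa>\<delta> * sqrt (real p * \<eta> k) / sqrt (real n + real p)"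
        and k1: "\<kappa>1 > zo_constants.c1 L" and k2: "0 < \<kappa>2" "\<kappa>2 < zo_constants.c2 L \<kappa>1"
        and k0: "3 * c0hat * \<nu> * \<kappa>2 / 16 \<le> \<kappa>0" "\<kappa>0 < 3 * \<nu> * \<kappa>2 / 16"
        and t1: "t1 \<ge> zo_constants.c3_hat L p Lf \<sigma>0 \<sigma>t0 \<kappa>0 \<kappa>1 \<kappa>2"
        and \<Delta>f: "f (average n x0) - opt_value p f \<le> \<Delta>f" and \<Delta>x: "consensus_error n p x0 \<le> \<Delta>x"
        and T: "1 \<le> T"
      interpret connected_laplacian n E a L by unfold_locales (use n net in auto)
      note par = parameter_conditions[OF k1 k2]
      have "0 < 3 * c0hat * \<nu> * \<kappa>2 / 16" using assms k2 by simp
      hence k0': "\<kappa>0 > 0" using k0 by linarith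
      have pP: "real p \<le> t1 * \<kappa>0" by (rule dimension_le[OF k0' par(1) t1])
      have tk: "t1 * \<kappa>0 > 0" using pP p by linarith
      hence t0: "t1 > 0" using k0' by (simp add: zero_less_mult_iff)
      have q0: "q > 0" using k2 k0' by (simp add: q_def)
      \<comment> \<open>Here the upper bound on \<open>\<kappa>0\<close> enters: it says
        \<open>q * \<nu> > 16 / 3\<close>. The resulting rate above \<open>2\<close> is what the
        induction for the \<open>1 / T\<^sup>2\<close> term demands.\<close>
      have q1: "8 / 3 \<le> q * \<nu> / 2" using k0 k0' by (simp add: q_def field_simps)
      have q2: "q \<le> 16 / (3 * c0hat * \<nu>)" using k0 k0' assms by (simp add: q_def field_simps)
      have cc: "c = contraction \<kappa>1 \<kappa>2" by (simp add: c_def contraction_def r2)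
      have c: "0 < c" "c < 1" using contraction_bounds[OF par(1) k2(1) par(2)] cc by auto
      have cV: "cV > 0" using par(1) by (simp add: cV_def)
      have B: "B \<ge> 0" using c by (simp add: B_def)
      have valid: valid unfolding valid_def using q0 q1 t0 tk c cV B by auto
      have st: "real k + t1 > 0" for k using t0 by simp
      have \<eta>q: "\<eta> k = q / (real k + t1)" for k using \<eta> \<beta> by (simp add: q_def)
      have \<eta>0: "0 \<le> \<eta> k" for k unfolding \<eta>q using q0 st[of k] by (simp add: less_imp_le)
      have \<beta>0: "\<beta> k \<noteq> 0" for k using \<beta> k0' st[of k] by simp
      define db where "db k = \<kappa>\<delta>\<^sup>2 * real p * \<eta> k / (real n + real p)" for k
      have \<delta>b: "(\<delta> i k)\<^sup>2 \<le> db k" if "i < n" for i k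
      proof -
        have "(\<delta> i k)\<^sup>2 \<le> (\<kappa>\<delta> * sqrt (real p * \<eta> k) / sqrt (real n + real p))\<^sup>2"
          using \<delta> that by (intro power_mono) (auto simp: less_imp_le)
        also have "\<dots> = db k" using \<eta>0[of k] by (simp add: db_def power_mult_distrib power_divide)
        finally show ?thesis .
      qed
      interpret zo_problem n p D M u \<xi> E a L Lf \<sigma>0 \<sigma>1 \<sigma>t0 \<sigma>2 F \<alpha> \<beta> \<eta> \<delta> x0 db
      proof (intro zo_problem.intro zo_draws.intro zo_problem_axioms.intro connected_laplacian_axioms)
        show "1 \<le> p" "zo_sampling n p D M u \<xi>" "Lf > 0" by fact+
        show "bdd_below (global_cost n D F ` space_R p)" using bdd f by simp
      qed (use int sm var het x0 \<eta>0 \<delta> \<delta>b fi f in auto)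
      \<comment> \<open>A deterministic majorant of the expected Lyapunov function per agent. Its
        recursion holds with equality, as \<open>zo_recursion\<close> requires, and \<open>B\<close>
        is the factor from \<open>lyap_step\<close>.\<close>
      define W where "W = decay_rec c (desc.Yk 0 / 2) (\<lambda>k. B * ((\<eta> k)\<^sup>2 * desc.Qk k))"
      have W0: "W 0 = desc.Yk 0 / 2" and W_Suc: "W (Suc k) = (1 - c) * W k + B * ((\<eta> k)\<^sup>2 * desc.Qk k)" for k
        by (simp_all add: W_def)
      have W_nonneg: "0 \<le> W k" for k
        by (induction k) (use c B desc.Yk_nonneg[of 0] desc.Qk_nonneg in \<open>auto simp: W0 W_Suc intro!: add_nonneg_nonneg mult_nonneg_nonneg\<close>)
      have YW: "cV * desc.Yk k \<le> W k" for k
        unfolding cV_def W_def B_def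
        by (rule desc.consensus_expectation[OF par(1) k2(1) par(2,3) cc]) (use \<alpha> \<eta> \<beta>0 in \<open>simp_all\<close>)
      have res: "desc.Dk T \<le> q\<^sup>2 * (Lf\<^sup>2 * \<kappa>\<delta>\<^sup>2 + Lf * K0 / 2) * (real p / (real n * real T)) + C * (real p / (real T)\<^sup>2)
         \<and> desc.Yk T \<le> C * (real p / (real T)\<^sup>2)"
      proof (rule rates[OF valid _ p pP _ _ _ T, where W = W and G = desc.Gk and Q = desc.Qk and \<eta> = \<eta> and db = db])
        show "1 \<le> n" using n by simp
        show "desc.Dk 0 \<le> \<Delta>f" using \<Delta>f f by (simp add: initial_values)
        show "W 0 \<le> \<Delta>x / 2" using \<Delta>x by (simp add: W0 initial_values)
        have "2 * \<nu> * desc.Dk k \<le> desc.Gk k" for k by (rule PL_expectation) (use PL f in simp)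
        thus "zo_recursion Lf \<nu> \<kappa>\<delta> \<sigma>0 \<sigma>1 \<sigma>t0 \<sigma>2 q t1 c cV B n p desc.Dk desc.Gk desc.Yk desc.Qk W \<eta> db"
          unfolding zo_recursion_def
          using \<eta>q db_def desc.Dk_nonneg desc.Gk_nonneg desc.Yk_nonneg desc.Qk_nonneg W_nonneg
            desc.descent_expectation desc.Qk_le desc.Gk_le YW W_Suc by blast
      qed
      have q2': "q\<^sup>2 * (Lf\<^sup>2 * \<kappa>\<delta>\<^sup>2 + Lf * K0 / 2) \<le> C1"
        unfolding C1_def using q2 q0 S by (intro mult_right_mono power_mono) auto
      have "desc.Dk T \<le> C1 * (real p / (real n * real T)) + C * (real p / (real T)\<^sup>2)"
        using res mult_right_mono[OF q2', of "real p / (real n * real T)"] by simp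
      note bounds = suboptimality_bound[OF this] consensus_bound[OF conjunct2[OF res]]
      have "x \<omega> T = fst (raw_iter T \<omega>)" for \<omega> using x by auto
      thus "(\<integral>\<^sup>+ \<omega>. ennreal (consensus_error n p (x \<omega> T)) \<partial>M) \<le> ennreal (C * (real p / (real T)\<^sup>2)) \<and>
         (\<integral>\<^sup>+ \<omega>. ennreal (f (average n (x \<omega> T)) - opt_value p f) \<partial>M)
           \<le> ennreal (C1 * (real p / (real n * real T)) + C * (real p / (real T)\<^sup>2))"
        using bounds f by simp
    qed
  qed
qed

end
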